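(* Let $\mathfrak{n}\simeq\mathbb{C}^6$ be the space of nilpotent lower triangular $4\times4$ complex matrices, regarded as an affine toric variety for the torus $T\simeq(\mathbb{C}^* )^6$ scaling the six entries, and let $H\subset\mathrm{PGL}(4)$, the torus of classes of diagonal matrices, act on $\mathfrak{n}$ by conjugation, so that $H$ is regarded as a subtorus of $T$. Then the combinatorial quotient $X_e$ of $\mathfrak{n}$ by the action of $H$ is a smooth projective toric variety of dimension $3$ and Picard number $4$, whose fan has the following rays in $\mathrm{N}(T/H)_{\mathbb{R}}=\mathbb{R}^3$ (with the identification given in the context): $$\rho_0=(-1,0,-1),\quad \rho_1=(-1,-1,-1),\quad \rho_2=(0,-1,-1),\quad \rho_3=(1,0,0),\quad \rho_4=(0,1,0),\quad \rho_5=(0,0,1),\quad \rho_6=(0,0,-1).$$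
   Context: Coordinates: an element of $\mathfrak{n}$ has entries $y_{ab}$, $1\le a\le b\le3$, in row $b+1$, column $a$ (rows and columns numbered from $1$ to $4$). The $H$-action is $y_{ab}\mapsto t_at_{a+1}\cdots t_b\,y_{ab}$ with $t_1,t_2,t_3$ coordinates of $H$ ($t_i=h_{i-1}h_i^{-1}$). The associated cone of $\mathfrak n$ is the positive orthant $\delta\subset \mathrm{N}(T)_{\mathbb{R}}=\mathbb{R}^6$; its fan is the fan of faces of $\delta$. Ordering the coordinates as $(y_{11},y_{22},y_{33},y_{12},y_{23},y_{13})$, the quotient map of lattices of one-parameter subgroups $\pi:\mathrm{N}(T)\to\mathrm{N}(T/H)\simeq\mathbb{Z}^3$ is given by the matrix $$\begin{pmatrix}-1&-1&0&1&0&0\\0&-1&-1&0&1&0\\-1&-1&-1&0&0&1\end{pmatrix}.$$ Combinatorial quotient: if $Z$ is a normal toric $T$-variety (not necessarily projective) with fan $\Sigma$ and $H\subset T$ is a subtorus with induced projection $\pi:\mathrm{N}(T)_{\mathbb{R}}\to\mathrm{N}(T/H)_{\mathbb{R}}$, the quotient fan $\pi(\Sigma)$ in $\mathrm{N}(T/H)_{\mathbb{R}}$ is defined by the property that the minimal cone of the fan containing $x$ is $\bigcap_{\sigma\in\Sigma,\,x\in\pi(\sigma)}\pi(\sigma)$; the combinatorial quotient of $Z$ by $H$ is the normal toric $T/H$-variety with fan $\pi(\Sigma)$. *)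

theory Defs
  imports "HOL-Analysis.Analysis"
begin

section \<open>Complex varieties as spaces with functions\<close>

text \<open>
  A variety is represented classically: its closed points with the Zariski topology, together
  with the sheaf of regular complex-valued functions. For an open set \<open>U\<close>, membership in
  \<open>Reg X U\<close> depends only on the values of a function on \<open>U\<close>.
\<close>

record 'a fun_space =
  Zar :: "'a topology"
  Reg :: "'a set \<Rightarrow> ('a \<Rightarrow> complex) set"

abbreviation points :: "'a fun_space \<Rightarrow> 'a set" where
  "points X \<equiv> topspace (Zar X)"

definition fun_space_iso :: "'a fun_space \<Rightarrow> 'b fun_space \<Rightarrow> ('a \<Rightarrow> 'b) \<Rightarrow> bool" where
  "fun_space_iso X Y \<phi> \<longleftrightarrow>
     homeomorphic_map (Zar X) (Zar Y) \<phi> \<and>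
     (\<forall>V f. openin (Zar Y) V \<longrightarrow>
        (f \<in> Reg Y V \<longleftrightarrow> f \<circ> \<phi> \<in> Reg X {p \<in> points X. \<phi> p \<in> V}))"

text \<open>The reduced induced structure on a closed subset: regular functions are those that extend
  locally to regular functions on the ambient space.\<close>

definition induced_space :: "'a fun_space \<Rightarrow> 'a set \<Rightarrow> 'a fun_space" where
  "induced_space X Y =
     \<lparr> Zar = subtopology (Zar X) Y,
       Reg = (\<lambda>V. {f. \<forall>p\<in>V. \<exists>U g. openin (Zar X) U \<and> p \<in> U \<and> g \<in> Reg X U \<and>
                                 (\<forall>q\<in>U \<inter> V. f q = g q)}) \<rparr>"

definition irreducible_in :: "'a topology \<Rightarrow> 'a set \<Rightarrow> bool" where
  "irreducible_in T Z \<longleftrightarrow> Z \<subseteq> topspace T \<and> Z \<noteq> {} \<and>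
     (\<forall>A B. closedin T A \<longrightarrow> closedin T B \<longrightarrow> Z \<subseteq> A \<union> B \<longrightarrow> Z \<subseteq> A \<or> Z \<subseteq> B)"

definition krull_dim :: "'a topology \<Rightarrow> enat" where
  "krull_dim T = Sup {enat n | n. \<exists>Z :: nat \<Rightarrow> 'a set.
     (\<forall>i\<le>n. closedin T (Z i) \<and> irreducible_in T (Z i)) \<and> (\<forall>i<n. Z i \<subset> Z (Suc i))}"


subsection \<open>Smoothness\<close>

text \<open>
  \<open>max_germs X p\<close> consists of representatives of the germs in the maximal ideal \<open>m\<close> of the local
  ring at \<open>p\<close>, and \<open>max_germs_sq X p\<close> of representatives of the germs in \<open>m\<^sup>2\<close>. The latter
  contains all functions vanishing near \<open>p\<close>, so the quotient of the two spaces is \<open>m/m\<^sup>2\<close>.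
\<close>

definition max_germs :: "'a fun_space \<Rightarrow> 'a \<Rightarrow> ('a \<Rightarrow> complex) set" where
  "max_germs X p = {f. f p = 0 \<and> (\<exists>U. openin (Zar X) U \<and> p \<in> U \<and> f \<in> Reg X U)}"

definition max_germs_sq :: "'a fun_space \<Rightarrow> 'a \<Rightarrow> ('a \<Rightarrow> complex) set" where
  "max_germs_sq X p = {f. \<exists>(n::nat) g h U.
     (\<forall>i<n. g i \<in> max_germs X p \<and> h i \<in> max_germs X p) \<and> openin (Zar X) U \<and> p \<in> U \<and>
     (\<forall>q\<in>U. f q = (\<Sum>i<n. g i q * h i q))}"

text \<open>The complex vector space \<open>m/m\<^sup>2\<close> has a basis of \<open>d\<close> elements.\<close>

definition cotangent_dim :: "'a fun_space \<Rightarrow> 'a \<Rightarrow> nat \<Rightarrow> bool" where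
  "cotangent_dim X p d \<longleftrightarrow> (\<exists>B. B \<subseteq> max_germs X p \<and> finite B \<and> card B = d \<and>
     (\<forall>f\<in>max_germs X p. \<exists>!c :: ('a \<Rightarrow> complex) \<Rightarrow> complex.
        (\<forall>b. b \<notin> B \<longrightarrow> c b = 0) \<and> (\<lambda>q. f q - (\<Sum>b\<in>B. c b * b q)) \<in> max_germs_sq X p))"

text \<open>For an irreducible variety, the local dimension at every point is the global dimension.\<close>

definition smooth_variety :: "'a fun_space \<Rightarrow> bool" where
  "smooth_variety X \<longleftrightarrow> irreducible_in (Zar X) (points X) \<and>
     (\<exists>d. krull_dim (Zar X) = enat d \<and> (\<forall>p\<in>points X. cotangent_dim X p d))"


subsection \<open>Projective varieties\<close>

text \<open>A point of projective \<open>N\<close>-space is the set of its vectors of homogeneous coordinates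
  \<open>v 0, \<dots>, v N\<close>; coordinates with index greater than \<open>N\<close> are set to zero.\<close>

definition proj_points :: "nat \<Rightarrow> (nat \<Rightarrow> complex) set set" where
  "proj_points N = {{(\<lambda>i. c * v i) | c. c \<noteq> 0} | v. (\<exists>i\<le>N. v i \<noteq> 0) \<and> (\<forall>i>N. v i = 0)}"

definition hom_polys :: "nat \<Rightarrow> nat \<Rightarrow> ((nat \<Rightarrow> complex) \<Rightarrow> complex) set" where
  "hom_polys N d = {(\<lambda>v. \<Sum>a\<in>A. c a * (\<Prod>i\<le>N. v i ^ a i)) | A (c :: (nat \<Rightarrow> nat) \<Rightarrow> complex).
     finite A \<and> (\<forall>a\<in>A. (\<Sum>i\<le>N. a i) = d)}"

definition projective_space :: "nat \<Rightarrow> (nat \<Rightarrow> complex) set fun_space" where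
  "projective_space N =
     \<lparr> Zar = topology_generated_by
         {{P \<in> proj_points N. \<forall>v\<in>P. F v \<noteq> 0} | F. \<exists>d. F \<in> hom_polys N d},
       Reg = (\<lambda>U. {f. \<forall>P\<in>U. \<exists>d. \<exists>G\<in>hom_polys N d. \<exists>H\<in>hom_polys N d.
         (\<forall>v\<in>P. H v \<noteq> 0) \<and> (\<forall>Q\<in>U. \<forall>v\<in>Q. H v \<noteq> 0 \<longrightarrow> f Q = G v / H v)}) \<rparr>"

definition projective_variety :: "'a fun_space \<Rightarrow> bool" where
  "projective_variety X \<longleftrightarrow> (\<exists>N Y \<phi>.
     closedin (Zar (projective_space N)) Y \<and>
     irreducible_in (Zar (projective_space N)) Y \<and>
     fun_space_iso X (induced_space (projective_space N) Y) \<phi>)"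


subsection \<open>Picard number\<close>

definition unit_functions :: "'a fun_space \<Rightarrow> 'a set \<Rightarrow> ('a \<Rightarrow> complex) set" where
  "unit_functions X U = {f \<in> Reg X U. \<exists>f'\<in>Reg X U. \<forall>p\<in>U. f p * f' p = 1}"

text \<open>
  A line bundle is given by transition functions on an open cover. Every open cover has a
  refinement of the form \<open>(N x)\<close> with \<open>x\<close> ranging over the points and \<open>N x\<close> an open neighbourhood
  of \<open>x\<close>, so only covers of this form are used. On \<open>N x \<inter> N y\<close> the transition function
  is \<open>g x y\<close>.
\<close>

type_synonym 'a lb_data = "('a \<Rightarrow> 'a set) \<times> ('a \<Rightarrow> 'a \<Rightarrow> 'a \<Rightarrow> complex)"

definition line_bundle :: "'a fun_space \<Rightarrow> 'a lb_data \<Rightarrow> bool" where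
  "line_bundle X = (\<lambda>(N, g).
     (\<forall>x\<in>points X. openin (Zar X) (N x) \<and> x \<in> N x) \<and>
     (\<forall>x\<in>points X. \<forall>y\<in>points X. g x y \<in> unit_functions X (N x \<inter> N y)) \<and>
     (\<forall>x\<in>points X. \<forall>y\<in>points X. \<forall>z\<in>points X. \<forall>p\<in>N x \<inter> N y \<inter> N z.
        g x y p * g y z p = g x z p))"

definition trivial_line_bundle :: "'a fun_space \<Rightarrow> 'a lb_data \<Rightarrow> bool" where
  "trivial_line_bundle X = (\<lambda>(N, g). \<exists>N' s.
     (\<forall>x\<in>points X. openin (Zar X) (N' x) \<and> x \<in> N' x \<and> N' x \<subseteq> N x \<and>
        s x \<in> unit_functions X (N' x)) \<and>
     (\<forall>x\<in>points X. \<forall>y\<in>points X. \<forall>p\<in>N' x \<inter> N' y. g x y p = s x p / s y p))"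

text \<open>The tensor product of the powers \<open>L i ^ a i\<close> for \<open>i < r\<close>.\<close>

definition lb_combination :: "nat \<Rightarrow> (nat \<Rightarrow> 'a lb_data) \<Rightarrow> (nat \<Rightarrow> int) \<Rightarrow> 'a lb_data" where
  "lb_combination r L a =
     ((\<lambda>x. \<Inter>i<r. fst (L i) x), (\<lambda>x y p. \<Prod>i<r. snd (L i) x y p powi a i))"

text \<open>The rank of the Picard group, i.e. the maximal number of line bundles whose classes are
  linearly independent over the integers.\<close>

definition picard_number :: "'a fun_space \<Rightarrow> enat" where
  "picard_number X = Sup {enat r | r. \<exists>L. (\<forall>i<r. line_bundle X (L i)) \<and>
     (\<forall>a. trivial_line_bundle X (lb_combination r L a) \<longrightarrow> (\<forall>i<r. a i = 0))}"


section \<open>Fans and toric varieties\<close>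

text \<open>The lattice \<open>N\<close> of one-parameter subgroups and the lattice \<open>M\<close> of characters are both
  \<open>int ^ 'n\<close>, paired by the standard inner product.\<close>

definition real_vec :: "int ^ 'n \<Rightarrow> real ^ 'n" where
  "real_vec v = (\<chi> i. real_of_int (v $ i))"

definition rational_cone :: "(real ^ 'n) set \<Rightarrow> bool" where
  "rational_cone \<sigma> \<longleftrightarrow> (\<exists>S. finite S \<and> \<sigma> = convex_cone hull (real_vec ` S))"

text \<open>In the library, the empty set is a face of every set; it is not a face of a cone.\<close>

definition cone_face :: "(real ^ 'n) set \<Rightarrow> (real ^ 'n) set \<Rightarrow> bool" where
  "cone_face \<tau> \<sigma> \<longleftrightarrow> \<tau> \<noteq> {} \<and> \<tau> face_of \<sigma>"

definition fan :: "(real ^ 'n) set set \<Rightarrow> bool" where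
  "fan \<Sigma> \<longleftrightarrow> finite \<Sigma> \<and> \<Sigma> \<noteq> {} \<and>
     (\<forall>\<sigma>\<in>\<Sigma>. rational_cone \<sigma> \<and> \<sigma> \<inter> uminus ` \<sigma> = {0}) \<and>
     (\<forall>\<sigma>\<in>\<Sigma>. \<forall>\<tau>. cone_face \<tau> \<sigma> \<longrightarrow> \<tau> \<in> \<Sigma>) \<and>
     (\<forall>\<sigma>\<in>\<Sigma>. \<forall>\<tau>\<in>\<Sigma>. cone_face (\<sigma> \<inter> \<tau>) \<sigma> \<and> cone_face (\<sigma> \<inter> \<tau>) \<tau>)"

definition face_fan :: "(real ^ 'n) set \<Rightarrow> (real ^ 'n) set set" where
  "face_fan \<sigma> = {\<tau>. cone_face \<tau> \<sigma>}"

definition rays :: "(real ^ 'n) set set \<Rightarrow> (real ^ 'n) set set" where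
  "rays \<Sigma> = {\<sigma> \<in> \<Sigma>. dim \<sigma> = 1}"

definition dual_monoid :: "(real ^ 'n) set \<Rightarrow> (int ^ 'n) set" where
  "dual_monoid \<sigma> = {m. \<forall>u\<in>\<sigma>. 0 \<le> real_vec m \<bullet> u}"

text \<open>
  The points of the affine chart \<open>U\<^sub>\<sigma>\<close> are the monoid homomorphisms from \<open>dual_monoid \<sigma>\<close>
  to the multiplicative monoid of complex numbers, extended here by zero. Such a point does not
  lie in the chart of a proper face of \<open>\<sigma>\<close> iff it vanishes at all noninvertible elements of
  \<open>dual_monoid \<sigma>\<close> (it then belongs to the torus orbit corresponding to \<open>\<sigma>\<close>). In the variety of a
  fan, each point is represented in the chart of the unique smallest cone whose chart contains it.
  The chart \<open>U\<^sub>\<tau>\<close> then consists of the points represented in the charts of the faces \<open>\<sigma>\<close> of \<open>\<tau>\<close>,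
  which are viewed as homomorphisms on \<open>dual_monoid \<tau>\<close> by restriction. Gluing the charts along
  common faces needs no further identifications.
\<close>

type_synonym 'n toric_point = "(real ^ 'n) set \<times> (int ^ 'n \<Rightarrow> complex)"

definition toric_points :: "(real ^ 'n) set set \<Rightarrow> 'n toric_point set" where
  "toric_points \<Sigma> = {(\<sigma>, \<gamma>). \<sigma> \<in> \<Sigma> \<and> \<gamma> 0 = 1 \<and>
     (\<forall>m\<in>dual_monoid \<sigma>. \<forall>m'\<in>dual_monoid \<sigma>. \<gamma> (m + m') = \<gamma> m * \<gamma> m') \<and>
     (\<forall>m. m \<notin> dual_monoid \<sigma> \<or> - m \<notin> dual_monoid \<sigma> \<longrightarrow> \<gamma> m = 0)}"

definition toric_chart :: "(real ^ 'n) set set \<Rightarrow> (real ^ 'n) set \<Rightarrow> 'n toric_point set" where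
  "toric_chart \<Sigma> \<tau> = {(\<sigma>, \<gamma>) \<in> toric_points \<Sigma>. cone_face \<sigma> \<tau>}"

text \<open>The elements of the monoid algebra of \<open>dual_monoid \<tau>\<close>, as functions on \<open>U\<^sub>\<tau>\<close>.\<close>

definition chart_functions :: "(real ^ 'n) set \<Rightarrow> ('n toric_point \<Rightarrow> complex) set" where
  "chart_functions \<tau> = {(\<lambda>p. \<Sum>m\<in>A. c m * snd p m) | A c. finite A \<and> A \<subseteq> dual_monoid \<tau>}"

definition toric_variety :: "(real ^ 'n) set set \<Rightarrow> 'n toric_point fun_space" where
  "toric_variety \<Sigma> =
     \<lparr> Zar = topology_generated_by
         {{p \<in> toric_chart \<Sigma> \<tau>. h p \<noteq> 0} | \<tau> h. \<tau> \<in> \<Sigma> \<and> h \<in> chart_functions \<tau>},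
       Reg = (\<lambda>U. {f. \<forall>p\<in>U. \<exists>\<tau>\<in>\<Sigma>. p \<in> toric_chart \<Sigma> \<tau> \<and>
         (\<exists>g\<in>chart_functions \<tau>. \<exists>h\<in>chart_functions \<tau>. h p \<noteq> 0 \<and>
            (\<forall>q\<in>U \<inter> toric_chart \<Sigma> \<tau>. h q \<noteq> 0 \<longrightarrow> f q = g q / h q))}) \<rparr>"

definition quotient_fan ::
    "(real ^ 'n \<Rightarrow> real ^ 'k) \<Rightarrow> (real ^ 'n) set set \<Rightarrow> (real ^ 'k) set set" where
  "quotient_fan \<pi> \<Sigma> = {\<Inter>{\<pi> ` \<sigma> | \<sigma>. \<sigma> \<in> \<Sigma> \<and> x \<in> \<pi> ` \<sigma>} | x. x \<in> \<pi> ` \<Union>\<Sigma>}"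

definition combinatorial_quotient ::
    "(real ^ 'n \<Rightarrow> real ^ 'k) \<Rightarrow> (real ^ 'n) set set \<Rightarrow> 'k toric_point fun_space" where
  "combinatorial_quotient \<pi> \<Sigma> = toric_variety (quotient_fan \<pi> \<Sigma>)"


section \<open>Nilpotent lower triangular matrices and the conjugation action\<close>

text \<open>Beware that \<open>4 = 0\<close> in the index type \<open>4\<close>, so its order is not that of the rows and columns
  numbered from 1 to 4; the entries above the diagonal are therefore listed.\<close>

definition lower_triangular :: "complex ^ 4 ^ 4 \<Rightarrow> bool" where
  "lower_triangular A \<longleftrightarrow> A $ 1 $ 2 = 0 \<and> A $ 1 $ 3 = 0 \<and> A $ 1 $ 4 = 0 \<and>
     A $ 2 $ 3 = 0 \<and> A $ 2 $ 4 = 0 \<and> A $ 3 $ 4 = 0"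

definition nilp_lower :: "(complex ^ 4 ^ 4) set" where
  "nilp_lower = {A. lower_triangular A \<and> (\<exists>k. (((**) A) ^^ k) (mat 1) = 0)}"

text \<open>The coordinates in the order \<open>(y\<^sub>1\<^sub>1, y\<^sub>2\<^sub>2, y\<^sub>3\<^sub>3, y\<^sub>1\<^sub>2, y\<^sub>2\<^sub>3, y\<^sub>1\<^sub>3)\<close>, where
  \<open>y\<^sub>a\<^sub>b\<close> is the entry in row \<open>b + 1\<close> and column \<open>a\<close>.\<close>

definition nilp_coords :: "complex ^ 4 ^ 4 \<Rightarrow> complex ^ 6" where
  "nilp_coords A = vector [A $ 2 $ 1, A $ 3 $ 2, A $ 4 $ 3, A $ 3 $ 1, A $ 4 $ 2, A $ 4 $ 1]"

definition diag_matrix :: "complex ^ 4 \<Rightarrow> complex ^ 4 ^ 4" where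
  "diag_matrix h = (\<chi> i j. if i = j then h $ i else 0)"

text \<open>The diagonal torus of \<open>PGL(4)\<close> as a subgroup of the torus of nonzero \<open>t\<close> scaling the six
  coordinates: \<open>t\<close> acts in the same way as conjugation by some invertible diagonal matrix.\<close>

definition H_torus :: "(complex ^ 6) set" where
  "H_torus = {t. (\<forall>i. t $ i \<noteq> 0) \<and> (\<exists>h. (\<forall>i. h $ i \<noteq> 0) \<and>
     (\<forall>A\<in>nilp_lower. nilp_coords (diag_matrix h ** A ** matrix_inv (diag_matrix h)) =
        (\<chi> i. t $ i * nilp_coords A $ i)))}"

text \<open>One-parameter subgroups of a subgroup of the torus, as elements of \<open>N(T)\<close>.\<close>

definition one_param_subgroups :: "(complex ^ 'n) set \<Rightarrow> (int ^ 'n) set" where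
  "one_param_subgroups G = {v. \<forall>s. s \<noteq> 0 \<longrightarrow> (\<chi> i. s powi (v $ i)) \<in> G}"

definition quot_matrix :: "'a::ring_1 ^ 6 ^ 3" where
  "quot_matrix = vector
     [vector [-1, -1,  0, 1, 0, 0],
      vector [ 0, -1, -1, 0, 1, 0],
      vector [-1, -1, -1, 0, 0, 1]]"

text \<open>The integral matrix \<open>P\<close> identifies \<open>N(T/G) = N(T)/N(G)\<close> with \<open>int ^ 'k\<close>.\<close>

definition presents_quotient_lattice :: "int ^ 'n ^ 'k \<Rightarrow> (complex ^ 'n) set \<Rightarrow> bool" where
  "presents_quotient_lattice P G \<longleftrightarrow>
     surj (\<lambda>v. P *v v) \<and> {v. P *v v = 0} = one_param_subgroups G"

definition nilp_fan :: "(real ^ 6) set set" where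
  "nilp_fan = face_fan {x. \<forall>i. 0 \<le> x $ i}"

abbreviation quot_map :: "real ^ 6 \<Rightarrow> real ^ 3" where
  "quot_map x \<equiv> quot_matrix *v x"

definition X_e :: "3 toric_point fun_space" where
  "X_e = combinatorial_quotient quot_map nilp_fan"

end

theory Submission
  imports Defs "HOL-Computational_Algebra.Field_as_Ring" "HOL-Computational_Algebra.Polynomial_Factorial"
    "HOL-Computational_Algebra.Fundamental_Theorem_Algebra"
begin

text \<open>
  The map \<open>quot_map\<close> sends the six unit vectors to \<open>\<rho>\<^sub>0, \<dots>, \<rho>\<^sub>5\<close>, so the images of the faces of the
  orthant are the cones generated by subsets of these six vectors. Together with
  \<open>\<rho>\<^sub>6 = \<rho>\<^sub>0 + \<rho>\<^sub>3 = \<rho>\<^sub>2 + \<rho>\<^sub>4 = - \<rho>\<^sub>5\<close> they are the rays of a complete fan with the ten maximal cones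
  012, 015, 026, 045, 046, 125, 235, 236, 345, 346 (\<open>cone_table\<close>), and this is the quotient fan, for two
  reasons. First, the relations \<open>\<rho>\<^sub>1 + \<rho>\<^sub>3 = \<rho>\<^sub>2\<close>, \<open>\<rho>\<^sub>1 + \<rho>\<^sub>4 = \<rho>\<^sub>0\<close>, \<open>\<rho>\<^sub>0 + \<rho>\<^sub>3 = \<rho>\<^sub>6 = \<rho>\<^sub>2 + \<rho>\<^sub>4\<close>,
  \<open>\<rho>\<^sub>5 + \<rho>\<^sub>6 = 0\<close> and \<open>\<rho>\<^sub>0 + \<rho>\<^sub>2 + \<rho>\<^sub>5 = \<rho>\<^sub>1\<close> rewrite every nonnegative combination of generators of
  an image into one supported on a cone of the fan, without leaving the image (\<open>straighten\<close>); so every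
  image is a union of cones of the fan. Second, every maximal cone is an image of a three-dimensional
  face or, if it contains \<open>\<rho>\<^sub>6\<close>, an intersection of two such images (\<open>maximal_cone_Int_images\<close>), and in
  a complete fan the smallest cone containing a point is the intersection of the maximal cones that
  contain it (\<open>Inter_maximal_cones\<close>).

  The ten cones are the inner normal cones at the ten vertices of a simple lattice polytope whose edge
  directions at each vertex form a lattice basis. The locale \<open>smooth_polytope\<close> derives the fan axioms
  and completeness from this: the cone of a vertex consists of the linear forms that are minimal there.

  Each maximal cone is generated by a basis of the lattice, so its chart is an affine 3-space
  (\<open>tpt\<close>). For a space with an atlas of this kind, in which any two charts overlap, irreducibility,
  dimension and smoothness are consequences of properties of the polynomial ring
  (locale \<open>affine_atlas\<close>). A chain of more than four irreducible closed sets would give four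
  polynomials without algebraic relations, but a count of monomials shows that four polynomials in three
  variables always satisfy one (\<open>prime_chain_bound\<close>). The cotangent space at a point is described
  by Taylor expansion to first order and by derivatives along lines (\<open>cotangent_dim_3\<close>).

  The Picard number is the number of rays minus three. As polynomial rings are factorial, a line bundle
  is trivial on each chart (\<open>line_bundle_trivial_on_chart\<close>); as the units on the torus are monomials, it
  is then given by characters \<open>\<mu> i - \<mu> j\<close> on the overlaps (\<open>line_bundle_has_char_data\<close>). The families
  \<open>\<mu>\<close> that occur are the integral piecewise linear functions on the fan, which are determined by
  arbitrary integers on the rays, and a bundle is trivial exactly if \<open>\<mu>\<close> is constant, that is, if the
  function is linear. With seven rays the rank is \<open>7 - 3 = 4\<close>.

  For projectivity, the characters at the vertices of the polytope and at their first neighbours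
  on the edges embed the toric variety into a projective space; the image is closed because it is cut out
  by binomials (\<open>Y\<close>, \<open>Y_chart\<close>, \<open>Y_vertex\<close>).
\<close>

section \<open>Polynomials in three variables\<close>

text \<open>
  For \<open>k :: complex \<Rightarrow> 'a\<close> the embedding of the constants and
  \<open>E\<close> a set of evaluations \<open>'a \<Rightarrow> complex\<close>, the last
  condition is the part of the Nullstellensatz that concerns a prime principal ideal. It is stated
  for an arbitrary ring so that it can be lifted along \<open>'a \<Rightarrow> 'a poly\<close> one
  variable at a time.
\<close>

definition separating :: "(complex \<Rightarrow> 'a::idom) \<Rightarrow> ('a \<Rightarrow> complex) set \<Rightarrow> bool" where
  "separating k E \<longleftrightarrow>
     (\<forall>\<phi>\<in>E. \<phi> 1 = 1 \<and> (\<forall>x y. \<phi> (x + y) = \<phi> x + \<phi> y \<and> \<phi> (x * y) = \<phi> x * \<phi> y) \<and> (\<forall>c. \<phi> (k c) = c)) \<and>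
     (\<forall>x. x \<noteq> 0 \<longrightarrow> (\<exists>\<phi>\<in>E. \<phi> x \<noteq> 0)) \<and>
     (\<forall>\<pi> g. prime_elem \<pi> \<longrightarrow> \<not> \<pi> dvd g \<longrightarrow> (\<exists>\<phi>\<in>E. \<phi> \<pi> = 0 \<and> \<phi> g \<noteq> 0))"

text \<open>
  This is the gcd of \<open>\<pi>\<close> and \<open>g\<close> over the field of fractions, with
  denominators cleared. A nonzero element of least degree in the ideal \<open>(\<pi>, g)\<close>
  divides all others up to constants, by pseudo-division; if its degree were positive, the prime
  \<open>\<pi>\<close> would divide it and hence \<open>g\<close>.
\<close>

lemma bezout_constant:
  fixes \<pi> g :: "'a::idom poly"
  assumes "prime_elem \<pi>" "degree \<pi> > 0" "\<not> \<pi> dvd g"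
  obtains r u v where "r \<noteq> 0" "[:r:] = u * \<pi> + v * g"
proof -
  define J where "J = {f. f \<noteq> 0 \<and> (\<exists>u v. f = u * \<pi> + v * g)}"
  have piJ: "\<pi> \<in> J"
  proof -
    have "\<pi> = 1 * \<pi> + 0 * g" by simp
    thus ?thesis using assms(1) unfolding J_def prime_elem_def by blast
  qed
  define r where "r = arg_min degree (\<lambda>f. f \<in> J)"
  have rJ: "r \<in> J" and rmin: "\<And>f. f \<in> J \<Longrightarrow> degree r \<le> degree f"
    using arg_min_natI[of "\<lambda>f. f \<in> J", OF piJ] arg_min_nat_le[of "\<lambda>f. f \<in> J"]
    unfolding r_def by auto
  from rJ obtain u v where r: "r \<noteq> 0" "r = u * \<pi> + v * g" unfolding J_def by auto
  have div: "\<exists>a q. a \<noteq> 0 \<and> smult a f = r * q" if "f = s * \<pi> + t * g" for f s t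
  proof -
    obtain a q where aq: "a \<noteq> 0" "smult a f = r * q + pseudo_mod f r"
      using pseudo_mod(1)[OF r(1)] by metis
    have "pseudo_mod f r = ([:a:] * s - u * q) * \<pi> + ([:a:] * t - v * q) * g"
      using aq(2) that r(2) by (simp add: algebra_simps smult_add_right)
    hence "pseudo_mod f r \<noteq> 0 \<Longrightarrow> pseudo_mod f r \<in> J" unfolding J_def by blast
    hence "pseudo_mod f r = 0"
      using rmin pseudo_mod(2)[OF r(1), of f] by fastforce
    thus ?thesis using aq by auto
  qed
  have "degree r = 0"
  proof (rule ccontr)
    assume deg: "degree r \<noteq> 0"
    obtain a q where aq: "a \<noteq> 0" "smult a \<pi> = r * q" using div[of \<pi> 1 0] by auto
    have "\<pi> dvd r * q" using aq(2) by (metis dvd_smult dvd_refl)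
    moreover have "\<not> \<pi> dvd q"
    proof
      assume "\<pi> dvd q"
      then obtain q' where "q = \<pi> * q'" by auto
      with aq(2) have "\<pi> * [:a:] = \<pi> * (r * q')" by (simp add: algebra_simps)
      hence "[:a:] = r * q'" using assms(1) mult_left_cancel[of \<pi>] unfolding prime_elem_def by blast
      moreover from this have "q' \<noteq> 0" using aq(1) by auto
      ultimately have "degree r + degree q' = 0"
        by (metis degree_mult_eq degree_pCons_0 r(1))
      thus False using deg by simp
    qed
    ultimately have "\<pi> dvd r" using assms(1) prime_elem_dvd_mult_iff by blast
    obtain b q2 where bq: "b \<noteq> 0" "smult b g = r * q2" using div[of g 0 1] by auto
    have "\<pi> dvd [:b:] * g" using bq(2) \<open>\<pi> dvd r\<close> by simp
    hence "\<pi> dvd [:b:]" using assms(1,3) prime_elem_dvd_mult_iff by blast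
    thus False using assms(2) bq(1) by (metis degree_pCons_0 dvd_imp_degree_le leD pCons_eq_0_iff)
  qed
  then obtain c where c: "r = [:c:]" by (rule degree_eq_zeroE)
  have "c \<noteq> 0" using r(1) c by simp
  moreover have "[:c:] = u * \<pi> + v * g" using r(2) unfolding c .
  ultimately show ?thesis by (rule that)
qed

lemma separating_complex: "separating (\<lambda>c. c) {\<lambda>x. x :: complex}"
  unfolding separating_def by (auto simp: prime_elem_def dvd_field_iff)

text \<open>
  If \<open>\<pi>\<close> is constant in the new variable, a coefficient of \<open>g\<close> not
  divisible by it is separated from it in the old ring. Otherwise \<open>bezout_constant\<close>
  gives a constant \<open>r\<close> in the ideal \<open>(\<pi>, g)\<close>: an evaluation of the
  old ring at which neither \<open>r\<close> nor the leading coefficient of \<open>\<pi>\<close>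
  vanishes leaves a nonconstant complex polynomial, and at one of its roots \<open>g\<close>
  cannot vanish, because \<open>r\<close> does not.
\<close>

lemma separating_poly:
  fixes k :: "complex \<Rightarrow> 'a::idom"
  assumes sep: "separating k E"
  shows "separating (\<lambda>c. [:k c:]) {\<lambda>P. \<phi> (poly P (k c)) | \<phi> c. \<phi> \<in> E}"
proof -
  have hom: "\<phi> 1 = 1" "\<phi> (x + y) = \<phi> x + \<phi> y" "\<phi> (x * y) = \<phi> x * \<phi> y" "\<phi> (k c) = c" if "\<phi> \<in> E" for \<phi> x y c
    using sep that unfolding separating_def by blast+
  have zero: "\<phi> 0 = 0" if "\<phi> \<in> E" for \<phi> using hom(2)[OF that, of 0 0] by simp
  have eval: "\<phi> (poly P (k c)) = poly (map_poly \<phi> P) c" if "\<phi> \<in> E" for \<phi> P c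
  proof (induction P)
    case 0 show ?case using zero[OF that] by simp
  next
    case (pCons a P)
    thus ?case using hom[OF that] by (simp add: map_poly_pCons zero[OF that])
  qed
  have nz: "\<exists>\<phi>\<in>E. \<phi> x \<noteq> 0" if "x \<noteq> 0" for x using sep that unfolding separating_def by blast
  have root_ex: "\<exists>c. poly p c \<noteq> 0" if "p \<noteq> 0" for p :: "complex poly"
    using that poly_all_0_iff_0 by blast
  have nz': "\<exists>\<phi>\<in>E. \<exists>c. \<phi> (poly P (k c)) \<noteq> 0" if "P \<noteq> 0" for P
  proof -
    have "lead_coeff P \<noteq> 0" using that by simp
    then obtain \<phi> where "\<phi> \<in> E" "\<phi> (lead_coeff P) \<noteq> 0" using nz by blast
    moreover from this have "map_poly \<phi> P \<noteq> 0"
      using zero by (metis coeff_0 coeff_map_poly)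
    ultimately show ?thesis using root_ex eval by metis
  qed
  have pr: "\<exists>\<phi>\<in>E. \<exists>c. \<phi> (poly \<pi> (k c)) = 0 \<and> \<phi> (poly g (k c)) \<noteq> 0"
    if pi: "prime_elem \<pi>" "\<not> \<pi> dvd g" for \<pi> g
  proof (cases "degree \<pi> = 0")
    case True
    then obtain a where a: "\<pi> = [:a:]" by (metis degree_eq_zeroE)
    hence "prime_elem a" using pi(1) prime_elem_const_poly_iff by blast
    moreover obtain i where "\<not> a dvd coeff g i" using pi(2) a const_poly_dvd_iff by blast
    ultimately obtain \<phi> where \<phi>: "\<phi> \<in> E" "\<phi> a = 0" "\<phi> (coeff g i) \<noteq> 0"
      using sep unfolding separating_def by blast
    hence "map_poly \<phi> g \<noteq> 0" using zero by (metis coeff_0 coeff_map_poly)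
    then obtain c where "poly (map_poly \<phi> g) c \<noteq> 0" using root_ex by blast
    thus ?thesis using \<phi> eval a by auto
  next
    case False
    then obtain r u v where r: "r \<noteq> 0" "[:r:] = u * \<pi> + v * g"
      using bezout_constant[OF pi(1) _ pi(2)] by blast
    have "r * lead_coeff \<pi> \<noteq> 0" using r False by auto
    then obtain \<phi> where \<phi>: "\<phi> \<in> E" "\<phi> (r * lead_coeff \<pi>) \<noteq> 0" using nz by blast
    have lc: "\<phi> r \<noteq> 0" "\<phi> (lead_coeff \<pi>) \<noteq> 0" using \<phi>(2) hom(3)[OF \<phi>(1), of r "lead_coeff \<pi>"] by auto
    have "coeff (map_poly \<phi> \<pi>) (degree \<pi>) \<noteq> 0" using lc zero[OF \<phi>(1)] by (simp add: coeff_map_poly)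
    hence "degree (map_poly \<phi> \<pi>) \<noteq> 0" using False le_degree by fastforce
    hence "\<not> constant (poly (map_poly \<phi> \<pi>))" by (simp add: constant_degree)
    then obtain c where c: "poly (map_poly \<phi> \<pi>) c = 0" using fundamental_theorem_of_algebra by blast
    have "\<phi> (poly [:r:] (k c)) = \<phi> (poly u (k c)) * \<phi> (poly \<pi> (k c)) + \<phi> (poly v (k c)) * \<phi> (poly g (k c))"
      unfolding r(2) using hom[OF \<phi>(1)] by simp
    hence "\<phi> (poly g (k c)) \<noteq> 0" using c eval[OF \<phi>(1)] lc by auto
    moreover have "\<phi> (poly \<pi> (k c)) = 0" using c eval[OF \<phi>(1)] by simp
    ultimately show ?thesis using \<phi>(1) by blast
  qed
  have A: "\<forall>\<psi>\<in>{\<lambda>P. \<phi> (poly P (k c)) | \<phi> c. \<phi> \<in> E}. \<psi> 1 = 1 \<and>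
      (\<forall>x y. \<psi> (x + y) = \<psi> x + \<psi> y \<and> \<psi> (x * y) = \<psi> x * \<psi> y) \<and> (\<forall>c. \<psi> [:k c:] = c)"
    using hom by auto
  show ?thesis
    unfolding separating_def
  proof (intro conjI)
    show "\<forall>\<psi>\<in>{\<lambda>P. \<phi> (poly P (k c)) | \<phi> c. \<phi> \<in> E}. \<psi> 1 = 1 \<and>
      (\<forall>x y. \<psi> (x + y) = \<psi> x + \<psi> y \<and> \<psi> (x * y) = \<psi> x * \<psi> y) \<and> (\<forall>c. \<psi> [:k c:] = c)" by (rule A)
    show "\<forall>x. x \<noteq> 0 \<longrightarrow> (\<exists>\<phi>\<in>{\<lambda>P. \<phi> (poly P (k c)) | \<phi> c. \<phi> \<in> E}. \<phi> x \<noteq> 0)" using nz' by fast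
    show "\<forall>\<pi> g. prime_elem \<pi> \<longrightarrow> \<not> \<pi> dvd g \<longrightarrow>
        (\<exists>\<phi>\<in>{\<lambda>P. \<phi> (poly P (k c)) | \<phi> c. \<phi> \<in> E}. \<phi> \<pi> = 0 \<and> \<phi> g \<noteq> 0)" using pr by fast
  qed
qed

type_synonym poly3 = "complex poly poly poly"

text \<open>
  The outermost variable of \<open>poly3\<close> is the first coordinate.
\<close>

definition ev :: "poly3 \<Rightarrow> complex ^ 3 \<Rightarrow> complex" where
  "ev P z = poly (poly (poly P [:[:z $ 1:]:]) [:z $ 2:]) (z $ 3)"

definition con :: "complex \<Rightarrow> poly3" where
  "con c = [:[:[:c:]:]:]"

definition var :: "3 \<Rightarrow> poly3" where
  "var k = (if k = 1 then [:0, 1:] else if k = 2 then [:[:0, 1:]:] else [:[:[:0, 1:]:]:])"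

lemma ev_simps [simp]:
  "ev 0 z = 0" "ev 1 z = 1" "ev (P + Q) z = ev P z + ev Q z" "ev (P - Q) z = ev P z - ev Q z"
  "ev (- P) z = - ev P z"
  "ev (P * Q) z = ev P z * ev Q z" "ev (P ^ n) z = ev P z ^ n" "ev (con c) z = c"
  by (auto simp: ev_def con_def)

lemma ev_var [simp]: "ev (var k) z = z $ k"
  using exhaust_3[of k] by (auto simp: ev_def var_def)

lemma ev_sum [simp]: "ev (sum f A) z = (\<Sum>x\<in>A. ev (f x) z)"
  by (induction A rule: infinite_finite_induct) auto

lemma ev_prod [simp]: "ev (prod f A) z = (\<Prod>x\<in>A. ev (f x) z)"
  by (induction A rule: infinite_finite_induct) auto

lemma separating_ev: "separating con (range (\<lambda>z P. ev P z))"
proof -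
  define E1 :: "(complex poly \<Rightarrow> complex) set" where "E1 = {\<lambda>P. \<phi> (poly P c) | \<phi> c. \<phi> \<in> {\<lambda>x. x}}"
  define E2 :: "(complex poly poly \<Rightarrow> complex) set" where "E2 = {\<lambda>P. \<phi> (poly P [:c:]) | \<phi> c. \<phi> \<in> E1}"
  define E3 :: "(poly3 \<Rightarrow> complex) set" where "E3 = {\<lambda>P. \<phi> (poly P [:[:c:]:]) | \<phi> c. \<phi> \<in> E2}"
  have "separating con E3"
    using separating_poly[OF separating_poly[OF separating_poly[OF separating_complex]]]
    unfolding E1_def E2_def E3_def con_def by simp
  moreover have "E3 = range (\<lambda>z P. ev P z)"
  proof
    show "range (\<lambda>z P. ev P z) \<subseteq> E3"
    proof
      fix f assume "f \<in> range (\<lambda>z P. ev P z)"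
      then obtain z where f: "f = (\<lambda>P. ev P z)" by (rule rangeE)
      have "(\<lambda>P. poly P (z $ 3)) \<in> E1" unfolding E1_def by auto
      hence "(\<lambda>P. poly (poly P [:z $ 2:]) (z $ 3)) \<in> E2"
        unfolding E2_def by (intro CollectI exI[of _ "\<lambda>P. poly P (z $ 3)"] exI[of _ "z $ 2"]) simp
      hence "(\<lambda>P. poly (poly (poly P [:[:z $ 1:]:]) [:z $ 2:]) (z $ 3)) \<in> E3"
        unfolding E3_def
        by (intro CollectI exI[of _ "\<lambda>P. poly (poly P [:z $ 2:]) (z $ 3)"] exI[of _ "z $ 1"]) simp
      thus "f \<in> E3" by (simp add: f ev_def)
    qed
    show "E3 \<subseteq> range (\<lambda>z P. ev P z)"
    proof
      fix f assume "f \<in> E3"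
      then obtain a b c where "f = (\<lambda>P. poly (poly (poly P [:[:a:]:]) [:b:]) c)"
        unfolding E1_def E2_def E3_def by blast
      hence "f = (\<lambda>P. ev P (vector [a, b, c]))" by (simp add: ev_def)
      thus "f \<in> range (\<lambda>z P. ev P z)" by (rule range_eqI)
    qed
  qed
  ultimately show ?thesis by simp
qed

text \<open>
  The zero set of a prime polynomial determines which polynomials it divides.
\<close>

lemma prime_separates:
  assumes "prime_elem \<pi>" "\<not> \<pi> dvd g"
  obtains z where "ev \<pi> z = 0" "ev g z \<noteq> 0"
  using separating_ev assms unfolding separating_def by blast

lemma ev_nonzero:
  assumes "P \<noteq> 0" obtains z where "ev P z \<noteq> 0"
  using separating_ev assms unfolding separating_def by blast

text \<open>
  Polynomials are only compared on dense open sets \<open>H \<noteq> 0\<close>, as identities on a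
  chart hold only where all functions involved are defined.
\<close>

lemma ev_eqI:
  assumes "H \<noteq> 0" "\<And>z. ev H z \<noteq> 0 \<Longrightarrow> ev P z = ev Q z"
  shows "P = Q"
proof (rule ccontr)
  assume "P \<noteq> Q"
  hence "H * (P - Q) \<noteq> 0" using assms(1) by simp
  then obtain z where "ev (H * (P - Q)) z \<noteq> 0" by (rule ev_nonzero)
  thus False using assms(2)[of z] by auto
qed

lemma poly3_induct [case_names con var add mult]:
  assumes c: "\<And>c. Q (con c)" and v: "\<And>k. Q (var k)"
    and a: "\<And>P P'. Q P \<Longrightarrow> Q P' \<Longrightarrow> Q (P + P')" and m: "\<And>P P'. Q P \<Longrightarrow> Q P' \<Longrightarrow> Q (P * P')"
  shows "Q P"
proof -
  have v1: "Q [:0, 1:]" and v2: "Q [:[:0, 1:]:]" and v3: "Q [:[:[:0, 1:]:]:]"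
    using v[of 1] v[of 2] v[of 3] by (auto simp: var_def)
  have Q0: "Q 0" using c[of 0] by (simp add: con_def)
  have 1: "Q [:[:p:]:]" for p :: "complex poly"
  proof (induction p)
    case 0 thus ?case using Q0 by simp
  next
    case (pCons x p)
    have "[:[:pCons x p:]:] = con x + [:[:[:0, 1:]:]:] * [:[:p:]:]" by (simp add: con_def)
    thus ?case using a[OF c m[OF v3 pCons(2)]] by simp
  qed
  have 2: "Q [:p:]" for p :: "complex poly poly"
  proof (induction p)
    case 0 thus ?case using Q0 by simp
  next
    case (pCons x p)
    have "[:pCons x p:] = [:[:x:]:] + [:[:0, 1:]:] * [:p:]" by simp
    thus ?case using a[OF 1[of x] m[OF v2 pCons(2)]] by simp
  qed
  show "Q P"
  proof (induction P)
    case 0 thus ?case using Q0 by simp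
  next
    case (pCons x p)
    have "pCons x p = [:x:] + [:0, 1:] * p" by simp
    thus ?case using a[OF 2[of x] m[OF v1 pCons(2)]] by simp
  qed
qed

lemma ev_line: "\<exists>r :: complex poly. \<forall>t. ev P (a + t *s b) = poly r t"
proof (induction P rule: poly3_induct)
  case (con c) show ?case by (rule exI[of _ "[:c:]"]) simp
next
  case (var k) show ?case by (rule exI[of _ "[:a $ k, b $ k:]"]) simp
next
  case (add P P') thus ?case by (metis ev_simps(3) poly_add)
next
  case (mult P P') thus ?case by (metis ev_simps(6) poly_mult)
qed

text \<open>
  The expansion to first order at \<open>a\<close> with polynomial coefficients; the values of
  \<open>Q k\<close> at \<open>a\<close> are the partial derivatives.
\<close>

lemma ev_taylor: "\<exists>Q. \<forall>z. ev P z = ev P a + (\<Sum>k\<in>UNIV. (z $ k - a $ k) * ev (Q k) z)"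
proof (induction P rule: poly3_induct)
  case (con c) show ?case by (rule exI[of _ "\<lambda>_. 0"]) simp
next
  case (var k) show ?case
    by (rule exI[of _ "\<lambda>j. if j = k then 1 else 0"]) (simp add: if_distrib[of "\<lambda>P. ev P z" for z] if_distrib[of "(*) c" for c] cong: if_cong)
next
  case (add P P')
  then obtain Q Q' where "\<And>z. ev P z = ev P a + (\<Sum>k\<in>UNIV. (z $ k - a $ k) * ev (Q k) z)"
    "\<And>z. ev P' z = ev P' a + (\<Sum>k\<in>UNIV. (z $ k - a $ k) * ev (Q' k) z)" by blast
  moreover have "ev (P + P') z = ev (P + P') a + (\<Sum>k\<in>UNIV. (z $ k - a $ k) * ev (Q k + Q' k) z)" for z
  proof -
    have "(\<Sum>k\<in>UNIV. (z $ k - a $ k) * ev (Q k + Q' k) z) =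
        (ev P z - ev P a) + (ev P' z - ev P' a)"
      by (subst calculation(1)[of z], subst calculation(2)[of z]) (simp add: distrib_left sum.distrib)
    thus ?thesis by simp
  qed
  ultimately show ?case by (intro exI[of _ "\<lambda>k. Q k + Q' k"]) blast
next
  case (mult P P')
  then obtain Q Q' where Q: "\<And>z. ev P z = ev P a + (\<Sum>k\<in>UNIV. (z $ k - a $ k) * ev (Q k) z)"
    "\<And>z. ev P' z = ev P' a + (\<Sum>k\<in>UNIV. (z $ k - a $ k) * ev (Q' k) z)" by blast
  have "ev (P * P') z = ev (P * P') a +
      (\<Sum>k\<in>UNIV. (z $ k - a $ k) * ev (P * Q' k + con (ev P' a) * Q k) z)" for z
  proof -
    have "ev (P * P') z = ev P z * (ev P' z - ev P' a) + ev P' a * (ev P z - ev P a) + ev (P * P') a"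
      by (simp add: algebra_simps)
    also have "ev P' z - ev P' a = (\<Sum>k\<in>UNIV. (z $ k - a $ k) * ev (Q' k) z)" using Q(2)[of z] by simp
    also have "ev P z - ev P a = (\<Sum>k\<in>UNIV. (z $ k - a $ k) * ev (Q k) z)" using Q(1)[of z] by simp
    finally show ?thesis
      by (simp add: sum_distrib_left distrib_left sum.distrib mult.left_commute)
  qed
  thus ?case by (intro exI[of _ "\<lambda>k. P * Q' k + con (ev P' a) * Q k"]) blast
qed

definition coeff3 :: "poly3 \<Rightarrow> nat \<times> nat \<times> nat \<Rightarrow> complex" where
  "coeff3 P = (\<lambda>(a, b, c). coeff (coeff (coeff P a) b) c)"

text \<open>
  The degree in each variable is bounded separately, so that the exponents allowed form a box.
\<close>

definition deg_le :: "nat \<Rightarrow> poly3 \<Rightarrow> bool" where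
  "deg_le M P \<longleftrightarrow> (\<forall>x. x \<notin> {..M} \<times> {..M} \<times> {..M} \<longrightarrow> coeff3 P x = 0)"

lemma coeff3_eqI: "(\<And>x. coeff3 P x = coeff3 Q x) \<Longrightarrow> P = Q"
  by (intro poly_eqI) (auto simp: coeff3_def)

lemma coeff3_con: "coeff3 (con c) x = (if x = (0, 0, 0) then c else 0)"
  by (cases x) (auto simp: coeff3_def con_def coeff_pCons split: nat.splits)

lemma coeff3_sum: "coeff3 (sum f A) x = (\<Sum>i\<in>A. coeff3 (f i) x)"
  by (cases x) (simp add: coeff3_def coeff_sum)

lemma coeff3_add: "coeff3 (P + Q) x = coeff3 P x + coeff3 Q x"
  by (cases x) (simp add: coeff3_def)

lemma coeff3_con_mult: "coeff3 (con c * P) x = c * coeff3 P x"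
  by (cases x) (simp add: coeff3_def con_def)

lemma deg_le_mono: "deg_le M P \<Longrightarrow> M \<le> M' \<Longrightarrow> deg_le M' P"
  unfolding deg_le_def by force

lemma deg_le_mult:
  assumes "deg_le M P" "deg_le M' Q"
  shows "deg_le (M + M') (P * Q)"
proof -
  have "coeff (coeff (coeff P i) j) k * coeff (coeff (coeff Q (a - i)) (b - j)) (c - k) = 0"
    if "\<not> (a \<le> M + M' \<and> b \<le> M + M' \<and> c \<le> M + M')" for a b c i j k
  proof -
    have "(i, j, k) \<notin> {..M} \<times> {..M} \<times> {..M} \<or> (a - i, b - j, c - k) \<notin> {..M'} \<times> {..M'} \<times> {..M'}"
      using that by auto
    thus ?thesis using assms unfolding deg_le_def coeff3_def by force
  qed
  thus ?thesis
    unfolding deg_le_def coeff3_def by (auto simp: coeff_mult coeff_sum intro!: sum.neutral)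
qed

lemma deg_le_ex: "\<exists>M. deg_le M P"
proof (induction P rule: poly3_induct)
  case (con c) show ?case by (auto simp: deg_le_def coeff3_con)
next
  case (var k)
  have "deg_le 1 (var k)"
    unfolding deg_le_def coeff3_def var_def by (auto simp: coeff_pCons split: nat.splits)
  thus ?case by blast
next
  case (add P P')
  then obtain M M' where "deg_le M P" "deg_le M' P'" by blast
  hence "deg_le (max M M') P" "deg_le (max M M') P'" by (auto intro: deg_le_mono)
  hence "deg_le (max M M') (P + P')" by (simp add: deg_le_def coeff3_add)
  thus ?case by blast
next
  case (mult P P') thus ?case using deg_le_mult by blast
qed

section \<open>Chains of irreducible subsets of affine space\<close>

text \<open>
  Gaussian elimination, one equation at a time: the equation \<open>e\<close> is solved for an
  unknown \<open>x0\<close> with nonzero coefficient, which is then eliminated from the other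
  equations.
\<close>

lemma homogeneous_system:
  fixes a :: "'e \<Rightarrow> 'x \<Rightarrow> 'f::field"
  assumes "finite E" "finite A" "card E < card A"
  shows "\<exists>c. (\<exists>x\<in>A. c x \<noteq> 0) \<and> (\<forall>e\<in>E. (\<Sum>x\<in>A. c x * a e x) = 0)"
  using assms
proof (induction E arbitrary: A a rule: finite_induct)
  case empty
  hence "A \<noteq> {}" by auto
  thus ?case by (intro exI[of _ "\<lambda>_. 1"]) auto
next
  case (insert e E)
  show ?case
  proof (cases "\<forall>x\<in>A. a e x = 0")
    case True
    obtain c where "\<exists>x\<in>A. c x \<noteq> 0" "\<forall>e\<in>E. (\<Sum>x\<in>A. c x * a e x) = 0"
      using insert.IH[of A a] insert.prems insert.hyps by fastforce
    thus ?thesis using True by (intro exI[of _ c]) auto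
  next
    case False
    then obtain x0 where x0: "x0 \<in> A" "a e x0 \<noteq> 0" by blast
    define A' where "A' = A - {x0}"
    have A': "finite A'" "card E < card A'" "A = insert x0 A'" "x0 \<notin> A'"
      using insert.prems insert.hyps x0 unfolding A'_def by auto
    obtain c where c: "\<exists>x\<in>A'. c x \<noteq> 0"
      "\<forall>e'\<in>E. (\<Sum>x\<in>A'. c x * (a e' x - a e' x0 * a e x / a e x0)) = 0"
      using insert.IH[OF A'(1,2), of "\<lambda>e' x. a e' x - a e' x0 * a e x / a e x0"] by blast
    define S where "S = (\<Sum>x\<in>A'. c x * a e x)"
    define d where "d = c(x0 := - S / a e x0)"
    have sum: "(\<Sum>x\<in>A. d x * a e' x) = (\<Sum>x\<in>A'. c x * a e' x) - S / a e x0 * a e' x0" for e'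
    proof -
      have "(\<Sum>x\<in>A'. d x * a e' x) = (\<Sum>x\<in>A'. c x * a e' x)"
        using A'(4) by (intro sum.cong) (auto simp: d_def)
      thus ?thesis using A' by (simp add: d_def)
    qed
    have "(\<Sum>x\<in>A. d x * a e' x) = 0" if "e' \<in> E" for e'
    proof -
      have "(\<Sum>x\<in>A'. c x * (a e' x - a e' x0 * a e x / a e x0)) =
          (\<Sum>x\<in>A'. c x * a e' x) - (\<Sum>x\<in>A'. (a e' x0 / a e x0) * (c x * a e x))"
        by (simp add: sum_subtractf algebra_simps)
      also have "(\<Sum>x\<in>A'. (a e' x0 / a e x0) * (c x * a e x)) = a e' x0 / a e x0 * S"
        by (simp only: S_def sum_distrib_left)
      also have "(\<Sum>x\<in>A'. c x * a e' x) - a e' x0 / a e x0 * S = (\<Sum>x\<in>A. d x * a e' x)"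
        by (simp add: sum)
      finally show ?thesis using c(2) that by simp
    qed
    moreover have "(\<Sum>x\<in>A. d x * a e x) = 0" using x0 by (simp add: sum) (simp add: S_def)
    moreover have "\<exists>x\<in>A. d x \<noteq> 0" using c(1) A' unfolding d_def by auto
    ultimately show ?thesis by (intro exI[of _ d]) auto
  qed
qed

text \<open>
  The head of an exponent list of length \<open>j + 1\<close> is the exponent of \<open>F
  j\<close>, so that dropping the head drops the last polynomial.
\<close>

primrec mon :: "(nat \<Rightarrow> poly3) \<Rightarrow> nat list \<Rightarrow> poly3" where
  "mon F [] = 1"
| "mon F (k # l) = F (length l) ^ k * mon F l"

lemma coeff3_zero: "coeff3 0 x = 0"
  by (cases x) (simp add: coeff3_def)

lemma deg_le_power: "deg_le e P \<Longrightarrow> deg_le (e * k) (P ^ k)"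
proof (induction k)
  case 0 show ?case using coeff3_con[of 1] by (auto simp: deg_le_def con_def simp flip: one_pCons)
next
  case (Suc k) thus ?case using deg_le_mult[of e P "e * k" "P ^ k"] by simp
qed

lemma deg_le_mon:
  assumes "\<And>j. j < length l \<Longrightarrow> deg_le e (F j)"
  shows "deg_le (e * sum_list l) (mon F l)"
  using assms
proof (induction l)
  case Nil show ?case using deg_le_power[of 0 1 0] coeff3_con[of 1]
    by (auto simp: deg_le_def con_def simp flip: one_pCons)
next
  case (Cons k l)
  thus ?case using deg_le_mult[OF deg_le_power[of e "F (length l)" k], of "e * sum_list l" "mon F l"]
    by (simp add: distrib_left)
qed

text \<open>
  Let \<open>S 0 \<subseteq> \<dots> \<subseteq> S n\<close> be sets with prime vanishing ideals
  and \<open>F j\<close> a polynomial that vanishes on \<open>S j\<close>, but not on \<open>S (j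
  + 1)\<close>. Then \<open>F 0, \<dots>, F (j - 1)\<close> satisfy no algebraic relation on
  \<open>S j\<close>. Write a relation on \<open>S (j + 1)\<close> as a polynomial in \<open>F
  j\<close>. As the ideal is prime, the lowest power of \<open>F j\<close> can be cancelled; on
  \<open>S j\<close> only the lowest coefficient survives, and it vanishes by induction on
  \<open>j\<close>.
\<close>

lemma mon_independent:
  fixes S :: "nat \<Rightarrow> (complex ^ 3) set" and F :: "nat \<Rightarrow> poly3"
  assumes ne: "S 0 \<noteq> {}"
    and mono: "\<And>j. j < n \<Longrightarrow> S j \<subseteq> S (Suc j)"
    and prime: "\<And>j P Q. j \<le> n \<Longrightarrow> \<forall>w\<in>S j. ev (P * Q) w = 0 \<Longrightarrow>
                  (\<forall>w\<in>S j. ev P w = 0) \<or> (\<forall>w\<in>S j. ev Q w = 0)"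
    and F0: "\<And>j. j < n \<Longrightarrow> \<forall>w\<in>S j. ev (F j) w = 0"
    and F1: "\<And>j. j < n \<Longrightarrow> \<exists>w\<in>S (Suc j). ev (F j) w \<noteq> 0"
    and "j \<le> n" "\<forall>w\<in>S j. (\<Sum>l | set l \<subseteq> {..D} \<and> length l = j. c l * ev (mon F l) w) = 0"
    and "set l \<subseteq> {..D}" "length l = j"
  shows "c l = 0"
  using assms(6-9)
proof (induction j arbitrary: c l)
  case 0
  have "{l. set l \<subseteq> {..D} \<and> length l = 0} = {[]}" by auto
  thus ?case using 0 ne by auto
next
  case (Suc j)
  define L where "L = {l. set l \<subseteq> {..D} \<and> length l = j}"
  define G where "G k = (\<Sum>l\<in>L. con (c (k # l)) * mon F l)" for k
  have finL: "finite L" unfolding L_def by (rule finite_lists_length_eq) simp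
  have sumL: "(\<Sum>l | set l \<subseteq> {..D} \<and> length l = Suc j. c l * ev (mon F l) w) =
      (\<Sum>k\<le>D. ev (F j) w ^ k * ev (G k) w)" for w
  proof -
    have bij: "bij_betw (\<lambda>(k, l). k # l) ({..D} \<times> L) {l. set l \<subseteq> {..D} \<and> length l = Suc j}"
      unfolding bij_betw_def L_def by (auto simp: inj_on_def image_iff length_Suc_conv)
    have "(\<Sum>l | set l \<subseteq> {..D} \<and> length l = Suc j. c l * ev (mon F l) w) =
        (\<Sum>(k, l)\<in>{..D} \<times> L. c (k # l) * ev (mon F (k # l)) w)"
      by (subst sum.reindex_bij_betw[OF bij, symmetric]) (simp add: case_prod_beta)
    also have "\<dots> = (\<Sum>k\<le>D. \<Sum>l\<in>L. ev (F j) w ^ k * (c (k # l) * ev (mon F l) w))"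
      unfolding sum.cartesian_product[symmetric]
      by (intro sum.cong refl) (auto simp: L_def)
    also have "\<dots> = (\<Sum>k\<le>D. ev (F j) w ^ k * ev (G k) w)"
      by (simp add: G_def sum_distrib_left)
    finally show ?thesis .
  qed
  have "\<forall>l\<in>L. c (k # l) = 0" if "k \<le> D" for k
    using that
  proof (induction k rule: less_induct)
    case (less k)
    have G0: "G k' = 0" if "k' < k" for k'
      using less.IH[OF that] less.prems that unfolding G_def by (intro sum.neutral) (auto simp: con_def)
    define Q where "Q = (\<Sum>k'\<in>{k..D}. F j ^ (k' - k) * G k')"
    have "ev (F j ^ k * Q) w = 0" if "w \<in> S (Suc j)" for w
    proof -
      have "ev (F j ^ k * Q) w = (\<Sum>k'\<in>{k..D}. ev (F j) w ^ k' * ev (G k') w)"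
        unfolding Q_def by (auto simp: sum_distrib_left simp flip: power_add mult.assoc intro!: sum.cong)
      also have "\<dots> = (\<Sum>k'\<le>D. ev (F j) w ^ k' * ev (G k') w)"
        using G0 by (intro sum.mono_neutral_left) auto
      also have "\<dots> = 0" using Suc.prems(2) that sumL by simp
      finally show ?thesis .
    qed
    hence "(\<forall>w\<in>S (Suc j). ev (F j ^ k) w = 0) \<or> (\<forall>w\<in>S (Suc j). ev Q w = 0)"
      using prime[OF Suc.prems(1)] by blast
    moreover have "\<not> (\<forall>w\<in>S (Suc j). ev (F j ^ k) w = 0)"
      using F1[of j] Suc.prems(1) by auto
    ultimately have Q0: "\<forall>w\<in>S (Suc j). ev Q w = 0" by blast
    have "ev (G k) w = 0" if w: "w \<in> S j" for w
    proof -
      have Fw: "ev (F j) w = 0" using F0[of j] Suc.prems(1) w by auto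
      have "ev Q w = (\<Sum>k'\<in>{k..D}. if k' = k then ev (G k) w else 0)"
        unfolding Q_def ev_sum by (rule sum.cong) (auto simp: Fw)
      also have "\<dots> = ev (G k) w" using less.prems by simp
      finally show ?thesis using Q0 w mono[of j] Suc.prems(1) by auto
    qed
    hence "\<forall>w\<in>S j. (\<Sum>l | set l \<subseteq> {..D} \<and> length l = j. c (k # l) * ev (mon F l) w) = 0"
      unfolding G_def L_def by simp
    thus ?case using Suc.IH[of "\<lambda>l. c (k # l)"] Suc.prems(1) unfolding L_def by simp
  qed
  thus ?case using Suc.prems(3,4) unfolding L_def by (auto simp: length_Suc_conv)
qed

text \<open>
  Four polynomials of degree at most \<open>e\<close> in each variable have \<open>(D +
  1)\<^sup>4\<close> monomials with exponents at most \<open>D\<close>, whose degrees are at most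
  \<open>M = 4 e D\<close>. The polynomials of these degrees form a space of dimension \<open>(M +
  1)\<^sup>3\<close>, which is smaller if \<open>D\<close> is large. So there is a relation, in
  contradiction to \<open>mon_independent\<close>.
\<close>

lemma prime_chain_bound:
  fixes S :: "nat \<Rightarrow> (complex ^ 3) set"
  assumes ne: "S 0 \<noteq> {}"
    and mono: "\<And>j. j < n \<Longrightarrow> S j \<subseteq> S (Suc j)"
    and prime: "\<And>j P Q. j \<le> n \<Longrightarrow> \<forall>w\<in>S j. ev (P * Q) w = 0 \<Longrightarrow>
                  (\<forall>w\<in>S j. ev P w = 0) \<or> (\<forall>w\<in>S j. ev Q w = 0)"
    and F: "\<And>j. j < n \<Longrightarrow> \<exists>P. (\<forall>w\<in>S j. ev P w = 0) \<and> (\<exists>w\<in>S (Suc j). ev P w \<noteq> 0)"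
  shows "n \<le> 3"
proof (rule ccontr)
  assume "\<not> n \<le> 3"
  hence n: "4 \<le> n" by simp
  obtain F where F: "\<And>j. j < n \<Longrightarrow> \<forall>w\<in>S j. ev (F j) w = 0" "\<And>j. j < n \<Longrightarrow> \<exists>w\<in>S (Suc j). ev (F j) w \<noteq> 0"
    using F by metis
  obtain d where d: "\<And>j. deg_le (d j) (F j)"
    using choice[of "\<lambda>j M. deg_le M (F j)"] deg_le_ex by blast
  define e where "e = Max (d ` {..<4})"
  have e: "deg_le e (F j)" if "j < 4" for j
    using deg_le_mono[OF d[of j], of e] that unfolding e_def by simp
  \<comment> \<open>With this value, \<open>(4 e D + 1)\<^sup>3 \<le> ((4 e + 1) (D + 1))\<^sup>3 = D (D +
    1)\<^sup>3 < (D + 1)\<^sup>4\<close>.\<close>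
  define D where "D = (4 * e + 1) ^ 3"
  define M where "M = e * (4 * D)"
  define L where "L = {l. set l \<subseteq> {..D} \<and> length l = 4}"
  have "M + 1 \<le> (4 * e + 1) * (D + 1)" unfolding M_def by (simp add: algebra_simps)
  hence "(M + 1) ^ 3 \<le> ((4 * e + 1) * (D + 1)) ^ 3" by (rule power_mono) simp
  also have "\<dots> = D * (D + 1) ^ 3" by (simp only: power_mult_distrib D_def)
  also have "\<dots> < (D + 1) * (D + 1) ^ 3" by simp
  also have "\<dots> = (D + 1) ^ 4" by (simp add: eval_nat_numeral)
  finally have less: "(M + 1) ^ 3 < (D + 1) ^ 4" .
  have card_box: "card ({..M} \<times> {..M} \<times> {..M}) = (M + 1) ^ 3"
    by (simp add: card_cartesian_product eval_nat_numeral)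
  have card_L: "card L = (D + 1) ^ 4" unfolding L_def by (simp add: card_lists_length_eq)
  have finL: "finite L" unfolding L_def by (rule finite_lists_length_eq) simp
  obtain c where c: "\<exists>l\<in>L. c l \<noteq> 0"
      "\<forall>x\<in>{..M} \<times> {..M} \<times> {..M}. (\<Sum>l\<in>L. c l * coeff3 (mon F l) x) = 0"
    using homogeneous_system[OF _ finL, of "{..M} \<times> {..M} \<times> {..M}" "\<lambda>x l. coeff3 (mon F l) x"]
      less card_box card_L by auto
  have degM: "deg_le M (mon F l)" if "l \<in> L" for l
  proof -
    have "sum_list l \<le> length l * D"
      using that sum_list_mono[of l "\<lambda>x. x" "\<lambda>_. D"] unfolding L_def by (auto simp: sum_list_triv)
    hence "e * sum_list l \<le> M" using that unfolding M_def L_def by simp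
    moreover have "deg_le (e * sum_list l) (mon F l)"
      using that e unfolding L_def by (intro deg_le_mon) auto
    ultimately show ?thesis by (rule deg_le_mono[rotated])
  qed
  have "(\<Sum>l\<in>L. con (c l) * mon F l) = 0"
  proof (rule coeff3_eqI)
    fix x
    show "coeff3 (\<Sum>l\<in>L. con (c l) * mon F l) x = coeff3 0 x"
    proof (cases "x \<in> {..M} \<times> {..M} \<times> {..M}")
      case True
      hence "(\<Sum>l\<in>L. c l * coeff3 (mon F l) x) = 0" using c(2) by blast
      thus ?thesis by (simp add: coeff3_sum coeff3_con_mult coeff3_zero)
    next
      case False
      hence "coeff3 (mon F l) x = 0" if "l \<in> L" for l using degM[OF that] unfolding deg_le_def by blast
      thus ?thesis by (simp add: coeff3_sum coeff3_con_mult coeff3_zero)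
    qed
  qed
  hence "ev (\<Sum>l\<in>L. con (c l) * mon F l) w = 0" for w by simp
  hence "\<forall>w\<in>S 4. (\<Sum>l | set l \<subseteq> {..D} \<and> length l = 4. c l * ev (mon F l) w) = 0"
    unfolding L_def by simp
  hence "c l = 0" if "l \<in> L" for l
    using mon_independent[OF ne mono prime F, where j = 4 and D = D and c = c and l = l] that n
    unfolding L_def by auto
  thus False using c(1) by blast
qed

section \<open>Spaces with an atlas of affine 3-spaces\<close>

lemma irreducible_in_opens:
  assumes "irreducible_in T Z" "openin T A" "openin T B" "Z \<inter> A \<noteq> {}" "Z \<inter> B \<noteq> {}"
  shows "Z \<inter> A \<inter> B \<noteq> {}"
proof
  assume *: "Z \<inter> A \<inter> B = {}"
  have "closedin T (topspace T - A)" "closedin T (topspace T - B)"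
    using assms(2,3) by auto
  moreover have "Z \<subseteq> (topspace T - A) \<union> (topspace T - B)"
    using * assms(1) unfolding irreducible_in_def by blast
  ultimately have "Z \<subseteq> topspace T - A \<or> Z \<subseteq> topspace T - B"
    using assms(1) unfolding irreducible_in_def by blast
  thus False using assms(4,5) by blast
qed

lemma irreducible_inI:
  assumes "Z \<subseteq> topspace T" "Z \<noteq> {}"
    and "\<And>A B. openin T A \<Longrightarrow> openin T B \<Longrightarrow> Z \<inter> A \<noteq> {} \<Longrightarrow> Z \<inter> B \<noteq> {} \<Longrightarrow> Z \<inter> A \<inter> B \<noteq> {}"
  shows "irreducible_in T Z"
  unfolding irreducible_in_def
proof (intro conjI allI impI)
  fix A B assume cl: "closedin T A" "closedin T B" and sub: "Z \<subseteq> A \<union> B"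
  have "openin T (topspace T - A)" "openin T (topspace T - B)" using cl by auto
  moreover have "Z \<inter> (topspace T - A) \<inter> (topspace T - B) = {}" using sub by blast
  ultimately have "Z \<inter> (topspace T - A) = {} \<or> Z \<inter> (topspace T - B) = {}" using assms(3) by blast
  thus "Z \<subseteq> A \<or> Z \<subseteq> B" using assms(1) by blast
qed (use assms in auto)

text \<open>
  The charts \<open>pt i\<close> are parametrised by affine 3-space. Open sets and regular
  functions are described by polynomials near each point: \<open>openI\<close> and
  \<open>regI\<close> need one chart per point, \<open>openD\<close> and \<open>regD\<close>
  provide the description in every chart. By \<open>overlap\<close>, every chart meets every other
  one.
\<close>

locale affine_atlas =
  fixes X :: "'a fun_space" and I :: "'i set" and pt :: "'i \<Rightarrow> complex ^ 3 \<Rightarrow> 'a"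
  assumes I_ne: "I \<noteq> {}"
    and inj: "i \<in> I \<Longrightarrow> inj (pt i)"
    and points: "points X = (\<Union>i\<in>I. range (pt i))"
    and openI: "\<lbrakk>W \<subseteq> points X; \<And>p. p \<in> W \<Longrightarrow>
          \<exists>i\<in>I. \<exists>z P. p = pt i z \<and> ev P z \<noteq> 0 \<and> (\<forall>w. ev P w \<noteq> 0 \<longrightarrow> pt i w \<in> W)\<rbrakk>
        \<Longrightarrow> openin (Zar X) W"
    and openD: "\<lbrakk>openin (Zar X) W; i \<in> I; pt i z \<in> W\<rbrakk>
        \<Longrightarrow> \<exists>P. ev P z \<noteq> 0 \<and> (\<forall>w. ev P w \<noteq> 0 \<longrightarrow> pt i w \<in> W)"
    and regI: "\<lbrakk>openin (Zar X) W; \<And>p. p \<in> W \<Longrightarrow>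
          \<exists>i\<in>I. \<exists>z G H. p = pt i z \<and> ev H z \<noteq> 0 \<and>
             (\<forall>w. pt i w \<in> W \<longrightarrow> ev H w \<noteq> 0 \<longrightarrow> f (pt i w) = ev G w / ev H w)\<rbrakk>
        \<Longrightarrow> f \<in> Reg X W"
    and regD: "\<lbrakk>openin (Zar X) W; f \<in> Reg X W; i \<in> I; pt i z \<in> W\<rbrakk>
        \<Longrightarrow> \<exists>G H. ev H z \<noteq> 0 \<and>
             (\<forall>w. pt i w \<in> W \<longrightarrow> ev H w \<noteq> 0 \<longrightarrow> f (pt i w) = ev G w / ev H w)"
    and overlap: "\<lbrakk>i \<in> I; j \<in> I\<rbrakk> \<Longrightarrow> \<exists>P. P \<noteq> 0 \<and> (\<forall>w. ev P w \<noteq> 0 \<longrightarrow> pt i w \<in> range (pt j))"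
begin

lemma pt_eq_iff: "i \<in> I \<Longrightarrow> pt i z = pt i w \<longleftrightarrow> z = w"
  using inj by (auto dest: injD)

lemma pt_in_points: "i \<in> I \<Longrightarrow> pt i z \<in> points X"
  using points by blast

lemma point_cases:
  assumes "p \<in> points X" obtains i z where "i \<in> I" "p = pt i z"
  using assms points by blast

lemma open_basic: "i \<in> I \<Longrightarrow> openin (Zar X) (pt i ` {w. ev P w \<noteq> 0})"
  by (rule openI) (use pt_in_points in blast)+

lemma open_chart: "i \<in> I \<Longrightarrow> openin (Zar X) (range (pt i))"
  using open_basic[of i 1] by simp

text \<open>
  Each chart is dense: an open set contains the complement of a hypersurface in some chart, and
  this meets the part of that chart which lies in chart \<open>i\<close>, because a product of
  nonzero polynomials is nonzero.
\<close>

lemma chart_dense: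
  assumes "openin (Zar X) W" "W \<noteq> {}" "i \<in> I"
  obtains P where "P \<noteq> 0" "\<And>w. ev P w \<noteq> 0 \<Longrightarrow> pt i w \<in> W"
proof -
  obtain p where "p \<in> W" using assms(2) by blast
  moreover from this have "p \<in> points X" using assms(1) openin_subset by blast
  ultimately obtain j z where j: "j \<in> I" "pt j z \<in> W" by (metis point_cases)
  obtain P where P: "ev P z \<noteq> 0" "\<forall>w. ev P w \<noteq> 0 \<longrightarrow> pt j w \<in> W" using openD[OF assms(1) j] by blast
  obtain Q where Q: "Q \<noteq> 0" "\<forall>w. ev Q w \<noteq> 0 \<longrightarrow> pt j w \<in> range (pt i)" using overlap[OF j(1) assms(3)] by blast
  have "P * Q \<noteq> 0" using P(1) Q(1) by auto
  then obtain w where w: "ev (P * Q) w \<noteq> 0" by (rule ev_nonzero)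
  hence "pt j w \<in> W" "pt j w \<in> range (pt i)" using P(2) Q(2) by auto
  then obtain u where "pt i u \<in> W" by auto
  from openD[OF assms(1,3) this] obtain R where "ev R u \<noteq> 0" "\<forall>w. ev R w \<noteq> 0 \<longrightarrow> pt i w \<in> W" by blast
  moreover from this have "R \<noteq> 0" by auto
  ultimately show ?thesis using that by blast
qed

lemma opens_meet:
  assumes "openin (Zar X) A" "openin (Zar X) B" "A \<noteq> {}" "B \<noteq> {}"
  shows "A \<inter> B \<noteq> {}"
proof -
  obtain i where i: "i \<in> I" using I_ne by blast
  obtain P where P: "P \<noteq> 0" "\<And>w. ev P w \<noteq> 0 \<Longrightarrow> pt i w \<in> A" using chart_dense[OF assms(1,3) i] by blast
  obtain Q where Q: "Q \<noteq> 0" "\<And>w. ev Q w \<noteq> 0 \<Longrightarrow> pt i w \<in> B" using chart_dense[OF assms(2,4) i] by blast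
  have "P * Q \<noteq> 0" using P(1) Q(1) by simp
  then obtain w where "ev (P * Q) w \<noteq> 0" by (rule ev_nonzero)
  thus ?thesis using P(2) Q(2) by auto
qed

lemma irreducible: "irreducible_in (Zar X) (points X)"
proof (rule irreducible_inI)
  show "points X \<noteq> {}" using I_ne points by auto
  fix A B assume "openin (Zar X) A" "openin (Zar X) B" "points X \<inter> A \<noteq> {}" "points X \<inter> B \<noteq> {}"
  thus "points X \<inter> A \<inter> B \<noteq> {}"
    using opens_meet[of A B] openin_subset[of "Zar X" A] by blast
qed simp

subsection \<open>Dimension\<close>

text \<open>
  A chart around a point of the smallest member of a chain sees the whole chain: an irreducible
  closed set is the closure of its part in any open set that it meets, so the inclusions remain
  strict in the chart.
\<close>

lemma chain_bound:
  assumes Z: "\<And>j. j \<le> n \<Longrightarrow> closedin (Zar X) (Z j) \<and> irreducible_in (Zar X) (Z j)"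
    and strict: "\<And>j. j < n \<Longrightarrow> Z j \<subset> Z (Suc j)"
  shows "n \<le> 3"
proof -
  obtain p where p: "p \<in> Z 0" using Z[of 0] unfolding irreducible_in_def by auto
  hence "p \<in> points X" using Z[of 0] closedin_subset by blast
  then obtain i z0 where i: "i \<in> I" "p = pt i z0" by (rule point_cases)
  define S where "S j = {w. pt i w \<in> Z j}" for j
  have "Z 0 \<subseteq> Z j" if "j \<le> n" for j
    using that
  proof (induction j)
    case (Suc j) thus ?case using strict[of j] by auto
  qed simp
  hence pj: "p \<in> Z j" if "j \<le> n" for j using p that by blast
  have basic: "closedin (Zar X) (points X - pt i ` {w. ev P w \<noteq> 0})" for P
    using open_basic[OF i(1)] by auto
  show ?thesis
  proof (rule prime_chain_bound[where S = S])
    show "S 0 \<noteq> {}" using p i unfolding S_def by auto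
    show "S j \<subseteq> S (Suc j)" if "j < n" for j using strict[OF that] unfolding S_def by auto
    show "(\<forall>w\<in>S j. ev P w = 0) \<or> (\<forall>w\<in>S j. ev Q w = 0)"
      if j: "j \<le> n" and PQ: "\<forall>w\<in>S j. ev (P * Q) w = 0" for j P Q
    proof (rule ccontr)
      assume "\<not> ?thesis"
      hence "Z j \<inter> pt i ` {w. ev P w \<noteq> 0} \<noteq> {}" "Z j \<inter> pt i ` {w. ev Q w \<noteq> 0} \<noteq> {}"
        unfolding S_def by auto
      hence "Z j \<inter> pt i ` {w. ev P w \<noteq> 0} \<inter> pt i ` {w. ev Q w \<noteq> 0} \<noteq> {}"
        using irreducible_in_opens[of "Zar X" "Z j"] Z[OF j] open_basic[OF i(1)] by blast
      then obtain q where "q \<in> Z j" "q \<in> pt i ` {w. ev P w \<noteq> 0}" "q \<in> pt i ` {w. ev Q w \<noteq> 0}"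
        by blast
      then obtain w w' where "pt i w \<in> Z j" "ev P w \<noteq> 0" "pt i w = pt i w'" "ev Q w' \<noteq> 0"
        by blast
      moreover from this have "w = w'" using pt_eq_iff[OF i(1)] by simp
      ultimately show False using PQ unfolding S_def by auto
    qed
    show "\<exists>P. (\<forall>w\<in>S j. ev P w = 0) \<and> (\<exists>w\<in>S (Suc j). ev P w \<noteq> 0)" if j: "j < n" for j
    proof -
      have op: "openin (Zar X) (points X - Z j)" using Z[of j] j by auto
      have sub: "Z (Suc j) \<subseteq> points X" using Z[of "Suc j"] j closedin_subset by auto
      hence "Z (Suc j) \<inter> (points X - Z j) \<noteq> {}" using strict[OF j] by auto
      moreover have "Z (Suc j) \<inter> range (pt i) \<noteq> {}" using pj[of "Suc j"] j i by auto
      ultimately have "Z (Suc j) \<inter> (points X - Z j) \<inter> range (pt i) \<noteq> {}"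
        using irreducible_in_opens[of "Zar X" "Z (Suc j)"] Z[of "Suc j"] j op open_chart[OF i(1)] by auto
      then obtain u where u: "pt i u \<in> Z (Suc j)" "pt i u \<in> points X - Z j" by auto
      obtain P where "ev P u \<noteq> 0" "\<forall>w. ev P w \<noteq> 0 \<longrightarrow> pt i w \<in> points X - Z j"
        using openD[OF op i(1) u(2)] by blast
      thus ?thesis using u(1) unfolding S_def by auto
    qed
  qed
qed

text \<open>
  Two nonempty open subsets of \<open>V\<close> contain points \<open>a\<close> and
  \<open>b\<close>; on the line through these, both contain complements of finite sets, so they
  meet.
\<close>

lemma closure_lines_irreducible:
  assumes i: "i \<in> I" and ne: "V \<noteq> {}"
    and line: "\<And>a b t. a \<in> V \<Longrightarrow> b \<in> V \<Longrightarrow> a + t *s (b - a) \<in> V"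
  shows "irreducible_in (Zar X) (Zar X closure_of (pt i ` V))"
proof (rule irreducible_inI)
  have sub: "pt i ` V \<subseteq> Zar X closure_of (pt i ` V)"
    using closure_of_subset[of "pt i ` V" "Zar X"] pt_in_points[OF i] by blast
  show "Zar X closure_of (pt i ` V) \<subseteq> points X" by (rule closure_of_subset_topspace)
  show "Zar X closure_of (pt i ` V) \<noteq> {}" using sub ne by blast
  fix A B assume AB: "openin (Zar X) A" "openin (Zar X) B"
    "Zar X closure_of (pt i ` V) \<inter> A \<noteq> {}" "Zar X closure_of (pt i ` V) \<inter> B \<noteq> {}"
  hence "A \<inter> pt i ` V \<noteq> {}" "B \<inter> pt i ` V \<noteq> {}"
    using openin_Int_closure_of_eq_empty[OF AB(1)] openin_Int_closure_of_eq_empty[OF AB(2)] by blast+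
  then obtain a b where ab: "a \<in> V" "b \<in> V" "pt i a \<in> A" "pt i b \<in> B" by blast
  obtain P where P: "ev P a \<noteq> 0" "\<forall>w. ev P w \<noteq> 0 \<longrightarrow> pt i w \<in> A" using openD[OF AB(1) i ab(3)] by blast
  obtain Q where Q: "ev Q b \<noteq> 0" "\<forall>w. ev Q w \<noteq> 0 \<longrightarrow> pt i w \<in> B" using openD[OF AB(2) i ab(4)] by blast
  obtain r where r: "\<forall>t. ev P (a + t *s (b - a)) = poly r t" using ev_line by blast
  obtain s where s: "\<forall>t. ev Q (a + t *s (b - a)) = poly s t" using ev_line by blast
  have "poly r 0 \<noteq> 0" "poly s 1 \<noteq> 0"
    using r[rule_format, of 0] s[rule_format, of 1] P(1) Q(1) by (auto simp: vector_smult_lzero)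
  hence "r * s \<noteq> 0" by auto
  then obtain t where "poly (r * s) t \<noteq> 0" using poly_all_0_iff_0 by blast
  hence "ev P (a + t *s (b - a)) \<noteq> 0" "ev Q (a + t *s (b - a)) \<noteq> 0" using r s by auto
  hence "pt i (a + t *s (b - a)) \<in> A \<inter> B" using P(2) Q(2) by blast
  thus "Zar X closure_of (pt i ` V) \<inter> A \<inter> B \<noteq> {}" using sub line[OF ab(1,2), of t] by blast
qed

lemma krull_dim_3: "krull_dim (Zar X) = 3"
proof -
  obtain i where i: "i \<in> I" using I_ne by blast
  \<comment> \<open>The closures of the coordinate subspaces of dimension 0, 1, 2, 3 of a chart.\<close>
  define V :: "nat \<Rightarrow> (complex ^ 3) set" where
    "V d = {w. (d < 1 \<longrightarrow> w $ 1 = 0) \<and> (d < 2 \<longrightarrow> w $ 2 = 0) \<and> (d < 3 \<longrightarrow> w $ 3 = 0)}" for d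
  define Z where "Z d = Zar X closure_of (pt i ` V d)" for d
  have irr: "irreducible_in (Zar X) (Z d)" for d
    unfolding Z_def
  proof (rule closure_lines_irreducible[OF i])
    show "V d \<noteq> {}" unfolding V_def by (auto intro: exI[of _ 0])
  qed (auto simp: V_def)
  have cl: "closedin (Zar X) (Z d)" for d unfolding Z_def by simp
  have strict: "Z d \<subset> Z (Suc d)" if d: "d < 3" for d
  proof
    show "Z d \<subseteq> Z (Suc d)" unfolding Z_def by (intro closure_of_mono image_mono) (auto simp: V_def)
    obtain k :: 3 where k: "axis k 1 \<in> V (Suc d)" "\<And>w. w \<in> V d \<Longrightarrow> w $ k = 0"
    proof -
      consider "d = 0" | "d = 1" | "d = 2" using d by linarith
      thus ?thesis
      proof cases
        case 1 show ?thesis by (rule that[of 1]) (auto simp: V_def 1 axis_def)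
      next
        case 2 show ?thesis by (rule that[of 2]) (auto simp: V_def 2 axis_def)
      next
        case 3 show ?thesis by (rule that[of 3]) (auto simp: V_def 3 axis_def)
      qed
    qed
    let ?A = "pt i ` {w. ev (var k) w \<noteq> 0}"
    have "?A \<inter> pt i ` V d = {}" using k(2) pt_eq_iff[OF i] by auto
    hence "?A \<inter> Z d = {}" unfolding Z_def
      using openin_Int_closure_of_eq_empty[OF open_basic[OF i]] by blast
    moreover have "pt i (axis k 1) \<in> ?A" by (simp add: axis_def)
    moreover have "pt i (axis k 1) \<in> Z (Suc d)"
      unfolding Z_def using closure_of_subset[of "pt i ` V (Suc d)" "Zar X"] k(1) pt_in_points[OF i] by blast
    ultimately show "Z d \<noteq> Z (Suc d)" by blast
  qed
  have "enat 3 \<in> {enat n | n. \<exists>Z. (\<forall>i\<le>n. closedin (Zar X) (Z i) \<and> irreducible_in (Zar X) (Z i)) \<and> (\<forall>i<n. Z i \<subset> Z (Suc i))}"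
    using cl irr strict by blast
  hence "enat 3 \<le> krull_dim (Zar X)" unfolding krull_dim_def by (rule Sup_upper)
  moreover have "krull_dim (Zar X) \<le> enat 3"
    unfolding krull_dim_def by (rule Sup_least) (use chain_bound in fastforce)
  ultimately show ?thesis by (metis antisym numeral_eq_enat)
qed

subsection \<open>Regular functions\<close>

lemma reg_sheaf:
  assumes W: "openin (Zar X) W"
    and loc: "\<And>p. p \<in> W \<Longrightarrow> \<exists>W' f'. openin (Zar X) W' \<and> p \<in> W' \<and> f' \<in> Reg X W' \<and> (\<forall>q\<in>W \<inter> W'. f q = f' q)"
  shows "f \<in> Reg X W"
proof (rule regI[OF W])
  fix p assume p: "p \<in> W"
  obtain W' f' where W': "openin (Zar X) W'" "p \<in> W'" "f' \<in> Reg X W'" "\<forall>q\<in>W \<inter> W'. f q = f' q"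
    using loc[OF p] by blast
  have "p \<in> points X" using p W openin_subset by blast
  then obtain i z where i: "i \<in> I" "p = pt i z" by (rule point_cases)
  obtain G H where GH: "ev H z \<noteq> 0" "\<forall>w. pt i w \<in> W' \<longrightarrow> ev H w \<noteq> 0 \<longrightarrow> f' (pt i w) = ev G w / ev H w"
    using regD[OF W'(1,3) i(1)] W'(2) i(2) by blast
  obtain P where P: "ev P z \<noteq> 0" "\<forall>w. ev P w \<noteq> 0 \<longrightarrow> pt i w \<in> W'"
    using openD[OF W'(1) i(1)] W'(2) i(2) by blast
  have "f (pt i w) = ev (G * P) w / ev (H * P) w" if "pt i w \<in> W" "ev (H * P) w \<noteq> 0" for w
    using that GH(2) P(2) W'(4) by auto
  moreover have "ev (H * P) z \<noteq> 0" using GH(1) P(1) by simp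
  ultimately show "\<exists>i\<in>I. \<exists>z G H. p = pt i z \<and> ev H z \<noteq> 0 \<and>
             (\<forall>w. pt i w \<in> W \<longrightarrow> ev H w \<noteq> 0 \<longrightarrow> f (pt i w) = ev G w / ev H w)"
    using i by blast
qed

lemma reg_restrict: "f \<in> Reg X W' \<Longrightarrow> openin (Zar X) W' \<Longrightarrow> openin (Zar X) W \<Longrightarrow> W \<subseteq> W' \<Longrightarrow> f \<in> Reg X W"
  by (rule reg_sheaf) blast+

lemma reg_fraction:
  assumes "i \<in> I" "openin (Zar X) W" "\<And>p. p \<in> W \<Longrightarrow> \<exists>w. p = pt i w \<and> ev H w \<noteq> 0 \<and> f p = ev G w / ev H w"
  shows "f \<in> Reg X W"
proof (rule regI[OF assms(2)])
  fix p assume "p \<in> W"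
  then obtain z where z: "p = pt i z" "ev H z \<noteq> 0" using assms(3) by blast
  moreover have "f (pt i w) = ev G w / ev H w" if "pt i w \<in> W" for w
    using assms(3)[OF that] pt_eq_iff[OF assms(1)] by auto
  ultimately show "\<exists>i\<in>I. \<exists>z G H. p = pt i z \<and> ev H z \<noteq> 0 \<and>
             (\<forall>w. pt i w \<in> W \<longrightarrow> ev H w \<noteq> 0 \<longrightarrow> f (pt i w) = ev G w / ev H w)"
    using assms(1) by blast
qed

lemma reg_mult:
  assumes W: "openin (Zar X) W" and f: "f \<in> Reg X W" and g: "g \<in> Reg X W"
  shows "(\<lambda>q. f q * g q) \<in> Reg X W"
proof (rule regI[OF W])
  fix p assume p: "p \<in> W"
  hence "p \<in> points X" using W openin_subset by blast
  then obtain i z where i: "i \<in> I" "p = pt i z" by (rule point_cases)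
  obtain G H where 1: "ev H z \<noteq> 0" "\<forall>w. pt i w \<in> W \<longrightarrow> ev H w \<noteq> 0 \<longrightarrow> f (pt i w) = ev G w / ev H w"
    using regD[OF W f i(1)] p i(2) by blast
  obtain G' H' where 2: "ev H' z \<noteq> 0" "\<forall>w. pt i w \<in> W \<longrightarrow> ev H' w \<noteq> 0 \<longrightarrow> g (pt i w) = ev G' w / ev H' w"
    using regD[OF W g i(1)] p i(2) by blast
  have "ev (H * H') z \<noteq> 0"
    "\<forall>w. pt i w \<in> W \<longrightarrow> ev (H * H') w \<noteq> 0 \<longrightarrow> f (pt i w) * g (pt i w) = ev (G * G') w / ev (H * H') w"
    using 1 2 by auto
  thus "\<exists>i\<in>I. \<exists>z G H. p = pt i z \<and> ev H z \<noteq> 0 \<and>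
             (\<forall>w. pt i w \<in> W \<longrightarrow> ev H w \<noteq> 0 \<longrightarrow> f (pt i w) * g (pt i w) = ev G w / ev H w)"
    using i by blast
qed

lemma reg_inverse:
  assumes W: "openin (Zar X) W" and f: "f \<in> Reg X W" and nz: "\<And>q. q \<in> W \<Longrightarrow> f q \<noteq> 0"
  shows "(\<lambda>q. inverse (f q)) \<in> Reg X W"
proof (rule regI[OF W])
  fix p assume p: "p \<in> W"
  hence "p \<in> points X" using W openin_subset by blast
  then obtain i z where i: "i \<in> I" "p = pt i z" by (rule point_cases)
  obtain G H where 1: "ev H z \<noteq> 0" "\<forall>w. pt i w \<in> W \<longrightarrow> ev H w \<noteq> 0 \<longrightarrow> f (pt i w) = ev G w / ev H w"
    using regD[OF W f i(1)] p i(2) by blast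
  have "ev G z \<noteq> 0" using 1 nz[OF p] p i(2) by auto
  hence "ev (G * H) z \<noteq> 0"
    "\<forall>w. pt i w \<in> W \<longrightarrow> ev (G * H) w \<noteq> 0 \<longrightarrow> inverse (f (pt i w)) = ev (H * H) w / ev (G * H) w"
    using 1 by auto
  thus "\<exists>i\<in>I. \<exists>z G H. p = pt i z \<and> ev H z \<noteq> 0 \<and>
             (\<forall>w. pt i w \<in> W \<longrightarrow> ev H w \<noteq> 0 \<longrightarrow> inverse (f (pt i w)) = ev G w / ev H w)"
    using i by blast
qed

lemma reg_const: "openin (Zar X) W \<Longrightarrow> (\<lambda>_. c) \<in> Reg X W"
proof (rule regI)
  fix p assume "openin (Zar X) W" "p \<in> W"
  hence "p \<in> points X" using openin_subset by blast
  then obtain i z where "i \<in> I" "p = pt i z" by (rule point_cases)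
  moreover have "ev 1 z \<noteq> 0 \<and> (\<forall>w. pt i w \<in> W \<longrightarrow> ev 1 w \<noteq> 0 \<longrightarrow> c = ev (con c) w / ev 1 w)" by simp
  ultimately show "\<exists>i\<in>I. \<exists>z G H. p = pt i z \<and> ev H z \<noteq> 0 \<and>
             (\<forall>w. pt i w \<in> W \<longrightarrow> ev H w \<noteq> 0 \<longrightarrow> c = ev G w / ev H w)"
    by blast
qed

lemma unit_iff:
  assumes W: "openin (Zar X) W"
  shows "f \<in> unit_functions X W \<longleftrightarrow> f \<in> Reg X W \<and> (\<forall>q\<in>W. f q \<noteq> 0)"
proof
  assume "f \<in> unit_functions X W"
  then obtain f' where "f \<in> Reg X W" "\<forall>q\<in>W. f q * f' q = 1" unfolding unit_functions_def by blast
  thus "f \<in> Reg X W \<and> (\<forall>q\<in>W. f q \<noteq> 0)" by force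
next
  assume f: "f \<in> Reg X W \<and> (\<forall>q\<in>W. f q \<noteq> 0)"
  hence "(\<lambda>q. inverse (f q)) \<in> Reg X W" using reg_inverse[OF W] by blast
  moreover have "\<forall>q\<in>W. f q * inverse (f q) = 1" using f by simp
  ultimately show "f \<in> unit_functions X W"
    unfolding unit_functions_def using f by (intro CollectI conjI bexI[of _ "\<lambda>q. inverse (f q)"]) auto
qed

lemma unit_powi:
  assumes W: "openin (Zar X) W" and f: "f \<in> unit_functions X W"
  shows "(\<lambda>q. f q powi n) \<in> unit_functions X W"
proof -
  have f': "f \<in> Reg X W" "\<forall>q\<in>W. f q \<noteq> 0" using f unit_iff[OF W] by auto
  have pos: "(\<lambda>q. g q ^ m) \<in> Reg X W" if "g \<in> Reg X W" for g m
  proof (induction m)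
    case 0 show ?case using reg_const[OF W, of 1] by simp
  next
    case (Suc m) thus ?case using reg_mult[OF W that, of "\<lambda>q. g q ^ m"] by simp
  qed
  have "(\<lambda>q. f q powi n) \<in> Reg X W"
  proof (cases "0 \<le> n")
    case True thus ?thesis using pos[OF f'(1), of "nat n"] by (simp add: power_int_def)
  next
    case False
    have "(\<lambda>q. inverse (f q)) \<in> Reg X W" using reg_inverse[OF W] f' by blast
    from pos[OF this, of "nat (- n)"] show ?thesis using False by (simp add: power_int_def power_inverse)
  qed
  thus ?thesis using f' unit_iff[OF W] by simp
qed

lemma unit_mult:
  assumes W: "openin (Zar X) W" and "f \<in> unit_functions X W" "g \<in> unit_functions X W"
  shows "(\<lambda>q. f q * g q) \<in> unit_functions X W"
  using assms reg_mult[OF W] unit_iff[OF W] by auto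

lemma unit_inverse:
  assumes W: "openin (Zar X) W" and "f \<in> unit_functions X W"
  shows "(\<lambda>q. inverse (f q)) \<in> unit_functions X W"
  using assms reg_inverse[OF W] unit_iff[OF W] by auto

lemma unit_prod:
  assumes W: "openin (Zar X) W" and "finite A" "\<And>a. a \<in> A \<Longrightarrow> f a \<in> unit_functions X W"
  shows "(\<lambda>q. \<Prod>a\<in>A. f a q) \<in> unit_functions X W"
  using assms(2,3)
proof (induction A rule: finite_induct)
  case empty show ?case using reg_const[OF W, of 1] unit_iff[OF W] by simp
next
  case (insert a A) thus ?case using unit_mult[OF W, of "f a" "\<lambda>q. \<Prod>a\<in>A. f a q"] by simp
qed

lemma unit_restrict:
  assumes "openin (Zar X) W'" "f \<in> unit_functions X W'" "openin (Zar X) W" "W \<subseteq> W'"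
  shows "f \<in> unit_functions X W"
proof -
  have f: "f \<in> Reg X W'" "\<forall>q\<in>W'. f q \<noteq> 0" using assms(2) unit_iff[OF assms(1)] by auto
  have "f \<in> Reg X W" by (rule reg_restrict[OF f(1) assms(1,3,4)])
  thus ?thesis using f(2) assms(4) unit_iff[OF assms(3)] by auto
qed

end

section \<open>Factorial properties of the polynomial ring\<close>

lemma prime_elem_X: "prime_elem [:0, 1 :: 'a::idom:]"
  unfolding prime_elem_def
proof (intro conjI allI impI)
  have dvd: "[:0, 1:] dvd p \<longleftrightarrow> poly p 0 = 0" for p :: "'a poly"
    using dvd_iff_poly_eq_0[of 0 p] by simp
  show "\<not> [:0, 1 :: 'a:] dvd 1" by (simp add: dvd)
  fix a b :: "'a poly"
  assume "[:0, 1:] dvd a * b"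
  thus "[:0, 1:] dvd a \<or> [:0, 1:] dvd b" by (simp add: dvd)
qed simp

lemma prime_elem_var: "prime_elem (var k)"
  using exhaust_3[of k] by (auto simp: var_def prime_elem_const_poly_iff prime_elem_X)

lemma unit_poly3:
  assumes "is_unit (P :: poly3)" obtains c where "c \<noteq> 0" "P = con c"
proof -
  obtain p where p: "P = [:p:]" "is_unit p" using assms by (rule is_unit_polyE)
  obtain q where q: "p = [:q:]" "is_unit q" using p(2) by (rule is_unit_polyE)
  obtain r where r: "q = [:r:]" "is_unit r" using q(2) by (rule is_unit_polyE)
  show ?thesis by (rule that[of r]) (use p q r in \<open>auto simp: con_def\<close>)
qed

text \<open>
  A prime factor that does not divide a coordinate would vanish somewhere on the torus, by
  \<open>prime_separates\<close>.
\<close>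

lemma nonvanishing_on_torus:
  assumes "\<And>w. (\<And>k. w $ k \<noteq> 0) \<Longrightarrow> ev P w \<noteq> 0"
  obtains c n where "c \<noteq> 0" "P = con c * (\<Prod>k\<in>UNIV. var k ^ n k)"
proof -
  have "(\<forall>w. (\<forall>k. w $ k \<noteq> 0) \<longrightarrow> ev P w \<noteq> 0) \<longrightarrow>
      (\<exists>c n. c \<noteq> 0 \<and> P = con c * (\<Prod>k\<in>UNIV. var k ^ n k))"
  proof (induction P rule: prime_divisors_induct)
    case zero
    have "\<forall>k. (1 :: complex ^ 3) $ k \<noteq> 0" by simp
    thus ?case by (metis ev_simps(1))
  next
    case (unit P)
    then obtain c where "c \<noteq> 0" "P = con c" by (rule unit_poly3)
    thus ?case by (intro impI exI[of _ c] exI[of _ "\<lambda>_. 0"]) simp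
  next
    case (factor p P)
    show ?case
    proof
      assume nv: "\<forall>w. (\<forall>k. w $ k \<noteq> 0) \<longrightarrow> ev (p * P) w \<noteq> 0"
      hence "\<forall>w. (\<forall>k. w $ k \<noteq> 0) \<longrightarrow> ev P w \<noteq> 0" by auto
      then obtain c n where cn: "c \<noteq> 0" "P = con c * (\<Prod>k\<in>UNIV. var k ^ n k)" using factor.IH by blast
      have pe: "prime_elem p" using factor.hyps by blast
      have "p dvd (\<Prod>k\<in>UNIV. var k)"
      proof (rule ccontr)
        assume "\<not> ?thesis"
        then obtain z where z: "ev p z = 0" "ev (\<Prod>k\<in>UNIV. var k) z \<noteq> 0"
          using prime_separates[OF pe] by blast
        hence "\<forall>k. z $ k \<noteq> 0" by simp
        thus False using nv z(1) by auto
      qed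
      then obtain k where "p dvd var k" using prime_dvd_prod_iff[of UNIV p var] factor.hyps by auto
      then obtain q where q: "var k = p * q" by blast
      hence "is_unit q"
        using prime_elem_imp_irreducible[OF prime_elem_var[of k]] pe prime_elem_not_unit
        unfolding irreducible_def by blast
      then obtain d where d: "d \<noteq> 0" "q = con d" by (rule unit_poly3)
      have "con (inverse d) * con d = 1" using d(1) by (simp add: con_def one_pCons)
      hence "p = con (inverse d) * var k" using q d by (simp add: mult.commute[of p] flip: mult.assoc)
      hence "p * P = con (inverse d * c) * (var k * (\<Prod>k\<in>UNIV. var k ^ n k))"
        using cn by (simp add: con_def mult_ac)
      also have "var k * (\<Prod>k\<in>UNIV. var k ^ n k) = (\<Prod>j\<in>UNIV. var j ^ (n(k := n k + 1)) j)"
        by (simp add: prod.remove[of UNIV k])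
      finally show "\<exists>c n. c \<noteq> 0 \<and> p * P = con c * (\<Prod>k\<in>UNIV. var k ^ n k)"
        using cn(1) d(1) by (intro exI[of _ "inverse d * c"] exI[of _ "n(k := n k + 1)"]) simp
    qed
  qed
  thus ?thesis using assms that by blast
qed

lemma multiplicity_prime_power_prod:
  assumes "finite S" "\<And>x. x \<in> S \<Longrightarrow> prime x" "prime p"
  shows "multiplicity p (\<Prod>x\<in>S. x ^ f x) = (if p \<in> S then f p else 0)"
proof -
  have "x \<noteq> 0" if "x \<in> S" for x using assms(2)[OF that] by auto
  hence "multiplicity p (\<Prod>x\<in>S. x ^ f x) = (\<Sum>x\<in>S. multiplicity p (x ^ f x))"
    using assms(1,3) by (intro prime_elem_multiplicity_prod_distrib) auto
  also have "\<dots> = (\<Sum>x\<in>S. if x = p then f p else 0)"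
    using assms(2,3) multiplicity_distinct_prime_power[OF assms(3)]
    by (intro sum.cong refl) (auto simp: multiplicity_same_power)
  also have "\<dots> = (if p \<in> S then f p else 0)" using assms(1) by simp
  finally show ?thesis .
qed

lemma reduced_fraction:
  fixes u v :: poly3
  assumes "v \<noteq> 0"
  obtains u' v' g where "u = u' * g" "v = v' * g" "coprime u' v'" "g \<noteq> 0"
proof -
  have nz: "gcd u v \<noteq> 0" using assms by simp
  then obtain u' v' where "u = u' * gcd u v" "v = v' * gcd u v" "coprime u' v'"
    using gcd_coprime_exists by blast
  thus ?thesis using nz by (rule that)
qed

text \<open>
  The hypothesis says that the fraction \<open>u / v\<close> has neither zeros nor poles through
  the point \<open>z\<close>. In lowest terms, a prime factor of the numerator or denominator
  vanishing at \<open>z\<close> would divide both.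
\<close>

lemma equal_multiplicities_unit:
  fixes u v :: poly3
  assumes nz: "u \<noteq> 0" "v \<noteq> 0"
    and mult: "\<And>\<pi>. prime \<pi> \<Longrightarrow> ev \<pi> z = 0 \<Longrightarrow> multiplicity \<pi> u = multiplicity \<pi> v"
  obtains u' v' where "u * v' = v * u'" "ev u' z \<noteq> 0" "ev v' z \<noteq> 0"
proof -
  obtain u' v' g where g: "u = u' * g" "v = v' * g" "coprime u' v'" "g \<noteq> 0"
    by (rule reduced_fraction[OF nz(2)])
  have nz': "u' \<noteq> 0" "v' \<noteq> 0" using g nz by auto
  have eq: "multiplicity \<pi> u' = multiplicity \<pi> v'" if "prime \<pi>" "ev \<pi> z = 0" for \<pi>
    using mult[OF that] that(1) nz' g(4) unfolding g(1,2)
    by (simp add: prime_elem_multiplicity_mult_distrib)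
  have no: False if P: "P = u' \<or> P = v'" "ev P z = 0" for P
  proof -
    have "P \<noteq> 0" using P nz' by auto
    have "\<exists>\<pi>. prime \<pi> \<and> \<pi> dvd P \<and> ev \<pi> z = 0"
      using \<open>P \<noteq> 0\<close> P(2)
    proof (induction P rule: prime_divisors_induct)
      case (unit P) thus ?case by (auto elim: unit_poly3)
    next
      case (factor p P)
      show ?case
      proof (cases "ev p z = 0")
        case True thus ?thesis using factor.hyps by auto
      next
        case False
        hence "ev P z = 0" "P \<noteq> 0" using factor.prems by auto
        thus ?thesis using factor.IH by (meson dvd_mult)
      qed
    qed simp
    then obtain \<pi> where \<pi>: "prime \<pi>" "\<pi> dvd P" "ev \<pi> z = 0" by blast
    have iff: "\<pi> dvd Q \<longleftrightarrow> multiplicity \<pi> Q \<noteq> 0" if "Q \<noteq> 0" for Q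
      using prime_elem_multiplicity_eq_zero_iff[of \<pi> Q] \<pi>(1) that by auto
    have "\<pi> dvd u' \<and> \<pi> dvd v'"
      using P(1) \<pi>(2) eq[OF \<pi>(1,3)] iff[OF nz'(1)] iff[OF nz'(2)] by auto
    hence "is_unit \<pi>" using g(3) by (meson coprime_common_divisor)
    thus False using \<pi>(1) by auto
  qed
  have "u * v' = v * u'" using g(1,2) by (simp add: mult_ac)
  thus ?thesis using that no by blast
qed

section \<open>Smoothness and line bundles in an atlas\<close>

context affine_atlas
begin

subsection \<open>Cotangent spaces\<close>

lemma max_germs_sqI:
  assumes "\<And>k :: 3. g k \<in> max_germs X p \<and> h k \<in> max_germs X p"
    and "openin (Zar X) U" "p \<in> U" "\<And>q. q \<in> U \<Longrightarrow> f q = (\<Sum>k\<in>UNIV. g k q * h k q)"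
  shows "f \<in> max_germs_sq X p"
proof -
  obtain b where b: "bij_betw b {0..<CARD(3)} (UNIV :: 3 set)"
    using ex_bij_betw_nat_finite[of "UNIV :: 3 set"] by auto
  have "(\<Sum>k\<in>UNIV. g k q * h k q) = (\<Sum>i<CARD(3). g (b i) q * h (b i) q)" for q
    using sum.reindex_bij_betw[OF b, of "\<lambda>k. g k q * h k q"] by (simp add: atLeast0LessThan)
  hence "\<forall>q\<in>U. f q = (\<Sum>i<CARD(3). (g \<circ> b) i q * (h \<circ> b) i q)" using assms(4) by simp
  moreover have "\<forall>i<CARD(3). (g \<circ> b) i \<in> max_germs X p \<and> (h \<circ> b) i \<in> max_germs X p"
    using assms(1) by simp
  ultimately show ?thesis unfolding max_germs_sq_def using assms(2,3) by blast
qed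

text \<open>
  Derivatives along lines are the linear functionals that show that the coordinates are linearly
  independent modulo the square of the maximal ideal.
\<close>

lemma germ_derivative:
  assumes "i \<in> I" "openin (Zar X) W" "pt i a \<in> W" "f \<in> Reg X W"
  obtains D where "((\<lambda>t. f (pt i (a + t *s v))) has_field_derivative D) (at 0)"
proof -
  obtain G H where GH: "ev H a \<noteq> 0" "\<forall>w. pt i w \<in> W \<longrightarrow> ev H w \<noteq> 0 \<longrightarrow> f (pt i w) = ev G w / ev H w"
    using regD[OF assms(2,4,1,3)] by blast
  obtain P where P: "ev P a \<noteq> 0" "\<forall>w. ev P w \<noteq> 0 \<longrightarrow> pt i w \<in> W" using openD[OF assms(2,1,3)] by blast
  obtain g where g: "\<forall>t. ev G (a + t *s v) = poly g t" using ev_line by blast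
  obtain h where h: "\<forall>t. ev H (a + t *s v) = poly h t" using ev_line by blast
  obtain r where r: "\<forall>t. ev P (a + t *s v) = poly r t" using ev_line by blast
  have 0: "poly h 0 \<noteq> 0" "poly r 0 \<noteq> 0"
    using GH(1) P(1) h[rule_format, of 0] r[rule_format, of 0] by (auto simp: vector_smult_lzero)
  define S where "S = {t. poly h t * poly r t \<noteq> 0}"
  have S: "open S" unfolding S_def by (intro open_Collect_neq continuous_intros)
  have S0: "0 \<in> S" using 0 unfolding S_def by simp
  have eq: "poly g t / poly h t = f (pt i (a + t *s v))" if "t \<in> S" for t
    using that GH(2) P(2) g h r unfolding S_def by auto
  obtain D where D: "((\<lambda>t. poly g t / poly h t) has_field_derivative D) (at 0)"
    using DERIV_quotient[OF poly_DERIV[of g 0] poly_DERIV[of h 0]] 0(1) by blast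
  have "((\<lambda>t. f (pt i (a + t *s v))) has_field_derivative D) (at 0)"
    by (rule has_field_derivative_transform_within_open[OF D S S0 eq])
  thus ?thesis by (rule that)
qed

text \<open>
  By the product rule, as all factors vanish at the point.
\<close>

lemma square_germ_derivative:
  assumes i: "i \<in> I" and f: "f \<in> max_germs_sq X (pt i a)"
  shows "((\<lambda>t. f (pt i (a + t *s v))) has_field_derivative 0) (at 0)"
proof -
  obtain n :: nat and g h U where gh: "\<forall>j<n. g j \<in> max_germs X (pt i a) \<and> h j \<in> max_germs X (pt i a)"
    and U: "openin (Zar X) U" "pt i a \<in> U" and eq: "\<forall>q\<in>U. f q = (\<Sum>j<n. g j q * h j q)"
    using f unfolding max_germs_sq_def by blast
  have D: "\<exists>D. ((\<lambda>t. g' (pt i (a + t *s v))) has_field_derivative D) (at 0)" "g' (pt i a) = 0"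
    if "g' \<in> max_germs X (pt i a)" for g'
    using that germ_derivative[OF i, of _ a g' v] unfolding max_germs_def by blast+
  have "((\<lambda>t. g j (pt i (a + t *s v)) * h j (pt i (a + t *s v))) has_field_derivative 0) (at 0)" if j: "j < n" for j
  proof -
    have m: "g j \<in> max_germs X (pt i a)" "h j \<in> max_germs X (pt i a)" using gh j by auto
    obtain D1 D2 where "((\<lambda>t. g j (pt i (a + t *s v))) has_field_derivative D1) (at 0)"
      "((\<lambda>t. h j (pt i (a + t *s v))) has_field_derivative D2) (at 0)"
      using D(1)[OF m(1)] D(1)[OF m(2)] by blast
    from DERIV_mult[OF this] show ?thesis
      using D(2)[OF m(1)] D(2)[OF m(2)] by (simp add: vector_smult_lzero)
  qed
  hence "((\<lambda>t. \<Sum>j<n. g j (pt i (a + t *s v)) * h j (pt i (a + t *s v))) has_field_derivative (\<Sum>j<n. 0)) (at 0)"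
    by (intro DERIV_sum) auto
  moreover obtain P where P: "ev P a \<noteq> 0" "\<forall>w. ev P w \<noteq> 0 \<longrightarrow> pt i w \<in> U" using openD[OF U(1) i U(2)] by blast
  obtain r where r: "\<forall>t. ev P (a + t *s v) = poly r t" using ev_line by blast
  have "poly r 0 \<noteq> 0" using P(1) r[rule_format, of 0] by (auto simp: vector_smult_lzero)
  moreover have "open {t. poly r t \<noteq> 0}" by (intro open_Collect_neq continuous_intros)
  moreover have "(\<Sum>j<n. g j (pt i (a + t *s v)) * h j (pt i (a + t *s v))) = f (pt i (a + t *s v))"
    if "t \<in> {t. poly r t \<noteq> 0}" for t
    using that P(2) r eq by auto
  ultimately show ?thesis
    using has_field_derivative_transform_within_open[of _ 0 0 "{t. poly r t \<noteq> 0}"] by auto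
qed

text \<open>
  The basis consists of the three coordinate functions, translated to vanish at the point. They
  generate by \<open>ev_taylor\<close>, applied to the numerator of a germ, and the coefficients
  are determined by the derivatives along the coordinate axes.
\<close>

lemma cotangent_dim_3:
  assumes "p \<in> points X" shows "cotangent_dim X p 3"
proof -
  obtain i a where i: "i \<in> I" and p: "p = pt i a" using assms by (rule point_cases)
  define b where "b k = (\<lambda>q. inv (pt i) q $ k - a $ k)" for k
  have b: "b k (pt i w) = w $ k - a $ k" for k w
    unfolding b_def using inj[OF i] by (simp add: inv_f_f)
  have inj_b: "inj b"
  proof (rule injI)
    fix k l assume "b k = b l"
    hence "b k (pt i (a + axis k 1)) = b l (pt i (a + axis k 1))" by simp
    thus "k = l" unfolding b by (simp add: axis_def split: if_splits)
  qed
  \<comment> \<open>Differences of a regular fraction and its value; the coordinates \<open>b k\<close> and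
    the error terms of the expansion are of this form.\<close>
  have germ: "(\<lambda>q. ev G (inv (pt i) q) / ev H (inv (pt i) q) - c) \<in> max_germs X p"
    if "ev H a \<noteq> 0" "c = ev G a / ev H a" for G H c
  proof -
    have "(\<lambda>q. ev G (inv (pt i) q) / ev H (inv (pt i) q) - c) \<in> Reg X (pt i ` {w. ev H w \<noteq> 0})"
    proof (rule reg_fraction[OF i open_basic[OF i], of _ H _ "G - con c * H"])
      fix q assume "q \<in> pt i ` {w. ev H w \<noteq> 0}"
      then obtain w where w: "q = pt i w" "ev H w \<noteq> 0" by auto
      hence "inv (pt i) q = w" using inj[OF i] by (simp add: inv_f_f)
      thus "\<exists>w. q = pt i w \<and> ev H w \<noteq> 0 \<and>
          ev G (inv (pt i) q) / ev H (inv (pt i) q) - c = ev (G - con c * H) w / ev H w"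
        using w by (intro exI[of _ w]) (simp add: diff_divide_distrib)
    qed
    moreover have "p \<in> pt i ` {w. ev H w \<noteq> 0}" using that p by auto
    moreover have "ev G (inv (pt i) p) / ev H (inv (pt i) p) - c = 0"
      using that inj[OF i] by (simp add: p inv_f_f)
    ultimately show ?thesis unfolding max_germs_def using open_basic[OF i] by blast
  qed
  have b_germ: "b k \<in> max_germs X p" for k
    using germ[of 1 "a $ k" "var k"] unfolding b_def by simp
  have sum_B: "(\<Sum>\<beta>\<in>range b. c \<beta> * \<beta> q) = (\<Sum>k\<in>UNIV. c (b k) * b k q)" for c q
    by (subst sum.reindex[OF inj_b]) simp
  have ex: "\<exists>c. (\<forall>\<beta>. \<beta> \<notin> range b \<longrightarrow> c \<beta> = 0) \<and> (\<lambda>q. f q - (\<Sum>\<beta>\<in>range b. c \<beta> * \<beta> q)) \<in> max_germs_sq X p"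
    if f: "f \<in> max_germs X p" for f
  proof -
    obtain W where W: "f p = 0" "openin (Zar X) W" "p \<in> W" "f \<in> Reg X W"
      using f unfolding max_germs_def by blast
    obtain G H where GH: "ev H a \<noteq> 0" "\<forall>w. pt i w \<in> W \<longrightarrow> ev H w \<noteq> 0 \<longrightarrow> f (pt i w) = ev G w / ev H w"
      using regD[OF W(2,4) i] W(3) p by blast
    have G0: "ev G a = 0" using GH W(1,3) p by auto
    obtain Q where Q: "\<forall>z. ev G z = ev G a + (\<Sum>k\<in>UNIV. (z $ k - a $ k) * ev (Q k) z)"
      using ev_taylor by blast
    define c where "c = (\<lambda>\<beta>. if \<beta> \<in> range b then ev (Q (inv b \<beta>)) a / ev H a else 0)"
    have c: "c (b k) = ev (Q k) a / ev H a" for k unfolding c_def using inj_b by (simp add: inv_f_f)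
    have op: "openin (Zar X) (W \<inter> pt i ` {w. ev H w \<noteq> 0})" using W(2) open_basic[OF i] by blast
    have "(\<lambda>q. f q - (\<Sum>\<beta>\<in>range b. c \<beta> * \<beta> q)) \<in> max_germs_sq X p"
    proof (rule max_germs_sqI[OF _ op])
      show "b k \<in> max_germs X p \<and>
          (\<lambda>q. ev (Q k) (inv (pt i) q) / ev H (inv (pt i) q) - c (b k)) \<in> max_germs X p" for k
        using b_germ germ[OF GH(1) c] by blast
      show "p \<in> W \<inter> pt i ` {w. ev H w \<noteq> 0}" using W(3) GH(1) p by auto
      fix q assume "q \<in> W \<inter> pt i ` {w. ev H w \<noteq> 0}"
      then obtain w where w: "q = pt i w" "pt i w \<in> W" "ev H w \<noteq> 0" by auto
      have "f q = (\<Sum>k\<in>UNIV. (w $ k - a $ k) * ev (Q k) w) / ev H w"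
        using GH(2) w Q[rule_format, of w] G0 by simp
      also have "\<dots> = (\<Sum>k\<in>UNIV. b k q * (ev (Q k) w / ev H w))"
        by (simp add: b w(1) sum_divide_distrib)
      finally have "f q = \<dots>" .
      hence "f q - (\<Sum>k\<in>UNIV. c (b k) * b k q) = (\<Sum>k\<in>UNIV. b k q * (ev (Q k) w / ev H w) - c (b k) * b k q)"
        by (simp add: sum_subtractf)
      also have "\<dots> = (\<Sum>k\<in>UNIV. b k q * (ev (Q k) w / ev H w - c (b k)))"
        by (intro sum.cong refl) (simp add: algebra_simps)
      finally show "f q - (\<Sum>\<beta>\<in>range b. c \<beta> * \<beta> q) =
          (\<Sum>k\<in>UNIV. b k q * (ev (Q k) (inv (pt i) q) / ev H (inv (pt i) q) - c (b k)))"
        unfolding sum_B using inj[OF i] by (simp add: w(1) inv_f_f)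
    qed
    thus ?thesis by (intro exI[of _ c]) (auto simp: c_def)
  qed
  \<comment> \<open>The difference of two such representations is a combination of the coordinates with all
    derivatives zero.\<close>
  have unique: "c = d"
    if c: "\<forall>\<beta>. \<beta> \<notin> range b \<longrightarrow> c \<beta> = 0" "(\<lambda>q. f q - (\<Sum>\<beta>\<in>range b. c \<beta> * \<beta> q)) \<in> max_germs_sq X p"
      and d: "\<forall>\<beta>. \<beta> \<notin> range b \<longrightarrow> d \<beta> = 0" "(\<lambda>q. f q - (\<Sum>\<beta>\<in>range b. d \<beta> * \<beta> q)) \<in> max_germs_sq X p"
    for f :: "'a \<Rightarrow> complex" and c d
  proof
    fix \<beta>
    show "c \<beta> = d \<beta>"
    proof (cases "\<beta> \<in> range b")
      case True
      then obtain k where k: "\<beta> = b k" by blast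
      have "((\<lambda>t. (f (pt i (a + t *s axis k 1)) - (\<Sum>l\<in>UNIV. d (b l) * b l (pt i (a + t *s axis k 1)))) -
          (f (pt i (a + t *s axis k 1)) - (\<Sum>l\<in>UNIV. c (b l) * b l (pt i (a + t *s axis k 1))))) has_field_derivative 0 - 0) (at 0)"
        using square_germ_derivative[OF i, of "\<lambda>q. f q - (\<Sum>\<beta>\<in>range b. c \<beta> * \<beta> q)" a "axis k 1"]
          square_germ_derivative[OF i, of "\<lambda>q. f q - (\<Sum>\<beta>\<in>range b. d \<beta> * \<beta> q)" a "axis k 1"] c(2) d(2)
        unfolding sum_B p by (intro DERIV_diff) auto
      moreover have "(\<Sum>l\<in>UNIV. e (b l) * b l (pt i (a + t *s axis k 1))) = e (b k) * t" for e t
        unfolding b by (simp add: axis_def if_distrib[of "\<lambda>x. _ * x"] cong: if_cong)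
      ultimately have "((\<lambda>t. (c (b k) - d (b k)) * t) has_field_derivative 0) (at 0)"
        by (simp add: algebra_simps)
      moreover have "((\<lambda>t. (c (b k) - d (b k)) * t) has_field_derivative (c (b k) - d (b k))) (at 0)"
        by (auto intro!: derivative_eq_intros)
      ultimately have "c (b k) - d (b k) = 0" using DERIV_unique by blast
      thus ?thesis using k by simp
    qed (use c(1) d(1) in simp)
  qed
  show ?thesis
    unfolding cotangent_dim_def
  proof (intro exI[of _ "range b"] conjI ballI)
    show "range b \<subseteq> max_germs X p" using b_germ by blast
    show "card (range b) = 3" using card_image[OF inj_b] by simp
    fix f assume f: "f \<in> max_germs X p"
    show "\<exists>!c. (\<forall>\<beta>. \<beta> \<notin> range b \<longrightarrow> c \<beta> = 0) \<and> (\<lambda>q. f q - (\<Sum>\<beta>\<in>range b. c \<beta> * \<beta> q)) \<in> max_germs_sq X p"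
    proof (rule ex_ex1I[OF ex[OF f]])
      fix c d
      assume c: "(\<forall>\<beta>. \<beta> \<notin> range b \<longrightarrow> c \<beta> = 0) \<and> (\<lambda>q. f q - (\<Sum>\<beta>\<in>range b. c \<beta> * \<beta> q)) \<in> max_germs_sq X p"
        and d: "(\<forall>\<beta>. \<beta> \<notin> range b \<longrightarrow> d \<beta> = 0) \<and> (\<lambda>q. f q - (\<Sum>\<beta>\<in>range b. d \<beta> * \<beta> q)) \<in> max_germs_sq X p"
      show "c = d"
        by (rule unique[OF conjunct1[OF c] conjunct2[OF c] conjunct1[OF d] conjunct2[OF d]])
    qed
  qed simp
qed

lemma smooth: "smooth_variety X"
  unfolding smooth_variety_def
  using irreducible krull_dim_3 cotangent_dim_3 by (intro conjI exI[of _ 3]) (auto simp: numeral_eq_enat)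

subsection \<open>Line bundles on a chart\<close>

text \<open>
  A regular function is given by fractions locally; on a chart, the fraction in lowest terms at
  one point works at all others, as its denominator divides all other denominators.
\<close>

lemma regular_reduced_fraction:
  assumes W: "openin (Zar X) W" and i: "i \<in> I" and ne: "W \<noteq> {}" and f: "f \<in> Reg X W"
  obtains a b where "coprime a b" "\<And>w. pt i w \<in> W \<Longrightarrow> ev b w \<noteq> 0 \<and> f (pt i w) = ev a w / ev b w"
proof -
  obtain P where P: "P \<noteq> 0" "\<And>w. ev P w \<noteq> 0 \<Longrightarrow> pt i w \<in> W" using chart_dense[OF W ne i] by blast
  obtain w0 where "ev P w0 \<noteq> 0" using P(1) by (rule ev_nonzero)
  hence w0: "pt i w0 \<in> W" using P(2) by blast
  obtain G H where GH: "ev H w0 \<noteq> 0" "\<forall>w. pt i w \<in> W \<longrightarrow> ev H w \<noteq> 0 \<longrightarrow> f (pt i w) = ev G w / ev H w"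
    using regD[OF W f i w0] by blast
  have "H \<noteq> 0" using GH(1) by auto
  then obtain a b g where ab: "G = a * g" "H = b * g" "coprime a b" "g \<noteq> 0" by (rule reduced_fraction)
  have "ev b w \<noteq> 0 \<and> f (pt i w) = ev a w / ev b w" if w: "pt i w \<in> W" for w
  proof -
    obtain G' H' where GH': "ev H' w \<noteq> 0" "\<forall>w. pt i w \<in> W \<longrightarrow> ev H' w \<noteq> 0 \<longrightarrow> f (pt i w) = ev G' w / ev H' w"
      using regD[OF W f i w] by blast
    have "a * H' = b * G'"
    proof (rule ev_eqI[of "P * H * H'"])
      show "P * H * H' \<noteq> 0" using P(1) \<open>H \<noteq> 0\<close> GH'(1) by auto
      fix z assume z: "ev (P * H * H') z \<noteq> 0"
      hence "pt i z \<in> W" using P(2) by auto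
      hence "ev G z / ev H z = ev G' z / ev H' z" using GH(2) GH'(2) z by auto
      moreover have "ev b z \<noteq> 0" "ev g z \<noteq> 0" "ev H' z \<noteq> 0" using z ab(2) by auto
      ultimately show "ev (a * H') z = ev (b * G') z" unfolding ab(1,2) by (simp add: field_simps)
    qed
    hence "b dvd a * H'" by simp
    hence "b dvd H'" using ab(3) by (simp add: coprime_commute coprime_dvd_mult_right_iff)
    hence b: "ev b w \<noteq> 0" using GH'(1) by auto
    have "ev a w * ev H' w = ev b w * ev G' w" using \<open>a * H' = b * G'\<close> by (metis ev_simps(6))
    moreover have "f (pt i w) = ev G' w / ev H' w" using GH' w by blast
    moreover have "ev G' w / ev H' w = ev a w / ev b w"
      using calculation(1) b GH'(1) by (simp add: frac_eq_eq mult.commute)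
    ultimately show ?thesis using b by simp
  qed
  thus ?thesis using that ab(3) by blast
qed

lemma unit_reduced_fraction:
  assumes W: "openin (Zar X) W" and i: "i \<in> I" and ne: "W \<noteq> {}" and f: "f \<in> unit_functions X W"
  obtains a b where "coprime a b" "a \<noteq> 0" "b \<noteq> 0"
    "\<And>w. pt i w \<in> W \<Longrightarrow> ev a w \<noteq> 0 \<and> ev b w \<noteq> 0 \<and> f (pt i w) = ev a w / ev b w"
proof -
  have f': "f \<in> Reg X W" "\<forall>q\<in>W. f q \<noteq> 0" using f unit_iff[OF W] by auto
  obtain a b where ab: "coprime a b" "\<And>w. pt i w \<in> W \<Longrightarrow> ev b w \<noteq> 0 \<and> f (pt i w) = ev a w / ev b w"
    using regular_reduced_fraction[OF W i ne f'(1)] by blast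
  have nz: "ev a w \<noteq> 0 \<and> ev b w \<noteq> 0 \<and> f (pt i w) = ev a w / ev b w" if "pt i w \<in> W" for w
    using ab(2)[OF that] f'(2) that by auto
  obtain P where P: "P \<noteq> 0" "\<And>w. ev P w \<noteq> 0 \<Longrightarrow> pt i w \<in> W" using chart_dense[OF W ne i] by blast
  obtain w where "ev P w \<noteq> 0" using P(1) by (rule ev_nonzero)
  hence "a \<noteq> 0" "b \<noteq> 0" using nz[OF P(2)] by auto
  thus ?thesis using that ab(1) nz by blast
qed

text \<open>
  This is the fact that a factorial ring has trivial Picard group, for cocycles. All transition
  functions are fractions; comparing with the neighbourhood of one base point (here
  \<open>0\<close>), the transition functions \<open>\<alpha> x 0 / \<beta> x 0\<close> would
  trivialise the bundle, but may have zeros or poles at \<open>x\<close>. Along a prime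
  \<open>\<pi>\<close> their order does not depend on the point \<open>x\<close> with \<open>\<pi>
  x = 0\<close>, and it is zero unless \<open>\<pi>\<close> divides the polynomial \<open>h
  0\<close> that describes the base neighbourhood. So the product of powers of finitely many
  primes \<open>A / B\<close> corrects all of them at once.
\<close>

lemma line_bundle_trivial_on_chart:
  assumes L: "line_bundle X (N, g)" and i: "i \<in> I"
  obtains N' s where
    "\<And>z. openin (Zar X) (N' z) \<and> pt i z \<in> N' z \<and> N' z \<subseteq> N (pt i z) \<and> N' z \<subseteq> range (pt i) \<and>
       s z \<in> unit_functions X (N' z)"
    "\<And>y z p. p \<in> N' y \<inter> N' z \<Longrightarrow> g (pt i y) (pt i z) p = s y p / s z p"
proof -
  define M where "M z = N (pt i z)" for z
  have pts: "pt i z \<in> points X" for z using pt_in_points[OF i] .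
  have M: "openin (Zar X) (M z)" "pt i z \<in> M z" for z
    using L pts unfolding line_bundle_def M_def by auto
  have unit: "g (pt i y) (pt i z) \<in> unit_functions X (M y \<inter> M z)" for y z
    using L pts unfolding line_bundle_def M_def by auto
  have cocycle: "g (pt i x) (pt i y) p * g (pt i y) (pt i z) p = g (pt i x) (pt i z) p"
    if "p \<in> M x \<inter> M y \<inter> M z" for x y z p
    using L pts that unfolding line_bundle_def M_def by blast
  have MM: "openin (Zar X) (M y \<inter> M z)" "M y \<inter> M z \<noteq> {}" for y z
    using M opens_meet[of "M y" "M z"] by blast+
  have "\<exists>a b. coprime a b \<and> a \<noteq> 0 \<and> b \<noteq> 0 \<and> (\<forall>w. pt i w \<in> M y \<inter> M z \<longrightarrow>
      ev a w \<noteq> 0 \<and> ev b w \<noteq> 0 \<and> g (pt i y) (pt i z) (pt i w) = ev a w / ev b w)" for y z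
    using unit_reduced_fraction[OF MM(1) i MM(2) unit[of y z]] by metis
  then obtain \<alpha> \<beta> where \<alpha>\<beta>: "\<And>y z. \<alpha> y z \<noteq> 0" "\<And>y z. \<beta> y z \<noteq> 0"
    "\<And>y z w. pt i w \<in> M y \<Longrightarrow> pt i w \<in> M z \<Longrightarrow>
      ev (\<alpha> y z) w \<noteq> 0 \<and> ev (\<beta> y z) w \<noteq> 0 \<and> g (pt i y) (pt i z) (pt i w) = ev (\<alpha> y z) w / ev (\<beta> y z) w"
    by (metis IntI)
  have "\<exists>P. ev P z \<noteq> 0 \<and> (\<forall>w. ev P w \<noteq> 0 \<longrightarrow> pt i w \<in> M z)" for z
    using openD[OF M(1) i M(2)] .
  then obtain h where h: "\<And>z. ev (h z) z \<noteq> 0" "\<And>z w. ev (h z) w \<noteq> 0 \<Longrightarrow> pt i w \<in> M z" by metis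
  have hnz: "h z \<noteq> 0" for z using h(1)[of z] by auto
  \<comment> \<open>The cocycle condition as an identity of polynomials.\<close>
  have rel: "\<alpha> x 0 * \<beta> x y * \<beta> y 0 = \<alpha> x y * \<alpha> y 0 * \<beta> x 0" for x y
  proof (rule ev_eqI[of "h x * h y * h 0"])
    show "h x * h y * h 0 \<noteq> 0" using hnz by simp
    fix w assume "ev (h x * h y * h 0) w \<noteq> 0"
    hence w: "pt i w \<in> M x" "pt i w \<in> M y" "pt i w \<in> M 0" using h(2) by auto
    have "g (pt i x) (pt i y) (pt i w) * g (pt i y) (pt i 0) (pt i w) = g (pt i x) (pt i 0) (pt i w)"
      using cocycle w by blast
    thus "ev (\<alpha> x 0 * \<beta> x y * \<beta> y 0) w = ev (\<alpha> x y * \<alpha> y 0 * \<beta> x 0) w"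
      using \<alpha>\<beta>(3)[OF w(1,2)] \<alpha>\<beta>(3)[OF w(2,3)] \<alpha>\<beta>(3)[OF w(1,3)] by (simp add: field_simps)
  qed
  \<comment> \<open>A prime dividing a numerator or denominator of a unit vanishes only outside of the
    domain of this unit.\<close>
  have ndvd: "\<not> \<pi> dvd \<alpha> x y \<and> \<not> \<pi> dvd \<beta> x y"
    if "prime \<pi>" "\<not> \<pi> dvd h x" "\<not> \<pi> dvd h y" for \<pi> x y
  proof -
    have "\<not> \<pi> dvd h x * h y" using that by (simp add: prime_dvd_mult_iff)
    moreover have "prime_elem \<pi>" using that(1) by auto
    ultimately obtain w where w: "ev \<pi> w = 0" "ev (h x * h y) w \<noteq> 0"
      by (metis prime_separates)
    hence "pt i w \<in> M x" "pt i w \<in> M y" using h(2) by auto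
    hence "ev (\<alpha> x y) w \<noteq> 0" "ev (\<beta> x y) w \<noteq> 0" using \<alpha>\<beta>(3) by blast+
    thus ?thesis using w(1) by auto
  qed
  have ndvd_h: "\<not> \<pi> dvd h x" if "ev \<pi> x = 0" for \<pi> x
    using h(1)[of x] that by auto
  have mult_zero: "multiplicity \<pi> (\<alpha> x y) = 0" "multiplicity \<pi> (\<beta> x y) = 0"
    if "prime \<pi>" "\<not> \<pi> dvd h x" "\<not> \<pi> dvd h y" for \<pi> x y
    using ndvd[OF that] by (auto intro: not_dvd_imp_multiplicity_0)
  define S where "S = {\<pi>. prime \<pi> \<and> \<pi> dvd h 0}"
  have finS: "finite S" unfolding S_def using finite_prime_divisors[OF hnz] .
  have "\<exists>y. ev \<pi> y = 0" if "prime \<pi>" for \<pi>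
  proof -
    have "prime_elem \<pi>" "\<not> \<pi> dvd 1" using that by auto
    thus ?thesis using prime_separates by blast
  qed
  then obtain Y where Y: "\<And>\<pi>. prime \<pi> \<Longrightarrow> ev \<pi> (Y \<pi>) = 0" by metis
  \<comment> \<open>The divisor common to all transition functions to the base point, read off at a test
    point \<open>Y \<pi>\<close> on the zero set of each prime.\<close>
  define A where "A = (\<Prod>\<pi>\<in>S. \<pi> ^ multiplicity \<pi> (\<alpha> (Y \<pi>) 0))"
  define B where "B = (\<Prod>\<pi>\<in>S. \<pi> ^ multiplicity \<pi> (\<beta> (Y \<pi>) 0))"
  have AB: "A \<noteq> 0" "B \<noteq> 0" unfolding A_def B_def S_def using finS by (auto simp: S_def)
  have multAB: "multiplicity \<pi> A = (if \<pi> \<in> S then multiplicity \<pi> (\<alpha> (Y \<pi>) 0) else 0)"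
    "multiplicity \<pi> B = (if \<pi> \<in> S then multiplicity \<pi> (\<beta> (Y \<pi>) 0) else 0)" if "prime \<pi>" for \<pi>
    unfolding A_def B_def by (rule multiplicity_prime_power_prod[OF finS _ that]; simp add: S_def)+
  have main: "multiplicity \<pi> (\<alpha> x 0 * B) = multiplicity \<pi> (\<beta> x 0 * A)"
    if \<pi>: "prime \<pi>" "ev \<pi> x = 0" for \<pi> x
  proof -
    have pe: "prime_elem \<pi>" using \<pi>(1) by auto
    have split: "multiplicity \<pi> (\<alpha> x 0 * B) = multiplicity \<pi> (\<alpha> x 0) + multiplicity \<pi> B"
      "multiplicity \<pi> (\<beta> x 0 * A) = multiplicity \<pi> (\<beta> x 0) + multiplicity \<pi> A"
      using prime_elem_multiplicity_mult_distrib[OF pe] AB \<alpha>\<beta>(1,2) by auto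
    show ?thesis
    proof (cases "\<pi> \<in> S")
      case False
      hence "\<not> \<pi> dvd h 0" using \<pi>(1) unfolding S_def by simp
      thus ?thesis using mult_zero[OF \<pi>(1) ndvd_h[OF \<pi>(2)], of 0] multAB[OF \<pi>(1)] False split by simp
    next
      case True
      define y where "y = Y \<pi>"
      have m0: "multiplicity \<pi> (\<alpha> x y) = 0" "multiplicity \<pi> (\<beta> x y) = 0"
        using mult_zero[OF \<pi>(1) ndvd_h[OF \<pi>(2)] ndvd_h[OF Y[OF \<pi>(1)]]] unfolding y_def by auto
      have "multiplicity \<pi> (\<alpha> x 0 * \<beta> x y * \<beta> y 0) = multiplicity \<pi> (\<alpha> x y * \<alpha> y 0 * \<beta> x 0)"
        using rel by simp
      hence "multiplicity \<pi> (\<alpha> x 0) + multiplicity \<pi> (\<beta> y 0) = multiplicity \<pi> (\<alpha> y 0) + multiplicity \<pi> (\<beta> x 0)"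
        using \<alpha>\<beta>(1,2) m0 by (simp add: prime_elem_multiplicity_mult_distrib[OF pe])
      thus ?thesis using multAB[OF \<pi>(1)] True split unfolding y_def by simp
    qed
  qed
  have "\<exists>u v. (\<alpha> x 0 * B) * v = (\<beta> x 0 * A) * u \<and> ev u x \<noteq> 0 \<and> ev v x \<noteq> 0" for x
  proof -
    have "\<alpha> x 0 * B \<noteq> 0" "\<beta> x 0 * A \<noteq> 0" using AB \<alpha>\<beta>(1,2) by auto
    from equal_multiplicities_unit[OF this main] show ?thesis by metis
  qed
  then obtain u v where uv: "\<And>x. (\<alpha> x 0 * B) * v x = (\<beta> x 0 * A) * u x" "\<And>x. ev (u x) x \<noteq> 0" "\<And>x. ev (v x) x \<noteq> 0"
    by metis
  define s where "s x = (\<lambda>q. ev (u x) (inv (pt i) q) / ev (v x) (inv (pt i) q))" for x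
  define N' where "N' x = M x \<inter> pt i ` {w. ev (u x * v x) w \<noteq> 0}" for x
  have s: "s x (pt i w) = ev (u x) w / ev (v x) w" for x w
    unfolding s_def using inj[OF i] by (simp add: inv_f_f)
  have opN: "openin (Zar X) (N' x)" for x unfolding N'_def using M(1) open_basic[OF i] by blast
  have N'D: "\<exists>w. q = pt i w \<and> pt i w \<in> M x \<and> ev (u x) w \<noteq> 0 \<and> ev (v x) w \<noteq> 0" if "q \<in> N' x" for q x
    using that unfolding N'_def by auto
  show ?thesis
  proof (rule that[of N' s])
    fix z
    have "s z \<in> Reg X (N' z)"
    proof (rule reg_fraction[OF i opN, of _ "v z" _ "u z"])
      fix q assume "q \<in> N' z"
      from N'D[OF this] show "\<exists>w. q = pt i w \<and> ev (v z) w \<noteq> 0 \<and> s z q = ev (u z) w / ev (v z) w"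
        using s by blast
    qed
    moreover have "\<forall>q\<in>N' z. s z q \<noteq> 0" using N'D s by fastforce
    ultimately have "s z \<in> unit_functions X (N' z)" using unit_iff[OF opN] by blast
    moreover have "pt i z \<in> N' z" unfolding N'_def using M(2) uv(2,3) by simp
    ultimately show "openin (Zar X) (N' z) \<and> pt i z \<in> N' z \<and> N' z \<subseteq> N (pt i z) \<and> N' z \<subseteq> range (pt i) \<and>
       s z \<in> unit_functions X (N' z)"
      using opN unfolding N'_def M_def by blast
  next
    fix y z p assume "p \<in> N' y \<inter> N' z"
    then obtain w where w: "p = pt i w" "pt i w \<in> M y" "pt i w \<in> M z" "ev (u y) w \<noteq> 0" "ev (v y) w \<noteq> 0"
      "ev (u z) w \<noteq> 0" "ev (v z) w \<noteq> 0"
    proof -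
      obtain w w' where "p = pt i w \<and> pt i w \<in> M y \<and> ev (u y) w \<noteq> 0 \<and> ev (v y) w \<noteq> 0"
        "p = pt i w' \<and> pt i w' \<in> M z \<and> ev (u z) w' \<noteq> 0 \<and> ev (v z) w' \<noteq> 0"
        using N'D[of p y] N'D[of p z] \<open>p \<in> N' y \<inter> N' z\<close> by blast
      moreover from this have "w = w'" using pt_eq_iff[OF i] by metis
      ultimately show ?thesis using that[of w] by simp
    qed
    have "(\<alpha> y z * u z * v y) * (\<beta> y 0 * A * \<alpha> z 0 * B) =
        v y * (\<alpha> y z * \<alpha> z 0 * \<beta> y 0) * (A * B * u z)" by (simp add: mult_ac)
    also have "\<dots> = (\<alpha> y 0 * B * v y) * \<beta> y z * (\<beta> z 0 * A * u z)"
      unfolding rel[of y z, symmetric] by (simp add: mult_ac)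
    also have "\<dots> = (\<beta> y z * u y * v z) * (\<beta> y 0 * A * \<alpha> z 0 * B)"
      unfolding uv(1)[of y] uv(1)[of z, symmetric] by (simp add: mult_ac)
    finally have "\<alpha> y z * u z * v y = \<beta> y z * u y * v z" using AB \<alpha>\<beta>(1,2) by simp
    hence "ev (\<alpha> y z) w * ev (u z) w * ev (v y) w = ev (\<beta> y z) w * ev (u y) w * ev (v z) w"
      by (metis ev_simps(6))
    thus "g (pt i y) (pt i z) p = s y p / s z p"
      using \<alpha>\<beta>(3)[OF w(2,3)] w s by (simp add: field_simps)
  qed
qed

end

section \<open>Smooth cones\<close>

text \<open>
  Faces are indexed by sets of rows, so that a cone and its faces share their coordinates.
\<close>

definition fcone :: "int ^ 'n ^ 'n \<Rightarrow> 'n::finite set \<Rightarrow> (real ^ 'n) set" where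
  "fcone B J = {x. \<exists>c. (\<forall>k. 0 \<le> c k) \<and> (\<forall>k. k \<notin> J \<longrightarrow> c k = 0) \<and>
     x = (\<Sum>k\<in>UNIV. c k *\<^sub>R real_vec (B $ k))}"

text \<open>
  The dual basis of the rows of \<open>B\<close>, and the coordinates of a vector with respect to
  these rows.
\<close>

definition dual_vec :: "int ^ 'n ^ 'n \<Rightarrow> 'n::finite \<Rightarrow> int ^ 'n" where
  "dual_vec B k = column k (matrix_inv B)"

definition coord :: "int ^ 'n ^ 'n \<Rightarrow> 'n::finite \<Rightarrow> real ^ 'n \<Rightarrow> real" where
  "coord B k x = real_vec (dual_vec B k) \<bullet> x"

lemma real_vec_simps:
  "real_vec (u + v) = real_vec u + real_vec v" "real_vec (u - v) = real_vec u - real_vec v"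
  "real_vec (- v) = - real_vec v" "real_vec 0 = 0"
  by (auto simp: real_vec_def vec_eq_iff)

lemma coord_add: "coord B k (x + y) = coord B k x + coord B k y"
  and coord_diff: "coord B k (x - y) = coord B k x - coord B k y"
  and coord_scaleR: "coord B k (t *\<^sub>R x) = t * coord B k x"
  and coord_0: "coord B k 0 = 0"
  by (auto simp: coord_def inner_add_right inner_diff_right)

lemma coord_sum: "coord B k (sum f A) = (\<Sum>a\<in>A. coord B k (f a))"
  by (simp add: coord_def inner_sum_right)

lemma inner_row: "real_vec m \<bullet> real_vec (B $ k) = real_of_int ((B *v m) $ k)"
  by (simp add: inner_vec_def real_vec_def matrix_vector_mult_def mult.commute)

context
  fixes B :: "int ^ 'n::finite ^ 'n"
  assumes inv: "invertible B"
begin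

lemma inv_mult: "B ** matrix_inv B = mat 1" "matrix_inv B ** B = mat 1"
proof -
  have "\<exists>A'. B ** A' = mat 1 \<and> A' ** B = mat 1" using inv unfolding invertible_def .
  from someI_ex[OF this] show "B ** matrix_inv B = mat 1" "matrix_inv B ** B = mat 1"
    unfolding matrix_inv_def by auto
qed

lemma mult_dual_vec: "B *v dual_vec B k = axis k 1"
proof -
  have "(B *v dual_vec B k) $ i = (B ** matrix_inv B) $ i $ k" for i
    by (simp add: dual_vec_def column_def matrix_vector_mult_def matrix_matrix_mult_def)
  thus ?thesis unfolding inv_mult by (auto simp: vec_eq_iff mat_def axis_def)
qed

lemma dual_vec_expand: "(\<Sum>k\<in>UNIV. (B *v m) $ k *s dual_vec B k) = m"
proof -
  have "(\<Sum>k\<in>UNIV. (B *v m) $ k *s dual_vec B k) = matrix_inv B *v (B *v m)"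
    by (simp add: matrix_mult_sum dual_vec_def)
  thus ?thesis by (simp add: matrix_vector_mul_assoc inv_mult)
qed

lemma mult_inject: "B *v m = B *v m' \<longleftrightarrow> m = m'"
  using dual_vec_expand by metis

lemma coord_row: "coord B j (real_vec (B $ k)) = (if j = k then 1 else 0)"
  unfolding coord_def inner_row mult_dual_vec by (auto simp: axis_def)

lemma coord_combination: "coord B j (\<Sum>k\<in>UNIV. c k *\<^sub>R real_vec (B $ k)) = c j"
  by (simp add: coord_sum coord_scaleR coord_row if_distrib[of "\<lambda>x. _ * x"] cong: if_cong)

lemma coord_expand: "(\<Sum>k\<in>UNIV. coord B k x *\<^sub>R real_vec (B $ k)) = x"
proof -
  have "(\<Sum>k\<in>UNIV. coord B k x *\<^sub>R real_vec (B $ k)) $ i = x $ i" for i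
  proof -
    have "(\<Sum>k\<in>UNIV. coord B k x *\<^sub>R real_vec (B $ k)) $ i =
        (\<Sum>k\<in>UNIV. \<Sum>j\<in>UNIV. real_of_int (matrix_inv B $ j $ k * B $ k $ i) * x $ j)"
      by (simp add: coord_def real_vec_def inner_vec_def dual_vec_def column_def sum_distrib_left sum_distrib_right mult_ac)
    also have "\<dots> = (\<Sum>j\<in>UNIV. real_of_int ((matrix_inv B ** B) $ j $ i) * x $ j)"
      by (subst sum.swap) (simp add: matrix_matrix_mult_def sum_distrib_right)
    also have "\<dots> = (\<Sum>j\<in>UNIV. if j = i then x $ j else 0)"
      unfolding inv_mult mat_def by (intro sum.cong refl) auto
    also have "\<dots> = x $ i" by simp
    finally show ?thesis .
  qed
  thus ?thesis by (simp add: vec_eq_iff)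
qed

lemma fcone_iff: "x \<in> fcone B J \<longleftrightarrow> (\<forall>k. 0 \<le> coord B k x) \<and> (\<forall>k. k \<notin> J \<longrightarrow> coord B k x = 0)"
proof
  assume "x \<in> fcone B J"
  thus "(\<forall>k. 0 \<le> coord B k x) \<and> (\<forall>k. k \<notin> J \<longrightarrow> coord B k x = 0)"
    unfolding fcone_def by (auto simp: coord_combination)
next
  assume "(\<forall>k. 0 \<le> coord B k x) \<and> (\<forall>k. k \<notin> J \<longrightarrow> coord B k x = 0)"
  thus "x \<in> fcone B J"
    unfolding fcone_def by (intro CollectI exI[of _ "\<lambda>k. coord B k x"]) (auto simp: coord_expand)
qed

lemma zero_fcone: "0 \<in> fcone B J"
  by (simp add: fcone_iff coord_0)

lemma row_fcone_iff: "real_vec (B $ k) \<in> fcone B J \<longleftrightarrow> k \<in> J"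
  by (auto simp: fcone_iff coord_row)

lemma fcone_subset_iff: "fcone B J \<subseteq> fcone B J' \<longleftrightarrow> J \<subseteq> J'"
proof
  show "J \<subseteq> J'" if "fcone B J \<subseteq> fcone B J'" using that row_fcone_iff by blast
next
  assume "J \<subseteq> J'"
  hence "k \<notin> J" if "k \<notin> J'" for k using that by blast
  thus "fcone B J \<subseteq> fcone B J'" by (auto simp: fcone_iff)
qed

lemma fcone_inject: "fcone B J = fcone B J' \<longleftrightarrow> J = J'"
  using fcone_subset_iff by (metis subset_antisym order_refl)

lemma fcone_pointed: "fcone B J \<inter> uminus ` fcone B J = {0}"
proof -
  have "x = 0" if x: "x \<in> fcone B J" "- x \<in> fcone B J" for x
  proof -
    have "coord B k x = 0" for k
    proof -
      have "coord B k (- x) = - coord B k x" using coord_scaleR[of B k "-1" x] by simp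
      moreover have "0 \<le> coord B k x" "0 \<le> coord B k (- x)" using x fcone_iff by blast+
      ultimately show ?thesis by linarith
    qed
    thus ?thesis using coord_expand[of x] by simp
  qed
  moreover have "- x \<in> fcone B J" if "x \<in> uminus ` fcone B J" for x
    using that by auto
  ultimately have "fcone B J \<inter> uminus ` fcone B J \<subseteq> {0}" by blast
  moreover have "0 \<in> fcone B J \<inter> uminus ` fcone B J"
    using zero_fcone[of J] by (intro IntI image_eqI[of _ _ 0]) auto
  ultimately show ?thesis by (intro subset_antisym) auto
qed

lemma fcone_generated: "fcone B J = convex_cone hull (real_vec ` (\<lambda>k. B $ k) ` J)"
proof
  show "fcone B J \<subseteq> convex_cone hull (real_vec ` (\<lambda>k. B $ k) ` J)"
  proof
    fix x assume x: "x \<in> fcone B J"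
    have gen: "(\<Sum>k\<in>A. coord B k x *\<^sub>R real_vec (B $ k)) \<in> convex_cone hull (real_vec ` (\<lambda>k. B $ k) ` J)"
      if "finite A" for A
      using that
    proof (induction A)
      case empty show ?case by (simp add: convex_cone_hull_contains_0)
    next
      case (insert k A)
      have "coord B k x *\<^sub>R real_vec (B $ k) \<in> convex_cone hull (real_vec ` (\<lambda>k. B $ k) ` J)"
      proof (cases "k \<in> J")
        case True
        thus ?thesis using x fcone_iff by (intro convex_cone_hull_mul hull_inc) auto
      next
        case False
        hence "coord B k x = 0" using x fcone_iff by blast
        thus ?thesis by (simp add: convex_cone_hull_contains_0)
      qed
      thus ?case using insert by (simp add: convex_cone_hull_add)
    qed
    from gen[of UNIV] show "x \<in> convex_cone hull (real_vec ` (\<lambda>k. B $ k) ` J)" by (simp add: coord_expand)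
  qed
  show "convex_cone hull (real_vec ` (\<lambda>k. B $ k) ` J) \<subseteq> fcone B J"
  proof (rule hull_minimal)
    show "real_vec ` (\<lambda>k. B $ k) ` J \<subseteq> fcone B J" using row_fcone_iff by auto
    show "convex_cone (fcone B J)"
      unfolding convex_cone_iff using zero_fcone by (auto simp: fcone_iff coord_add coord_scaleR)
  qed
qed

lemma rational_fcone: "rational_cone (fcone B J)"
  unfolding rational_cone_def using fcone_generated by (intro exI[of _ "(\<lambda>k. B $ k) ` J"]) simp

lemma fcone_convex: "convex (fcone B J)"
  by (auto simp: convex_alt fcone_iff coord_add coord_scaleR)

lemma fcone_face: "J' \<subseteq> J \<Longrightarrow> cone_face (fcone B J') (fcone B J)"
proof -
  assume J: "J' \<subseteq> J"
  have key: "a \<in> fcone B J' \<and> b \<in> fcone B J'"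
    if ab: "a \<in> fcone B J" "b \<in> fcone B J" "x \<in> fcone B J'" "x \<in> open_segment a b" for a b x
  proof -
    obtain u where u: "0 < u" "u < 1" "x = (1 - u) *\<^sub>R a + u *\<^sub>R b" using ab(4) by (auto simp: in_segment)
    have "coord B k a = 0 \<and> coord B k b = 0" if "k \<notin> J'" for k
    proof -
      have "(1 - u) * coord B k a + u * coord B k b = 0"
        using ab(3) that u(3) unfolding fcone_iff by (auto simp: coord_add coord_scaleR)
      moreover have "0 \<le> (1 - u) * coord B k a" "0 \<le> u * coord B k b"
        using ab(1,2) u unfolding fcone_iff by auto
      ultimately show ?thesis using u by (smt (verit) mult_eq_0_iff)
    qed
    thus ?thesis using ab(1,2) unfolding fcone_iff by auto
  qed
  show ?thesis
    unfolding cone_face_def face_of_def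
  proof (intro conjI ballI impI)
    show "fcone B J' \<noteq> {}" using zero_fcone by blast
    show "fcone B J' \<subseteq> fcone B J" using J fcone_subset_iff by blast
    show "convex (fcone B J')" by (rule fcone_convex)
  qed (use key in blast)+
qed

text \<open>
  A face contains with a sum of two elements of the cone both summands. The sum \<open>s\<close>
  of suitable elements of the face is positive in every coordinate in which some element is; so
  any element \<open>y\<close> of the cone spanned by these coordinates is a summand of a multiple
  of \<open>s\<close>.
\<close>

lemma face_fcone:
  assumes "cone_face \<tau> (fcone B J)"
  obtains J' where "J' \<subseteq> J" "\<tau> = fcone B J'"
proof -
  let ?\<sigma> = "fcone B J"
  have ne: "\<tau> \<noteq> {}" and face: "\<tau> face_of ?\<sigma>" using assms unfolding cone_face_def by auto
  have sub: "\<tau> \<subseteq> ?\<sigma>" and conv: "convex \<tau>" using face unfolding face_of_def by auto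
  have cone: "t *\<^sub>R x \<in> ?\<sigma>" "x + y \<in> ?\<sigma>" if "x \<in> ?\<sigma>" "y \<in> ?\<sigma>" "0 \<le> t" for x y t
    using that by (auto simp: fcone_iff coord_add coord_scaleR)
  have 0: "0 \<in> \<tau>"
  proof -
    obtain x where x: "x \<in> \<tau>" using ne by blast
    show ?thesis
    proof (cases "x = 0")
      case False
      have "x \<in> open_segment 0 (2 *\<^sub>R x)"
        using False by (auto simp: in_segment intro!: exI[of _ "1/2"])
      thus ?thesis using face_ofD[OF face _ zero_fcone cone(1)[of x x 2] x] x sub by auto
    qed (use x in simp)
  qed
  have scale: "t *\<^sub>R x \<in> \<tau>" if x: "x \<in> \<tau>" and t: "0 \<le> t" for x t
  proof (cases "t \<le> 1 \<or> x = 0")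
    case True
    thus ?thesis using convexD[OF conv 0 x, of "1 - t" t] t x 0 by auto
  next
    case False
    have "x \<in> open_segment 0 (t *\<^sub>R x)"
      using False by (auto simp: in_segment intro!: exI[of _ "1/t"])
    thus ?thesis using face_ofD[OF face _ zero_fcone cone(1)[of x x t] x] x sub t by auto
  qed
  have add: "x + y \<in> \<tau>" if "x \<in> \<tau>" "y \<in> \<tau>" for x y
  proof -
    have "(1/2) *\<^sub>R x + (1/2) *\<^sub>R y \<in> \<tau>" using convexD[OF conv that, of "1/2" "1/2"] by simp
    from scale[OF this, of 2] show ?thesis by (simp add: scaleR_add_right)
  qed
  have summand: "a \<in> \<tau>" if ab: "a \<in> ?\<sigma>" "b \<in> ?\<sigma>" "a + b \<in> \<tau>" for a b
  proof (cases "a = b")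
    case True
    have "(1/2) *\<^sub>R (a + b) \<in> \<tau>" using scale[OF ab(3), of "1/2"] by simp
    thus ?thesis using True by (simp add: scaleR_2[symmetric])
  next
    case False
    have "a + b \<in> open_segment (2 *\<^sub>R a) (2 *\<^sub>R b)"
      using False by (auto simp: in_segment intro!: exI[of _ "1/2"])
    hence "2 *\<^sub>R a \<in> \<tau>"
      using face_ofD[OF face _ cone(1)[OF ab(1) ab(1), of 2] cone(1)[OF ab(2) ab(2), of 2] ab(3)] by auto
    from scale[OF this, of "1/2"] show ?thesis by simp
  qed
  define J' where "J' = {k. \<exists>x\<in>\<tau>. coord B k x > 0}"
  have "\<exists>x\<in>\<tau>. coord B k x > 0" if "k \<in> J'" for k using that unfolding J'_def by blast
  then obtain X where X: "\<And>k. k \<in> J' \<Longrightarrow> X k \<in> \<tau> \<and> coord B k (X k) > 0" by metis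
  have sum: "(\<Sum>k\<in>A. X k) \<in> \<tau>" if "finite A" "A \<subseteq> J'" for A
    using that by (induction A) (use 0 add X in auto)
  define s where "s = (\<Sum>k\<in>J'. X k)"
  have s: "s \<in> \<tau>" unfolding s_def by (rule sum) auto
  have s_pos: "coord B k s > 0" if "k \<in> J'" for k
  proof -
    have "coord B k (X j) \<ge> 0" if "j \<in> J'" for j using X[OF that] sub fcone_iff by blast
    moreover have "coord B k s = (\<Sum>j\<in>J'. coord B k (X j))" unfolding s_def by (rule coord_sum)
    ultimately show ?thesis using sum_pos2[of J' k "\<lambda>j. coord B k (X j)"] X[OF that] that by auto
  qed
  have sub1: "\<tau> \<subseteq> fcone B J'"
  proof
    fix x assume x: "x \<in> \<tau>"
    hence "0 \<le> coord B k x" for k using sub fcone_iff by blast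
    moreover have "coord B k x = 0" if "k \<notin> J'" for k
      using that x calculation[of k] unfolding J'_def by force
    ultimately show "x \<in> fcone B J'" unfolding fcone_iff by blast
  qed
  have J': "J' \<subseteq> J"
  proof
    fix k assume "k \<in> J'"
    then obtain x where "x \<in> \<tau>" "coord B k x > 0" unfolding J'_def by blast
    thus "k \<in> J" using sub fcone_iff[of x J] by force
  qed
  have "fcone B J' \<subseteq> \<tau>"
  proof
    fix y assume y: "y \<in> fcone B J'"
    define N where "N = (\<Sum>k\<in>J'. coord B k y / coord B k s)"
    have Nk: "coord B k y \<le> N * coord B k s" for k
    proof (cases "k \<in> J'")
      case True
      have "coord B k y / coord B k s \<le> N"
        unfolding N_def using True y s_pos by (intro member_le_sum) (auto simp: fcone_iff divide_nonneg_pos)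
      thus ?thesis using s_pos[OF True] by (simp add: pos_divide_le_eq)
    next
      case False
      hence "coord B k y = 0" "coord B k s = 0" using y s sub1 fcone_iff by blast+
      thus ?thesis by simp
    qed
    have N0: "0 \<le> N" unfolding N_def using y s_pos by (intro sum_nonneg) (auto simp: fcone_iff divide_nonneg_pos)
    have "N *\<^sub>R s - y \<in> fcone B J'"
    proof -
      have "s \<in> fcone B J'" using s sub1 by blast
      thus ?thesis using Nk y unfolding fcone_iff coord_diff coord_scaleR by auto
    qed
    hence "N *\<^sub>R s - y \<in> ?\<sigma>" using J' fcone_subset_iff by blast
    moreover have "y \<in> ?\<sigma>" using y J' fcone_subset_iff by blast
    moreover have "y + (N *\<^sub>R s - y) \<in> \<tau>" using scale[OF s N0] by simp
    ultimately show "y \<in> \<tau>" using summand by blast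
  qed
  thus ?thesis using that[of J'] J' sub1 by blast
qed

lemma dual_monoid_fcone: "dual_monoid (fcone B J) = {m. \<forall>k\<in>J. 0 \<le> (B *v m) $ k}"
proof (intro set_eqI iffI)
  fix m assume "m \<in> dual_monoid (fcone B J)"
  hence "0 \<le> real_vec m \<bullet> real_vec (B $ k)" if "k \<in> J" for k
    using that row_fcone_iff unfolding dual_monoid_def by blast
  thus "m \<in> {m. \<forall>k\<in>J. 0 \<le> (B *v m) $ k}" unfolding inner_row by simp
next
  fix m assume m: "m \<in> {m. \<forall>k\<in>J. 0 \<le> (B *v m) $ k}"
  have "0 \<le> real_vec m \<bullet> u" if u: "u \<in> fcone B J" for u
  proof -
    have "real_vec m \<bullet> u = real_vec m \<bullet> (\<Sum>k\<in>UNIV. coord B k u *\<^sub>R real_vec (B $ k))"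
      by (simp add: coord_expand)
    also have "\<dots> = (\<Sum>k\<in>UNIV. coord B k u * real_of_int ((B *v m) $ k))"
      by (simp add: inner_sum_right inner_row)
    also have "\<dots> \<ge> 0"
    proof (rule sum_nonneg)
      fix k show "0 \<le> coord B k u * real_of_int ((B *v m) $ k)"
        using m u by (cases "k \<in> J") (auto simp: fcone_iff)
    qed
    finally show ?thesis .
  qed
  thus "m \<in> dual_monoid (fcone B J)" unfolding dual_monoid_def by blast
qed

lemma inner_coord: "real_vec m \<bullet> x = (\<Sum>k\<in>UNIV. coord B k x * real_of_int ((B *v m) $ k))"
proof -
  have "real_vec m \<bullet> x = real_vec m \<bullet> (\<Sum>k\<in>UNIV. coord B k x *\<^sub>R real_vec (B $ k))"
    by (simp add: coord_expand)
  thus ?thesis by (simp add: inner_sum_right inner_row)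
qed

lemma dim_fcone: "dim (fcone B J) = card J"
proof -
  let ?R = "(\<lambda>k. real_vec (B $ k)) ` J"
  have inj: "inj_on (\<lambda>k. real_vec (B $ k)) J"
    by (rule inj_onI) (metis coord_row zero_neq_one)
  have "independent ?R"
  proof (rule independent_if_scalars_zero)
    fix f x assume f: "(\<Sum>x\<in>?R. f x *\<^sub>R x) = 0" and "x \<in> ?R"
    then obtain j where j: "j \<in> J" "x = real_vec (B $ j)" by blast
    have "0 = coord B j (\<Sum>k\<in>J. f (real_vec (B $ k)) *\<^sub>R real_vec (B $ k))"
      using f by (simp add: sum.reindex[OF inj] coord_0)
    also have "\<dots> = (\<Sum>k\<in>J. if j = k then f (real_vec (B $ k)) else 0)"
      unfolding coord_sum coord_scaleR coord_row by (intro sum.cong) auto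
    also have "\<dots> = f x" using j by simp
    finally show "f x = 0" by simp
  qed simp
  moreover have "?R \<subseteq> fcone B J" using row_fcone_iff by blast
  moreover have "fcone B J \<subseteq> span ?R"
  proof
    fix x assume x: "x \<in> fcone B J"
    have "coord B k x *\<^sub>R real_vec (B $ k) \<in> span ?R" for k
    proof (cases "k \<in> J")
      case True thus ?thesis by (intro span_scale span_base) auto
    next
      case False
      hence "coord B k x = 0" using x fcone_iff by blast
      thus ?thesis by (simp add: span_zero)
    qed
    hence "(\<Sum>k\<in>UNIV. coord B k x *\<^sub>R real_vec (B $ k)) \<in> span ?R" by (intro span_sum) auto
    thus "x \<in> span ?R" by (simp add: coord_expand)
  qed
  ultimately have "dim (fcone B J) = card ?R" by (intro dim_unique) auto
  thus ?thesis using card_image[OF inj] by simp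
qed

lemma fcone_ray: "fcone B {k} = conic hull {real_vec (B $ k)}"
proof -
  have "fcone B {k} = {t *\<^sub>R real_vec (B $ k) | t. 0 \<le> t}"
  proof (intro set_eqI iffI)
    fix x assume "x \<in> fcone B {k}"
    hence c: "0 \<le> coord B k x" "\<And>j. j \<noteq> k \<Longrightarrow> coord B j x = 0" unfolding fcone_iff by auto
    have "x = (\<Sum>j\<in>UNIV. coord B j x *\<^sub>R real_vec (B $ j))" by (simp add: coord_expand)
    also have "\<dots> = (\<Sum>j\<in>UNIV. if j = k then coord B k x *\<^sub>R real_vec (B $ k) else 0)"
      using c(2) by (intro sum.cong refl) auto
    finally have "x = coord B k x *\<^sub>R real_vec (B $ k)" by simp
    with c(1) show "x \<in> {t *\<^sub>R real_vec (B $ k) | t. 0 \<le> t}" by auto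
  next
    fix x assume "x \<in> {t *\<^sub>R real_vec (B $ k) | t. 0 \<le> t}"
    thus "x \<in> fcone B {k}" by (auto simp: fcone_iff coord_scaleR coord_row)
  qed
  thus ?thesis by (auto simp: conic_hull_explicit)
qed

end

section \<open>Fans from polytopes with smooth vertices\<close>

locale smooth_cones =
  fixes K :: "'i set" and B :: "'i \<Rightarrow> int ^ 'n::finite ^ 'n"
  assumes finite_K: "finite K" and K_ne: "K \<noteq> {}"
    and inv: "i \<in> K \<Longrightarrow> invertible (B i)"
begin

definition Sig :: "(real ^ 'n) set set" where
  "Sig = {fcone (B i) J | i J. i \<in> K}"

lemma Sig_cases:
  assumes "\<sigma> \<in> Sig" obtains i J where "i \<in> K" "\<sigma> = fcone (B i) J"
  using assms unfolding Sig_def by blast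

lemma fcone_Sig: "i \<in> K \<Longrightarrow> fcone (B i) J \<in> Sig"
  unfolding Sig_def by blast

lemma rays_Sig: "rays Sig = {conic hull {real_vec (B i $ k)} | i k. i \<in> K}"
proof (intro set_eqI iffI)
  fix \<sigma> assume "\<sigma> \<in> rays Sig"
  then obtain i J where i: "i \<in> K" "\<sigma> = fcone (B i) J" "dim \<sigma> = 1"
    unfolding rays_def by (auto elim: Sig_cases)
  hence "card J = 1" using dim_fcone[OF inv[OF i(1)]] by simp
  then obtain k where "J = {k}" by (meson card_1_singletonE)
  thus "\<sigma> \<in> {conic hull {real_vec (B i $ k)} | i k. i \<in> K}" using i fcone_ray[OF inv[OF i(1)]] by blast
next
  fix \<sigma> assume "\<sigma> \<in> {conic hull {real_vec (B i $ k)} | i k. i \<in> K}"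
  then obtain i k where i: "i \<in> K" "\<sigma> = fcone (B i) {k}" using fcone_ray[OF inv] by auto
  thus "\<sigma> \<in> rays Sig" unfolding rays_def using dim_fcone[OF inv[OF i(1)], of "{k}"] fcone_Sig[OF i(1)] by simp
qed

end

text \<open>
  The lattice points \<open>vtx i\<close> are the vertices of a polytope, and the rows of \<open>B
  i\<close> are the primitive inner normals of the facets through \<open>vtx i\<close>: all
  vertices lie on the inner side of these facets, a vertex on a facet has its normal among its
  rows, and each of the edges at \<open>vtx i\<close>, whose directions form the dual basis, ends
  at another vertex.
\<close>

locale smooth_polytope = smooth_cones K B for K :: "'i set" and B :: "'i \<Rightarrow> int ^ 'n::finite ^ 'n" +
  fixes vtx :: "'i \<Rightarrow> int ^ 'n"
  assumes vtx_nonneg: "\<lbrakk>i \<in> K; j \<in> K\<rbrakk> \<Longrightarrow> 0 \<le> (B i *v (vtx j - vtx i)) $ k"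
    and vtx_zero: "\<lbrakk>i \<in> K; j \<in> K; (B i *v (vtx j - vtx i)) $ k = 0\<rbrakk> \<Longrightarrow> \<exists>l. B i $ k = B j $ l"
    and edge: "i \<in> K \<Longrightarrow> \<exists>j\<in>K. \<exists>e>0. B i *v (vtx j - vtx i) = axis k e"
begin

lemma vtx_zero_iff:
  assumes "i \<in> K" "j \<in> K"
  shows "(B i *v (vtx j - vtx i)) $ k = 0 \<longleftrightarrow> (\<exists>l. B i $ k = B j $ l)"
proof
  assume "\<exists>l. B i $ k = B j $ l"
  then obtain l where l: "B i $ k = B j $ l" by blast
  have "(B i *v m) $ k = (B j *v m) $ l" for m using l by (simp add: matrix_vector_mult_def)
  moreover have "(B j *v (vtx j - vtx i)) $ l = - (B j *v (vtx i - vtx j)) $ l"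
    by (simp add: matrix_vector_mult_def sum_negf[symmetric] algebra_simps)
  ultimately show "(B i *v (vtx j - vtx i)) $ k = 0"
    using vtx_nonneg[OF assms(1,2), of k] vtx_nonneg[OF assms(2,1), of l] by simp
qed (rule vtx_zero[OF assms])

text \<open>
  A vertex at which the linear form \<open>x\<close> is minimal has \<open>x\<close> in its cone,
  since \<open>x\<close> does not decrease along the edges.
\<close>

lemma complete: "\<exists>i\<in>K. x \<in> fcone (B i) UNIV"
proof -
  obtain i where i: "i \<in> K" "\<And>j. j \<in> K \<Longrightarrow> real_vec (vtx i) \<bullet> x \<le> real_vec (vtx j) \<bullet> x"
    using ex_min_if_finite[of "(\<lambda>i. real_vec (vtx i) \<bullet> x) ` K"] finite_K K_ne by force
  have "0 \<le> coord (B i) k x" for k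
  proof -
    obtain j e where j: "j \<in> K" "e > 0" "B i *v (vtx j - vtx i) = axis k e" using edge[OF i(1)] by blast
    have "real_vec (vtx j - vtx i) \<bullet> x = coord (B i) k x * real_of_int e"
      unfolding inner_coord[OF inv[OF i(1)]] j(3)
      by (simp add: axis_def if_distrib[of real_of_int] if_distrib[of "\<lambda>x. _ * x"] cong: if_cong)
    moreover have "real_vec (vtx j - vtx i) \<bullet> x \<ge> 0"
      using i(2)[OF j(1)] by (simp add: real_vec_simps inner_diff_left)
    ultimately show ?thesis using j(2) by (simp add: zero_le_mult_iff)
  qed
  thus ?thesis using i(1) fcone_iff[OF inv[OF i(1)]] by blast
qed

text \<open>
  A point \<open>x\<close> in both cones, as a linear form on the polytope, is minimal at both
  vertices, so it takes the same value there. Hence each of its coordinates in the first cone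
  belongs to a facet that contains both vertices.
\<close>

lemma fcone_Int:
  assumes i: "i \<in> K" and j: "j \<in> K"
  shows "fcone (B i) J \<inter> fcone (B j) J' = fcone (B i) {k \<in> J. \<exists>l\<in>J'. B i $ k = B j $ l}" (is "_ = fcone _ ?J")
proof
  have mono: "real_vec (B i $ k) \<in> fcone (B j) J'" if "k \<in> ?J" for k
    using that row_fcone_iff[OF inv[OF j]] by force
  show "fcone (B i) ?J \<subseteq> fcone (B i) J \<inter> fcone (B j) J'"
  proof
    fix x assume x: "x \<in> fcone (B i) ?J"
    have "coord (B j) l x = (\<Sum>k\<in>UNIV. coord (B i) k x * coord (B j) l (real_vec (B i $ k)))" for l
      by (subst coord_expand[OF inv[OF i], of x, symmetric]) (simp add: coord_sum coord_scaleR)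
    moreover have "0 \<le> coord (B i) k x * coord (B j) l (real_vec (B i $ k)) \<and>
        (l \<notin> J' \<longrightarrow> coord (B i) k x * coord (B j) l (real_vec (B i $ k)) = 0)" for k l
      using x mono[of k] unfolding fcone_iff[OF inv[OF i]] fcone_iff[OF inv[OF j]]
      by (cases "k \<in> ?J") auto
    ultimately have "x \<in> fcone (B j) J'"
      unfolding fcone_iff[OF inv[OF j]] by (auto intro!: sum_nonneg sum.neutral)
    moreover have "x \<in> fcone (B i) J" using x fcone_subset_iff[OF inv[OF i], of ?J J] by blast
    ultimately show "x \<in> fcone (B i) J \<inter> fcone (B j) J'" by blast
  qed
  show "fcone (B i) J \<inter> fcone (B j) J' \<subseteq> fcone (B i) ?J"
  proof
    fix x assume x: "x \<in> fcone (B i) J \<inter> fcone (B j) J'"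
    have xi: "0 \<le> coord (B i) k x" "k \<notin> J \<Longrightarrow> coord (B i) k x = 0" for k
      using x fcone_iff[OF inv[OF i]] by blast+
    have xj: "0 \<le> coord (B j) k x" "k \<notin> J' \<Longrightarrow> coord (B j) k x = 0" for k
      using x fcone_iff[OF inv[OF j]] by blast+
    have "real_vec (vtx j - vtx i) \<bullet> x = (\<Sum>k\<in>UNIV. coord (B i) k x * real_of_int ((B i *v (vtx j - vtx i)) $ k))"
      by (rule inner_coord[OF inv[OF i]])
    moreover have "real_vec (vtx i - vtx j) \<bullet> x = (\<Sum>k\<in>UNIV. coord (B j) k x * real_of_int ((B j *v (vtx i - vtx j)) $ k))"
      by (rule inner_coord[OF inv[OF j]])
    moreover have "\<dots> \<ge> 0" using xj vtx_nonneg[OF j i] by (intro sum_nonneg) simp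
    moreover have "real_vec (vtx i - vtx j) \<bullet> x = - (real_vec (vtx j - vtx i) \<bullet> x)"
      by (simp add: real_vec_simps inner_diff_left)
    ultimately have "(\<Sum>k\<in>UNIV. coord (B i) k x * real_of_int ((B i *v (vtx j - vtx i)) $ k)) \<le> 0" by linarith
    moreover have nn: "0 \<le> coord (B i) k x * real_of_int ((B i *v (vtx j - vtx i)) $ k)" for k
      using xi vtx_nonneg[OF i j] by simp
    ultimately have zero: "coord (B i) k x * real_of_int ((B i *v (vtx j - vtx i)) $ k) = 0" for k
      by (metis (no_types, lifting) UNIV_I finite order_antisym sum_nonneg sum_nonneg_eq_0_iff)
    have "\<exists>l. B i $ k = B j $ l" if "coord (B i) k x \<noteq> 0" for k
      using zero[of k] that vtx_zero[OF i j, of k] by auto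
    then obtain f where f: "\<And>k. coord (B i) k x \<noteq> 0 \<Longrightarrow> B i $ k = B j $ f k" by metis
    have coordf: "coord (B j) l x = (\<Sum>k\<in>UNIV. if coord (B i) k x \<noteq> 0 \<and> l = f k then coord (B i) k x else 0)" for l
    proof -
      have "coord (B j) l x = (\<Sum>k\<in>UNIV. coord (B i) k x * coord (B j) l (real_vec (B i $ k)))"
        by (subst coord_expand[OF inv[OF i], of x, symmetric]) (simp add: coord_sum coord_scaleR)
      also have "\<dots> = (\<Sum>k\<in>UNIV. if coord (B i) k x \<noteq> 0 \<and> l = f k then coord (B i) k x else 0)"
      proof (intro sum.cong refl)
        fix k
        show "coord (B i) k x * coord (B j) l (real_vec (B i $ k)) =
            (if coord (B i) k x \<noteq> 0 \<and> l = f k then coord (B i) k x else 0)"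
          by (cases "coord (B i) k x = 0") (simp_all add: f coord_row[OF inv[OF j]])
      qed
      finally show ?thesis .
    qed
    have "\<exists>l\<in>J'. B i $ k = B j $ l" if k: "coord (B i) k x \<noteq> 0" for k
    proof -
      have "0 < coord (B i) k x" using xi(1)[of k] k by simp
      also have "\<dots> \<le> coord (B j) (f k) x"
        unfolding coordf[of "f k"]
        using member_le_sum[of k UNIV "\<lambda>k'. if coord (B i) k' x \<noteq> 0 \<and> f k = f k' then coord (B i) k' x else 0"] xi(1) k
        by simp
      finally have "f k \<in> J'" using xj(2) by force
      thus ?thesis using f[OF k] by blast
    qed
    thus "x \<in> fcone (B i) ?J" unfolding fcone_iff[OF inv[OF i]] using xi by blast
  qed
qed

lemma fan_Sig: "fan Sig"
  unfolding fan_def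
proof (intro conjI ballI allI impI)
  have "Sig = (\<lambda>(i, J). fcone (B i) J) ` (K \<times> UNIV)" unfolding Sig_def by auto
  thus "finite Sig" using finite_K by simp
  show "Sig \<noteq> {}" using K_ne fcone_Sig by blast
next
  fix \<sigma> assume "\<sigma> \<in> Sig"
  thus "rational_cone \<sigma>" by (elim Sig_cases) (simp add: rational_fcone[OF inv])
next
  fix \<sigma> assume "\<sigma> \<in> Sig"
  thus "\<sigma> \<inter> uminus ` \<sigma> = {0}" by (elim Sig_cases) (simp add: fcone_pointed[OF inv])
next
  fix \<sigma> \<tau> assume "\<sigma> \<in> Sig" "cone_face \<tau> \<sigma>"
  thus "\<tau> \<in> Sig" by (metis Sig_cases face_fcone[OF inv] fcone_Sig)
next
  fix \<sigma> \<tau> assume "\<sigma> \<in> Sig" "\<tau> \<in> Sig"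
  then obtain i J j J' where i: "i \<in> K" "\<sigma> = fcone (B i) J" and j: "j \<in> K" "\<tau> = fcone (B j) J'"
    by (metis Sig_cases)
  show "cone_face (\<sigma> \<inter> \<tau>) \<sigma>"
    unfolding i(2) j(2) fcone_Int[OF i(1) j(1)] by (rule fcone_face[OF inv[OF i(1)]]) auto
  show "cone_face (\<sigma> \<inter> \<tau>) \<tau>"
    unfolding i(2) j(2) Int_commute[of "fcone (B i) J"] fcone_Int[OF j(1) i(1)]
    by (rule fcone_face[OF inv[OF j(1)]]) auto
qed

end

section \<open>Affine charts of smooth toric threefolds\<close>

lemma mv_simps:
  fixes A :: "int ^ 'n::finite ^ 'n"
  shows "A *v (u + v) = A *v u + A *v v" "A *v (u - v) = A *v u - A *v v" "A *v (- v) = - (A *v v)"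
    "A *v (c *s v) = c *s (A *v v)" "A *v 0 = 0"
  by (simp_all add: vec_eq_iff matrix_vector_mult_def sum_negf sum_distrib_left mult_ac
      distrib_left right_diff_distrib sum.distrib sum_subtractf)

lemma fcone_empty: "fcone B {} = {0}"
  unfolding fcone_def by (auto intro!: exI[of _ "\<lambda>_. 0"])

text \<open>
  The point with coordinates \<open>z\<close> in the chart of a maximal cone lies in the orbit of
  the face spanned by the rows whose coordinates vanish. As \<open>0 powi 0 = 1\<close> and
  \<open>0 powi n = 0\<close> for all other \<open>n\<close>, also for negative ones, the product
  of powers vanishes at all characters that are not invertible on this face, as a
  \<open>toric_point\<close> must.
\<close>

definition tpt :: "int ^ 'n ^ 'n \<Rightarrow> complex ^ 'n::finite \<Rightarrow> 'n toric_point" where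
  "tpt B z = (fcone B {k. z $ k = 0}, \<lambda>m. \<Prod>k\<in>UNIV. z $ k powi ((B *v m) $ k))"

lemma power_int_add_nonneg:
  fixes x :: complex
  assumes "x = 0 \<Longrightarrow> 0 \<le> a \<and> 0 \<le> b"
  shows "x powi (a + b) = x powi a * x powi b"
  using assms by (cases "x = 0") (auto simp: power_int_add power_int_0_left_if)

context
  fixes B :: "int ^ 'n::finite ^ 'n"
  assumes inv: "invertible B"
begin

lemma dual_iff: "m \<in> dual_monoid (fcone B J) \<longleftrightarrow> (\<forall>k\<in>J. 0 \<le> (B *v m) $ k)"
  by (simp add: dual_monoid_fcone[OF inv])

lemma tpt_mult:
  assumes "m \<in> dual_monoid (fcone B {k. z $ k = 0})" "m' \<in> dual_monoid (fcone B {k. z $ k = 0})"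
  shows "snd (tpt B z) (m + m') = snd (tpt B z) m * snd (tpt B z) m'"
proof -
  have "z $ k powi ((B *v (m + m')) $ k) = z $ k powi ((B *v m) $ k) * z $ k powi ((B *v m') $ k)" for k
    using assms unfolding dual_iff mv_simps by (auto intro: power_int_add_nonneg)
  thus ?thesis by (simp add: tpt_def prod.distrib)
qed

lemma tpt_dual_vec: "snd (tpt B z) (dual_vec B k) = z $ k"
proof -
  have "snd (tpt B z) (dual_vec B k) = (\<Prod>j\<in>UNIV. z $ j powi (if j = k then 1 else 0))"
    by (simp add: tpt_def mult_dual_vec[OF inv] axis_def)
  also have "\<dots> = (\<Prod>j\<in>UNIV. if j = k then z $ j else 1)" by (intro prod.cong) auto
  finally have "snd (tpt B z) (dual_vec B k) = \<dots>" .
  thus ?thesis by simp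
qed

lemma tpt_inject: "tpt B z = tpt B w \<longleftrightarrow> z = w"
  using tpt_dual_vec by (metis vec_eq_iff)

lemma tpt_zero: "snd (tpt B z) 0 = 1"
  by (simp add: tpt_def mv_simps)

lemma tpt_outside:
  assumes "m \<notin> dual_monoid (fcone B {k. z $ k = 0}) \<or> - m \<notin> dual_monoid (fcone B {k. z $ k = 0})"
  shows "snd (tpt B z) m = 0"
proof -
  obtain k where "z $ k = 0" "(B *v m) $ k \<noteq> 0"
    using assms unfolding dual_iff mv_simps by force
  hence "\<exists>k\<in>UNIV. z $ k powi ((B *v m) $ k) = 0" by (auto simp: power_int_0_left_if)
  thus ?thesis unfolding tpt_def by simp
qed

text \<open>
  The converse: the coordinates of a point are the values at the dual basis, and multiplicativity
  determines the other values.
\<close>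

lemma torus_orbit_point:
  assumes \<gamma>0: "\<gamma> 0 = 1"
    and mult: "\<And>m m'. m \<in> dual_monoid (fcone B J) \<Longrightarrow> m' \<in> dual_monoid (fcone B J) \<Longrightarrow> \<gamma> (m + m') = \<gamma> m * \<gamma> m'"
    and zero: "\<And>m. m \<notin> dual_monoid (fcone B J) \<or> - m \<notin> dual_monoid (fcone B J) \<Longrightarrow> \<gamma> m = 0"
  obtains z where "(fcone B J, \<gamma>) = tpt B z" "J = {k. z $ k = 0}"
proof -
  define z :: "complex ^ 'n" where "z = (\<chi> k. \<gamma> (dual_vec B k))"
  let ?D = "{m. \<forall>k\<in>J. (B *v m) $ k = 0}"
  have D: "m \<in> dual_monoid (fcone B J)" if "m \<in> ?D" for m
    using that unfolding dual_iff by auto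
  have multD: "\<gamma> (m + m') = \<gamma> m * \<gamma> m'" if "m \<in> ?D" "m' \<in> ?D" for m m'
    using mult[OF D[OF that(1)] D[OF that(2)]] .
  have dual_D: "c *s dual_vec B k \<in> ?D" if "k \<notin> J" for k c
    using that by (auto simp: mv_simps mult_dual_vec[OF inv] axis_def)
  have neg: "\<gamma> m * \<gamma> (- m) = 1" if "m \<in> ?D" for m
    using multD[of m "- m"] that \<gamma>0 by (auto simp: mv_simps)
  have J: "J = {k. z $ k = 0}"
  proof (intro set_eqI iffI)
    fix k assume k: "k \<in> J"
    have "- dual_vec B k \<notin> dual_monoid (fcone B J)"
      using k unfolding dual_iff mv_simps mult_dual_vec[OF inv] by (auto simp: axis_def)
    hence "\<gamma> (dual_vec B k) = 0" using zero by blast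
    thus "k \<in> {k. z $ k = 0}" by (simp add: z_def)
  next
    fix k assume k: "k \<in> {k. z $ k = 0}"
    show "k \<in> J"
    proof (rule ccontr)
      assume "k \<notin> J"
      from neg[OF dual_D[OF this, of 1]] show False using k by (simp add: z_def)
    qed
  qed
  have pow: "\<gamma> (n *s dual_vec B k) = z $ k powi n" if k: "k \<notin> J" for k n
  proof -
    have nat: "\<gamma> (int n *s dual_vec B k) = z $ k ^ n" for n
    proof (induction n)
      case 0 show ?case by (simp add: \<gamma>0)
    next
      case (Suc n)
      have "\<gamma> (int (Suc n) *s dual_vec B k) = \<gamma> (1 *s dual_vec B k + int n *s dual_vec B k)"
        by (simp add: vector_sadd_rdistrib)
      also have "\<dots> = \<gamma> (1 *s dual_vec B k) * \<gamma> (int n *s dual_vec B k)"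
        by (rule multD[OF dual_D[OF k] dual_D[OF k]])
      finally show ?case using Suc by (simp add: z_def)
    qed
    show ?thesis
    proof (cases "0 \<le> n")
      case True thus ?thesis using nat[of "nat n"] by (simp add: power_int_def)
    next
      case False
      have "\<gamma> (n *s dual_vec B k) * \<gamma> (- (n *s dual_vec B k)) = 1" by (rule neg[OF dual_D[OF k]])
      moreover have "- (n *s dual_vec B k) = int (nat (- n)) *s dual_vec B k"
        using False by (simp add: vec_eq_iff)
      ultimately have "\<gamma> (n *s dual_vec B k) * z $ k ^ nat (- n) = 1" using nat[of "nat (- n)"] by metis
      moreover have "z $ k \<noteq> 0" using k J by blast
      ultimately show ?thesis using False by (simp add: power_int_def field_simps)
    qed
  qed
  have "\<gamma> m = (\<Prod>k\<in>UNIV. z $ k powi ((B *v m) $ k))" for m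
  proof (cases "m \<in> ?D")
    case True
    define s where "s A = (\<Sum>k\<in>A. (B *v m) $ k *s dual_vec B k)" for A
    have term_D: "(B *v m) $ k *s dual_vec B k \<in> ?D" for k
    proof (cases "k \<in> J")
      case True
      hence "(B *v m) $ k = 0" using \<open>m \<in> ?D\<close> by blast
      thus ?thesis by (simp add: mv_simps)
    qed (rule dual_D)
    have s_D: "s A \<in> ?D" for A
      unfolding s_def by (induction A rule: infinite_finite_induct) (use term_D in \<open>auto simp: mv_simps\<close>)
    have "\<gamma> (s A) = (\<Prod>k\<in>A. z $ k powi ((B *v m) $ k))" if "finite A" for A
      using that
    proof (induction A)
      case empty show ?case by (simp add: s_def \<gamma>0)
    next
      case (insert k A)
      have "s (insert k A) = (B *v m) $ k *s dual_vec B k + s A" using insert by (simp add: s_def)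
      hence "\<gamma> (s (insert k A)) = \<gamma> ((B *v m) $ k *s dual_vec B k) * \<gamma> (s A)"
        using multD[OF term_D s_D] by simp
      also have "\<gamma> ((B *v m) $ k *s dual_vec B k) = z $ k powi ((B *v m) $ k)"
      proof (cases "k \<in> J")
        case True
        hence "(B *v m) $ k = 0" using \<open>m \<in> ?D\<close> by blast
        thus ?thesis by (simp add: \<gamma>0)
      qed (rule pow)
      finally show ?case using insert by simp
    qed
    from this[of UNIV] show ?thesis by (simp add: s_def dual_vec_expand[OF inv])
  next
    case False
    then obtain k where k: "k \<in> J" "(B *v m) $ k \<noteq> 0" by blast
    have "m \<notin> dual_monoid (fcone B J) \<or> - m \<notin> dual_monoid (fcone B J)"
      using k unfolding dual_iff mv_simps by force
    hence "\<gamma> m = 0" by (rule zero)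
    moreover have "\<exists>k\<in>UNIV. z $ k powi ((B *v m) $ k) = 0"
      using k J by (auto simp: power_int_0_left_if)
    ultimately show ?thesis by simp
  qed
  hence "(fcone B J, \<gamma>) = tpt B z" unfolding tpt_def J[symmetric] by auto
  thus ?thesis using J that by blast
qed

end

lemma sum_merge:
  assumes "finite X"
  obtains c' :: "'b \<Rightarrow> complex" where "\<And>f. (\<Sum>x\<in>X. c x * f (a x)) = (\<Sum>y\<in>a ` X. c' y * f y)"
proof -
  define c' where "c' y = (\<Sum>x\<in>{x \<in> X. a x = y}. c x)" for y
  have "(\<Sum>x\<in>X. c x * f (a x)) = (\<Sum>y\<in>a ` X. c' y * f y)" for f
  proof -
    have "(\<Sum>x\<in>X. c x * f (a x)) = (\<Sum>y\<in>a ` X. \<Sum>x\<in>{x \<in> X. a x = y}. c x * f (a x))"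
      by (rule sum.image_gen[OF assms])
    also have "\<dots> = (\<Sum>y\<in>a ` X. c' y * f y)"
      unfolding c'_def by (auto simp: sum_distrib_right intro!: sum.cong)
    finally show ?thesis .
  qed
  thus ?thesis by (rule that)
qed

lemma chart_functionsI:
  assumes "finite X" "a ` X \<subseteq> dual_monoid \<tau>"
  shows "(\<lambda>p. \<Sum>x\<in>X. c x * snd p (a x)) \<in> chart_functions \<tau>"
proof -
  obtain c' where "\<And>f. (\<Sum>x\<in>X. c x * f (a x)) = (\<Sum>y\<in>a ` X. c' y * f y)"
    using sum_merge[OF assms(1)] by blast
  hence "(\<lambda>p. \<Sum>x\<in>X. c x * snd p (a x)) = (\<lambda>p. \<Sum>y\<in>a ` X. c' y * snd p y)" by blast
  thus ?thesis unfolding chart_functions_def using assms by blast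
qed

text \<open>
  The dual basis generates the dual monoid of a maximal cone, so the functions on its chart are
  all polynomials.
\<close>

lemma poly_chart_function:
  fixes B :: "int ^ 3 ^ 3"
  assumes inv: "invertible B"
  shows "\<exists>h\<in>chart_functions (fcone B UNIV). \<forall>z. h (tpt B z) = ev P z"
proof (induction P rule: poly3_induct)
  case (con c)
  have "0 \<in> dual_monoid (fcone B UNIV)" by (simp add: dual_monoid_fcone[OF inv] mv_simps)
  hence "(\<lambda>p. \<Sum>m\<in>{0}. c * snd p m) \<in> chart_functions (fcone B UNIV)"
    unfolding chart_functions_def by (intro CollectI exI[of _ "{0}"] exI[of _ "\<lambda>_. c"]) auto
  thus ?case by (rule bexI[rotated]) (simp add: tpt_zero[OF inv])
next
  case (var k)
  have "dual_vec B k \<in> dual_monoid (fcone B UNIV)"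
    by (simp add: dual_monoid_fcone[OF inv] mult_dual_vec[OF inv] axis_def)
  hence "(\<lambda>p. \<Sum>m\<in>{dual_vec B k}. 1 * snd p m) \<in> chart_functions (fcone B UNIV)"
    unfolding chart_functions_def by (intro CollectI exI[of _ "{dual_vec B k}"] exI[of _ "\<lambda>_. 1"]) auto
  thus ?case by (rule bexI[rotated]) (simp add: tpt_dual_vec[OF inv])
next
  case (add P P')
  then obtain h h' where h: "h \<in> chart_functions (fcone B UNIV)" "\<forall>z. h (tpt B z) = ev P z"
    "h' \<in> chart_functions (fcone B UNIV)" "\<forall>z. h' (tpt B z) = ev P' z" by blast
  obtain A c where A: "h = (\<lambda>p. \<Sum>m\<in>A. c m * snd p m)" "finite A" "A \<subseteq> dual_monoid (fcone B UNIV)"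
    using h(1) unfolding chart_functions_def by blast
  obtain A' c' where A': "h' = (\<lambda>p. \<Sum>m\<in>A'. c' m * snd p m)" "finite A'" "A' \<subseteq> dual_monoid (fcone B UNIV)"
    using h(3) unfolding chart_functions_def by blast
  have "(\<lambda>p. \<Sum>x\<in>A <+> A'. case_sum c c' x * snd p (case_sum (\<lambda>m. m) (\<lambda>m. m) x)) \<in> chart_functions (fcone B UNIV)"
    using A A' by (intro chart_functionsI) auto
  thus ?case using h(2,4) A A' by (rule_tac bexI) (auto simp: sum.Plus)
next
  case (mult P P')
  then obtain h h' where h: "h \<in> chart_functions (fcone B UNIV)" "\<forall>z. h (tpt B z) = ev P z"
    "h' \<in> chart_functions (fcone B UNIV)" "\<forall>z. h' (tpt B z) = ev P' z" by blast
  obtain A c where A: "h = (\<lambda>p. \<Sum>m\<in>A. c m * snd p m)" "finite A" "A \<subseteq> dual_monoid (fcone B UNIV)"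
    using h(1) unfolding chart_functions_def by blast
  obtain A' c' where A': "h' = (\<lambda>p. \<Sum>m\<in>A'. c' m * snd p m)" "finite A'" "A' \<subseteq> dual_monoid (fcone B UNIV)"
    using h(3) unfolding chart_functions_def by blast
  let ?g = "\<lambda>p. \<Sum>x\<in>A \<times> A'. (c (fst x) * c' (snd x)) * snd p (fst x + snd x)"
  have dual: "m \<in> dual_monoid (fcone B {k. z $ k = 0})" if "m \<in> A \<union> A'" for m z
    using that A(3) A'(3) unfolding dual_monoid_fcone[OF inv] by blast
  have "(\<lambda>x. fst x + snd x) ` (A \<times> A') \<subseteq> dual_monoid (fcone B UNIV)"
  proof (rule image_subsetI)
    fix x assume "x \<in> A \<times> A'"
    hence "fst x \<in> dual_monoid (fcone B UNIV)" "snd x \<in> dual_monoid (fcone B UNIV)" using A(3) A'(3) by auto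
    thus "fst x + snd x \<in> dual_monoid (fcone B UNIV)" unfolding dual_iff[OF inv] mv_simps by auto
  qed
  hence g: "?g \<in> chart_functions (fcone B UNIV)" using A A' by (intro chart_functionsI) auto
  have "?g (tpt B z) = ev (P * P') z" for z
  proof -
    have "?g (tpt B z) = (\<Sum>x\<in>A \<times> A'. (c (fst x) * snd (tpt B z) (fst x)) * (c' (snd x) * snd (tpt B z) (snd x)))"
      using tpt_mult[OF inv dual dual] by (intro sum.cong refl) auto
    also have "\<dots> = h (tpt B z) * h' (tpt B z)"
      unfolding A(1) A'(1) sum_product sum.cartesian_product by (simp add: case_prod_beta)
    finally show ?thesis using h by simp
  qed
  thus ?case by (intro bexI[OF _ g] allI)
qed

text \<open>
  A function on the chart of \<open>\<tau>\<close> is a Laurent polynomial in the coordinates of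
  \<open>B\<close>, near a point with zero set \<open>J\<close>. The exponents of the coordinates
  in \<open>J\<close> are nonnegative, and the other coordinates are cleared by a power. The bound
  works for all larger exponents so that one power can serve a numerator and a denominator.
\<close>

lemma chart_function_local:
  fixes B :: "int ^ 3 ^ 3"
  assumes inv: "invertible B" and face: "cone_face (fcone B J) \<tau>" and h: "h \<in> chart_functions \<tau>"
  shows "\<exists>M0. \<forall>M\<ge>M0. \<exists>P. \<forall>w. (\<forall>k. k \<notin> J \<longrightarrow> w $ k \<noteq> 0) \<longrightarrow> ev P w = h (tpt B w) * (\<Prod>k\<in>- J. w $ k ^ M)"
proof -
  obtain A c where A: "h = (\<lambda>p. \<Sum>m\<in>A. c m * snd p m)" "finite A" "A \<subseteq> dual_monoid \<tau>"
    using h unfolding chart_functions_def by blast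
  have "fcone B J \<subseteq> \<tau>" using face unfolding cone_face_def face_of_def by blast
  hence "A \<subseteq> dual_monoid (fcone B J)" using A(3) unfolding dual_monoid_def by blast
  hence nn: "0 \<le> (B *v m) $ k" if "m \<in> A" "k \<in> J" for m k
    using that unfolding dual_monoid_fcone[OF inv] by blast
  define M0 where "M0 = (\<Sum>m\<in>A. \<Sum>k\<in>UNIV. nat \<bar>(B *v m) $ k\<bar>)"
  have M0: "\<bar>(B *v m) $ k\<bar> \<le> int M0" if "m \<in> A" for m k
  proof -
    have "nat \<bar>(B *v m) $ k\<bar> \<le> (\<Sum>k\<in>UNIV. nat \<bar>(B *v m) $ k\<bar>)" by (rule member_le_sum) auto
    also have "\<dots> \<le> M0" unfolding M0_def using that A(2)
      by (intro member_le_sum[of m A "\<lambda>m. \<Sum>k\<in>UNIV. nat \<bar>(B *v m) $ k\<bar>"]) auto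
    finally show ?thesis by simp
  qed
  show ?thesis
  proof (intro exI[of _ M0] allI impI)
    fix M assume M: "M0 \<le> M"
    define P where "P = (\<Sum>m\<in>A. con (c m) * (\<Prod>k\<in>UNIV. var k ^ (if k \<in> J then nat ((B *v m) $ k) else nat ((B *v m) $ k + int M))))"
    have "ev P w = h (tpt B w) * (\<Prod>k\<in>- J. w $ k ^ M)" if w: "\<forall>k. k \<notin> J \<longrightarrow> w $ k \<noteq> 0" for w
    proof -
      have "(\<Prod>k\<in>UNIV. w $ k ^ (if k \<in> J then nat ((B *v m) $ k) else nat ((B *v m) $ k + int M))) =
          snd (tpt B w) m * (\<Prod>k\<in>- J. w $ k ^ M)" if m: "m \<in> A" for m
      proof -
        have "(\<Prod>k\<in>- J. w $ k ^ M) = (\<Prod>k\<in>UNIV. if k \<in> J then 1 else w $ k ^ M)"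
          by (intro prod.mono_neutral_cong_left) auto
        moreover have "w $ k ^ (if k \<in> J then nat ((B *v m) $ k) else nat ((B *v m) $ k + int M)) =
            w $ k powi ((B *v m) $ k) * (if k \<in> J then 1 else w $ k ^ M)" for k
        proof (cases "k \<in> J")
          case True
          thus ?thesis using nn[OF m True] by (simp add: power_int_def)
        next
          case False
          have "0 \<le> (B *v m) $ k + int M" using M0[OF m, of k] M by linarith
          hence "w $ k ^ nat ((B *v m) $ k + int M) = w $ k powi ((B *v m) $ k + int M)"
            by (simp add: power_int_def)
          also have "\<dots> = w $ k powi ((B *v m) $ k) * w $ k ^ M"
            using w False by (simp add: power_int_add)
          finally show ?thesis using False by simp
        qed
        ultimately show ?thesis by (simp add: tpt_def prod.distrib)
      qed
      thus ?thesis unfolding P_def A(1) by (simp add: sum_distrib_right mult.assoc)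
    qed
    thus "\<exists>P. \<forall>w. (\<forall>k. k \<notin> J \<longrightarrow> w $ k \<noteq> 0) \<longrightarrow> ev P w = h (tpt B w) * (\<Prod>k\<in>- J. w $ k ^ M)" by blast
  qed
qed

locale smooth_toric = smooth_cones K B for K :: "'i set" and B :: "'i \<Rightarrow> int ^ 3 ^ 3"
begin

lemma tpt_points:
  assumes i: "i \<in> K" shows "tpt (B i) z \<in> toric_points Sig"
proof -
  have "tpt (B i) z = (fcone (B i) {k. z $ k = 0}, snd (tpt (B i) z))" by (simp add: tpt_def)
  moreover have "(fcone (B i) {k. z $ k = 0}, snd (tpt (B i) z)) \<in> toric_points Sig"
    unfolding toric_points_def mem_Collect_eq split
    using fcone_Sig[OF i] tpt_zero[OF inv[OF i]] tpt_mult[OF inv[OF i]] tpt_outside[OF inv[OF i]] by blast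
  ultimately show ?thesis by simp
qed

lemma toric_point_in_chart:
  assumes "p \<in> toric_points Sig" "i \<in> K" "fst p = fcone (B i) J"
  obtains z where "p = tpt (B i) z" "J = {k. z $ k = 0}"
proof -
  obtain \<gamma> where p: "p = (fcone (B i) J, \<gamma>)" using assms(3) by (metis prod.collapse)
  have 1: "\<gamma> 0 = 1"
    and 2: "\<And>m m'. m \<in> dual_monoid (fcone (B i) J) \<Longrightarrow> m' \<in> dual_monoid (fcone (B i) J) \<Longrightarrow> \<gamma> (m + m') = \<gamma> m * \<gamma> m'"
    and 3: "\<And>m. m \<notin> dual_monoid (fcone (B i) J) \<or> - m \<notin> dual_monoid (fcone (B i) J) \<Longrightarrow> \<gamma> m = 0"
    using assms(1) unfolding p toric_points_def by auto
  obtain z where "(fcone (B i) J, \<gamma>) = tpt (B i) z" "J = {k. z $ k = 0}"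
    by (rule torus_orbit_point[OF inv[OF assms(2)] 1 2 3])
  thus ?thesis using that p by simp
qed

lemma toric_points_eq: "toric_points Sig = (\<Union>i\<in>K. range (tpt (B i)))"
proof (intro set_eqI iffI)
  fix p assume p: "p \<in> toric_points Sig"
  hence "fst p \<in> Sig" unfolding toric_points_def by auto
  then obtain i J where i: "i \<in> K" "fst p = fcone (B i) J" by (rule Sig_cases)
  obtain z where "p = tpt (B i) z" by (rule toric_point_in_chart[OF p i])
  thus "p \<in> (\<Union>i\<in>K. range (tpt (B i)))" using i(1) by blast
qed (use tpt_points in blast)

lemma tpt_chart_iff:
  "i \<in> K \<Longrightarrow> tpt (B i) z \<in> toric_chart Sig \<tau> \<longleftrightarrow> cone_face (fcone (B i) {k. z $ k = 0}) \<tau>"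
  unfolding toric_chart_def using tpt_points[of i z] by (simp add: tpt_def split_beta)

lemma full_chart: "i \<in> K \<Longrightarrow> toric_chart Sig (fcone (B i) UNIV) = range (tpt (B i))"
proof (intro set_eqI iffI)
  fix p assume i: "i \<in> K" and p: "p \<in> toric_chart Sig (fcone (B i) UNIV)"
  hence p': "p \<in> toric_points Sig" "cone_face (fst p) (fcone (B i) UNIV)" unfolding toric_chart_def by auto
  obtain J where "fst p = fcone (B i) J" by (rule face_fcone[OF inv[OF i] p'(2)])
  then obtain z where "p = tpt (B i) z" by (rule toric_point_in_chart[OF p'(1) i])
  thus "p \<in> range (tpt (B i))" by blast
next
  fix p assume i: "i \<in> K" and "p \<in> range (tpt (B i))"
  thus "p \<in> toric_chart Sig (fcone (B i) UNIV)"
    using tpt_chart_iff[OF i] fcone_face[OF inv[OF i]] by auto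
qed

lemma local_chart:
  assumes i: "i \<in> K" and p: "tpt (B i) z \<in> toric_chart Sig \<tau>"
    and w: "\<And>k. z $ k \<noteq> 0 \<Longrightarrow> w $ k \<noteq> 0"
  shows "tpt (B i) w \<in> toric_chart Sig \<tau>"
proof -
  have "cone_face (fcone (B i) {k. w $ k = 0}) (fcone (B i) {k. z $ k = 0})"
    using w by (intro fcone_face[OF inv[OF i]]) auto
  moreover have "cone_face (fcone (B i) {k. z $ k = 0}) \<tau>" using p tpt_chart_iff[OF i] by blast
  ultimately have "cone_face (fcone (B i) {k. w $ k = 0}) \<tau>"
    unfolding cone_face_def using face_of_trans by blast
  thus ?thesis using tpt_chart_iff[OF i] by blast
qed

definition basic_opens :: "3 toric_point set set" where
  "basic_opens = {{p \<in> toric_chart Sig \<tau>. h p \<noteq> 0} | \<tau> h. \<tau> \<in> Sig \<and> h \<in> chart_functions \<tau>}"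

lemma Zar_toric: "Zar (toric_variety Sig) = topology_generated_by basic_opens"
  by (simp add: toric_variety_def basic_opens_def)

lemma Reg_toric: "f \<in> Reg (toric_variety Sig) W \<longleftrightarrow> (\<forall>p\<in>W. \<exists>\<tau>\<in>Sig. p \<in> toric_chart Sig \<tau> \<and>
         (\<exists>g\<in>chart_functions \<tau>. \<exists>h\<in>chart_functions \<tau>. h p \<noteq> 0 \<and>
            (\<forall>q\<in>W \<inter> toric_chart Sig \<tau>. h q \<noteq> 0 \<longrightarrow> f q = g q / h q)))"
  by (simp add: toric_variety_def)

lemma basic_chart_open:
  assumes "i \<in> K" shows "tpt (B i) ` {w. ev P w \<noteq> 0} \<in> basic_opens"
proof -
  obtain h where h: "h \<in> chart_functions (fcone (B i) UNIV)" "\<forall>z. h (tpt (B i) z) = ev P z"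
    using poly_chart_function[OF inv[OF assms]] by blast
  have "tpt (B i) ` {w. ev P w \<noteq> 0} = {p \<in> toric_chart Sig (fcone (B i) UNIV). h p \<noteq> 0}"
    unfolding full_chart[OF assms] using h(2) by auto
  thus ?thesis unfolding basic_opens_def using h(1) fcone_Sig[OF assms] by blast
qed

lemma points_toric: "points (toric_variety Sig) = (\<Union>i\<in>K. range (tpt (B i)))"
proof -
  have "points (toric_variety Sig) = \<Union>basic_opens" by (simp add: Zar_toric)
  also have "\<dots> = (\<Union>i\<in>K. range (tpt (B i)))"
  proof
    show "\<Union>basic_opens \<subseteq> (\<Union>i\<in>K. range (tpt (B i)))"
      unfolding basic_opens_def toric_points_eq[symmetric] toric_chart_def by blast
    have "range (tpt (B i)) \<in> basic_opens" if "i \<in> K" for i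
      using basic_chart_open[OF that, of 1] by simp
    thus "(\<Union>i\<in>K. range (tpt (B i))) \<subseteq> \<Union>basic_opens" by blast
  qed
  finally show ?thesis .
qed

lemma open_toricD:
  assumes i: "i \<in> K" and W: "openin (Zar (toric_variety Sig)) W" "tpt (B i) z \<in> W"
  shows "\<exists>P. ev P z \<noteq> 0 \<and> (\<forall>w. ev P w \<noteq> 0 \<longrightarrow> tpt (B i) w \<in> W)"
proof -
  have "generate_topology_on basic_opens W"
    using W(1) unfolding Zar_toric by (rule openin_topology_generated_by)
  thus ?thesis using W(2)
  proof (induction W rule: generate_topology_on.induct)
    case Empty thus ?case by simp
  next
    case (Int U V)
    then obtain P Q where "ev P z \<noteq> 0" "\<forall>w. ev P w \<noteq> 0 \<longrightarrow> tpt (B i) w \<in> U"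
      "ev Q z \<noteq> 0" "\<forall>w. ev Q w \<noteq> 0 \<longrightarrow> tpt (B i) w \<in> V" by auto
    thus ?case by (intro exI[of _ "P * Q"]) auto
  next
    case (UN S)
    then obtain U where "U \<in> S" "tpt (B i) z \<in> U" by blast
    with UN obtain P where "ev P z \<noteq> 0" "\<forall>w. ev P w \<noteq> 0 \<longrightarrow> tpt (B i) w \<in> U" by blast
    thus ?case using \<open>U \<in> S\<close> by blast
  next
    case (Basis s)
    then obtain \<tau> h where s: "s = {p \<in> toric_chart Sig \<tau>. h p \<noteq> 0}" "\<tau> \<in> Sig" "h \<in> chart_functions \<tau>"
      unfolding basic_opens_def by blast
    define J where "J = {k. z $ k = 0}"
    have z: "tpt (B i) z \<in> toric_chart Sig \<tau>" "h (tpt (B i) z) \<noteq> 0" using Basis s(1) by auto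
    hence "cone_face (fcone (B i) J) \<tau>" using tpt_chart_iff[OF i] unfolding J_def by blast
    from chart_function_local[OF inv[OF i] this s(3)] obtain M P where
      P: "\<forall>w. (\<forall>k. k \<notin> J \<longrightarrow> w $ k \<noteq> 0) \<longrightarrow> ev P w = h (tpt (B i) w) * (\<Prod>k\<in>- J. w $ k ^ M)" by blast
    have zJ: "\<forall>k. k \<notin> J \<longrightarrow> z $ k \<noteq> 0" unfolding J_def by simp
    have "ev (P * (\<Prod>k\<in>- J. var k)) z \<noteq> 0" using P zJ z(2) by simp
    moreover have "tpt (B i) w \<in> s" if w: "ev (P * (\<Prod>k\<in>- J. var k)) w \<noteq> 0" for w
    proof -
      have "\<forall>k. k \<notin> J \<longrightarrow> w $ k \<noteq> 0" using w by simp
      moreover from this have "h (tpt (B i) w) \<noteq> 0" using P w by auto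
      ultimately show ?thesis using local_chart[OF i z(1), of w] unfolding s(1) J_def by simp
    qed
    ultimately show ?case by blast
  qed
qed

lemma reg_toricD:
  assumes i: "i \<in> K" and f: "f \<in> Reg (toric_variety Sig) W" and z: "tpt (B i) z \<in> W"
  shows "\<exists>G H. ev H z \<noteq> 0 \<and> (\<forall>w. tpt (B i) w \<in> W \<longrightarrow> ev H w \<noteq> 0 \<longrightarrow> f (tpt (B i) w) = ev G w / ev H w)"
proof -
  obtain \<tau> g h where \<tau>: "\<tau> \<in> Sig" "tpt (B i) z \<in> toric_chart Sig \<tau>"
    "g \<in> chart_functions \<tau>" "h \<in> chart_functions \<tau>" "h (tpt (B i) z) \<noteq> 0"
    "\<forall>q\<in>W \<inter> toric_chart Sig \<tau>. h q \<noteq> 0 \<longrightarrow> f q = g q / h q"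
    using f z unfolding Reg_toric by blast
  define J where "J = {k. z $ k = 0}"
  have face: "cone_face (fcone (B i) J) \<tau>" using \<tau>(2) tpt_chart_iff[OF i] unfolding J_def by blast
  obtain M1 where M1: "\<forall>M\<ge>M1. \<exists>P. \<forall>w. (\<forall>k. k \<notin> J \<longrightarrow> w $ k \<noteq> 0) \<longrightarrow> ev P w = g (tpt (B i) w) * (\<Prod>k\<in>- J. w $ k ^ M)"
    using chart_function_local[OF inv[OF i] face \<tau>(3)] by blast
  obtain M2 where M2: "\<forall>M\<ge>M2. \<exists>P. \<forall>w. (\<forall>k. k \<notin> J \<longrightarrow> w $ k \<noteq> 0) \<longrightarrow> ev P w = h (tpt (B i) w) * (\<Prod>k\<in>- J. w $ k ^ M)"
    using chart_function_local[OF inv[OF i] face \<tau>(4)] by blast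
  define M where "M = max M1 M2"
  obtain P where P: "\<forall>w. (\<forall>k. k \<notin> J \<longrightarrow> w $ k \<noteq> 0) \<longrightarrow> ev P w = g (tpt (B i) w) * (\<Prod>k\<in>- J. w $ k ^ M)"
    using M1[rule_format, of M] unfolding M_def by auto
  obtain Q where Q: "\<forall>w. (\<forall>k. k \<notin> J \<longrightarrow> w $ k \<noteq> 0) \<longrightarrow> ev Q w = h (tpt (B i) w) * (\<Prod>k\<in>- J. w $ k ^ M)"
    using M2[rule_format, of M] unfolding M_def by auto
  let ?V = "\<Prod>k\<in>- J. var k"
  have zJ: "\<forall>k. k \<notin> J \<longrightarrow> z $ k \<noteq> 0" unfolding J_def by simp
  have "ev (Q * ?V) z \<noteq> 0" using Q zJ \<tau>(5) by simp
  moreover have "f (tpt (B i) w) = ev (P * ?V) w / ev (Q * ?V) w"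
    if w: "tpt (B i) w \<in> W" "ev (Q * ?V) w \<noteq> 0" for w
  proof -
    have wJ: "\<forall>k. k \<notin> J \<longrightarrow> w $ k \<noteq> 0" using w(2) by simp
    have Q': "ev Q w = h (tpt (B i) w) * (\<Prod>k\<in>- J. w $ k ^ M)" using Q wJ by blast
    have P': "ev P w = g (tpt (B i) w) * (\<Prod>k\<in>- J. w $ k ^ M)" using P wJ by blast
    have nz: "(\<Prod>k\<in>- J. w $ k ^ M) \<noteq> 0" "ev ?V w \<noteq> 0" "h (tpt (B i) w) \<noteq> 0" using w(2) Q' by auto
    have "tpt (B i) w \<in> toric_chart Sig \<tau>" using local_chart[OF i \<tau>(2), of w] wJ unfolding J_def by simp
    hence "f (tpt (B i) w) = g (tpt (B i) w) / h (tpt (B i) w)" using \<tau>(6) w(1) nz(3) by blast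
    thus ?thesis using nz by (simp add: P' Q')
  qed
  ultimately show ?thesis by blast
qed

sublocale affine_atlas "toric_variety Sig" K "\<lambda>i. tpt (B i)"
proof
  show "K \<noteq> {}" by (rule K_ne)
  show "inj (tpt (B i))" if "i \<in> K" for i by (rule injI) (simp add: tpt_inject[OF inv[OF that]])
  show "points (toric_variety Sig) = (\<Union>i\<in>K. range (tpt (B i)))" by (rule points_toric)
  show "openin (Zar (toric_variety Sig)) W"
    if "W \<subseteq> points (toric_variety Sig)"
      and loc: "\<And>p. p \<in> W \<Longrightarrow> \<exists>i\<in>K. \<exists>z P. p = tpt (B i) z \<and> ev P z \<noteq> 0 \<and> (\<forall>w. ev P w \<noteq> 0 \<longrightarrow> tpt (B i) w \<in> W)"
    for W
  proof (subst openin_subopen, intro ballI)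
    fix p assume "p \<in> W"
    then obtain i z P where i: "i \<in> K" "p = tpt (B i) z" "ev P z \<noteq> 0" "\<forall>w. ev P w \<noteq> 0 \<longrightarrow> tpt (B i) w \<in> W"
      using loc by metis
    have "openin (Zar (toric_variety Sig)) (tpt (B i) ` {w. ev P w \<noteq> 0})"
      unfolding Zar_toric using basic_chart_open[OF i(1)] by (rule topology_generated_by_Basis)
    moreover have "p \<in> tpt (B i) ` {w. ev P w \<noteq> 0}" using i by blast
    moreover have "tpt (B i) ` {w. ev P w \<noteq> 0} \<subseteq> W" using i by blast
    ultimately show "\<exists>T. openin (Zar (toric_variety Sig)) T \<and> p \<in> T \<and> T \<subseteq> W" by blast
  qed
  show "\<exists>P. ev P z \<noteq> 0 \<and> (\<forall>w. ev P w \<noteq> 0 \<longrightarrow> tpt (B i) w \<in> W)"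
    if "openin (Zar (toric_variety Sig)) W" "i \<in> K" "tpt (B i) z \<in> W" for W i z
    by (rule open_toricD[OF that(2,1,3)])
  show "f \<in> Reg (toric_variety Sig) W"
    if W: "openin (Zar (toric_variety Sig)) W"
      and f: "\<And>p. p \<in> W \<Longrightarrow> \<exists>i\<in>K. \<exists>z G H. p = tpt (B i) z \<and> ev H z \<noteq> 0 \<and>
           (\<forall>w. tpt (B i) w \<in> W \<longrightarrow> ev H w \<noteq> 0 \<longrightarrow> f (tpt (B i) w) = ev G w / ev H w)" for W f
    unfolding Reg_toric
  proof
    fix p assume "p \<in> W"
    then obtain i z G H where i: "i \<in> K" "p = tpt (B i) z" "ev H z \<noteq> 0"
      "\<forall>w. tpt (B i) w \<in> W \<longrightarrow> ev H w \<noteq> 0 \<longrightarrow> f (tpt (B i) w) = ev G w / ev H w" using f by metis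
    obtain g where g: "g \<in> chart_functions (fcone (B i) UNIV)" "\<forall>z. g (tpt (B i) z) = ev G z"
      using poly_chart_function[OF inv[OF i(1)]] by blast
    obtain h where h: "h \<in> chart_functions (fcone (B i) UNIV)" "\<forall>z. h (tpt (B i) z) = ev H z"
      using poly_chart_function[OF inv[OF i(1)]] by blast
    have "p \<in> toric_chart Sig (fcone (B i) UNIV)" using full_chart[OF i(1)] i(2) by blast
    moreover have "h p \<noteq> 0" using h(2) i by simp
    moreover have "\<forall>q\<in>W \<inter> toric_chart Sig (fcone (B i) UNIV). h q \<noteq> 0 \<longrightarrow> f q = g q / h q"
      unfolding full_chart[OF i(1)] using i(4) g(2) h(2) by auto
    ultimately show "\<exists>\<tau>\<in>Sig. p \<in> toric_chart Sig \<tau> \<and>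
         (\<exists>g\<in>chart_functions \<tau>. \<exists>h\<in>chart_functions \<tau>. h p \<noteq> 0 \<and>
            (\<forall>q\<in>W \<inter> toric_chart Sig \<tau>. h q \<noteq> 0 \<longrightarrow> f q = g q / h q))"
      using fcone_Sig[OF i(1)] g(1) h(1) by blast
  qed
  show "\<exists>G H. ev H z \<noteq> 0 \<and> (\<forall>w. tpt (B i) w \<in> W \<longrightarrow> ev H w \<noteq> 0 \<longrightarrow> f (tpt (B i) w) = ev G w / ev H w)"
    if "openin (Zar (toric_variety Sig)) W" "f \<in> Reg (toric_variety Sig) W" "i \<in> K" "tpt (B i) z \<in> W" for W f i z
    by (rule reg_toricD[OF that(3,2,4)])
  show "\<exists>P. P \<noteq> 0 \<and> (\<forall>w. ev P w \<noteq> 0 \<longrightarrow> tpt (B i) w \<in> range (tpt (B j)))" if i: "i \<in> K" and j: "j \<in> K" for i j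
  proof (intro exI conjI allI impI)
    have "ev (\<Prod>k\<in>UNIV. var k) 1 \<noteq> 0" by simp
    thus "(\<Prod>k\<in>UNIV. var k) \<noteq> 0" by (metis ev_simps(1))
    fix w assume "ev (\<Prod>k\<in>UNIV. var k) w \<noteq> 0"
    hence "{k. w $ k = 0} = {}" by simp
    hence "fst (tpt (B i) w) = fcone (B i) {}" by (simp add: tpt_def)
    also have "\<dots> = fcone (B j) {}" by (simp add: fcone_empty)
    finally obtain z where "tpt (B i) w = tpt (B j) z"
      by (rule toric_point_in_chart[OF tpt_points[OF i] j])
    thus "tpt (B i) w \<in> range (tpt (B j))" by blast
  qed
qed

end

section \<open>The Picard number\<close>

lemma snd_tpt: "snd (tpt B z) m = (\<Prod>k\<in>UNIV. z $ k powi ((B *v m) $ k))"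
  by (simp add: tpt_def)

lemma snd_tpt_nonzero_iff: "snd (tpt B z) m \<noteq> 0 \<longleftrightarrow> (\<forall>k. z $ k = 0 \<longrightarrow> (B *v m) $ k = 0)"
  by (auto simp: snd_tpt power_int_eq_0_iff)

lemma mult_dual_combination:
  assumes "invertible B"
  shows "(B *v (\<Sum>k\<in>UNIV. c k *s dual_vec B k)) $ j = c j"
proof -
  have "B *v (\<Sum>k\<in>A. c k *s dual_vec B k) = (\<Sum>k\<in>A. c k *s axis k 1)" if "finite A" for A
    using that by (induction A) (simp_all add: mv_simps mult_dual_vec[OF assms])
  thus ?thesis by (simp add: axis_def if_distrib[of "\<lambda>x. _ * x"] cong: if_cong)
qed

lemma cross_ratio:
  fixes a b c d g :: complex
  assumes "g = a / b" "g = c / d" "a \<noteq> 0" "b \<noteq> 0" "c \<noteq> 0" "d \<noteq> 0"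
  shows "b / d = a / c"
proof -
  have "a * d = c * b" using assms by (simp add: frac_eq_eq)
  thus ?thesis using assms(3-6) by (simp add: frac_eq_eq mult.commute)
qed

lemma prod_power_int: "(\<Prod>x\<in>A. f x) powi n = (\<Prod>x\<in>A. f x powi n)" for f :: "'x \<Rightarrow> complex"
  by (induction A rule: infinite_finite_induct) (simp_all add: power_int_mult_distrib)

lemma snd_tpt_combination:
  fixes m :: "'t \<Rightarrow> int ^ 'n::finite"
  assumes "finite T" "\<And>t. t \<in> T \<Longrightarrow> snd (tpt B z) (m t) \<noteq> 0"
  shows "snd (tpt B z) (\<Sum>t\<in>T. a t *s m t) = (\<Prod>t\<in>T. snd (tpt B z) (m t) powi a t)"
  using assms
proof (induction T rule: finite_induct)
  case empty show ?case by (simp add: snd_tpt mv_simps)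
next
  case (insert t T)
  have nz: "\<forall>k. z $ k = 0 \<longrightarrow> (B *v m t) $ k = 0" using insert.prems snd_tpt_nonzero_iff by blast
  have "snd (tpt B z) (\<Sum>t\<in>T. a t *s m t) \<noteq> 0" using insert by simp
  hence nz': "\<forall>k. z $ k = 0 \<longrightarrow> (B *v (\<Sum>t\<in>T. a t *s m t)) $ k = 0" using snd_tpt_nonzero_iff by blast
  have "z $ k powi (a t * (B *v m t) $ k + (B *v (\<Sum>t\<in>T. a t *s m t)) $ k) =
      (z $ k powi ((B *v m t) $ k)) powi a t * z $ k powi ((B *v (\<Sum>t\<in>T. a t *s m t)) $ k)" for k
    using nz nz' by (cases "z $ k = 0") (simp_all add: power_int_add power_int_mult mult.commute[of "a t"])
  hence "snd (tpt B z) (a t *s m t + (\<Sum>t\<in>T. a t *s m t)) =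
      (\<Prod>k\<in>UNIV. (z $ k powi ((B *v m t) $ k)) powi a t) * snd (tpt B z) (\<Sum>t\<in>T. a t *s m t)"
    by (simp add: snd_tpt mv_simps prod.distrib)
  also have "(\<Prod>k\<in>UNIV. (z $ k powi ((B *v m t) $ k)) powi a t) = snd (tpt B z) (m t) powi a t"
    by (simp add: snd_tpt prod_power_int)
  finally show ?case using insert by simp
qed

lemma prime_elem_dvd_prod:
  assumes "prime_elem p" "finite A" "p dvd prod f A" shows "\<exists>x\<in>A. p dvd f x"
  using assms(2,3)
proof (induction A)
  case empty thus ?case using assms(1) by (simp add: prime_elem_def)
next
  case (insert x A) thus ?case using prime_elem_dvd_mult_iff[OF assms(1)] by auto
qed

lemma var_dvd_var: "var k dvd var j \<Longrightarrow> k = j"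
proof (rule ccontr)
  assume "var k dvd var j" "k \<noteq> j"
  then obtain Q where "var j = var k * Q" by blast
  hence "ev (var j) (axis j 1) = ev (var k) (axis j 1) * ev Q (axis j 1)" by simp
  thus False using \<open>k \<noteq> j\<close> by (simp add: axis_def)
qed

context smooth_toric
begin

abbreviation (input) "X \<equiv> toric_variety Sig"
abbreviation (input) "U i \<equiv> range (tpt (B i))"

lemma torus_in_chart:
  assumes "i \<in> K" "j \<in> K" "\<forall>k. w $ k \<noteq> 0"
  obtains v where "tpt (B i) w = tpt (B j) v" "\<forall>k. v $ k \<noteq> 0"
proof -
  have "{k. w $ k = 0} = {}" using assms(3) by simp
  hence "fst (tpt (B i) w) = fcone (B j) {}" by (simp add: tpt_def fcone_empty)
  then obtain v where "tpt (B i) w = tpt (B j) v" "{} = {k. v $ k = 0}"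
    by (rule toric_point_in_chart[OF tpt_points[OF assms(1)] assms(2)])
  thus ?thesis using that by blast
qed

text \<open>
  If the character \<open>m\<close> had a zero or a pole along a coordinate plane through
  \<open>a\<close>, so had \<open>f\<close>, since they agree on the torus up to a constant. The
  comparison of prime factors is the polynomial identity \<open>id\<close>, in which the negative
  exponents have been moved to the other side.
\<close>

lemma unit_monomial:
  assumes W: "openin (Zar X) W" and f: "f \<in> unit_functions X W" and i: "i \<in> K" and a: "tpt (B i) a \<in> W"
    and c: "c \<noteq> 0" and mon: "\<And>w. (\<forall>k. w $ k \<noteq> 0) \<Longrightarrow> tpt (B i) w \<in> W \<Longrightarrow> f (tpt (B i) w) = c * snd (tpt (B i) w) m"
  shows "snd (tpt (B i) a) m \<noteq> 0" and "f (tpt (B i) a) = c * snd (tpt (B i) a) m"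
proof -
  define n where "n k = (B i *v m) $ k" for k
  have f': "f \<in> Reg X W" "f (tpt (B i) a) \<noteq> 0" using f a unit_iff[OF W] by auto
  obtain G H where GH: "ev H a \<noteq> 0" "\<forall>w. tpt (B i) w \<in> W \<longrightarrow> ev H w \<noteq> 0 \<longrightarrow> f (tpt (B i) w) = ev G w / ev H w"
    using regD[OF W f'(1) i a] by blast
  have G: "ev G a \<noteq> 0" using GH a f'(2) by auto
  obtain P where P: "ev P a \<noteq> 0" "\<forall>w. ev P w \<noteq> 0 \<longrightarrow> tpt (B i) w \<in> W" using openD[OF W i a] by blast
  let ?pos = "\<Prod>k\<in>UNIV. var k ^ nat (n k)" and ?neg = "\<Prod>k\<in>UNIV. var k ^ nat (- n k)"
  have id: "G * ?neg = con c * H * ?pos"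
  proof (rule ev_eqI[of "P * H * (\<Prod>k\<in>UNIV. var k)"])
    have "P \<noteq> 0" "H \<noteq> 0" using P(1) GH(1) by auto
    moreover have "(\<Prod>k\<in>UNIV. var k) \<noteq> 0" using prime_elem_var by (auto simp: prime_elem_def)
    ultimately show "P * H * (\<Prod>k\<in>UNIV. var k) \<noteq> 0" by simp
    fix w assume "ev (P * H * (\<Prod>k\<in>UNIV. var k)) w \<noteq> 0"
    hence w: "ev P w \<noteq> 0" "ev H w \<noteq> 0" "\<forall>k. w $ k \<noteq> 0" by auto
    have "ev G w / ev H w = c * (\<Prod>k\<in>UNIV. w $ k powi n k)"
      using mon[OF w(3)] GH(2) P(2) w(1,2) by (simp add: snd_tpt n_def)
    hence "ev G w = c * ev H w * (\<Prod>k\<in>UNIV. w $ k powi n k)" using w(2) by (simp add: field_simps)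
    moreover have "w $ k powi n k * w $ k ^ nat (- n k) = w $ k ^ nat (n k)" for k
      using w(3) by (cases "0 \<le> n k") (simp_all add: power_int_def power_inverse)
    hence "(\<Prod>k\<in>UNIV. w $ k powi n k) * (\<Prod>k\<in>UNIV. w $ k ^ nat (- n k)) = (\<Prod>k\<in>UNIV. w $ k ^ nat (n k))"
      by (simp flip: prod.distrib)
    ultimately show "ev (G * ?neg) w = ev (con c * H * ?pos) w" by (simp add: mult.assoc)
  qed
  have nodvd: "\<not> var k dvd Q * (\<Prod>j\<in>UNIV. var j ^ e j)" if "a $ k = 0" "ev Q a \<noteq> 0" "e k = 0" for k Q e
  proof
    assume d: "var k dvd Q * (\<Prod>j\<in>UNIV. var j ^ e j)"
    have "\<not> var k dvd Q" using that(1,2) by auto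
    hence "var k dvd (\<Prod>j\<in>UNIV. var j ^ e j)" using d prime_elem_dvd_mult_iff[OF prime_elem_var] by blast
    then obtain j where j: "var k dvd var j ^ e j"
      using prime_elem_dvd_prod[OF prime_elem_var, of UNIV k "\<lambda>j. var j ^ e j"] by auto
    hence "var k dvd var j" using prime_elem_dvd_power[OF prime_elem_var] by blast
    hence "j = k" using var_dvd_var by blast
    thus False using j that(3) prime_elem_var[of k] by (auto simp: prime_elem_def)
  qed
  have n0: "n k = 0" if k: "a $ k = 0" for k
  proof (rule ccontr)
    assume "n k \<noteq> 0"
    have dvd: "var k dvd Q * (\<Prod>j\<in>UNIV. var j ^ e j)" if "0 < e k" for Q e
    proof -
      have "var k dvd var k ^ e k" using that by (simp add: dvd_power)
      also have "var k ^ e k dvd (\<Prod>j\<in>UNIV. var j ^ e j)" by (rule dvd_prodI) auto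
      finally show ?thesis by simp
    qed
    show False
    proof (cases "0 < n k")
      case True
      hence "var k dvd G * ?neg" unfolding id by (intro dvd) simp
      thus False using nodvd[OF k G, of "\<lambda>k. nat (- n k)"] True by simp
    next
      case False
      hence "var k dvd con c * H * ?pos" unfolding id[symmetric] using \<open>n k \<noteq> 0\<close> by (intro dvd) simp
      moreover have "ev (con c * H) a \<noteq> 0" using c GH(1) by simp
      ultimately show False using nodvd[OF k, of "con c * H" "\<lambda>k. nat (n k)"] False by simp
    qed
  qed
  thus "snd (tpt (B i) a) m \<noteq> 0" unfolding snd_tpt_nonzero_iff n_def by blast
  have "ev (G * ?neg) a = ev (con c * H * ?pos) a" using id by simp
  moreover have "a $ k powi n k * a $ k ^ nat (- n k) = a $ k ^ nat (n k)" for k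
    using n0[of k] by (cases "0 \<le> n k"; cases "a $ k = 0") (simp_all add: power_int_def power_inverse)
  hence "(\<Prod>k\<in>UNIV. a $ k powi n k) * (\<Prod>k\<in>UNIV. a $ k ^ nat (- n k)) = (\<Prod>k\<in>UNIV. a $ k ^ nat (n k))"
    by (simp flip: prod.distrib)
  ultimately have "ev G a * (\<Prod>k\<in>UNIV. a $ k ^ nat (- n k)) =
      c * ev H a * (\<Prod>k\<in>UNIV. a $ k powi n k) * (\<Prod>k\<in>UNIV. a $ k ^ nat (- n k))" by (simp add: mult.assoc)
  moreover have "(\<Prod>k\<in>UNIV. a $ k ^ nat (- n k)) \<noteq> 0" using n0 by auto
  ultimately have "ev G a = c * ev H a * (\<Prod>k\<in>UNIV. a $ k powi n k)" by simp
  thus "f (tpt (B i) a) = c * snd (tpt (B i) a) m"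
    using GH a by (simp add: snd_tpt n_def)
qed

text \<open>
  Numerator and denominator of a unit do not vanish on the torus.
\<close>

lemma torus_unit_monomial:
  assumes W: "openin (Zar X) W" and f: "f \<in> unit_functions X W" and i: "i \<in> K"
    and torus: "\<And>w. (\<forall>k. w $ k \<noteq> 0) \<Longrightarrow> tpt (B i) w \<in> W"
  obtains c m where "c \<noteq> 0" "\<And>w. (\<forall>k. w $ k \<noteq> 0) \<Longrightarrow> f (tpt (B i) w) = c * snd (tpt (B i) w) m"
proof -
  have "tpt (B i) 1 \<in> W" by (rule torus) simp
  hence "W \<noteq> {}" by blast
  then obtain a b where ab: "\<And>w. tpt (B i) w \<in> W \<Longrightarrow> ev a w \<noteq> 0 \<and> ev b w \<noteq> 0 \<and> f (tpt (B i) w) = ev a w / ev b w"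
    using unit_reduced_fraction[OF W i _ f] by metis
  obtain c n where c: "c \<noteq> 0" "a = con c * (\<Prod>k\<in>UNIV. var k ^ n k)"
    using nonvanishing_on_torus[of a] ab torus by metis
  obtain d l where d: "d \<noteq> 0" "b = con d * (\<Prod>k\<in>UNIV. var k ^ l k)"
    using nonvanishing_on_torus[of b] ab torus by metis
  define m where "m = (\<Sum>k\<in>UNIV. (int (n k) - int (l k)) *s dual_vec (B i) k)"
  have m: "(B i *v m) $ k = int (n k) - int (l k)" for k
    unfolding m_def by (rule mult_dual_combination[OF inv[OF i]])
  have "f (tpt (B i) w) = (c / d) * snd (tpt (B i) w) m" if w: "\<forall>k. w $ k \<noteq> 0" for w
  proof -
    have "f (tpt (B i) w) = (c / d) * ((\<Prod>k\<in>UNIV. w $ k ^ n k) / (\<Prod>k\<in>UNIV. w $ k ^ l k))"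
      using ab[OF torus[OF w]] c(2) d(2) by simp
    also have "(\<Prod>k\<in>UNIV. w $ k ^ n k) / (\<Prod>k\<in>UNIV. w $ k ^ l k) = snd (tpt (B i) w) m"
      unfolding snd_tpt m by (simp add: w power_int_diff flip: prod_dividef)
    finally show ?thesis .
  qed
  thus ?thesis using that[of "c / d" m] c(1) d(1) by simp
qed

text \<open>
  The bundle \<open>L\<close> has the nonvanishing section \<open>s i\<close> on the chart of
  \<open>i\<close>, and on overlaps of charts these sections differ by the characters \<open>\<mu>
  i - \<mu> j\<close>. As the trivialisations are given near each point separately,
  \<open>s\<close> also depends on the point \<open>z\<close> around which it is considered.
\<close>

definition char_data :: "3 toric_point lb_data \<Rightarrow> ('i \<Rightarrow> int ^ 3) \<Rightarrow> bool" where
  "char_data L \<mu> \<longleftrightarrow> (\<exists>M s.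
     (\<forall>i\<in>K. \<forall>z. openin (Zar X) (M i z) \<and> tpt (B i) z \<in> M i z \<and> M i z \<subseteq> fst L (tpt (B i) z) \<and>
        M i z \<subseteq> U i \<and> s i z \<in> unit_functions X (M i z)) \<and>
     (\<forall>i\<in>K. \<forall>j\<in>K. \<forall>y z. \<forall>p\<in>M i y \<inter> M j z.
        snd L (tpt (B i) y) (tpt (B j) z) p = s i y p / s j z p * snd p (\<mu> i - \<mu> j)))"

lemma glue_units:
  assumes W: "openin (Zar X) W"
    and loc: "\<And>p. p \<in> W \<Longrightarrow> \<exists>W' f'. openin (Zar X) W' \<and> p \<in> W' \<and> f' \<in> unit_functions X W' \<and> (\<forall>q\<in>W \<inter> W'. f q = f' q)"
  shows "f \<in> unit_functions X W"
  unfolding unit_iff[OF W]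
proof (intro conjI ballI)
  show "f \<in> Reg X W"
  proof (rule reg_sheaf[OF W])
    fix p assume "p \<in> W"
    then obtain W' f' where "openin (Zar X) W'" "p \<in> W'" "f' \<in> unit_functions X W'" "\<forall>q\<in>W \<inter> W'. f q = f' q"
      using loc by metis
    thus "\<exists>W' f'. openin (Zar X) W' \<and> p \<in> W' \<and> f' \<in> Reg X W' \<and> (\<forall>q\<in>W \<inter> W'. f q = f' q)"
      using unit_iff by metis
  qed
  fix q assume "q \<in> W"
  then obtain W' f' where "openin (Zar X) W'" "q \<in> W'" "f' \<in> unit_functions X W'" "\<forall>q\<in>W \<inter> W'. f q = f' q"
    using loc by metis
  thus "f q \<noteq> 0" using unit_iff \<open>q \<in> W\<close> by auto
qed

lemma unit_divide:
  assumes W: "openin (Zar X) W" and "f \<in> unit_functions X W" "g \<in> unit_functions X W"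
  shows "(\<lambda>q. f q / g q) \<in> unit_functions X W"
  using unit_mult[OF W assms(2) unit_inverse[OF W assms(3)]] by (simp add: divide_inverse)

lemma line_bundleD:
  assumes "line_bundle X L" "x \<in> points X" "y \<in> points X"
  shows "openin (Zar X) (fst L x)" "x \<in> fst L x" "snd L x y \<in> unit_functions X (fst L x \<inter> fst L y)"
    "\<And>p z. z \<in> points X \<Longrightarrow> p \<in> fst L x \<inter> fst L y \<inter> fst L z \<Longrightarrow> snd L x y p * snd L y z p = snd L x z p"
  using assms unfolding line_bundle_def by (auto simp: split_beta)

text \<open>
  The bundle is trivial on each chart. The quotient \<open>u i\<close> of the sections on the
  charts \<open>i\<close> and \<open>i0\<close> is a unit on the overlap, in particular on the
  torus, and so a constant times a character \<open>\<nu> i\<close>; the constants are absorbed in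
  the sections. The resulting formula for the transition functions extends from the torus to the
  overlaps by \<open>unit_monomial\<close>.
\<close>

lemma line_bundle_has_char_data:
  assumes L: "line_bundle X L"
  shows "\<exists>\<mu>. char_data L \<mu>"
proof -
  have Lp: "line_bundle X (fst L, snd L)" using L by simp
  have "\<exists>N' s. (\<forall>z. openin (Zar X) (N' z) \<and> tpt (B i) z \<in> N' z \<and> N' z \<subseteq> fst L (tpt (B i) z) \<and> N' z \<subseteq> U i \<and>
       s z \<in> unit_functions X (N' z)) \<and>
     (\<forall>y z. \<forall>p \<in> N' y \<inter> N' z. snd L (tpt (B i) y) (tpt (B i) z) p = s y p / s z p)" if "i \<in> K" for i
    by (rule line_bundle_trivial_on_chart[OF Lp that]) blast
  then obtain M s where M: "\<And>i z. i \<in> K \<Longrightarrow> openin (Zar X) (M i z) \<and> tpt (B i) z \<in> M i z \<and>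
      M i z \<subseteq> fst L (tpt (B i) z) \<and> M i z \<subseteq> U i \<and> s i z \<in> unit_functions X (M i z)"
    and g: "\<And>i y z p. i \<in> K \<Longrightarrow> p \<in> M i y \<inter> M i z \<Longrightarrow> snd L (tpt (B i) y) (tpt (B i) z) p = s i y p / s i z p"
    by metis
  have s_nz: "s i z p \<noteq> 0" if "i \<in> K" "p \<in> M i z" for i z p
    using M[OF that(1), of z] unit_iff that(2) by blast
  obtain i0 where i0: "i0 \<in> K" using K_ne by blast
  define \<zeta> where "\<zeta> i = inv (tpt (B i))" for i
  have \<zeta>: "\<zeta> i (tpt (B i) z) = z" if "i \<in> K" for i z unfolding \<zeta>_def using inj[OF that] by (simp add: inv_f_f)
  define u where "u i p = s i (\<zeta> i p) p / s i0 (\<zeta> i0 p) p" for i p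
  have op: "openin (Zar X) (U i \<inter> U j)" if "i \<in> K" "j \<in> K" for i j
    using open_chart that by blast
  have u_unit: "u i \<in> unit_functions X (U i \<inter> U i0)" if i: "i \<in> K" for i
  proof (rule glue_units[OF op[OF i i0]])
    fix p assume "p \<in> U i \<inter> U i0"
    then obtain z z0 where p: "p = tpt (B i) z" "p = tpt (B i0) z0" by blast
    let ?W = "M i z \<inter> M i0 z0"
    have W: "openin (Zar X) ?W" using M[OF i] M[OF i0] by blast
    have "(\<lambda>q. s i z q / s i0 z0 q) \<in> unit_functions X ?W"
      using M[OF i, of z] M[OF i0, of z0] W by (intro unit_divide) (auto intro: unit_restrict)
    moreover have "u i q = s i z q / s i0 z0 q" if q: "q \<in> (U i \<inter> U i0) \<inter> ?W" for q
    proof -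
      obtain y y0 where y: "q = tpt (B i) y" "q = tpt (B i0) y0" using q by blast
      have "q \<in> M i y" "q \<in> M i0 y0" using M[OF i, of y] M[OF i0, of y0] y by auto
      hence r: "snd L p q q = s i z q / s i y q" "snd L p q q = s i0 z0 q / s i0 y0 q"
        using g[OF i, of q z y] g[OF i0, of q z0 y0] q p y by auto
      have nz: "s i y q \<noteq> 0" "s i0 y0 q \<noteq> 0" "s i0 z0 q \<noteq> 0" "s i z q \<noteq> 0"
        using s_nz i i0 q \<open>q \<in> M i y\<close> \<open>q \<in> M i0 y0\<close> by blast+
      have "u i q = s i y q / s i0 y0 q" unfolding u_def using \<zeta>[OF i, of y] \<zeta>[OF i0, of y0] y by simp
      also have "\<dots> = s i z q / s i0 z0 q" by (rule cross_ratio[OF r nz(4,1,3,2)])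
      finally show ?thesis .
    qed
    moreover have "p \<in> ?W" using M[OF i, of z] M[OF i0, of z0] p by auto
    ultimately show "\<exists>W' f'. openin (Zar X) W' \<and> p \<in> W' \<and> f' \<in> unit_functions X W' \<and>
        (\<forall>q\<in>U i \<inter> U i0 \<inter> W'. u i q = f' q)"
      using W by (intro exI[of _ ?W] exI[of _ "\<lambda>q. s i z q / s i0 z0 q"]) simp
  qed
  have "\<exists>c m. c \<noteq> 0 \<and> (\<forall>w. (\<forall>k. w $ k \<noteq> 0) \<longrightarrow> u i (tpt (B i0) w) = c * snd (tpt (B i0) w) m)" if i: "i \<in> K" for i
  proof -
    have T: "tpt (B i0) w \<in> U i \<inter> U i0" if "\<forall>k. w $ k \<noteq> 0" for w
    proof -
      have "\<forall>k. w $ k \<noteq> 0" by (rule that)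
      then obtain v where "tpt (B i0) w = tpt (B i) v" by (metis torus_in_chart[OF i0 i])
      thus ?thesis by blast
    qed
    show ?thesis
    proof (rule torus_unit_monomial[OF op[OF i i0] u_unit[OF i] i0])
      show "tpt (B i0) w \<in> U i \<inter> U i0" if "\<forall>k. w $ k \<noteq> 0" for w by (rule T[OF that])
      fix c m assume "c \<noteq> 0" "\<And>w. (\<forall>k. w $ k \<noteq> 0) \<Longrightarrow> u i (tpt (B i0) w) = c * snd (tpt (B i0) w) m"
      thus ?thesis by blast
    qed
  qed
  then obtain c \<nu> where c: "\<And>i. i \<in> K \<Longrightarrow> c i \<noteq> 0"
    and \<nu>: "\<And>i w. i \<in> K \<Longrightarrow> (\<forall>k. w $ k \<noteq> 0) \<Longrightarrow> u i (tpt (B i0) w) = c i * snd (tpt (B i0) w) (\<nu> i)"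
    by metis
  define s' where "s' i z = (\<lambda>q. s i z q * inverse (c i))" for i z
  have c_unit: "(\<lambda>q. inverse (c i)) \<in> unit_functions X W" if "i \<in> K" "openin (Zar X) W" for i W
    using c[OF that(1)] unit_iff[OF that(2)] reg_const[OF that(2)] by simp
  have s'_unit: "s' i z \<in> unit_functions X (M i z)" if "i \<in> K" for i z
    unfolding s'_def using M[OF that, of z] c_unit[OF that] by (intro unit_mult) auto
  have torus: "snd L (tpt (B i) y) (tpt (B j) z) p * (s' j z p / s' i y p) = snd p (- \<nu> i - - \<nu> j)"
    if i: "i \<in> K" and j: "j \<in> K" and p: "p \<in> M i y \<inter> M j z" "p = tpt (B i0) w" "\<forall>k. w $ k \<noteq> 0" for i j y z p w
  proof -
    obtain a b where ab: "p = tpt (B i) a" "p = tpt (B j) b" using M[OF i, of y] M[OF j, of z] p(1) by blast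
    have pM: "p \<in> M i a" "p \<in> M j b" using M[OF i, of a] M[OF j, of b] ab by auto
    have pts: "tpt (B i) y \<in> points X" "tpt (B j) z \<in> points X" "p \<in> points X"
      using pt_in_points i j ab by auto
    have "snd L (tpt (B i) y) p p * snd L p (tpt (B j) z) p = snd L (tpt (B i) y) (tpt (B j) z) p"
    proof (rule line_bundleD(4)[OF L pts(1,3,2)])
      show "p \<in> fst L (tpt (B i) y) \<inter> fst L p \<inter> fst L (tpt (B j) z)"
        using M[OF i, of y] M[OF j, of z] M[OF i, of a] p(1) pM ab by auto
    qed
    moreover have "snd L (tpt (B i) y) p p = s i y p / s i a p" using g[OF i, of p y a] p(1) pM ab by auto
    moreover have "snd L p (tpt (B j) z) p = s j b p / s j z p" using g[OF j, of p b z] p(1) pM ab by auto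
    moreover have "s i a p = u i p * s i0 (\<zeta> i0 p) p" "s j b p = u j p * s i0 (\<zeta> i0 p) p" "s i0 (\<zeta> i0 p) p \<noteq> 0"
    proof -
      have "p \<in> M i0 w" using M[OF i0, of w] p(2) by auto
      thus nz: "s i0 (\<zeta> i0 p) p \<noteq> 0" using s_nz[OF i0] \<zeta>[OF i0] p(2) by simp
      have "\<zeta> i p = a" "\<zeta> j p = b" using \<zeta>[OF i, of a] \<zeta>[OF j, of b] ab by simp_all
      thus "s i a p = u i p * s i0 (\<zeta> i0 p) p" "s j b p = u j p * s i0 (\<zeta> i0 p) p"
        unfolding u_def using nz by simp_all
    qed
    moreover have "s i y p \<noteq> 0" "s j z p \<noteq> 0" using s_nz i j p(1) by blast+
    moreover have "u i p = c i * snd p (\<nu> i)" "u j p = c j * snd p (\<nu> j)"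
      using \<nu>[OF i p(3)] \<nu>[OF j p(3)] p(2) by simp_all
    moreover have "snd p (\<nu> i) \<noteq> 0" "snd p (\<nu> j) \<noteq> 0"
      unfolding p(2) snd_tpt_nonzero_iff using p(3) by auto
    moreover have "snd p (- \<nu> i - - \<nu> j) = snd p (\<nu> j) / snd p (\<nu> i)"
      using p(3) by (simp add: p(2) snd_tpt mv_simps power_int_diff flip: prod_dividef)
    moreover from calculation have "snd L (tpt (B i) y) (tpt (B j) z) p =
        s i y p / (c i * snd p (\<nu> i) * s i0 (\<zeta> i0 p) p) * (c j * snd p (\<nu> j) * s i0 (\<zeta> i0 p) p / s j z p)" by simp
    ultimately show ?thesis unfolding s'_def using c[OF i] c[OF j] by (simp only:) (simp add: field_simps)
  qed
  have "snd L (tpt (B i) y) (tpt (B j) z) p = s' i y p / s' j z p * snd p (- \<nu> i - - \<nu> j)"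
    if i: "i \<in> K" and j: "j \<in> K" and p: "p \<in> M i y \<inter> M j z" for i j y z p
  proof -
    let ?W = "M i y \<inter> M j z"
    have W: "openin (Zar X) ?W" using M[OF i] M[OF j] by blast
    obtain a where a: "p = tpt (B i) a" using M[OF i, of y] p by blast
    let ?f = "\<lambda>q. snd L (tpt (B i) y) (tpt (B j) z) q * (s' j z q / s' i y q)"
    have pts: "tpt (B i) y \<in> points X" "tpt (B j) z \<in> points X" using pt_in_points i j by auto
    have "snd L (tpt (B i) y) (tpt (B j) z) \<in> unit_functions X ?W"
    proof (rule unit_restrict[OF _ line_bundleD(3)[OF L pts] W])
      show "openin (Zar X) (fst L (tpt (B i) y) \<inter> fst L (tpt (B j) z))"
        using line_bundleD(1)[OF L pts] line_bundleD(1)[OF L pts(2,1)] by blast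
      show "?W \<subseteq> fst L (tpt (B i) y) \<inter> fst L (tpt (B j) z)" using M[OF i, of y] M[OF j, of z] by blast
    qed
    moreover have "s' j z \<in> unit_functions X ?W" "s' i y \<in> unit_functions X ?W"
      using s'_unit[OF j, of z] s'_unit[OF i, of y] M[OF j, of z] M[OF i, of y] W
      by (auto intro: unit_restrict)
    ultimately have f: "?f \<in> unit_functions X ?W" by (intro unit_mult unit_divide W)
    have "?f (tpt (B i) w) = 1 * snd (tpt (B i) w) (- \<nu> i - - \<nu> j)"
      if w: "\<forall>k. w $ k \<noteq> 0" "tpt (B i) w \<in> ?W" for w
    proof -
      obtain v where v: "tpt (B i) w = tpt (B i0) v" "\<forall>k. v $ k \<noteq> 0" by (rule torus_in_chart[OF i i0 w(1)])
      show ?thesis using torus[OF i j w(2) v] by simp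
    qed
    from unit_monomial(2)[OF W f i _ _ this, of a]
    have "?f p = snd p (- \<nu> i - - \<nu> j)" using p a by simp
    moreover have "s' i y p \<noteq> 0" "s' j z p \<noteq> 0"
      unfolding s'_def using s_nz i j p c by auto
    ultimately show ?thesis by (simp add: field_simps)
  qed
  thus ?thesis
    unfolding char_data_def using M s'_unit
    by (intro exI[of _ "\<lambda>i. - \<nu> i"] exI[of _ M] exI[of _ s']) auto
qed

lemma char_data_combination:
  assumes L: "\<And>t. t < r \<Longrightarrow> line_bundle X (L t)" and \<mu>: "\<And>t. t < r \<Longrightarrow> char_data (L t) (\<mu> t)"
  shows "char_data (lb_combination r L a) (\<lambda>i. \<Sum>t<r. a t *s \<mu> t i)"
proof -
  have "\<forall>t\<in>{..<r}. \<exists>M s. (\<forall>i\<in>K. \<forall>z. openin (Zar X) (M i z) \<and> tpt (B i) z \<in> M i z \<and> M i z \<subseteq> fst (L t) (tpt (B i) z) \<and>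
        M i z \<subseteq> U i \<and> s i z \<in> unit_functions X (M i z)) \<and>
     (\<forall>i\<in>K. \<forall>j\<in>K. \<forall>y z. \<forall>p\<in>M i y \<inter> M j z.
        snd (L t) (tpt (B i) y) (tpt (B j) z) p = s i y p / s j z p * snd p (\<mu> t i - \<mu> t j))"
    using \<mu> unfolding char_data_def by simp
  then obtain M s where M: "\<And>t i z. t < r \<Longrightarrow> i \<in> K \<Longrightarrow> openin (Zar X) (M t i z) \<and> tpt (B i) z \<in> M t i z \<and>
      M t i z \<subseteq> fst (L t) (tpt (B i) z) \<and> M t i z \<subseteq> U i \<and> s t i z \<in> unit_functions X (M t i z)"
    and g: "\<And>t i j y z p. t < r \<Longrightarrow> i \<in> K \<Longrightarrow> j \<in> K \<Longrightarrow> p \<in> M t i y \<inter> M t j z \<Longrightarrow>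
      snd (L t) (tpt (B i) y) (tpt (B j) z) p = s t i y p / s t j z p * snd p (\<mu> t i - \<mu> t j)"
    unfolding Ball_def lessThan_iff by metis
  define M' where "M' i z = U i \<inter> (\<Inter>t<r. M t i z)" for i z
  define s' where "s' i z = (\<lambda>p. \<Prod>t<r. s t i z p powi a t)" for i z
  have M'_open: "openin (Zar X) (M' i z)" if i: "i \<in> K" for i z
  proof -
    have "M' i z = U i \<inter> \<Inter>(insert (U i) ((\<lambda>t. M t i z) ` {..<r}))" unfolding M'_def by auto
    moreover have "openin (Zar X) (\<Inter>(insert (U i) ((\<lambda>t. M t i z) ` {..<r})))"
      using M[OF _ i] open_chart[OF i] by (intro openin_Inter) auto
    ultimately show ?thesis using open_chart[OF i] by auto
  qed
  have "s' i z \<in> unit_functions X (M' i z)" if i: "i \<in> K" for i z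
    unfolding s'_def
  proof (rule unit_prod[OF M'_open[OF i]])
    fix t assume "t \<in> {..<r}"
    hence "openin (Zar X) (M t i z)" "s t i z \<in> unit_functions X (M t i z)" using M[OF _ i] by auto
    hence "s t i z \<in> unit_functions X (M' i z)"
      by (rule unit_restrict[OF _ _ M'_open[OF i]]) (use \<open>t \<in> {..<r}\<close> in \<open>auto simp: M'_def\<close>)
    thus "(\<lambda>p. s t i z p powi a t) \<in> unit_functions X (M' i z)" by (rule unit_powi[OF M'_open[OF i]])
  qed simp
  moreover have "snd (lb_combination r L a) (tpt (B i) y) (tpt (B j) z) p =
      s' i y p / s' j z p * snd p ((\<Sum>t<r. a t *s \<mu> t i) - (\<Sum>t<r. a t *s \<mu> t j))"
    if i: "i \<in> K" and j: "j \<in> K" and p: "p \<in> M' i y \<inter> M' j z" for i j y z p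
  proof -
    obtain w where w: "p = tpt (B i) w" using p unfolding M'_def by blast
    have pM: "p \<in> M t i y \<inter> M t j z" if "t < r" for t using p that unfolding M'_def by auto
    have nz: "snd p (\<mu> t i - \<mu> t j) \<noteq> 0" if t: "t < r" for t
    proof -
      have pts: "tpt (B i) y \<in> points X" "tpt (B j) z \<in> points X" using pt_in_points i j by auto
      have "p \<in> fst (L t) (tpt (B i) y) \<inter> fst (L t) (tpt (B j) z)" using M[OF t i, of y] M[OF t j, of z] pM[OF t] by auto
      moreover have "openin (Zar X) (fst (L t) (tpt (B i) y) \<inter> fst (L t) (tpt (B j) z))"
        using line_bundleD(1)[OF L[OF t] pts] line_bundleD(1)[OF L[OF t] pts(2,1)] by blast
      ultimately have "snd (L t) (tpt (B i) y) (tpt (B j) z) p \<noteq> 0"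
        using line_bundleD(3)[OF L[OF t] pts] unit_iff by blast
      thus ?thesis using g[OF t i j pM[OF t]] by auto
    qed
    have "snd (lb_combination r L a) (tpt (B i) y) (tpt (B j) z) p =
        (\<Prod>t<r. (s t i y p / s t j z p * snd p (\<mu> t i - \<mu> t j)) powi a t)"
      unfolding lb_combination_def using g[OF _ i j pM] by simp
    also have "\<dots> = s' i y p / s' j z p * (\<Prod>t<r. snd p (\<mu> t i - \<mu> t j) powi a t)"
      by (simp add: s'_def power_int_mult_distrib power_int_divide_distrib prod.distrib prod_dividef)
    also have "(\<Prod>t<r. snd p (\<mu> t i - \<mu> t j) powi a t) = snd p (\<Sum>t<r. a t *s (\<mu> t i - \<mu> t j))"
      unfolding w using nz unfolding w by (intro snd_tpt_combination[symmetric]) auto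
    also have "(\<Sum>t<r. a t *s (\<mu> t i - \<mu> t j)) = (\<Sum>t<r. a t *s \<mu> t i) - (\<Sum>t<r. a t *s \<mu> t j)"
      by (simp add: vector_ssub_ldistrib sum_subtractf)
    finally show ?thesis .
  qed
  moreover have "tpt (B i) z \<in> M' i z \<and> M' i z \<subseteq> fst (lb_combination r L a) (tpt (B i) z) \<and> M' i z \<subseteq> U i" if "i \<in> K" for i z
    unfolding M'_def lb_combination_def using M[OF _ that] by fastforce
  ultimately show ?thesis
    unfolding char_data_def using M'_open by (intro exI[of _ M'] exI[of _ s']) auto
qed

text \<open>
  If \<open>\<mu>\<close> is constant, the local sections fit together.
\<close>

lemma char_data_trivial:
  assumes L: "char_data L \<mu>" and eq: "\<And>i j. i \<in> K \<Longrightarrow> j \<in> K \<Longrightarrow> \<mu> i = \<mu> j"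
  shows "trivial_line_bundle X L"
proof -
  obtain M s where M: "\<And>i z. i \<in> K \<Longrightarrow> openin (Zar X) (M i z) \<and> tpt (B i) z \<in> M i z \<and> M i z \<subseteq> fst L (tpt (B i) z) \<and>
        M i z \<subseteq> U i \<and> s i z \<in> unit_functions X (M i z)"
    and g: "\<And>i j y z p. i \<in> K \<Longrightarrow> j \<in> K \<Longrightarrow> p \<in> M i y \<inter> M j z \<Longrightarrow>
        snd L (tpt (B i) y) (tpt (B j) z) p = s i y p / s j z p * snd p (\<mu> i - \<mu> j)"
    using L unfolding char_data_def by metis
  have "\<forall>x\<in>points X. \<exists>i z. i \<in> K \<and> x = tpt (B i) z" using points by blast
  then obtain c \<zeta> where c: "\<And>x. x \<in> points X \<Longrightarrow> c x \<in> K \<and> x = tpt (B (c x)) (\<zeta> x)" by metis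
  have zero: "snd p 0 = 1" if "i \<in> K" "p \<in> U i" for i p
    using that tpt_zero[OF inv] by auto
  have "snd L x y p = s (c x) (\<zeta> x) p / s (c y) (\<zeta> y) p"
    if x: "x \<in> points X" and y: "y \<in> points X" and p: "p \<in> M (c x) (\<zeta> x) \<inter> M (c y) (\<zeta> y)" for x y p
  proof -
    have "snd L (tpt (B (c x)) (\<zeta> x)) (tpt (B (c y)) (\<zeta> y)) p = s (c x) (\<zeta> x) p / s (c y) (\<zeta> y) p * snd p (\<mu> (c x) - \<mu> (c y))"
      using g[OF _ _ p] c[OF x] c[OF y] by blast
    moreover have "snd p (\<mu> (c x) - \<mu> (c y)) = 1"
      using eq[of "c x" "c y"] c[OF x] c[OF y] zero[of "c x" p] M[of "c x" "\<zeta> x"] p by auto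
    ultimately show ?thesis using c[OF x] c[OF y] by simp
  qed
  moreover have "openin (Zar X) (M (c x) (\<zeta> x)) \<and> x \<in> M (c x) (\<zeta> x) \<and> M (c x) (\<zeta> x) \<subseteq> fst L x \<and>
      s (c x) (\<zeta> x) \<in> unit_functions X (M (c x) (\<zeta> x))" if "x \<in> points X" for x
    using M[of "c x" "\<zeta> x"] c[OF that] by auto
  ultimately show ?thesis
    unfolding trivial_line_bundle_def split_beta
    by (intro exI[of _ "\<lambda>x. M (c x) (\<zeta> x)"] exI[of _ "\<lambda>x. s (c x) (\<zeta> x)"]) blast
qed

text \<open>
  Comparing a trivialisation of \<open>L\<close> with the section on a chart gives a unit on
  affine 3-space, which is a constant: on the torus it is a constant multiple of a character, and
  a character without a zero or pole at the origin is trivial. Hence the character \<open>\<mu> i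
  - \<mu> j\<close> is constant on the torus.
\<close>

lemma trivial_char_data:
  assumes L: "char_data L \<mu>" and cocycle: "\<And>x. x \<in> points X \<Longrightarrow> snd L x x x = 1"
    and triv: "trivial_line_bundle X L" and i: "i \<in> K" and j: "j \<in> K"
  shows "\<mu> i = \<mu> j"
proof -
  obtain M s where M: "\<And>i z. i \<in> K \<Longrightarrow> openin (Zar X) (M i z) \<and> tpt (B i) z \<in> M i z \<and> M i z \<subseteq> fst L (tpt (B i) z) \<and>
        M i z \<subseteq> U i \<and> s i z \<in> unit_functions X (M i z)"
    and g: "\<And>i j y z p. i \<in> K \<Longrightarrow> j \<in> K \<Longrightarrow> p \<in> M i y \<inter> M j z \<Longrightarrow>
        snd L (tpt (B i) y) (tpt (B j) z) p = s i y p / s j z p * snd p (\<mu> i - \<mu> j)"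
    using L unfolding char_data_def by metis
  obtain N' t where N': "\<And>x. x \<in> points X \<Longrightarrow> openin (Zar X) (N' x) \<and> x \<in> N' x \<and> t x \<in> unit_functions X (N' x)"
    and t: "\<And>x y p. x \<in> points X \<Longrightarrow> y \<in> points X \<Longrightarrow> p \<in> N' x \<inter> N' y \<Longrightarrow> snd L x y p = t x p / t y p"
    using triv unfolding trivial_line_bundle_def split_beta by metis
  have s_nz: "s i z p \<noteq> 0" if "i \<in> K" "p \<in> M i z" for i z p
    using M[OF that(1), of z] unit_iff that(2) by blast
  have t_nz: "t x p \<noteq> 0" if "x \<in> points X" "p \<in> N' x" for x p
    using N'[OF that(1)] unit_iff that(2) by blast
  define \<zeta> where "\<zeta> i = inv (tpt (B i))" for i
  have \<zeta>: "\<zeta> i (tpt (B i) z) = z" if "i \<in> K" for i z unfolding \<zeta>_def using inj[OF that] by (simp add: inv_f_f)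
  have const: "\<exists>c. c \<noteq> 0 \<and> (\<forall>w. (\<forall>k. w $ k \<noteq> 0) \<longrightarrow> t (tpt (B i) w) (tpt (B i) w) = c * s i w (tpt (B i) w))"
    if i: "i \<in> K" for i
  proof -
    define v where "v p = t p p / s i (\<zeta> i p) p" for p
    have v: "v \<in> unit_functions X (U i)"
    proof (rule glue_units[OF open_chart[OF i]])
      fix x assume "x \<in> U i"
      then obtain z where x: "x = tpt (B i) z" by blast
      have xp: "x \<in> points X" using x pt_in_points[OF i] by simp
      let ?W = "N' x \<inter> M i z"
      have W: "openin (Zar X) ?W" using N'[OF xp] M[OF i] by blast
      have "(\<lambda>q. t x q / s i z q) \<in> unit_functions X ?W"
        using N'[OF xp] M[OF i, of z] W by (intro unit_divide) (auto intro: unit_restrict)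
      moreover have "v q = t x q / s i z q" if q: "q \<in> U i \<inter> ?W" for q
      proof -
        obtain y where y: "q = tpt (B i) y" using q by blast
        have qp: "q \<in> points X" using y pt_in_points[OF i] by simp
        have qM: "q \<in> M i y" "q \<in> N' q" using M[OF i, of y] N'[OF qp] y by auto
        have r1: "snd L x q q = t x q / t q q" using t[OF xp qp] q qM by auto
        have r2: "snd L x q q = s i z q / s i y q"
          using g[OF i i, of q z y] q qM x y tpt_zero[OF inv[OF i], of y] by simp
        have nz: "t x q \<noteq> 0" "t q q \<noteq> 0" "s i z q \<noteq> 0" "s i y q \<noteq> 0"
          using t_nz[OF xp] t_nz[OF qp] s_nz[OF i] q qM by auto
        have "v q = t q q / s i y q" unfolding v_def using \<zeta>[OF i, of y] y by simp
        also have "\<dots> = t x q / s i z q" by (rule cross_ratio[OF r1 r2 nz])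
        finally show ?thesis .
      qed
      ultimately show "\<exists>W' f'. openin (Zar X) W' \<and> x \<in> W' \<and> f' \<in> unit_functions X W' \<and> (\<forall>q\<in>U i \<inter> W'. v q = f' q)"
        using W N'[OF xp] M[OF i, of z] x by blast
    qed
    obtain c m where c: "c \<noteq> 0" "\<And>w. (\<forall>k. w $ k \<noteq> 0) \<Longrightarrow> v (tpt (B i) w) = c * snd (tpt (B i) w) m"
      by (rule torus_unit_monomial[OF open_chart[OF i] v i]) auto
    have "snd (tpt (B i) 0) m \<noteq> 0"
      by (rule unit_monomial(1)[OF open_chart[OF i] v i _ c(1)]) (use c(2) in auto)
    hence "B i *v m = 0" unfolding snd_tpt_nonzero_iff by (simp add: vec_eq_iff)
    hence m: "m = 0" using mult_inject[OF inv[OF i], of m 0] by (simp add: mv_simps)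
    have "t (tpt (B i) w) (tpt (B i) w) = c * s i w (tpt (B i) w)" if w: "\<forall>k. w $ k \<noteq> 0" for w
    proof -
      have "v (tpt (B i) w) = c" using c(2)[OF w] m tpt_zero[OF inv[OF i]] by simp
      moreover have "s i w (tpt (B i) w) \<noteq> 0" using s_nz[OF i] M[OF i, of w] by blast
      ultimately show ?thesis unfolding v_def \<zeta>[OF i] by (simp add: field_simps)
    qed
    thus ?thesis using c(1) by blast
  qed
  obtain c where c: "c \<noteq> 0" "\<And>w. (\<forall>k. w $ k \<noteq> 0) \<Longrightarrow> t (tpt (B i) w) (tpt (B i) w) = c * s i w (tpt (B i) w)"
    using const[OF i] by blast
  obtain d where d: "d \<noteq> 0" "\<And>w. (\<forall>k. w $ k \<noteq> 0) \<Longrightarrow> t (tpt (B j) w) (tpt (B j) w) = d * s j w (tpt (B j) w)"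
    using const[OF j] by blast
  have chi: "snd (tpt (B i) w) (\<mu> i - \<mu> j) = c / d" if w: "\<forall>k. w $ k \<noteq> 0" for w
  proof -
    define p where "p = tpt (B i) w"
    obtain v where v: "tpt (B i) w = tpt (B j) v" "\<forall>k. v $ k \<noteq> 0" by (rule torus_in_chart[OF i j w])
    have pp: "p \<in> points X" unfolding p_def by (rule pt_in_points[OF i])
    have pM: "p \<in> M i w \<inter> M j v" unfolding p_def using M[OF i, of w] M[OF j, of v] v(1) by auto
    have 1: "1 = s i w p / s j v p * snd p (\<mu> i - \<mu> j)"
      using g[OF i j pM] cocycle[OF pp] v(1) unfolding p_def by simp
    have "t p p = c * s i w p" using c(2)[OF w] unfolding p_def .
    moreover have "t p p = d * s j v p" using d(2)[OF v(2)] v(1) unfolding p_def by simp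
    moreover have nz: "s i w p \<noteq> 0" "s j v p \<noteq> 0" using s_nz i j pM by auto
    moreover have "s j v p = s i w p * snd p (\<mu> i - \<mu> j)" using 1 nz by (simp add: field_simps)
    ultimately have "s i w p * c = s i w p * (d * snd p (\<mu> i - \<mu> j))" by (metis mult.commute mult.left_commute)
    hence "c = d * snd p (\<mu> i - \<mu> j)" using nz by simp
    thus ?thesis using d(1) unfolding p_def[symmetric] by simp
  qed
  have "snd (tpt (B i) 1) (\<mu> i - \<mu> j) = 1" by (simp add: snd_tpt)
  hence cd: "c / d = 1" using chi[of 1] by simp
  have "(B i *v (\<mu> i - \<mu> j)) $ k = 0" for k
  proof -
    \<comment> \<open>Evaluating at the points with one coordinate 2 and the others 1 shows that the exponents
      are zero.\<close>
    define w :: "complex ^ 3" where "w = (\<chi> l. if l = k then 2 else 1)"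
    have "snd (tpt (B i) w) (\<mu> i - \<mu> j) = (\<Prod>l\<in>UNIV. if l = k then 2 powi ((B i *v (\<mu> i - \<mu> j)) $ k) else 1)"
      unfolding snd_tpt w_def by (intro prod.cong) auto
    hence "(2 :: complex) powi ((B i *v (\<mu> i - \<mu> j)) $ k) = 1" using chi[of w] cd by (simp add: w_def)
    hence "norm ((2 :: complex) powi ((B i *v (\<mu> i - \<mu> j)) $ k)) = 1" by simp
    hence "(2 :: real) powi ((B i *v (\<mu> i - \<mu> j)) $ k) = 2 powi 0" by (simp add: norm_power_int)
    thus ?thesis
      using power_int_strict_increasing[of "(B i *v (\<mu> i - \<mu> j)) $ k" 0 "2 :: real"]
        power_int_strict_increasing[of 0 "(B i *v (\<mu> i - \<mu> j)) $ k" "2 :: real"]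
      by (cases "(B i *v (\<mu> i - \<mu> j)) $ k" "0 :: int" rule: linorder_cases) auto
  qed
  hence "B i *v (\<mu> i - \<mu> j) = B i *v 0" by (simp add: vec_eq_iff mv_simps)
  thus ?thesis using mult_inject[OF inv[OF i], of "\<mu> i - \<mu> j" 0] by simp
qed

end

lemma common_denominator:
  fixes c :: "'x \<Rightarrow> rat"
  assumes "finite A"
  shows "\<exists>d>0. \<forall>x\<in>A. \<exists>n :: int. of_int d * c x = of_int n"
  using assms
proof (induction A)
  case empty show ?case by (intro exI[of _ 1]) auto
next
  case (insert x A)
  then obtain d where d: "d > 0" "\<forall>x\<in>A. \<exists>n :: int. of_int d * c x = of_int n" by blast
  obtain a b where ab: "c x = Rat.Fract a b" "b > 0" by (cases "c x")
  have "\<exists>n :: int. of_int (d * b) * c y = of_int n" if "y \<in> insert x A" for y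
  proof (cases "y = x")
    case True
    have "of_int (d * b) * c y = of_int (d * a)" using True ab by (simp add: Rat.Fract_of_int_quotient)
    thus ?thesis by blast
  next
    case False
    then obtain n where "of_int d * c y = of_int n" using d(2) \<open>y \<in> insert x A\<close> by blast
    hence "of_int (d * b) * c y = of_int (b * n)" by (simp add: mult_ac)
    thus ?thesis by blast
  qed
  thus ?case using d(1) ab(2) by (intro exI[of _ "d * b"]) auto
qed

lemma integer_homogeneous_system:
  fixes a :: "'e \<Rightarrow> 'x \<Rightarrow> int"
  assumes "finite E" "finite A" "card E < card A"
  obtains n where "\<exists>x\<in>A. n x \<noteq> 0" "\<And>e. e \<in> E \<Longrightarrow> (\<Sum>x\<in>A. n x * a e x) = 0"
proof -
  obtain c :: "'x \<Rightarrow> rat" where c: "\<exists>x\<in>A. c x \<noteq> 0" "\<forall>e\<in>E. (\<Sum>x\<in>A. c x * of_int (a e x)) = 0"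
    using homogeneous_system[OF assms, of "\<lambda>e x. of_int (a e x)"] by blast
  obtain d where d: "d > 0" "\<forall>x\<in>A. \<exists>n :: int. of_int d * c x = of_int n"
    using common_denominator[OF assms(2), of c] by blast
  obtain n where n: "\<And>x. x \<in> A \<Longrightarrow> of_int d * c x = of_int (n x)" using d(2) by metis
  have "n x \<noteq> 0" if "x \<in> A" "c x \<noteq> 0" for x using n[OF that(1)] that(2) d(1) by auto
  hence "\<exists>x\<in>A. n x \<noteq> 0" using c(1) by blast
  moreover have "(\<Sum>x\<in>A. n x * a e x) = 0" if "e \<in> E" for e
  proof -
    have "of_int (\<Sum>x\<in>A. n x * a e x) = (\<Sum>x\<in>A. (of_int d * c x) * of_int (a e x) :: rat)"
      by (simp add: n)
    also have "\<dots> = of_int d * (\<Sum>x\<in>A. c x * of_int (a e x))" by (simp add: sum_distrib_left mult.assoc)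
    also have "\<dots> = 0" using c(2) that by simp
    finally show ?thesis by (simp only: of_int_eq_0_iff)
  qed
  ultimately show ?thesis by (rule that)
qed

locale toric_polytope = smooth_polytope K B vtx
  for K :: "'i set" and B :: "'i \<Rightarrow> int ^ 3 ^ 3" and vtx :: "'i \<Rightarrow> int ^ 3"

sublocale toric_polytope \<subseteq> smooth_toric K B
  by unfold_locales

context toric_polytope
begin

definition ray_set :: "(int ^ 3) set" where
  "ray_set = (\<Union>i\<in>K. range (($) (B i)))"

lemma finite_ray_set: "finite ray_set"
  unfolding ray_set_def using finite_K by simp

lemma row_ray_set: "i \<in> K \<Longrightarrow> B i $ k \<in> ray_set"
  unfolding ray_set_def by blast

lemma rows_distinct: "i \<in> K \<Longrightarrow> B i $ k = B i $ l \<longleftrightarrow> k = l"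
  by (metis coord_row[OF inv] zero_neq_one)

text \<open>
  The linear forms \<open>\<mu> i\<close> on the maximal cones take the same values on common
  rays, so they form an integral piecewise linear function on the fan.
\<close>

definition compatible :: "('i \<Rightarrow> int ^ 3) \<Rightarrow> bool" where
  "compatible \<mu> \<longleftrightarrow> (\<forall>i\<in>K. \<forall>j\<in>K. \<forall>k l. B i $ k = B j $ l \<longrightarrow> (B i *v \<mu> i) $ k = (B j *v \<mu> j) $ l)"

text \<open>
  The point lies in the orbit of one cone of the fan, which is a face of both maximal cones and is
  spanned by the rows with vanishing coordinates in either chart.
\<close>

lemma common_ray_point:
  assumes "i \<in> K" "j \<in> K" "tpt (B i) z = tpt (B j) y" "z $ k = 0"
  obtains l where "B i $ k = B j $ l" "y $ l = 0"
proof -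
  have "fcone (B i) {k. z $ k = 0} = fcone (B j) {k. y $ k = 0}" using assms(3) by (simp add: tpt_def)
  hence "fcone (B i) {k. z $ k = 0} = fcone (B i) {k. z $ k = 0} \<inter> fcone (B j) {k. y $ k = 0}" by simp
  also have "\<dots> = fcone (B i) {k \<in> {k. z $ k = 0}. \<exists>l\<in>{k. y $ k = 0}. B i $ k = B j $ l}"
    by (rule fcone_Int[OF assms(1,2)])
  finally have "{k. z $ k = 0} = {k \<in> {k. z $ k = 0}. \<exists>l\<in>{k. y $ k = 0}. B i $ k = B j $ l}"
    by (rule iffD1[OF fcone_inject[OF inv[OF assms(1)]]])
  hence "k \<in> {k \<in> {k. z $ k = 0}. \<exists>l\<in>{k. y $ k = 0}. B i $ k = B j $ l}" using assms(4) by blast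
  thus ?thesis using that by blast
qed

lemma compatible_nonzero:
  assumes \<mu>: "compatible \<mu>" and i: "i \<in> K" and j: "j \<in> K" and p: "p \<in> U i" "p \<in> U j"
  shows "snd p (\<mu> i - \<mu> j) \<noteq> 0"
proof -
  obtain z y where z: "p = tpt (B i) z" and y: "p = tpt (B j) y" using p by blast
  have "(B i *v (\<mu> i - \<mu> j)) $ k = 0" if k: "z $ k = 0" for k
  proof -
    obtain l where l: "B i $ k = B j $ l" using common_ray_point[OF i j _ k] z y by metis
    have "(B i *v \<mu> j) $ k = (B j *v \<mu> j) $ l" using l by (simp add: matrix_vector_mult_def)
    moreover have "(B i *v \<mu> i) $ k = (B j *v \<mu> j) $ l" using \<mu> i j l unfolding compatible_def by blast
    ultimately show ?thesis by (simp add: mv_simps)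
  qed
  thus ?thesis unfolding z snd_tpt_nonzero_iff by blast
qed

lemma snd_add:
  assumes "p \<in> points X" "snd p m \<noteq> 0" "snd p m' \<noteq> 0"
  shows "snd p (m + m') = snd p m * snd p m'"
proof -
  obtain i z where i: "i \<in> K" "p = tpt (B i) z" using assms(1) by (rule point_cases)
  have "m \<in> dual_monoid (fcone (B i) {k. z $ k = 0})" "m' \<in> dual_monoid (fcone (B i) {k. z $ k = 0})"
    using assms(2,3) tpt_outside[OF inv[OF i(1)]] i(2) by blast+
  thus ?thesis unfolding i(2) by (rule tpt_mult[OF inv[OF i(1)]])
qed

lemma compatible_unit:
  assumes \<mu>: "compatible \<mu>" and i: "i \<in> K" and j: "j \<in> K" and W: "openin (Zar X) W" "W \<subseteq> U i \<inter> U j"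
  shows "(\<lambda>p. snd p (\<mu> i - \<mu> j)) \<in> unit_functions X W"
proof -
  define n where "n k = (B i *v (\<mu> i - \<mu> j)) $ k" for k
  let ?G = "\<Prod>k\<in>UNIV. var k ^ nat (n k)" and ?H = "\<Prod>k\<in>UNIV. var k ^ nat (- n k)"
  have "(\<lambda>p. snd p (\<mu> i - \<mu> j)) \<in> Reg X W"
  proof (rule reg_fraction[OF i W(1), of ?H _ ?G])
    fix p assume p: "p \<in> W"
    then obtain z where z: "p = tpt (B i) z" using W(2) by blast
    have "snd p (\<mu> i - \<mu> j) \<noteq> 0" using compatible_nonzero[OF \<mu> i j] p W(2) by blast
    hence n0: "n k = 0" if "z $ k = 0" for k using that unfolding z snd_tpt_nonzero_iff n_def by blast
    have "z $ k powi n k = z $ k ^ nat (n k) / z $ k ^ nat (- n k)" for k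
      using n0[of k] by (cases "0 \<le> n k") (simp_all add: power_int_def divide_inverse power_inverse)
    hence "snd p (\<mu> i - \<mu> j) = ev ?G z / ev ?H z"
      by (simp add: z snd_tpt n_def[symmetric] prod_dividef)
    moreover have "ev ?H z \<noteq> 0" using n0 by auto
    ultimately show "\<exists>w. p = tpt (B i) w \<and> ev ?H w \<noteq> 0 \<and> snd p (\<mu> i - \<mu> j) = ev ?G w / ev ?H w"
      using z by blast
  qed
  moreover have "\<forall>p\<in>W. snd p (\<mu> i - \<mu> j) \<noteq> 0" using compatible_nonzero[OF \<mu> i j] W(2) by blast
  ultimately show ?thesis using unit_iff[OF W(1)] by blast
qed

text \<open>
  The line bundle of a piecewise linear function: the transition functions are the characters
  \<open>\<mu> i - \<mu> j\<close>, which vanish nowhere on the overlaps by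
  \<open>compatible_nonzero\<close>. Each point is assigned a chart \<open>c x\<close> that
  contains it.
\<close>

lemma compatible_line_bundle:
  assumes \<mu>: "compatible \<mu>"
  obtains L where "line_bundle X L" "char_data L \<mu>"
proof -
  have "\<forall>x\<in>points X. \<exists>i. i \<in> K \<and> x \<in> U i" using points by blast
  then obtain c where c: "\<And>x. x \<in> points X \<Longrightarrow> c x \<in> K \<and> x \<in> U (c x)" by metis
  define L :: "3 toric_point lb_data" where "L = ((\<lambda>x. U (c x)), (\<lambda>x y p. snd p (\<mu> (c x) - \<mu> (c y))))"
  have op: "openin (Zar X) (U i \<inter> U j)" if "i \<in> K" "j \<in> K" for i j using open_chart that by blast
  have cocycle: "snd p (\<mu> i - \<mu> j) * snd p (\<mu> j - \<mu> k) = snd p (\<mu> i - \<mu> k)"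
    if "i \<in> K" "j \<in> K" "k \<in> K" "p \<in> U i" "p \<in> U j" "p \<in> U k" for i j k p
  proof -
    have "p \<in> points X" using that points by blast
    from snd_add[OF this compatible_nonzero[OF \<mu> that(1,2,4,5)] compatible_nonzero[OF \<mu> that(2,3,5,6)]]
    show ?thesis by simp
  qed
  have "line_bundle X L"
    unfolding line_bundle_def L_def split
  proof (intro conjI ballI)
    fix x assume x: "x \<in> points X"
    show "openin (Zar X) (U (c x))" "x \<in> U (c x)" using c[OF x] open_chart by auto
  next
    fix x y assume "x \<in> points X" "y \<in> points X"
    hence "c x \<in> K" "c y \<in> K" using c by auto
    thus "(\<lambda>p. snd p (\<mu> (c x) - \<mu> (c y))) \<in> unit_functions X (U (c x) \<inter> U (c y))"
      using compatible_unit[OF \<mu> _ _ op] by blast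
  next
    fix x y z p assume "x \<in> points X" "y \<in> points X" "z \<in> points X" "p \<in> U (c x) \<inter> U (c y) \<inter> U (c z)"
    thus "snd p (\<mu> (c x) - \<mu> (c y)) * snd p (\<mu> (c y) - \<mu> (c z)) = snd p (\<mu> (c x) - \<mu> (c z))"
      using cocycle c by blast
  qed
  moreover have "char_data L \<mu>"
    unfolding char_data_def
  proof (intro exI[of _ "\<lambda>i z. U i \<inter> U (c (tpt (B i) z))"]
      exI[of _ "\<lambda>i z p. snd p (\<mu> (c (tpt (B i) z)) - \<mu> i)"] conjI ballI allI)
    fix i z assume i: "i \<in> K"
    have x: "c (tpt (B i) z) \<in> K" "tpt (B i) z \<in> U (c (tpt (B i) z))" using c[OF pt_in_points[OF i]] by auto
    show "openin (Zar X) (U i \<inter> U (c (tpt (B i) z)))" by (rule op[OF i x(1)])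
    show "tpt (B i) z \<in> U i \<inter> U (c (tpt (B i) z))" using x by blast
    show "U i \<inter> U (c (tpt (B i) z)) \<subseteq> fst L (tpt (B i) z)" by (simp add: L_def)
    show "U i \<inter> U (c (tpt (B i) z)) \<subseteq> U i" by blast
    show "(\<lambda>p. snd p (\<mu> (c (tpt (B i) z)) - \<mu> i)) \<in> unit_functions X (U i \<inter> U (c (tpt (B i) z)))"
      using compatible_unit[OF \<mu> x(1) i op[OF i x(1)]] by blast
  next
    fix i j y z p
    assume i: "i \<in> K" and j: "j \<in> K"
      and p: "p \<in> (U i \<inter> U (c (tpt (B i) y))) \<inter> (U j \<inter> U (c (tpt (B j) z)))"
    define a b where "a = c (tpt (B i) y)" and "b = c (tpt (B j) z)"
    have ab: "a \<in> K" "b \<in> K" "p \<in> U i" "p \<in> U j" "p \<in> U a" "p \<in> U b"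
      using c[OF pt_in_points[OF i]] c[OF pt_in_points[OF j]] p unfolding a_def b_def by auto
    have "snd p (\<mu> a - \<mu> i) * snd p (\<mu> i - \<mu> j) = snd p (\<mu> a - \<mu> j)"
      "snd p (\<mu> a - \<mu> b) * snd p (\<mu> b - \<mu> j) = snd p (\<mu> a - \<mu> j)"
      using cocycle ab i j by blast+
    moreover have "snd p (\<mu> b - \<mu> j) \<noteq> 0" using compatible_nonzero[OF \<mu> ab(2) j ab(6,4)] .
    ultimately have "snd p (\<mu> a - \<mu> b) = snd p (\<mu> a - \<mu> i) / snd p (\<mu> b - \<mu> j) * snd p (\<mu> i - \<mu> j)"
      by (simp add: eq_divide_eq)
    thus "snd L (tpt (B i) y) (tpt (B j) z) p =
        snd p (\<mu> (c (tpt (B i) y)) - \<mu> i) / snd p (\<mu> (c (tpt (B j) z)) - \<mu> j) * snd p (\<mu> i - \<mu> j)"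
      unfolding L_def a_def b_def by simp
  qed
  ultimately show ?thesis by (rule that)
qed

text \<open>
  A common ray of two cones gives a point in both charts at which only the coordinate of this ray
  vanishes. The character \<open>\<mu> i - \<mu> j\<close> is a quotient of units there, so its
  exponent at this ray is zero.
\<close>

lemma char_data_compatible:
  assumes L: "line_bundle X L" and cd: "char_data L \<mu>"
  shows "compatible \<mu>"
  unfolding compatible_def
proof (intro ballI allI impI)
  fix i j k l assume i: "i \<in> K" and j: "j \<in> K" and row: "B i $ k = B j $ l"
  define z :: "complex ^ 3" where "z = (\<chi> h. if h = k then 0 else 1)"
  define p where "p = tpt (B i) z"
  have J: "{h. z $ h = 0} = {k}" unfolding z_def by auto
  have "fst p = fcone (B j) {l}"
    unfolding p_def tpt_def J using fcone_ray[OF inv[OF i]] fcone_ray[OF inv[OF j]] row by simp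
  then obtain y where y: "p = tpt (B j) y"
    using toric_point_in_chart[OF _ j] tpt_points[OF i] unfolding p_def by metis
  obtain M s where M: "\<And>i z. i \<in> K \<Longrightarrow> tpt (B i) z \<in> M i z"
    and g: "\<And>i j y z p. i \<in> K \<Longrightarrow> j \<in> K \<Longrightarrow> p \<in> M i y \<inter> M j z \<Longrightarrow>
        snd L (tpt (B i) y) (tpt (B j) z) p = s i y p / s j z p * snd p (\<mu> i - \<mu> j)"
    using cd unfolding char_data_def by metis
  have pp: "p \<in> points X" unfolding p_def by (rule pt_in_points[OF i])
  have "snd L p p p \<noteq> 0"
    using line_bundleD(3)[OF L pp pp] line_bundleD(1,2)[OF L pp pp] unit_iff by auto
  moreover have "snd L p p p = s i z p / s j y p * snd p (\<mu> i - \<mu> j)"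
    using g[OF i j, of p z y] M[OF i, of z] M[OF j, of y] y unfolding p_def by auto
  ultimately have "snd p (\<mu> i - \<mu> j) \<noteq> 0" by auto
  hence "(B i *v (\<mu> i - \<mu> j)) $ k = 0" unfolding p_def snd_tpt_nonzero_iff z_def by simp
  moreover have "(B i *v \<mu> j) $ k = (B j *v \<mu> j) $ l" using row by (simp add: matrix_vector_mult_def)
  ultimately show "(B i *v \<mu> i) $ k = (B j *v \<mu> j) $ l" by (simp add: mv_simps)
qed

lemma combination_diag:
  assumes "\<And>t. t < r \<Longrightarrow> line_bundle X (L t)" "x \<in> points X"
  shows "snd (lb_combination r L a) x x x = 1"
proof -
  have "snd (L t) x x x = 1" if t: "t < r" for t
  proof -
    have x: "x \<in> fst (L t) x" "openin (Zar X) (fst (L t) x)" using line_bundleD(1,2)[OF assms(1)[OF t] assms(2,2)] by auto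
    have "snd (L t) x x x * snd (L t) x x x = snd (L t) x x x"
      using line_bundleD(4)[OF assms(1)[OF t] assms(2,2,2)] x by blast
    moreover have "snd (L t) x x x \<noteq> 0"
      using line_bundleD(3)[OF assms(1)[OF t] assms(2,2)] x unit_iff by auto
    ultimately show ?thesis by simp
  qed
  thus ?thesis by (simp add: lb_combination_def)
qed

text \<open>
  The piecewise linear functions of \<open>r\<close> bundles and the three coordinate functions
  are \<open>r + 3\<close> integral vectors indexed by the rays. If there are fewer rays, these
  satisfy a linear relation, that is, a combination of the piecewise linear functions is linear
  and the corresponding combination of bundles is trivial.
\<close>

lemma picard_upper:
  assumes L: "\<And>t. t < r \<Longrightarrow> line_bundle X (L t)"
    and indep: "\<And>a. trivial_line_bundle X (lb_combination r L a) \<Longrightarrow> (\<forall>t<r. a t = 0)"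
  shows "r + 3 \<le> card ray_set"
proof (rule ccontr)
  assume "\<not> ?thesis"
  hence less: "card ray_set < r + 3" by simp
  have "\<forall>t\<in>{..<r}. \<exists>\<mu>. char_data (L t) \<mu>" using line_bundle_has_char_data[OF L] by blast
  then obtain \<mu> where \<mu>: "\<And>t. t < r \<Longrightarrow> char_data (L t) (\<mu> t)" by (metis lessThan_iff)
  have comp: "compatible (\<mu> t)" if "t < r" for t by (rule char_data_compatible[OF L[OF that] \<mu>[OF that]])
  have "\<forall>\<rho>\<in>ray_set. \<exists>i k. i \<in> K \<and> \<rho> = B i $ k" unfolding ray_set_def by blast
  then obtain I k where Ik: "\<And>\<rho>. \<rho> \<in> ray_set \<Longrightarrow> I \<rho> \<in> K \<and> \<rho> = B (I \<rho>) $ k \<rho>" by metis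
  define \<psi> where "\<psi> \<rho> t = (B (I \<rho>) *v \<mu> t (I \<rho>)) $ k \<rho>" for \<rho> t
  have \<psi>: "(B i *v \<mu> t i) $ h = \<psi> (B i $ h) t" if "t < r" "i \<in> K" for t i h
  proof -
    have "I (B i $ h) \<in> K" "B i $ h = B (I (B i $ h)) $ k (B i $ h)" using Ik[OF row_ray_set[OF that(2)], of h] by auto
    thus ?thesis unfolding \<psi>_def using comp[OF that(1)] that(2) unfolding compatible_def by blast
  qed
  \<comment> \<open>The unknowns: coefficients of the bundles and, with opposite sign, the linear form
    \<open>m\<close>.\<close>
  define A :: "(nat + 3) set" where "A = {..<r} <+> UNIV"
  have "finite A" "card ray_set < card A" unfolding A_def using less by (auto simp: card_Plus)
  then obtain n where n: "\<exists>x\<in>A. n x \<noteq> 0"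
    "\<And>\<rho>. \<rho> \<in> ray_set \<Longrightarrow> (\<Sum>x\<in>A. n x * (case x of Inl t \<Rightarrow> \<psi> \<rho> t | Inr h \<Rightarrow> - (\<rho> $ h))) = 0"
    using integer_homogeneous_system[OF finite_ray_set, of A "\<lambda>\<rho> x. case x of Inl t \<Rightarrow> \<psi> \<rho> t | Inr h \<Rightarrow> - (\<rho> $ h)"]
    by metis
  define m :: "int ^ 3" where "m = (\<chi> h. n (Inr h))"
  have key: "(\<Sum>t<r. n (Inl t) * \<psi> \<rho> t) = (\<Sum>h\<in>UNIV. \<rho> $ h * m $ h)" if "\<rho> \<in> ray_set" for \<rho>
    using n(2)[OF that] unfolding A_def by (simp add: sum.Plus m_def sum_negf mult.commute)
  have const: "(\<Sum>t<r. n (Inl t) *s \<mu> t i) = m" if i: "i \<in> K" for i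
  proof -
    have lin: "B i *v (\<Sum>t\<in>T. n (Inl t) *s \<mu> t i) = (\<Sum>t\<in>T. n (Inl t) *s (B i *v \<mu> t i))" if "finite T" for T
      using that by (induction T) (simp_all add: mv_simps)
    have "(B i *v (\<Sum>t<r. n (Inl t) *s \<mu> t i)) $ h = (B i *v m) $ h" for h
    proof -
      have "(B i *v (\<Sum>t<r. n (Inl t) *s \<mu> t i)) $ h = (\<Sum>t<r. n (Inl t) * \<psi> (B i $ h) t)"
        unfolding lin[OF finite_lessThan] using \<psi>[OF _ i] by simp
      also have "\<dots> = (B i *v m) $ h" unfolding key[OF row_ray_set[OF i]] by (simp add: matrix_vector_mult_def)
      finally show ?thesis .
    qed
    hence "B i *v (\<Sum>t<r. n (Inl t) *s \<mu> t i) = B i *v m" by (simp add: vec_eq_iff)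
    thus ?thesis using mult_inject[OF inv[OF i]] by blast
  qed
  have "trivial_line_bundle X (lb_combination r L (\<lambda>t. n (Inl t)))"
    by (rule char_data_trivial[OF char_data_combination[OF L \<mu>]]) (simp_all add: const)
  hence zero: "\<forall>t<r. n (Inl t) = 0" by (rule indep)
  obtain i where i: "i \<in> K" using K_ne by blast
  have "m = 0" using const[OF i] zero by simp
  hence "n (Inr h) = 0" for h unfolding m_def by (simp add: vec_eq_iff)
  thus False using n(1) zero unfolding A_def by auto
qed

text \<open>
  For each ray outside of a fixed maximal cone \<open>i0\<close> there is the function that is one
  on this ray and zero on all others. A linear combination of these that is linear vanishes on
  \<open>i0\<close>, so it is zero.
\<close>

lemma picard_lower:
  obtains L where "\<And>t. t < card ray_set - 3 \<Longrightarrow> line_bundle X (L t)"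
    "\<And>a. trivial_line_bundle X (lb_combination (card ray_set - 3) L a) \<Longrightarrow> (\<forall>t < card ray_set - 3. a t = 0)"
proof -
  define r where "r = card ray_set - 3"
  obtain i0 where i0: "i0 \<in> K" using K_ne by blast
  define R where "R = ray_set - range (($) (B i0))"
  have "card (range (($) (B i0))) = 3"
    using card_image[of "($) (B i0)" UNIV] rows_distinct[OF i0] by (simp add: inj_on_def)
  hence "card R = r" unfolding R_def r_def
    using card_Diff_subset[of "range (($) (B i0))" ray_set] row_ray_set[OF i0] by auto
  moreover have "finite R" unfolding R_def using finite_ray_set by simp
  ultimately obtain \<rho> where \<rho>: "bij_betw \<rho> {0..<r} R" using ex_bij_betw_nat_finite by blast
  define e where "e t v = (if v = \<rho> t then 1 else 0 :: int)" for t v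
  define \<mu> where "\<mu> t i = (\<Sum>k\<in>UNIV. e t (B i $ k) *s dual_vec (B i) k)" for t i
  have \<mu>: "(B i *v \<mu> t i) $ k = e t (B i $ k)" if "i \<in> K" for t i k
    unfolding \<mu>_def by (rule mult_dual_combination[OF inv[OF that]])
  have comp: "compatible (\<mu> t)" for t unfolding compatible_def using \<mu> by auto
  have "\<exists>L. line_bundle X L \<and> char_data L (\<mu> t)" for t by (rule compatible_line_bundle[OF comp]) blast
  then obtain L where L: "\<And>t. line_bundle X (L t)" "\<And>t. char_data (L t) (\<mu> t)" by metis
  have "a t = 0" if triv: "trivial_line_bundle X (lb_combination r L a)" and t: "t < r" for a t
  proof -
    have "\<rho> t \<in> R" using \<rho> t unfolding bij_betw_def by auto
    then obtain i k where i: "i \<in> K" "\<rho> t = B i $ k" unfolding R_def ray_set_def by blast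
    have lin: "B i *v (\<Sum>t\<in>T. a t *s \<mu> t i) = (\<Sum>t\<in>T. a t *s (B i *v \<mu> t i))" if "finite T" for T i
      using that by (induction T) (simp_all add: mv_simps)
    have "\<mu> s i0 = 0" if "s < r" for s
    proof -
      have "\<rho> s \<in> R" using \<rho> that unfolding bij_betw_def by auto
      hence "B i0 $ k \<noteq> \<rho> s" for k unfolding R_def by (metis DiffE rangeI)
      hence "e s (B i0 $ k) = 0" for k by (simp add: e_def)
      thus ?thesis unfolding \<mu>_def by simp
    qed
    hence "(\<Sum>s<r. a s *s \<mu> s i0) = 0" by simp
    moreover have "(\<Sum>s<r. a s *s \<mu> s i) = (\<Sum>s<r. a s *s \<mu> s i0)"
      using trivial_char_data[OF char_data_combination[OF L] combination_diag[OF L(1)] triv i(1) i0] .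
    ultimately have "(B i *v (\<Sum>s<r. a s *s \<mu> s i)) $ k = 0" by (simp add: mv_simps)
    hence "(\<Sum>s<r. a s * e s (B i $ k)) = 0" unfolding lin[OF finite_lessThan] by (simp add: \<mu>[OF i(1)])
    moreover have "e s (B i $ k) = (if s = t then 1 else 0)" if "s < r" for s
      using \<rho> that t unfolding e_def i(2)[symmetric] bij_betw_def inj_on_def by auto
    hence "(\<Sum>s<r. a s * e s (B i $ k)) = (\<Sum>s<r. if s = t then a s else 0)" by (intro sum.cong) auto
    ultimately show ?thesis using t by simp
  qed
  thus ?thesis using that[of L] L(1) unfolding r_def by blast
qed

theorem picard_number_eq: "picard_number X = enat (card ray_set - 3)"
proof (rule antisym)
  show "picard_number X \<le> enat (card ray_set - 3)"
    unfolding picard_number_def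
  proof (rule Sup_least)
    fix x assume "x \<in> {enat r | r. \<exists>L. (\<forall>i<r. line_bundle X (L i)) \<and>
     (\<forall>a. trivial_line_bundle X (lb_combination r L a) \<longrightarrow> (\<forall>i<r. a i = 0))}"
    then obtain r L where "x = enat r" "\<forall>i<r. line_bundle X (L i)"
      "\<forall>a. trivial_line_bundle X (lb_combination r L a) \<longrightarrow> (\<forall>i<r. a i = 0)" by blast
    thus "x \<le> enat (card ray_set - 3)" using picard_upper[of r L] by auto
  qed
  obtain L where "\<And>t. t < card ray_set - 3 \<Longrightarrow> line_bundle X (L t)"
    "\<And>a. trivial_line_bundle X (lb_combination (card ray_set - 3) L a) \<Longrightarrow> (\<forall>t < card ray_set - 3. a t = 0)"
    using picard_lower by blast
  thus "enat (card ray_set - 3) \<le> picard_number X"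
    unfolding picard_number_def by (intro Sup_upper) blast
qed

end

section \<open>Homogeneous polynomials and projective space\<close>

lemma hom_polysI:
  assumes "finite X" "\<And>x. x \<in> X \<Longrightarrow> (\<Sum>i\<le>N. a x i) = d"
  shows "(\<lambda>v. \<Sum>x\<in>X. c x * (\<Prod>i\<le>N. v i ^ a x i)) \<in> hom_polys N d"
proof -
  obtain c' where c': "\<And>f. (\<Sum>x\<in>X. c x * f (a x)) = (\<Sum>y\<in>a ` X. c' y * f y)"
    using sum_merge[OF assms(1)] by blast
  have "(\<lambda>v. \<Sum>x\<in>X. c x * (\<Prod>i\<le>N. v i ^ a x i)) = (\<lambda>v. \<Sum>y\<in>a ` X. c' y * (\<Prod>i\<le>N. v i ^ y i))"
    using c'[of "\<lambda>y. \<Prod>i\<le>N. v i ^ y i" for v] by blast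
  moreover have "\<forall>y\<in>a ` X. (\<Sum>i\<le>N. y i) = d" using assms(2) by blast
  ultimately show ?thesis unfolding hom_polys_def using assms(1) by blast
qed

lemma hom_polysE:
  assumes "F \<in> hom_polys N d"
  obtains A c where "finite A" "\<forall>a\<in>A. (\<Sum>i\<le>N. a i) = d" "F = (\<lambda>v. \<Sum>a\<in>A. c a * (\<Prod>i\<le>N. v i ^ a i))"
  using assms unfolding hom_polys_def by blast

lemma hom_add: "F \<in> hom_polys N d \<Longrightarrow> G \<in> hom_polys N d \<Longrightarrow> (\<lambda>v. F v + G v) \<in> hom_polys N d"
proof -
  assume F: "F \<in> hom_polys N d" and G: "G \<in> hom_polys N d"
  obtain A c where A: "finite A" "\<forall>a\<in>A. (\<Sum>i\<le>N. a i) = d" "F = (\<lambda>v. \<Sum>a\<in>A. c a * (\<Prod>i\<le>N. v i ^ a i))"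
    by (rule hom_polysE[OF F])
  obtain A' c' where A': "finite A'" "\<forall>a\<in>A'. (\<Sum>i\<le>N. a i) = d" "G = (\<lambda>v. \<Sum>a\<in>A'. c' a * (\<Prod>i\<le>N. v i ^ a i))"
    by (rule hom_polysE[OF G])
  have "(\<lambda>v. \<Sum>x\<in>A <+> A'. case_sum c c' x * (\<Prod>i\<le>N. v i ^ (case_sum (\<lambda>a. a) (\<lambda>a. a) x) i)) \<in> hom_polys N d"
    using A(1,2) A'(1,2) by (intro hom_polysI) auto
  thus ?thesis using A A' by (simp add: sum.Plus)
qed

lemma hom_mult: "F \<in> hom_polys N d \<Longrightarrow> G \<in> hom_polys N d' \<Longrightarrow> (\<lambda>v. F v * G v) \<in> hom_polys N (d + d')"
proof -
  assume F: "F \<in> hom_polys N d" and G: "G \<in> hom_polys N d'"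
  obtain A c where A: "finite A" "\<forall>a\<in>A. (\<Sum>i\<le>N. a i) = d" "F = (\<lambda>v. \<Sum>a\<in>A. c a * (\<Prod>i\<le>N. v i ^ a i))"
    by (rule hom_polysE[OF F])
  obtain A' c' where A': "finite A'" "\<forall>a\<in>A'. (\<Sum>i\<le>N. a i) = d'" "G = (\<lambda>v. \<Sum>a\<in>A'. c' a * (\<Prod>i\<le>N. v i ^ a i))"
    by (rule hom_polysE[OF G])
  have "(\<lambda>v. \<Sum>x\<in>A \<times> A'. (c (fst x) * c' (snd x)) * (\<Prod>i\<le>N. v i ^ (fst x i + snd x i))) \<in> hom_polys N (d + d')"
    using A(1,2) A'(1,2) by (intro hom_polysI) (auto simp: sum.distrib)
  moreover have "(\<Sum>x\<in>A \<times> A'. (c (fst x) * c' (snd x)) * (\<Prod>i\<le>N. v i ^ (fst x i + snd x i))) = F v * G v" for v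
    unfolding A(3) A'(3) sum_product sum.cartesian_product
    by (simp add: case_prod_beta power_add prod.distrib mult_ac)
  ultimately show ?thesis by simp
qed

lemma hom_const: "(\<lambda>v. c) \<in> hom_polys N 0"
  using hom_polysI[where X = "{()}" and N = N and a = "\<lambda>_ _. 0" and d = 0 and c = "\<lambda>_. c"] by simp

lemma prod_power_delta: "t \<le> N \<Longrightarrow> (\<Prod>s\<le>N. v s ^ (if s = t then n else 0)) = (v t ^ n :: 'a::comm_monoid_mult)" for t N :: nat
proof -
  assume t: "t \<le> N"
  have "(\<Prod>s\<le>N. v s ^ (if s = t then n else 0)) = (\<Prod>s\<le>N. if s = t then v s ^ n else 1)"
    by (intro prod.cong) auto
  thus ?thesis using t by simp
qed

lemma hom_monomial: "(\<lambda>v. \<Prod>s\<le>N. v s ^ a s) \<in> hom_polys N (\<Sum>s\<le>N. a s)"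
  using hom_polysI[where X = "{()}" and N = N and a = "\<lambda>_. a" and d = "\<Sum>s\<le>N. a s" and c = "\<lambda>_. 1"] by simp

lemma hom_var:
  assumes "t \<le> N" shows "(\<lambda>v. v t) \<in> hom_polys N 1"
proof -
  have "(\<lambda>v. \<Prod>s\<le>N. v s ^ (if s = t then 1 else 0)) = (\<lambda>v :: nat \<Rightarrow> complex. v t)"
    by (rule ext) (simp only: prod_power_delta[OF assms] power_one_right)
  moreover have "(\<Sum>s\<le>N. if s = t then 1 else 0) = (1 :: nat)" using assms by simp
  ultimately show ?thesis
    using hom_monomial[where N = N and a = "\<lambda>s. if s = t then 1 else 0"] by (simp only:)
qed

lemma hom_power: "t \<le> N \<Longrightarrow> (\<lambda>v. v t ^ n) \<in> hom_polys N n"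
proof (induction n)
  case 0 show ?case using hom_const[of 1 N] by simp
next
  case (Suc n) thus ?case using hom_mult[OF hom_var[of t N], of "\<lambda>v. v t ^ n" n] by simp
qed

lemma hom_scale:
  assumes "F \<in> hom_polys N d" shows "F (\<lambda>i. c * v i) = c ^ d * F v"
proof -
  obtain A c' where A: "finite A" "\<forall>a\<in>A. (\<Sum>i\<le>N. a i) = d" "F = (\<lambda>v. \<Sum>a\<in>A. c' a * (\<Prod>i\<le>N. v i ^ a i))"
    by (rule hom_polysE[OF assms])
  have "(\<Prod>i\<le>N. (c * v i) ^ a i) = c ^ d * (\<Prod>i\<le>N. v i ^ a i)" if "a \<in> A" for a
    using A(2) that by (simp add: power_mult_distrib prod.distrib flip: power_sum)
  thus ?thesis unfolding A(3) by (simp add: sum_distrib_left mult.left_commute)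
qed

definition line_through :: "(nat \<Rightarrow> complex) \<Rightarrow> (nat \<Rightarrow> complex) set" where
  "line_through v = {(\<lambda>i. c * v i) | c. c \<noteq> 0}"

lemma line_through_self: "v \<in> line_through v"
  unfolding line_through_def by (intro CollectI exI[of _ 1]) simp

lemma line_throughE:
  assumes "w \<in> line_through v" obtains c where "c \<noteq> 0" "w = (\<lambda>i. c * v i)"
  using assms unfolding line_through_def by blast

lemma line_through_scale: "c \<noteq> 0 \<Longrightarrow> line_through (\<lambda>i. c * v i) = line_through v"
proof -
  assume c: "c \<noteq> 0"
  have "(\<lambda>i. d * v i) \<in> line_through (\<lambda>i. c * v i)" if "d \<noteq> 0" for d
    unfolding line_through_def using c that by (intro CollectI exI[of _ "d / c"]) auto
  moreover have "(\<lambda>i. d * (c * v i)) \<in> line_through v" if "d \<noteq> 0" for d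
    unfolding line_through_def using c that by (intro CollectI exI[of _ "d * c"]) (auto simp: mult.assoc)
  ultimately show ?thesis by (auto elim!: line_throughE)
qed

lemma proj_points_iff: "P \<in> proj_points N \<longleftrightarrow> (\<exists>v. P = line_through v \<and> (\<exists>i\<le>N. v i \<noteq> 0) \<and> (\<forall>i>N. v i = 0))"
  unfolding proj_points_def line_through_def by blast

lemma proj_pointsD:
  assumes "P \<in> proj_points N" "v \<in> P"
  shows "P = line_through v" "\<exists>i\<le>N. v i \<noteq> 0" "\<forall>i>N. v i = 0"
proof -
  obtain u where u: "P = line_through u" "\<exists>i\<le>N. u i \<noteq> 0" "\<forall>i>N. u i = 0"
    using assms(1) proj_points_iff by blast
  obtain c where c: "c \<noteq> 0" "v = (\<lambda>i. c * u i)" using assms(2) unfolding u(1) by (rule line_throughE)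
  show "P = line_through v" unfolding c(2) u(1) using line_through_scale[OF c(1)] by simp
  show "\<exists>i\<le>N. v i \<noteq> 0" "\<forall>i>N. v i = 0" using u(2,3) c by auto
qed

lemma proj_points_ne: "P \<in> proj_points N \<Longrightarrow> \<exists>v. v \<in> P"
  using line_through_self by (metis proj_points_iff)

definition nonzero_locus :: "nat \<Rightarrow> ((nat \<Rightarrow> complex) \<Rightarrow> complex) \<Rightarrow> (nat \<Rightarrow> complex) set set" where
  "nonzero_locus N F = {P \<in> proj_points N. \<forall>v\<in>P. F v \<noteq> 0}"

text \<open>
  By homogeneity, one vector of homogeneous coordinates decides.
\<close>

lemma nonzero_locus_iff:
  assumes "F \<in> hom_polys N d" "P \<in> proj_points N" "v \<in> P"
  shows "P \<in> nonzero_locus N F \<longleftrightarrow> F v \<noteq> 0"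
proof
  assume nz: "F v \<noteq> 0"
  have "F w \<noteq> 0" if w: "w \<in> P" for w
  proof -
    obtain c where "c \<noteq> 0" "w = (\<lambda>i. c * v i)"
      using w unfolding proj_pointsD(1)[OF assms(2,3)] by (rule line_throughE)
    thus ?thesis using hom_scale[OF assms(1)] nz by simp
  qed
  thus "P \<in> nonzero_locus N F" unfolding nonzero_locus_def using assms(2) by blast
qed (use assms in \<open>auto simp: nonzero_locus_def\<close>)

lemma Zar_proj: "Zar (projective_space N) = topology_generated_by {nonzero_locus N F | F. \<exists>d. F \<in> hom_polys N d}"
  by (simp add: projective_space_def nonzero_locus_def)

lemma open_nonzero_locus: "F \<in> hom_polys N d \<Longrightarrow> openin (Zar (projective_space N)) (nonzero_locus N F)"
  unfolding Zar_proj by (rule topology_generated_by_Basis) blast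

lemma points_proj: "points (projective_space N) = proj_points N"
proof -
  have "points (projective_space N) = \<Union>{nonzero_locus N F | F. \<exists>d. F \<in> hom_polys N d}" by (simp add: Zar_proj)
  also have "\<dots> = proj_points N"
  proof
    show "\<Union>{nonzero_locus N F | F. \<exists>d. F \<in> hom_polys N d} \<subseteq> proj_points N" unfolding nonzero_locus_def by blast
    have "nonzero_locus N (\<lambda>v. 1) = proj_points N" unfolding nonzero_locus_def by simp
    thus "proj_points N \<subseteq> \<Union>{nonzero_locus N F | F. \<exists>d. F \<in> hom_polys N d}" using hom_const[of 1 N] by blast
  qed
  finally show ?thesis .
qed

lemma Reg_proj: "f \<in> Reg (projective_space N) U \<longleftrightarrow> (\<forall>P\<in>U. \<exists>d. \<exists>G\<in>hom_polys N d. \<exists>H\<in>hom_polys N d.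
         (\<forall>v\<in>P. H v \<noteq> 0) \<and> (\<forall>Q\<in>U. \<forall>v\<in>Q. H v \<noteq> 0 \<longrightarrow> f Q = G v / H v))"
  by (simp add: projective_space_def)

lemma ratio_constant:
  assumes "G \<in> hom_polys N d" "H \<in> hom_polys N d" "Q \<in> proj_points N" "v \<in> Q" "w \<in> Q"
  shows "G v / H v = G w / H w"
proof -
  obtain c where "c \<noteq> 0" "w = (\<lambda>i. c * v i)"
    using assms(5) unfolding proj_pointsD(1)[OF assms(3,4)] by (rule line_throughE)
  thus ?thesis using hom_scale[OF assms(1)] hom_scale[OF assms(2)] by simp
qed

section \<open>The projective embedding\<close>

context toric_polytope
begin

text \<open>
  The first lattice point after the vertex on the \<open>k\<close>-th edge. The quotient of the
  characters at this point and at the vertex is the \<open>k\<close>-th coordinate of the chart.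
\<close>

definition nbr :: "'i \<Rightarrow> 3 \<Rightarrow> int ^ 3" where
  "nbr i k = vtx i + dual_vec (B i) k"

definition lattice_pts :: "(int ^ 3) set" where
  "lattice_pts = vtx ` K \<union> (\<Union>i\<in>K. range (nbr i))"

lemma finite_lattice_pts: "finite lattice_pts"
  unfolding lattice_pts_def using finite_K by simp

lemma edge_dual_vec:
  assumes "i \<in> K"
  obtains j e where "j \<in> K" "e > 0" "vtx j - vtx i = e *s dual_vec (B i) k"
proof -
  obtain j e where j: "j \<in> K" "e > 0" "B i *v (vtx j - vtx i) = axis k e" using edge[OF assms] by blast
  have "B i *v (e *s dual_vec (B i) k) = axis k e"
    unfolding mv_simps mult_dual_vec[OF inv[OF assms]] by (simp add: vec_eq_iff axis_def)
  hence "B i *v (vtx j - vtx i) = B i *v (e *s dual_vec (B i) k)" using j(3) by simp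
  thus ?thesis using that j mult_inject[OF inv[OF assms]] by blast
qed

text \<open>
  The point \<open>nbr j l\<close> lies on an edge, so a multiple of it is a nonnegative
  combination of two vertices.
\<close>

lemma lattice_pts_nonneg:
  assumes "i \<in> K" "m \<in> lattice_pts" shows "0 \<le> (B i *v (m - vtx i)) $ k"
proof -
  consider j where "j \<in> K" "m = vtx j" | j l where "j \<in> K" "m = nbr j l"
    using assms(2) unfolding lattice_pts_def by blast
  thus ?thesis
  proof cases
    case 1 thus ?thesis using vtx_nonneg[OF assms(1)] by simp
  next
    case 2
    obtain j' e where e: "j' \<in> K" "e > 0" "vtx j' - vtx j = e *s dual_vec (B j) l" using edge_dual_vec[OF 2(1)] by metis
    have "e *s (m - vtx i) = (e - 1) *s (vtx j - vtx i) + (vtx j' - vtx i)"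
      using e(3) unfolding 2(2) nbr_def by (simp add: vec_eq_iff algebra_simps)
    hence "(B i *v (e *s (m - vtx i))) $ k = (B i *v ((e - 1) *s (vtx j - vtx i) + (vtx j' - vtx i))) $ k"
      by (rule arg_cong)
    hence "e * (B i *v (m - vtx i)) $ k = (e - 1) * (B i *v (vtx j - vtx i)) $ k + (B i *v (vtx j' - vtx i)) $ k"
      by (simp only: mv_simps(1,4) vector_add_component vector_smult_component)
    also have "\<dots> \<ge> 0" using e(2) vtx_nonneg[OF assms(1) 2(1)] vtx_nonneg[OF assms(1) e(1)] by simp
    finally show ?thesis using e(2) by (simp add: zero_le_mult_iff)
  qed
qed

end

text \<open>
  The homogeneous coordinates of the ambient projective space are numbered by an enumeration of
  \<open>lattice_pts\<close>.
\<close>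

locale toric_embedding = toric_polytope K B vtx
  for K :: "'i set" and B :: "'i \<Rightarrow> int ^ 3 ^ 3" and vtx :: "'i \<Rightarrow> int ^ 3" +
  fixes N :: nat and e :: "nat \<Rightarrow> int ^ 3"
  assumes enum: "bij_betw e {..N} lattice_pts"
begin

text \<open>
  The indices of the homogeneous coordinates that belong to a vertex and to its neighbours.
\<close>

definition iv :: "'i \<Rightarrow> nat" where "iv i = the_inv_into {..N} e (vtx i)"
definition ib :: "'i \<Rightarrow> 3 \<Rightarrow> nat" where "ib i k = the_inv_into {..N} e (nbr i k)"

lemma e_lattice: "t \<le> N \<Longrightarrow> e t \<in> lattice_pts"
  using enum unfolding bij_betw_def by auto

lemma e_inject: "s \<le> N \<Longrightarrow> t \<le> N \<Longrightarrow> e s = e t \<longleftrightarrow> s = t"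
  using enum unfolding bij_betw_def inj_on_def by auto

lemma the_index: "m \<in> lattice_pts \<Longrightarrow> the_inv_into {..N} e m \<le> N \<and> e (the_inv_into {..N} e m) = m"
  using the_inv_into_into[of e "{..N}" m "{..N}"] f_the_inv_into_f[of e "{..N}" m] enum
  unfolding bij_betw_def by auto

lemma iv: "i \<in> K \<Longrightarrow> iv i \<le> N" "i \<in> K \<Longrightarrow> e (iv i) = vtx i"
  unfolding iv_def using the_index[of "vtx i"] by (auto simp: lattice_pts_def)

lemma ib: "i \<in> K \<Longrightarrow> ib i k \<le> N" "i \<in> K \<Longrightarrow> e (ib i k) = nbr i k"
  unfolding ib_def using the_index[of "nbr i k"] by (auto simp: lattice_pts_def)

definition expo :: "'i \<Rightarrow> nat \<Rightarrow> 3 \<Rightarrow> nat" where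
  "expo i t k = nat ((B i *v (e t - vtx i)) $ k)"

lemma expo: "i \<in> K \<Longrightarrow> t \<le> N \<Longrightarrow> int (expo i t k) = (B i *v (e t - vtx i)) $ k"
  unfolding expo_def using lattice_pts_nonneg[OF _ e_lattice] by simp

text \<open>
  The characters \<open>e t\<close> divided by the character of the vertex \<open>i\<close>, as
  monomials in the coordinates of the chart.
\<close>

definition lift :: "'i \<Rightarrow> complex ^ 3 \<Rightarrow> nat \<Rightarrow> complex" where
  "lift i z t = (if t \<le> N then \<Prod>k\<in>UNIV. z $ k ^ expo i t k else 0)"

lemma lift_snd: "i \<in> K \<Longrightarrow> t \<le> N \<Longrightarrow> lift i z t = snd (tpt (B i) z) (e t - vtx i)"
  by (simp add: lift_def snd_tpt expo[symmetric])

lemma lift_iv: "i \<in> K \<Longrightarrow> lift i z (iv i) = 1"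
  using iv by (simp add: lift_def expo_def mv_simps)

lemma lift_ib:
  assumes "i \<in> K" shows "lift i z (ib i k) = z $ k"
proof -
  have "expo i (ib i k) l = (if l = k then 1 else 0)" for l
    by (simp add: expo_def ib[OF assms] nbr_def mult_dual_vec[OF inv[OF assms]] axis_def)
  hence "lift i z (ib i k) = (\<Prod>l\<in>UNIV. z $ l ^ (if l = k then 1 else 0))"
    using ib[OF assms] by (simp add: lift_def)
  also have "\<dots> = (\<Prod>l\<in>UNIV. if l = k then z $ l else 1)" by (intro prod.cong) auto
  finally have "lift i z (ib i k) = \<dots>" .
  thus ?thesis by simp
qed

lemma lift_proj: "i \<in> K \<Longrightarrow> line_through (lift i z) \<in> proj_points N"
  unfolding proj_points_iff
proof (intro exI[of _ "lift i z"] conjI exI[of _ "iv i"])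
  assume i: "i \<in> K"
  show "iv i \<le> N" by (rule iv(1)[OF i])
  show "lift i z (iv i) \<noteq> 0" using lift_iv[OF i] by simp
qed (auto simp: lift_def)

text \<open>
  Passing from one vertex to another multiplies all homogeneous coordinates by the same character,
  which does not vanish at a common point of the two charts.
\<close>

lemma lift_transition:
  assumes i: "i \<in> K" and j: "j \<in> K" and p: "tpt (B i) z = tpt (B j) y"
  shows "line_through (lift i z) = line_through (lift j y)"
proof -
  define p where "p = tpt (B i) z"
  define c where "c = snd p (vtx i - vtx j)"
  have "(B i *v (vtx i - vtx j)) $ k = 0" if k: "z $ k = 0" for k
  proof -
    obtain l where "B i $ k = B j $ l" using common_ray_point[OF i j p k] by blast
    hence "(B i *v (vtx j - vtx i)) $ k = 0" using vtx_zero_iff[OF i j] by blast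
    thus ?thesis by (simp add: mv_simps)
  qed
  hence c: "c \<noteq> 0" unfolding c_def p_def snd_tpt_nonzero_iff by blast
  have "lift j y t = c * lift i z t" for t
  proof (cases "t \<le> N")
    case True
    have "e t - vtx i \<in> dual_monoid (fcone (B i) {k. z $ k = 0})"
      unfolding dual_monoid_fcone[OF inv[OF i]] using lattice_pts_nonneg[OF i e_lattice[OF True]] by blast
    moreover have "vtx i - vtx j \<in> dual_monoid (fcone (B i) {k. z $ k = 0})"
      using c tpt_outside[OF inv[OF i]] unfolding c_def p_def by blast
    ultimately have "snd p ((vtx i - vtx j) + (e t - vtx i)) = c * snd p (e t - vtx i)"
      unfolding c_def p_def by (rule tpt_mult[OF inv[OF i], rotated])
    moreover have "(vtx i - vtx j) + (e t - vtx i) = e t - vtx j" by simp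
    ultimately show ?thesis using lift_snd[OF i True] lift_snd[OF j True] assms(3) unfolding p_def by simp
  qed (simp add: lift_def)
  hence "lift j y = (\<lambda>t. c * lift i z t)" by blast
  thus ?thesis using line_through_scale[OF c] by simp
qed

text \<open>
  By \<open>lift_transition\<close>, the choice of the chart does not matter.
\<close>

definition emb :: "3 toric_point \<Rightarrow> (nat \<Rightarrow> complex) set" where
  "emb p = (SOME P. \<exists>i z. i \<in> K \<and> p = tpt (B i) z \<and> P = line_through (lift i z))"

lemma emb: "i \<in> K \<Longrightarrow> emb (tpt (B i) z) = line_through (lift i z)"
proof -
  assume i: "i \<in> K"
  have "\<exists>j y. j \<in> K \<and> tpt (B i) z = tpt (B j) y \<and> emb (tpt (B i) z) = line_through (lift j y)"
    unfolding emb_def by (rule someI_ex) (use i in blast)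
  thus ?thesis using lift_transition[OF i] by metis
qed

lemma lift_in_emb: "i \<in> K \<Longrightarrow> lift i z \<in> emb (tpt (B i) z)"
  using emb line_through_self by simp

lemma emb_proj: "p \<in> points X \<Longrightarrow> emb p \<in> proj_points N"
  using emb lift_proj point_cases by metis

lemma pullback_poly:
  assumes "F \<in> hom_polys N d" "i \<in> K"
  shows "\<exists>P. \<forall>z. F (lift i z) = ev P z"
proof -
  obtain A c where A: "finite A" "\<forall>a\<in>A. (\<Sum>i\<le>N. a i) = d" "F = (\<lambda>v. \<Sum>a\<in>A. c a * (\<Prod>t\<le>N. v t ^ a t))"
    by (rule hom_polysE[OF assms(1)])
  show ?thesis
    by (rule exI[of _ "\<Sum>a\<in>A. con (c a) * (\<Prod>t\<le>N. (\<Prod>k\<in>UNIV. var k ^ expo i t k) ^ a t)"])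
      (simp add: A(3) lift_def)
qed

text \<open>
  The homogeneous coordinate of the vertex has the value one and those of its neighbours have the
  coordinates of the chart as values; summands are brought to the same degree by powers of the
  former.
\<close>

lemma homogenize:
  assumes i: "i \<in> K"
  shows "\<exists>d. \<exists>F\<in>hom_polys N d. \<forall>z. F (lift i z) = ev P z"
proof (induction P rule: poly3_induct)
  case (con c) show ?case using hom_const[of c N] by (intro exI[of _ 0] bexI[of _ "\<lambda>v. c"]) auto
next
  case (var k)
  show ?case using hom_var[OF ib(1)[OF i], of k] lift_ib[OF i]
    by (intro exI[of _ 1] bexI[of _ "\<lambda>v. v (ib i k)"]) auto
next
  case (add P P')
  then obtain d F d' F' where F: "F \<in> hom_polys N d" "\<forall>z. F (lift i z) = ev P z"
    "F' \<in> hom_polys N d'" "\<forall>z. F' (lift i z) = ev P' z" by blast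
  have "(\<lambda>v. F v * v (iv i) ^ d' + F' v * v (iv i) ^ d) \<in> hom_polys N (d + d')"
    using hom_mult[OF F(1) hom_power[OF iv(1)[OF i]], of d'] hom_mult[OF F(3) hom_power[OF iv(1)[OF i]], of d]
    by (intro hom_add) (simp_all add: add.commute)
  thus ?case using F(2,4) lift_iv[OF i] by (intro exI[of _ "d + d'"] bexI) auto
next
  case (mult P P')
  then obtain d F d' F' where F: "F \<in> hom_polys N d" "\<forall>z. F (lift i z) = ev P z"
    "F' \<in> hom_polys N d'" "\<forall>z. F' (lift i z) = ev P' z" by blast
  show ?case using hom_mult[OF F(1,3)] F(2,4) by (intro exI[of _ "d + d'"] bexI) auto
qed

text \<open>
  Two monomials in the homogeneous coordinates restrict to the same character; only pairs of the
  same degree are used.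
\<close>

definition binomial_relation :: "(nat \<Rightarrow> nat) \<Rightarrow> (nat \<Rightarrow> nat) \<Rightarrow> bool" where
  "binomial_relation a b \<longleftrightarrow> (\<Sum>t\<le>N. a t) = (\<Sum>t\<le>N. b t) \<and>
     (\<Sum>t\<le>N. int (a t) *s e t) = (\<Sum>t\<le>N. int (b t) *s e t)"

definition Y :: "(nat \<Rightarrow> complex) set set" where
  "Y = {P \<in> proj_points N. \<forall>v\<in>P. \<forall>a b. binomial_relation a b \<longrightarrow> (\<Prod>t\<le>N. v t ^ a t) = (\<Prod>t\<le>N. v t ^ b t)}"

lemma closed_Y: "closedin (Zar (projective_space N)) Y"
proof -
  have hom: "(\<lambda>v. (\<Prod>t\<le>N. v t ^ a t) - (\<Prod>t\<le>N. v t ^ b t)) \<in> hom_polys N (\<Sum>t\<le>N. a t)"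
    if "binomial_relation a b" for a b
  proof -
    have b: "(\<lambda>v. \<Prod>t\<le>N. v t ^ b t) \<in> hom_polys N (\<Sum>t\<le>N. a t)"
      using that hom_monomial[where N = N and a = b] unfolding binomial_relation_def by simp
    show ?thesis
      using hom_add[OF hom_monomial[where N = N and a = a] hom_mult[OF hom_const[of "-1" N] b, simplified]] by simp
  qed
  have "proj_points N - Y = \<Union>{nonzero_locus N (\<lambda>v. (\<Prod>t\<le>N. v t ^ a t) - (\<Prod>t\<le>N. v t ^ b t)) | a b. binomial_relation a b}"
    (is "?L = ?R")
  proof
    show "?L \<subseteq> ?R"
    proof
      fix P assume P: "P \<in> ?L"
      then obtain v a b where v: "v \<in> P" "binomial_relation a b" "(\<Prod>t\<le>N. v t ^ a t) \<noteq> (\<Prod>t\<le>N. v t ^ b t)"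
        unfolding Y_def by blast
      hence "P \<in> nonzero_locus N (\<lambda>v. (\<Prod>t\<le>N. v t ^ a t) - (\<Prod>t\<le>N. v t ^ b t))"
        using nonzero_locus_iff[OF hom[OF v(2)] _ v(1)] P by simp
      thus "P \<in> ?R" using v(2) by blast
    qed
    show "?R \<subseteq> ?L"
    proof
      fix P assume "P \<in> ?R"
      then obtain a b where ab: "binomial_relation a b" "P \<in> nonzero_locus N (\<lambda>v. (\<Prod>t\<le>N. v t ^ a t) - (\<Prod>t\<le>N. v t ^ b t))"
        by blast
      hence P: "P \<in> proj_points N" unfolding nonzero_locus_def by blast
      then obtain v where "v \<in> P" using proj_points_ne by blast
      thus "P \<in> ?L" using ab P unfolding Y_def nonzero_locus_def by fastforce
    qed
  qed
  moreover have "openin (Zar (projective_space N)) ?R"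
    using open_nonzero_locus[OF hom] by (intro openin_Union) blast
  ultimately have "openin (Zar (projective_space N)) (proj_points N - Y)" by simp
  moreover have "Y \<subseteq> proj_points N" unfolding Y_def by blast
  ultimately show ?thesis by (simp add: closedin_def points_proj)
qed

lemma emb_in_Y:
  assumes "p \<in> points X" shows "emb p \<in> Y"
proof -
  obtain i z where i: "i \<in> K" "p = tpt (B i) z" using assms by (rule point_cases)
  have mono: "(\<Prod>t\<le>N. lift i z t ^ a t) = (\<Prod>k\<in>UNIV. z $ k ^ (\<Sum>t\<le>N. expo i t k * a t))" for a
  proof -
    have "(\<Prod>t\<le>N. lift i z t ^ a t) = (\<Prod>t\<le>N. \<Prod>k\<in>UNIV. z $ k ^ (expo i t k * a t))"
      by (intro prod.cong refl) (simp add: lift_def prod_power_distrib power_mult)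
    also have "\<dots> = (\<Prod>k\<in>UNIV. \<Prod>t\<le>N. z $ k ^ (expo i t k * a t))" by (rule prod.swap)
    finally show ?thesis by (simp add: power_sum)
  qed
  have lin: "int (\<Sum>t\<le>N. expo i t k * a t) = (B i *v (\<Sum>t\<le>N. int (a t) *s e t)) $ k - int (\<Sum>t\<le>N. a t) * (B i *v vtx i) $ k" for a k
  proof -
    have 1: "B i *v (\<Sum>t\<in>T. int (a t) *s e t) = (\<Sum>t\<in>T. int (a t) *s (B i *v e t))" if "finite T" for T
      using that by (induction T) (simp_all add: mv_simps)
    have "int (\<Sum>t\<le>N. expo i t k * a t) = (\<Sum>t\<le>N. int (a t) * (B i *v e t) $ k - int (a t) * (B i *v vtx i) $ k)"
      unfolding of_nat_sum by (intro sum.cong refl) (simp add: expo[OF i(1)] mv_simps algebra_simps)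
    thus ?thesis unfolding 1[OF finite_atMost] by (simp add: sum_subtractf sum_distrib_right)
  qed
  have "(\<Prod>t\<le>N. v t ^ a t) = (\<Prod>t\<le>N. v t ^ b t)" if v: "v \<in> emb p" and ab: "binomial_relation a b" for v a b
  proof -
    have ex: "(\<Sum>t\<le>N. expo i t k * a t) = (\<Sum>t\<le>N. expo i t k * b t)" for k
    proof -
      have "int (\<Sum>t\<le>N. expo i t k * a t) = int (\<Sum>t\<le>N. expo i t k * b t)"
        unfolding lin using ab unfolding binomial_relation_def by simp
      thus ?thesis by (simp only: of_nat_eq_iff)
    qed
    obtain c where c: "v = (\<lambda>t. c * lift i z t)" using v unfolding i(2) emb[OF i(1)] by (rule line_throughE)
    have vm: "(\<Prod>t\<le>N. v t ^ a t) = c ^ (\<Sum>t\<le>N. a t) * (\<Prod>t\<le>N. lift i z t ^ a t)" for a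
      unfolding c using hom_scale[OF hom_monomial[where N = N and a = a]] by simp
    have "(\<Sum>t\<le>N. a t) = (\<Sum>t\<le>N. b t)" using ab unfolding binomial_relation_def by blast
    thus ?thesis unfolding vm[of a] vm[of b] mono ex by simp
  qed
  thus ?thesis unfolding Y_def using emb_proj[OF assms] by blast
qed

text \<open>
  A point of \<open>Y\<close> whose coordinate at the vertex is scaled to one is determined by its
  coordinates at the neighbours: the expansion of \<open>e t - vtx i\<close> in the dual basis,
  with nonnegative coefficients \<open>expo i t k\<close>, is a binomial relation.
\<close>

lemma Y_chart:
  assumes P: "P \<in> Y" and v: "v \<in> P" "v (iv i) \<noteq> 0" and i: "i \<in> K"
  obtains z where "P = emb (tpt (B i) z)"
proof -
  define w where "w t = inverse (v (iv i)) * v t" for t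
  have Pp: "P \<in> proj_points N" using P unfolding Y_def by blast
  have w: "w \<in> P"
    unfolding proj_pointsD(1)[OF Pp v(1)] line_through_def w_def
    using v(2) by (intro CollectI exI[of _ "inverse (v (iv i))"]) auto
  have w1: "w (iv i) = 1" unfolding w_def using v(2) by simp
  define z :: "complex ^ 3" where "z = (\<chi> k. w (ib i k))"
  have "w t = lift i z t" for t
  proof (cases "t \<le> N")
    case True
    \<comment> \<open>The relation \<open>e t + (\<Sum>k. expo i t k) vtx i = (\<Sum>k. expo i t k nbr i k) +
      vtx i\<close>; the last summand on the right makes the degrees equal.\<close>
    define a where "a s = (if s = t then 1 else 0) + (if s = iv i then \<Sum>k\<in>UNIV. expo i t k else 0)" for s
    define b where "b s = (\<Sum>k\<in>UNIV. if s = ib i k then expo i t k else 0) + (if s = iv i then 1 else 0)" for s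
    have ivN: "iv i \<le> N" and ibN: "ib i k \<le> N" for k using iv(1)[OF i] ib(1)[OF i] .
    have "binomial_relation a b"
      unfolding binomial_relation_def
    proof
      have "(\<Sum>s\<le>N. a s) = 1 + (\<Sum>k\<in>UNIV. expo i t k)" unfolding a_def using True ivN by (simp add: sum.distrib)
      moreover have "(\<Sum>s\<le>N. \<Sum>k\<in>UNIV. if s = ib i k then expo i t k else 0) = (\<Sum>k\<in>UNIV. expo i t k)"
        by (subst sum.swap) (simp add: ibN)
      hence "(\<Sum>s\<le>N. b s) = (\<Sum>k\<in>UNIV. expo i t k) + 1" unfolding b_def using ivN by (simp add: sum.distrib)
      ultimately show "(\<Sum>s\<le>N. a s) = (\<Sum>s\<le>N. b s)" by simp
      have delta: "(\<Sum>s\<le>N. int (if s = u then n else 0) *s e s) = int n *s e u" if "u \<le> N" for u n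
      proof -
        have "(\<Sum>s\<le>N. int (if s = u then n else 0) *s e s) = (\<Sum>s\<le>N. if s = u then int n *s e s else 0)"
          by (intro sum.cong) auto
        thus ?thesis using that by simp
      qed
      have "(\<Sum>s\<le>N. int (a s) *s e s) = e t + int (\<Sum>k\<in>UNIV. expo i t k) *s vtx i"
        unfolding a_def of_nat_add vector_sadd_rdistrib sum.distrib delta[OF True] delta[OF ivN] iv(2)[OF i] by simp
      moreover have "(\<Sum>s\<le>N. int (b s) *s e s) = (\<Sum>k\<in>UNIV. int (expo i t k) *s nbr i k) + vtx i"
      proof -
        have "(\<Sum>s\<le>N. int (\<Sum>k\<in>UNIV. if s = ib i k then expo i t k else 0) *s e s) =
            (\<Sum>s\<le>N. \<Sum>k\<in>UNIV. int (if s = ib i k then expo i t k else 0) *s e s)"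
          by (intro sum.cong refl) (simp add: vec_eq_iff sum_distrib_right)
        also have "\<dots> = (\<Sum>k\<in>UNIV. int (expo i t k) *s nbr i k)"
          by (subst sum.swap) (simp only: delta[OF ibN] ib(2)[OF i])
        finally show ?thesis
          unfolding b_def of_nat_add vector_sadd_rdistrib sum.distrib delta[OF ivN] iv(2)[OF i] by simp
      qed
      moreover have "(\<Sum>k\<in>UNIV. int (expo i t k) *s nbr i k) =
          int (\<Sum>k\<in>UNIV. expo i t k) *s vtx i + (\<Sum>k\<in>UNIV. int (expo i t k) *s dual_vec (B i) k)"
        by (simp add: nbr_def vec_eq_iff distrib_left sum.distrib sum_distrib_right)
      moreover have "(\<Sum>k\<in>UNIV. int (expo i t k) *s dual_vec (B i) k) = e t - vtx i"
        unfolding expo[OF i True] by (rule dual_vec_expand[OF inv[OF i]])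
      ultimately show "(\<Sum>s\<le>N. int (a s) *s e s) = (\<Sum>s\<le>N. int (b s) *s e s)" by simp
    qed
    hence "(\<Prod>s\<le>N. w s ^ a s) = (\<Prod>s\<le>N. w s ^ b s)" using P w unfolding Y_def by blast
    moreover have "(\<Prod>s\<le>N. w s ^ a s) = w t"
      unfolding a_def power_add prod.distrib prod_power_delta[OF True] prod_power_delta[OF ivN] by (simp add: w1)
    moreover have "(\<Prod>s\<le>N. w s ^ b s) = (\<Prod>k\<in>UNIV. w (ib i k) ^ expo i t k)"
    proof -
      have "(\<Prod>s\<le>N. w s ^ b s) = (\<Prod>s\<le>N. \<Prod>k\<in>UNIV. w s ^ (if s = ib i k then expo i t k else 0))"
        unfolding b_def power_add prod.distrib prod_power_delta[OF ivN] power_sum by (simp add: w1)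
      also have "\<dots> = (\<Prod>k\<in>UNIV. w (ib i k) ^ expo i t k)"
        by (subst prod.swap) (simp only: prod_power_delta[OF ibN])
      finally show ?thesis .
    qed
    ultimately show ?thesis using True by (simp add: lift_def z_def)
  next
    case False
    thus ?thesis using proj_pointsD(3)[OF Pp w] by (simp add: lift_def)
  qed
  hence "w = lift i z" by blast
  hence "P = emb (tpt (B i) z)" using proj_pointsD(1)[OF Pp w] emb[OF i] by simp
  thus ?thesis by (rule that)
qed

text \<open>
  So \<open>Y\<close> is covered by the charts of \<open>Y_chart\<close>. If the coordinate at a
  neighbour of a vertex is nonzero, the binomial relation \<open>n nbr i k = (n - 1) vtx i + vtx
  j\<close> along the edge from \<open>vtx i\<close> to \<open>vtx j\<close> shows that the
  coordinate at \<open>vtx j\<close> is nonzero.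
\<close>

lemma Y_vertex:
  assumes P: "P \<in> Y" and v: "v \<in> P" shows "\<exists>i\<in>K. v (iv i) \<noteq> 0"
proof -
  have Pp: "P \<in> proj_points N" using P unfolding Y_def by blast
  obtain t where t: "t \<le> N" "v t \<noteq> 0" using proj_pointsD(2)[OF Pp v] by blast
  consider i where "i \<in> K" "e t = vtx i" | i k where "i \<in> K" "e t = nbr i k"
    using e_lattice[OF t(1)] unfolding lattice_pts_def by blast
  thus ?thesis
  proof cases
    case 1
    hence "t = iv i" using e_inject[OF t(1) iv(1)[OF 1(1)]] iv(2)[OF 1(1)] by simp
    thus ?thesis using 1(1) t(2) by blast
  next
    case 2
    obtain j n where j: "j \<in> K" "n > 0" "vtx j - vtx i = n *s dual_vec (B i) k" using edge_dual_vec[OF 2(1)] by metis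
    define m where "m = nat n"
    have m: "int m = n" "m > 0" unfolding m_def using j(2) by auto
    define a where "a s = (if s = t then m else 0)" for s
    define b where "b s = (if s = iv i then m - 1 else 0) + (if s = iv j then 1 else 0)" for s
    have N: "iv i \<le> N" "iv j \<le> N" using iv(1) 2(1) j(1) by auto
    have "binomial_relation a b"
      unfolding binomial_relation_def
    proof
      show "(\<Sum>s\<le>N. a s) = (\<Sum>s\<le>N. b s)" unfolding a_def b_def using t(1) N m(2) by (simp add: sum.distrib)
      have delta: "(\<Sum>s\<le>N. int (if s = u then n else 0) *s e s) = int n *s e u" if "u \<le> N" for u n
      proof -
        have "(\<Sum>s\<le>N. int (if s = u then n else 0) *s e s) = (\<Sum>s\<le>N. if s = u then int n *s e s else 0)"
          by (intro sum.cong) auto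
        thus ?thesis using that by simp
      qed
      have "(\<Sum>s\<le>N. int (a s) *s e s) = n *s nbr i k" unfolding a_def delta[OF t(1)] m(1) 2(2) ..
      moreover have "(\<Sum>s\<le>N. int (b s) *s e s) = (n - 1) *s vtx i + vtx j"
        unfolding b_def of_nat_add vector_sadd_rdistrib sum.distrib delta[OF N(1)] delta[OF N(2)] iv(2)[OF 2(1)] iv(2)[OF j(1)]
        using m by (simp add: of_nat_diff)
      moreover have "n *s nbr i k = (n - 1) *s vtx i + vtx j"
        using j(3) unfolding nbr_def by (simp add: vec_eq_iff algebra_simps)
      ultimately show "(\<Sum>s\<le>N. int (a s) *s e s) = (\<Sum>s\<le>N. int (b s) *s e s)" by simp
    qed
    hence "(\<Prod>s\<le>N. v s ^ a s) = (\<Prod>s\<le>N. v s ^ b s)" using P v unfolding Y_def by blast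
    moreover have "(\<Prod>s\<le>N. v s ^ a s) = v t ^ m" unfolding a_def by (rule prod_power_delta[OF t(1)])
    moreover have "(\<Prod>s\<le>N. v s ^ b s) = v (iv i) ^ (m - 1) * v (iv j)"
      unfolding b_def power_add prod.distrib prod_power_delta[OF N(1)] prod_power_delta[OF N(2)] by simp
    ultimately have "v (iv j) \<noteq> 0" using t(2) by auto
    thus ?thesis using j(1) by blast
  qed
qed

lemma emb_image: "emb ` points X = Y"
proof
  show "emb ` points X \<subseteq> Y" using emb_in_Y by blast
  show "Y \<subseteq> emb ` points X"
  proof
    fix P assume P: "P \<in> Y"
    then obtain v where v: "v \<in> P" using proj_points_ne unfolding Y_def by blast
    obtain i where i: "i \<in> K" "v (iv i) \<noteq> 0" using Y_vertex[OF P v] by blast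
    obtain z where "P = emb (tpt (B i) z)" by (rule Y_chart[OF P v i(2,1)])
    thus "P \<in> emb ` points X" using pt_in_points[OF i(1)] by blast
  qed
qed

lemma emb_inj: "inj_on emb (points X)"
proof (rule inj_onI)
  fix p q assume p: "p \<in> points X" and q: "q \<in> points X" and eq: "emb p = emb q"
  obtain i z where i: "i \<in> K" "p = tpt (B i) z" using p by (rule point_cases)
  obtain j y where j: "j \<in> K" "q = tpt (B j) y" using q by (rule point_cases)
  define J where "J = {k. y $ k = 0}"
  have "lift i z \<in> line_through (lift j y)" using lift_in_emb[OF i(1), of z] eq i j emb[OF j(1)] by simp
  then obtain c where c: "c \<noteq> 0" "lift i z = (\<lambda>t. c * lift j y t)" by (rule line_throughE)
  have "lift j y (iv i) \<noteq> 0" using c(2) lift_iv[OF i(1), of z] by (metis mult_zero_right zero_neq_one)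
  hence "snd (tpt (B j) y) (vtx i - vtx j) \<noteq> 0" using lift_snd[OF j(1) iv(1)[OF i(1)]] iv(2)[OF i(1)] by simp
  hence "(B j *v (vtx i - vtx j)) $ k = 0" if "k \<in> J" for k using that unfolding snd_tpt_nonzero_iff J_def by blast
  hence "\<exists>l. B j $ k = B i $ l" if "k \<in> J" for k using vtx_zero[OF j(1) i(1)] that by blast
  hence "{k \<in> J. \<exists>l\<in>UNIV. B j $ k = B i $ l} = J" by blast
  hence "fcone (B j) J = fcone (B j) J \<inter> fcone (B i) UNIV" using fcone_Int[OF j(1) i(1), of J UNIV] by simp
  also have "\<dots> = fcone (B i) {k \<in> UNIV. \<exists>l\<in>J. B i $ k = B j $ l}"
    using fcone_Int[OF i(1) j(1), of UNIV J] by (simp add: Int_commute)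
  finally have fst_q: "fst q = fcone (B i) {k \<in> UNIV. \<exists>l\<in>J. B i $ k = B j $ l}"
    by (simp add: j(2) tpt_def J_def)
  have "q \<in> toric_points Sig" using tpt_points[OF j(1)] j(2) by simp
  then obtain x where x: "q = tpt (B i) x" by (rule toric_point_in_chart[OF _ i(1) fst_q])
  have "lift i x \<in> line_through (lift i z)" using lift_in_emb[OF i(1), of x] eq x i emb[OF i(1)] by simp
  then obtain d where d: "lift i x = (\<lambda>t. d * lift i z t)" by (rule line_throughE)
  have "d = 1" using fun_cong[OF d, of "iv i"] lift_iv[OF i(1)] by simp
  hence "x $ k = z $ k" for k using fun_cong[OF d, of "ib i k"] lift_ib[OF i(1)] by simp
  hence "x = z" by (simp add: vec_eq_iff)
  thus "p = q" using i(2) x by simp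
qed

lemma emb_continuous: "continuous_map (Zar X) (Zar (projective_space N)) emb"
  unfolding Zar_proj continuous_on_generated_topo_iff
proof (intro conjI allI impI)
  fix U assume "U \<in> {nonzero_locus N F | F. \<exists>d. F \<in> hom_polys N d}"
  then obtain F d where F: "U = nonzero_locus N F" "F \<in> hom_polys N d" by blast
  show "openin (Zar X) (emb -` U \<inter> points X)"
  proof (rule openI)
    fix p assume p: "p \<in> emb -` U \<inter> points X"
    hence "p \<in> points X" by blast
    then obtain i z where i: "i \<in> K" "p = tpt (B i) z" by (rule point_cases)
    obtain P where P: "\<forall>z. F (lift i z) = ev P z" using pullback_poly[OF F(2) i(1)] by blast
    have iff: "emb (tpt (B i) w) \<in> U \<longleftrightarrow> ev P w \<noteq> 0" for w
      unfolding F(1) nonzero_locus_iff[OF F(2) emb_proj[OF pt_in_points[OF i(1)]] lift_in_emb[OF i(1)]] using P by simp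
    hence "ev P z \<noteq> 0" "\<forall>w. ev P w \<noteq> 0 \<longrightarrow> tpt (B i) w \<in> emb -` U \<inter> points X"
      using p i pt_in_points[OF i(1)] by auto
    thus "\<exists>i\<in>K. \<exists>z P. p = tpt (B i) z \<and> ev P z \<noteq> 0 \<and> (\<forall>w. ev P w \<noteq> 0 \<longrightarrow> tpt (B i) w \<in> emb -` U \<inter> points X)"
      using i by blast
  qed blast
next
  have "emb ` points X \<subseteq> points (projective_space N)" using emb_proj points_proj by blast
  thus "emb ` points X \<subseteq> \<Union>{nonzero_locus N F | F. \<exists>d. F \<in> hom_polys N d}" by (simp add: Zar_proj)
qed

lemma emb_chart_nbhd:
  assumes i: "i \<in> K" and P: "ev P z \<noteq> 0"
  obtains F d where "F \<in> hom_polys N d" "emb (tpt (B i) z) \<in> nonzero_locus N F"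
    "\<And>Q. Q \<in> Y \<Longrightarrow> Q \<in> nonzero_locus N F \<Longrightarrow> \<exists>w. Q = emb (tpt (B i) w) \<and> ev P w \<noteq> 0"
proof -
  obtain d F where F: "F \<in> hom_polys N d" "\<forall>z. F (lift i z) = ev P z" using homogenize[OF i] by metis
  have G: "(\<lambda>v. F v * v (iv i)) \<in> hom_polys N (d + 1)" by (rule hom_mult[OF F(1) hom_var[OF iv(1)[OF i]]])
  have iff: "emb (tpt (B i) w) \<in> nonzero_locus N (\<lambda>v. F v * v (iv i)) \<longleftrightarrow> ev P w \<noteq> 0" for w
    unfolding nonzero_locus_iff[OF G emb_proj[OF pt_in_points[OF i]] lift_in_emb[OF i]]
    using F(2) lift_iv[OF i] by simp
  have "\<exists>w. Q = emb (tpt (B i) w) \<and> ev P w \<noteq> 0" if Q: "Q \<in> Y" "Q \<in> nonzero_locus N (\<lambda>v. F v * v (iv i))" for Q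
  proof -
    obtain v where v: "v \<in> Q" using proj_points_ne Q(1) unfolding Y_def by blast
    hence "v (iv i) \<noteq> 0" using Q(2) unfolding nonzero_locus_def by auto
    then obtain w where "Q = emb (tpt (B i) w)" by (rule Y_chart[OF Q(1) v _ i])
    thus ?thesis using iff Q(2) by blast
  qed
  thus ?thesis using that[OF G] iff P by blast
qed

lemma emb_homeomorphic: "homeomorphic_map (Zar X) (subtopology (Zar (projective_space N)) Y) emb"
proof (rule bijective_open_imp_homeomorphic_map)
  show "continuous_map (Zar X) (subtopology (Zar (projective_space N)) Y) emb"
    using emb_continuous emb_in_Y by (auto simp: continuous_map_in_subtopology)
  show "emb ` points X = topspace (subtopology (Zar (projective_space N)) Y)"
    using emb_image closedin_subset[OF closed_Y] by (simp add: topspace_subtopology inf_absorb2)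
  show "inj_on emb (points X)" by (rule emb_inj)
  show "open_map (Zar X) (subtopology (Zar (projective_space N)) Y) emb"
    unfolding open_map_def
  proof (intro allI impI)
    fix W assume W: "openin (Zar X) W"
    show "openin (subtopology (Zar (projective_space N)) Y) (emb ` W)"
    proof (subst openin_subopen, intro ballI)
      fix q assume "q \<in> emb ` W"
      then obtain p where p: "p \<in> W" "q = emb p" by blast
      hence "p \<in> points X" using W openin_subset by blast
      then obtain i z where i: "i \<in> K" "p = tpt (B i) z" by (rule point_cases)
      obtain P where P: "ev P z \<noteq> 0" "\<forall>w. ev P w \<noteq> 0 \<longrightarrow> tpt (B i) w \<in> W"
        using openD[OF W i(1)] p(1) i(2) by blast
      obtain F d where F: "F \<in> hom_polys N d" "emb (tpt (B i) z) \<in> nonzero_locus N F"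
        "\<And>Q. Q \<in> Y \<Longrightarrow> Q \<in> nonzero_locus N F \<Longrightarrow> \<exists>w. Q = emb (tpt (B i) w) \<and> ev P w \<noteq> 0"
        using emb_chart_nbhd[OF i(1) P(1)] by metis
      have "openin (subtopology (Zar (projective_space N)) Y) (nonzero_locus N F \<inter> Y)"
        unfolding openin_subtopology using open_nonzero_locus[OF F(1)] by blast
      moreover have "q \<in> nonzero_locus N F \<inter> Y"
        using F(2) p(2) i(2) emb_in_Y[OF \<open>p \<in> points X\<close>] by simp
      moreover have "nonzero_locus N F \<inter> Y \<subseteq> emb ` W" using F(3) P(2) by blast
      ultimately show "\<exists>T. openin (subtopology (Zar (projective_space N)) Y) T \<and> q \<in> T \<and> T \<subseteq> emb ` W" by blast
    qed
  qed
qed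

text \<open>
  Homogeneous fractions pull back to fractions of polynomials. Conversely, a fraction of
  polynomials on a chart is homogenised; the additional power of the vertex coordinate makes the
  degrees equal and restricts the fraction to the part of \<open>Y\<close> described by the chart.
\<close>

lemma emb_regular:
  assumes V: "openin (subtopology (Zar (projective_space N)) Y) V"
  shows "f \<in> Reg (induced_space (projective_space N) Y) V \<longleftrightarrow> f \<circ> emb \<in> Reg X {p \<in> points X. emb p \<in> V}"
proof -
  define W where "W = {p \<in> points X. emb p \<in> V}"
  have VY: "V \<subseteq> Y" using openin_subset[OF V] by (simp add: topspace_subtopology)
  have "continuous_map (Zar X) (subtopology (Zar (projective_space N)) Y) emb"
    using emb_homeomorphic homeomorphic_imp_continuous_map by blast
  hence W: "openin (Zar X) W" unfolding W_def using V by (rule openin_continuous_map_preimage)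
  have ind: "f \<in> Reg (induced_space (projective_space N) Y) V \<longleftrightarrow> (\<forall>q\<in>V. \<exists>U g. openin (Zar (projective_space N)) U \<and>
      q \<in> U \<and> g \<in> Reg (projective_space N) U \<and> (\<forall>q\<in>U \<inter> V. f q = g q))"
    by (simp add: induced_space_def)
  show ?thesis unfolding W_def[symmetric]
  proof
    assume f: "f \<in> Reg (induced_space (projective_space N) Y) V"
    show "f \<circ> emb \<in> Reg X W"
    proof (rule regI[OF W])
      fix p assume p: "p \<in> W"
      hence "p \<in> points X" "emb p \<in> V" unfolding W_def by auto
      then obtain i z where i: "i \<in> K" "p = tpt (B i) z" by (metis point_cases)
      obtain U g where U: "openin (Zar (projective_space N)) U" "emb p \<in> U" "g \<in> Reg (projective_space N) U"
        "\<forall>q\<in>U \<inter> V. f q = g q" using f \<open>emb p \<in> V\<close> unfolding ind by blast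
      obtain d G H where GH: "G \<in> hom_polys N d" "H \<in> hom_polys N d" "\<forall>v\<in>emb p. H v \<noteq> 0"
        "\<forall>Q\<in>U. \<forall>v\<in>Q. H v \<noteq> 0 \<longrightarrow> g Q = G v / H v" using U(2,3) unfolding Reg_proj by blast
      obtain G' where G': "\<forall>z. G (lift i z) = ev G' z" using pullback_poly[OF GH(1) i(1)] by blast
      obtain H' where H': "\<forall>z. H (lift i z) = ev H' z" using pullback_poly[OF GH(2) i(1)] by blast
      have "openin (Zar X) {p \<in> points X. emb p \<in> U}"
        using emb_continuous U(1) by (rule openin_continuous_map_preimage)
      moreover have "tpt (B i) z \<in> {p \<in> points X. emb p \<in> U}" using U(2) \<open>p \<in> points X\<close> i(2) by simp
      ultimately obtain P where P: "ev P z \<noteq> 0" "\<forall>w. ev P w \<noteq> 0 \<longrightarrow> tpt (B i) w \<in> {p \<in> points X. emb p \<in> U}"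
        using openD[OF _ i(1)] by blast
      have "H (lift i z) \<noteq> 0" using GH(3) lift_in_emb[OF i(1), of z] i(2) by simp
      hence "ev (H' * P) z \<noteq> 0" using H' P(1) by simp
      moreover have "(f \<circ> emb) (tpt (B i) w) = ev (G' * P) w / ev (H' * P) w"
        if w: "tpt (B i) w \<in> W" "ev (H' * P) w \<noteq> 0" for w
      proof -
        have "emb (tpt (B i) w) \<in> U" using P(2) w(2) by auto
        moreover have "emb (tpt (B i) w) \<in> V" using w(1) unfolding W_def by blast
        moreover have "H (lift i w) \<noteq> 0" using H' w(2) by simp
        ultimately have "f (emb (tpt (B i) w)) = G (lift i w) / H (lift i w)"
          using U(4) GH(4) lift_in_emb[OF i(1), of w] by (metis IntI)
        thus ?thesis using G' H' w(2) by simp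
      qed
      ultimately show "\<exists>i\<in>K. \<exists>z G H. p = tpt (B i) z \<and> ev H z \<noteq> 0 \<and>
          (\<forall>w. tpt (B i) w \<in> W \<longrightarrow> ev H w \<noteq> 0 \<longrightarrow> (f \<circ> emb) (tpt (B i) w) = ev G w / ev H w)"
        using i by blast
    qed
  next
    assume f: "f \<circ> emb \<in> Reg X W"
    show "f \<in> Reg (induced_space (projective_space N) Y) V"
      unfolding ind
    proof
      fix q assume q: "q \<in> V"
      then obtain p where p: "p \<in> points X" "q = emb p" using VY emb_image by blast
      hence pW: "p \<in> W" using q unfolding W_def by blast
      obtain i z where i: "i \<in> K" "p = tpt (B i) z" using p(1) by (rule point_cases)
      obtain G H where GH: "ev H z \<noteq> 0" "\<forall>w. tpt (B i) w \<in> W \<longrightarrow> ev H w \<noteq> 0 \<longrightarrow> (f \<circ> emb) (tpt (B i) w) = ev G w / ev H w"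
        using regD[OF W f i(1)] pW i(2) by blast
      obtain d1 G1 where G1: "G1 \<in> hom_polys N d1" "\<forall>z. G1 (lift i z) = ev G z" using homogenize[OF i(1)] by metis
      obtain d2 H1 where H1: "H1 \<in> hom_polys N d2" "\<forall>z. H1 (lift i z) = ev H z" using homogenize[OF i(1)] by metis
      define d where "d = d1 + d2 + 1"
      define Gh where "Gh v = G1 v * v (iv i) ^ (d2 + 1)" for v :: "nat \<Rightarrow> complex"
      define Hh where "Hh v = H1 v * v (iv i) ^ (d1 + 1)" for v :: "nat \<Rightarrow> complex"
      have Gh: "Gh \<in> hom_polys N d"
        using hom_mult[OF G1(1) hom_power[OF iv(1)[OF i(1)]], of "d2 + 1"] unfolding Gh_def[abs_def] d_def by (simp add: add_ac)
      have Hh: "Hh \<in> hom_polys N d"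
        using hom_mult[OF H1(1) hom_power[OF iv(1)[OF i(1)]], of "d1 + 1"] unfolding Hh_def[abs_def] d_def by (simp add: add_ac)
      have lifts: "Gh (lift i w) = ev G w" "Hh (lift i w) = ev H w" for w
        unfolding Gh_def Hh_def using G1(2) H1(2) lift_iv[OF i(1)] by auto
      define U where "U = nonzero_locus N Hh"
      define g where "g Q = (SOME c. \<exists>v\<in>Q. c = Gh v / Hh v)" for Q
      have g: "g Q = Gh v / Hh v" if Q: "Q \<in> proj_points N" "v \<in> Q" for Q v
      proof -
        have "\<exists>c. \<exists>v\<in>Q. c = Gh v / Hh v" using Q(2) by blast
        hence "\<exists>v\<in>Q. g Q = Gh v / Hh v" unfolding g_def by (rule someI_ex)
        then obtain w where w: "w \<in> Q" "g Q = Gh w / Hh w" by blast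
        thus ?thesis using ratio_constant[OF Gh Hh Q(1) w(1) Q(2)] by simp
      qed
      have UP: "Q \<in> proj_points N" if "Q \<in> U" for Q using that unfolding U_def nonzero_locus_def by blast
      have "g \<in> Reg (projective_space N) U"
        unfolding Reg_proj
      proof
        fix P assume P: "P \<in> U"
        have "\<forall>v\<in>P. Hh v \<noteq> 0" using P unfolding U_def nonzero_locus_def by blast
        moreover have "\<forall>Q\<in>U. \<forall>v\<in>Q. Hh v \<noteq> 0 \<longrightarrow> g Q = Gh v / Hh v" using g UP by blast
        ultimately show "\<exists>d. \<exists>G\<in>hom_polys N d. \<exists>H\<in>hom_polys N d. (\<forall>v\<in>P. H v \<noteq> 0) \<and>
            (\<forall>Q\<in>U. \<forall>v\<in>Q. H v \<noteq> 0 \<longrightarrow> g Q = G v / H v)" using Gh Hh by blast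
      qed
      moreover have "q \<in> U"
        unfolding U_def p(2) i(2) nonzero_locus_iff[OF Hh emb_proj[OF pt_in_points[OF i(1)]] lift_in_emb[OF i(1)]]
        using lifts GH(1) by simp
      moreover have "f Q = g Q" if Q: "Q \<in> U \<inter> V" for Q
      proof -
        have QY: "Q \<in> Y" using Q VY by blast
        obtain v where v: "v \<in> Q" using proj_points_ne UP Q by blast
        have "Hh v \<noteq> 0" using Q v unfolding U_def nonzero_locus_def by blast
        hence "v (iv i) \<noteq> 0" unfolding Hh_def by auto
        then obtain w where w: "Q = emb (tpt (B i) w)" by (rule Y_chart[OF QY v _ i(1)])
        have wW: "tpt (B i) w \<in> W" unfolding W_def using pt_in_points[OF i(1)] Q w by blast
        have "Hh (lift i w) \<noteq> 0" using Q lift_in_emb[OF i(1), of w] w unfolding U_def nonzero_locus_def by blast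
        hence "f Q = ev G w / ev H w" using GH(2) wW w lifts by simp
        also have "\<dots> = g Q" using g[OF UP lift_in_emb[OF i(1), of w, folded w]] Q lifts by simp
        finally show ?thesis .
      qed
      moreover have "openin (Zar (projective_space N)) U" unfolding U_def by (rule open_nonzero_locus[OF Hh])
      ultimately show "\<exists>U g. openin (Zar (projective_space N)) U \<and> q \<in> U \<and> g \<in> Reg (projective_space N) U \<and>
          (\<forall>q\<in>U \<inter> V. f q = g q)" by blast
    qed
  qed
qed

lemma irreducible_Y: "irreducible_in (Zar (projective_space N)) Y"
proof (rule irreducible_inI)
  show "Y \<subseteq> points (projective_space N)" using closed_Y closedin_subset by blast
  obtain i where "i \<in> K" using K_ne by blast
  thus "Y \<noteq> {}" using emb_in_Y pt_in_points by blast
  fix A C assume A: "openin (Zar (projective_space N)) A" "Y \<inter> A \<noteq> {}" and C: "openin (Zar (projective_space N)) C" "Y \<inter> C \<noteq> {}"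
  have op: "openin (Zar X) {p \<in> points X. emb p \<in> A}" "openin (Zar X) {p \<in> points X. emb p \<in> C}"
    using openin_continuous_map_preimage[OF emb_continuous] A(1) C(1) by auto
  have ne: "{p \<in> points X. emb p \<in> A} \<noteq> {}" if A: "Y \<inter> A \<noteq> {}" for A
  proof -
    obtain q where "q \<in> Y" "q \<in> A" using A by blast
    moreover from this obtain p where "p \<in> points X" "q = emb p" using emb_image by blast
    ultimately show ?thesis by blast
  qed
  have "{p \<in> points X. emb p \<in> A} \<noteq> {}" "{p \<in> points X. emb p \<in> C} \<noteq> {}"
    using ne A(2) C(2) by simp_all
  hence "{p \<in> points X. emb p \<in> A} \<inter> {p \<in> points X. emb p \<in> C} \<noteq> {}" by (rule opens_meet[OF op])
  thus "Y \<inter> A \<inter> C \<noteq> {}" using emb_in_Y by blast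
qed

lemma projective: "projective_variety X"
  unfolding projective_variety_def
proof (intro exI conjI)
  show "closedin (Zar (projective_space N)) Y" by (rule closed_Y)
  show "irreducible_in (Zar (projective_space N)) Y" by (rule irreducible_Y)
  show "fun_space_iso X (induced_space (projective_space N) Y) emb"
    unfolding fun_space_iso_def
  proof (intro conjI allI impI)
    have Zar: "Zar (induced_space (projective_space N) Y) = subtopology (Zar (projective_space N)) Y"
      by (simp add: induced_space_def)
    show "homeomorphic_map (Zar X) (Zar (induced_space (projective_space N) Y)) emb"
      unfolding Zar by (rule emb_homeomorphic)
    fix V f assume "openin (Zar (induced_space (projective_space N) Y)) V"
    thus "f \<in> Reg (induced_space (projective_space N) Y) V \<longleftrightarrow> f \<circ> emb \<in> Reg X {p \<in> points X. emb p \<in> V}"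
      unfolding Zar by (rule emb_regular)
  qed
qed

end

theorem (in toric_polytope) projective: "projective_variety X"
proof -
  obtain e where e: "bij_betw e {0..<card lattice_pts} lattice_pts"
    using ex_bij_betw_nat_finite[OF finite_lattice_pts] by blast
  have "lattice_pts \<noteq> {}" unfolding lattice_pts_def using K_ne by blast
  hence "card lattice_pts \<noteq> 0" using finite_lattice_pts by simp
  hence "{0..<card lattice_pts} = {..card lattice_pts - 1}" by auto
  then interpret toric_embedding K B vtx "card lattice_pts - 1" e
    using e by unfold_locales simp
  show ?thesis by (rule projective)
qed

section \<open>Minimal cones containing a point\<close>

context smooth_polytope
begin

text \<open>
  For a point \<open>x\<close> of the cone of \<open>i\<close>, these rows span the face that
  contains \<open>x\<close> in its relative interior.
\<close>

definition support :: "'i \<Rightarrow> real ^ 'n \<Rightarrow> 'n set" where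
  "support i x = {k. coord (B i) k x > 0}"

lemma mem_support_cone: "i \<in> K \<Longrightarrow> x \<in> fcone (B i) UNIV \<Longrightarrow> x \<in> fcone (B i) (support i x)"
  unfolding fcone_iff[OF inv] support_def by (auto simp: less_eq_real_def)

lemma support_cone_least:
  assumes i: "i \<in> K" and j: "j \<in> K" and x: "x \<in> fcone (B i) UNIV" "x \<in> fcone (B j) J"
  shows "fcone (B i) (support i x) \<subseteq> fcone (B j) J"
proof -
  have "x \<in> fcone (B i) {k \<in> UNIV. \<exists>l\<in>J. B i $ k = B j $ l}"
    using x fcone_Int[OF i j, of UNIV J] by blast
  hence "support i x \<subseteq> {k \<in> UNIV. \<exists>l\<in>J. B i $ k = B j $ l}"
    unfolding support_def fcone_iff[OF inv[OF i]] by force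
  hence "fcone (B i) (support i x) \<subseteq> fcone (B i) {k \<in> UNIV. \<exists>l\<in>J. B i $ k = B j $ l}"
    using fcone_subset_iff[OF inv[OF i]] by blast
  thus ?thesis using fcone_Int[OF i j, of UNIV J] by blast
qed

text \<open>
  For a row \<open>k\<close> outside of the support of \<open>x\<close>, the cone across the facet
  opposite to the \<open>k\<close>-th ray also contains \<open>x\<close>. The two cones meet in
  this facet only, so the \<open>k\<close>-th coordinate of \<open>y\<close> vanishes.
\<close>

lemma Inter_maximal_cones:
  assumes i: "i \<in> K" and x: "x \<in> fcone (B i) UNIV"
    and y: "\<And>j. j \<in> K \<Longrightarrow> x \<in> fcone (B j) UNIV \<Longrightarrow> y \<in> fcone (B j) UNIV"
  shows "y \<in> fcone (B i) (support i x)"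
proof -
  have yi: "y \<in> fcone (B i) UNIV" by (rule y[OF i x])
  have "coord (B i) k y = 0" if k: "k \<notin> support i x" for k
  proof -
    obtain j e where j: "j \<in> K" "e > 0" "B i *v (vtx j - vtx i) = axis k e" using edge[OF i] by blast
    have rows: "(\<exists>l. B i $ h = B j $ l) \<longleftrightarrow> h \<noteq> k" for h
      using vtx_zero_iff[OF i j(1), of h] j(2) unfolding j(3) by (auto simp: axis_def)
    have Int: "fcone (B i) UNIV \<inter> fcone (B j) UNIV = fcone (B i) (- {k})"
      using fcone_Int[OF i j(1), of UNIV UNIV] rows by (simp add: Compl_eq)
    have "fcone (B i) (support i x) \<subseteq> fcone (B i) (- {k})"
      using k fcone_subset_iff[OF inv[OF i]] by blast
    hence "x \<in> fcone (B j) UNIV" using mem_support_cone[OF i x] Int by blast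
    hence "y \<in> fcone (B i) (- {k})" using y[OF j(1)] yi Int by blast
    thus ?thesis unfolding fcone_iff[OF inv[OF i]] by blast
  qed
  thus ?thesis using yi unfolding fcone_iff[OF inv[OF i]] by blast
qed

end

section \<open>The fan of the combinatorial quotient\<close>

text \<open>
  Multiplying the adjugate matrix by the determinant, which is its own inverse, gives the inverse.
\<close>

lemma unimodular_invertible:
  fixes B :: "int ^ 3 ^ 3"
  assumes "\<bar>det B\<bar> = 1" shows "invertible B"
proof -
  have d: "det B * det B = 1" using assms by (auto simp: abs_if split: if_splits)
  define A :: "int ^ 3 ^ 3" where "A = vector
    [vector [B$2$2 * B$3$3 - B$2$3 * B$3$2, B$1$3 * B$3$2 - B$1$2 * B$3$3, B$1$2 * B$2$3 - B$1$3 * B$2$2],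
     vector [B$2$3 * B$3$1 - B$2$1 * B$3$3, B$1$1 * B$3$3 - B$1$3 * B$3$1, B$1$3 * B$2$1 - B$1$1 * B$2$3],
     vector [B$2$1 * B$3$2 - B$2$2 * B$3$1, B$1$2 * B$3$1 - B$1$1 * B$3$2, B$1$1 * B$2$2 - B$1$2 * B$2$1]]"
  have A: "B ** A = mat (det B)" "A ** B = mat (det B)"
    unfolding A_def by (simp_all add: vec_eq_iff forall_3 matrix_matrix_mult_def sum_3 mat_def det_3 algebra_simps)
  define C where "C = (\<chi> i j. det B * A $ i $ j)"
  have "(B ** C) $ i $ j = det B * (B ** A) $ i $ j" "(C ** B) $ i $ j = det B * (A ** B) $ i $ j" for i j
    by (simp_all add: C_def matrix_matrix_mult_def sum_distrib_left mult_ac)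
  hence "B ** C = mat 1" "C ** B = mat 1" unfolding A vec_eq_iff by (simp_all add: mat_def d)
  thus ?thesis unfolding invertible_def by blast
qed

text \<open>
  The numbers of the three rays of a maximal cone and the corresponding vertex of the polytope.
  Tuples of numerals make the conditions on the table decidable by rewriting.
\<close>

type_synonym cone_data = "(nat \<times> nat \<times> nat) \<times> (int \<times> int \<times> int)"

definition vec3 :: "int \<times> int \<times> int \<Rightarrow> int ^ 3" where
  "vec3 = (\<lambda>(x, y, z). vector [x, y, z])"

definition dot3 :: "int \<times> int \<times> int \<Rightarrow> int \<times> int \<times> int \<Rightarrow> int" where
  "dot3 = (\<lambda>(x, y, z) (x', y', z'). x * x' + y * y' + z * z')"

definition ray_coords :: "nat \<Rightarrow> int \<times> int \<times> int" where
  "ray_coords n = [(-1, 0, -1), (-1, -1, -1), (0, -1, -1), (1, 0, 0), (0, 1, 0), (0, 0, 1), (0, 0, -1)] ! n"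

text \<open>
  The vertices are those of the polytope given by \<open>x, y, z \<ge> 0\<close>, \<open>z \<le>
  2\<close>, \<open>x + z \<le> 3\<close>, \<open>y + z \<le> 3\<close> and \<open>x + y + z \<le>
  5\<close>, whose inner normals are the seven rays.
\<close>

definition cone_table :: "cone_data set" where
  "cone_table = {((0, 1, 2), (2, 2, 1)), ((0, 1, 5), (3, 2, 0)), ((0, 2, 6), (1, 1, 2)), ((0, 4, 5), (3, 0, 0)),
     ((0, 4, 6), (1, 0, 2)), ((1, 2, 5), (2, 3, 0)), ((2, 3, 5), (0, 3, 0)), ((2, 3, 6), (0, 1, 2)),
     ((3, 4, 5), (0, 0, 0)), ((3, 4, 6), (0, 0, 2))}"

definition cone_rows :: "cone_data \<Rightarrow> int ^ 3 ^ 3" where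
  "cone_rows = (\<lambda>((a, b, c), v). vector [vec3 (ray_coords a), vec3 (ray_coords b), vec3 (ray_coords c)])"

definition cone_vtx :: "cone_data \<Rightarrow> int ^ 3" where
  "cone_vtx i = vec3 (snd i)"

lemma ray_coords_simps [simp]:
  "ray_coords 0 = (-1, 0, -1)" "ray_coords (Suc 0) = (-1, -1, -1)" "ray_coords 1 = (-1, -1, -1)" "ray_coords 2 = (0, -1, -1)"
  "ray_coords 3 = (1, 0, 0)" "ray_coords 4 = (0, 1, 0)" "ray_coords 5 = (0, 0, 1)" "ray_coords 6 = (0, 0, -1)"
  by (simp_all add: ray_coords_def eval_nat_numeral)

lemma vec3_nth [simp]: "vec3 (x, y, z) $ 1 = x" "vec3 (x, y, z) $ 2 = y" "vec3 (x, y, z) $ 3 = z"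
  by (simp_all add: vec3_def)

lemma cone_rows_nth [simp]:
  "cone_rows ((a, b, c), v) $ 1 = vec3 (ray_coords a)" "cone_rows ((a, b, c), v) $ 2 = vec3 (ray_coords b)"
  "cone_rows ((a, b, c), v) $ 3 = vec3 (ray_coords c)"
  by (simp_all add: cone_rows_def)

lemma row_diff: "(A *v (vec3 w - vec3 v)) $ k = dot3 u w - dot3 u v" if "A $ k = vec3 u" for A :: "int ^ 3 ^ 3"
  using that by (cases u; cases v; cases w) (simp add: matrix_vector_mult_def sum_3 dot3_def algebra_simps)

lemma table_convex:
  "\<forall>((a, b, c), v)\<in>cone_table. \<forall>((a', b', c'), w)\<in>cone_table. \<forall>n\<in>{a, b, c}.
     0 \<le> dot3 (ray_coords n) w - dot3 (ray_coords n) v \<and>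
     (dot3 (ray_coords n) w - dot3 (ray_coords n) v = 0 \<longrightarrow> n \<in> {a', b', c'})"
  by code_simp

text \<open>
  The edge from \<open>v\<close> to \<open>w\<close> leaves the facet of \<open>p\<close> and runs
  inside the facets of \<open>q\<close> and \<open>r\<close>.
\<close>

lemma table_edges:
  "\<forall>((a, b, c), v)\<in>cone_table. \<forall>(p, q, r)\<in>{(a, b, c), (b, a, c), (c, a, b)}. \<exists>(t, w)\<in>cone_table.
     0 < dot3 (ray_coords p) w - dot3 (ray_coords p) v \<and>
     dot3 (ray_coords q) w - dot3 (ray_coords q) v = 0 \<and> dot3 (ray_coords r) w - dot3 (ray_coords r) v = 0"
  by code_simp

lemma table_unimodular: "i \<in> cone_table \<Longrightarrow> \<bar>det (cone_rows i)\<bar> = 1"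
  unfolding cone_table_def by (auto simp: det_3)

interpretation quotient: toric_polytope cone_table cone_rows cone_vtx
proof
  show "finite cone_table" "cone_table \<noteq> {}" by (auto simp: cone_table_def)
  show "invertible (cone_rows i)" if "i \<in> cone_table" for i
    using unimodular_invertible[OF table_unimodular[OF that]] .
next
  fix i j :: cone_data and k :: 3 assume ij: "i \<in> cone_table" "j \<in> cone_table"
  obtain a b c v where i: "i = ((a, b, c), v)" by (cases i) auto
  obtain a' b' c' w where j: "j = ((a', b', c'), w)" by (cases j) auto
  define n where "n = (if k = 1 then a else if k = 2 then b else c)"
  have n: "n \<in> {a, b, c}" "cone_rows i $ k = vec3 (ray_coords n)"
    unfolding n_def i using exhaust_3[of k] by auto
  have eq: "(cone_rows i *v (cone_vtx j - cone_vtx i)) $ k = dot3 (ray_coords n) w - dot3 (ray_coords n) v"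
    using row_diff[OF n(2), of w v] by (simp add: cone_vtx_def i j)
  have tab: "0 \<le> dot3 (ray_coords n) w - dot3 (ray_coords n) v \<and>
     (dot3 (ray_coords n) w - dot3 (ray_coords n) v = 0 \<longrightarrow> n \<in> {a', b', c'})"
    using table_convex ij n(1) unfolding i j by fast
  show "0 \<le> (cone_rows i *v (cone_vtx j - cone_vtx i)) $ k" unfolding eq using tab by blast
  assume "(cone_rows i *v (cone_vtx j - cone_vtx i)) $ k = 0"
  hence "n \<in> {a', b', c'}" unfolding eq using tab by blast
  hence "cone_rows i $ k = cone_rows j $ 1 \<or> cone_rows i $ k = cone_rows j $ 2 \<or> cone_rows i $ k = cone_rows j $ 3"
    using n(2) j by auto
  thus "\<exists>l. cone_rows i $ k = cone_rows j $ l" by blast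
next
  fix i :: cone_data and k :: 3 assume i: "i \<in> cone_table"
  obtain a b c v where i': "i = ((a, b, c), v)" by (cases i) auto
  define p q r where "p = (if k = 1 then a else if k = 2 then b else c)"
    and "q = (if k = 1 then b else a)" and "r = (if k = 3 then b else c)"
  have "(p, q, r) \<in> {(a, b, c), (b, a, c), (c, a, b)}" unfolding p_def q_def r_def using exhaust_3[of k] by auto
  then obtain t w where w: "(t, w) \<in> cone_table" "0 < dot3 (ray_coords p) w - dot3 (ray_coords p) v"
     "dot3 (ray_coords q) w - dot3 (ray_coords q) v = 0" "dot3 (ray_coords r) w - dot3 (ray_coords r) v = 0"
    using table_edges i unfolding i' by fast
  have diff: "(cone_rows i *v (cone_vtx (t, w) - cone_vtx i)) $ 1 = dot3 (ray_coords a) w - dot3 (ray_coords a) v"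
    "(cone_rows i *v (cone_vtx (t, w) - cone_vtx i)) $ 2 = dot3 (ray_coords b) w - dot3 (ray_coords b) v"
    "(cone_rows i *v (cone_vtx (t, w) - cone_vtx i)) $ 3 = dot3 (ray_coords c) w - dot3 (ray_coords c) v"
    by (simp_all add: cone_vtx_def i' row_diff)
  have "cone_rows i *v (cone_vtx (t, w) - cone_vtx i) = axis k (dot3 (ray_coords p) w - dot3 (ray_coords p) v)"
    unfolding vec_eq_iff forall_3 diff
    using exhaust_3[of k] w(3,4) by (auto simp: axis_def p_def q_def r_def)
  thus "\<exists>j\<in>cone_table. \<exists>e>0. cone_rows i *v (cone_vtx j - cone_vtx i) = axis k e" using w(1,2) by blast
qed

definition ray :: "nat \<Rightarrow> real ^ 3" where
  "ray n = real_vec (vec3 (ray_coords n))"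

lemma ray_nth:
  "ray n $ 1 = (case ray_coords n of (x, y, z) \<Rightarrow> x)" "ray n $ 2 = (case ray_coords n of (x, y, z) \<Rightarrow> y)"
  "ray n $ 3 = (case ray_coords n of (x, y, z) \<Rightarrow> z)"
  by (cases "ray_coords n"; simp add: ray_def real_vec_def)+

lemma ray_relations:
  "ray 1 + ray 3 = ray 2" "ray 1 + ray 4 = ray 0" "ray 0 + ray 3 = ray 6" "ray 2 + ray 4 = ray 6"
  "ray 5 + ray 6 = 0" "ray 0 + ray 2 + ray 5 = ray 1"
  by (simp_all add: vec_eq_iff forall_3 ray_nth)

definition cone3 :: "nat \<Rightarrow> nat \<Rightarrow> nat \<Rightarrow> (real ^ 3) set" where
  "cone3 a b c = {x. \<exists>p q r. 0 \<le> p \<and> 0 \<le> q \<and> 0 \<le> r \<and> x = p *\<^sub>R ray a + q *\<^sub>R ray b + r *\<^sub>R ray c}"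

lemma fcone_rows: "fcone (cone_rows ((a, b, c), v)) UNIV = cone3 a b c"
proof (intro set_eqI iffI)
  fix x assume "x \<in> fcone (cone_rows ((a, b, c), v)) UNIV"
  then obtain f where f: "\<forall>k. 0 \<le> f k" "x = (\<Sum>k\<in>UNIV. f k *\<^sub>R real_vec (cone_rows ((a, b, c), v) $ k))"
    unfolding fcone_def by blast
  have "x = f 1 *\<^sub>R ray a + f 2 *\<^sub>R ray b + f 3 *\<^sub>R ray c" unfolding f(2) by (simp add: sum_3 ray_def)
  thus "x \<in> cone3 a b c" unfolding cone3_def using f(1) by blast
next
  fix x assume "x \<in> cone3 a b c"
  then obtain p q r where "0 \<le> p" "0 \<le> q" "0 \<le> r" "x = p *\<^sub>R ray a + q *\<^sub>R ray b + r *\<^sub>R ray c"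
    unfolding cone3_def by blast
  thus "x \<in> fcone (cone_rows ((a, b, c), v)) UNIV" unfolding fcone_def
    by (intro CollectI exI[of _ "\<lambda>k :: 3. if k = 1 then p else if k = 2 then q else r"]) (simp add: sum_3 ray_def)
qed

definition cone_closed :: "(real ^ 3) set \<Rightarrow> bool" where
  "cone_closed T \<longleftrightarrow> 0 \<in> T \<and> (\<forall>x\<in>T. \<forall>y\<in>T. x + y \<in> T) \<and> (\<forall>x\<in>T. \<forall>t\<ge>0. t *\<^sub>R x \<in> T)"

lemma cone_closed_add: "cone_closed T \<Longrightarrow> x \<in> T \<Longrightarrow> y \<in> T \<Longrightarrow> x + y \<in> T"
  and cone_closed_scale: "cone_closed T \<Longrightarrow> x \<in> T \<Longrightarrow> 0 \<le> t \<Longrightarrow> t *\<^sub>R x \<in> T"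
  by (simp_all add: cone_closed_def)

definition expansion :: "(real ^ 3) set \<Rightarrow> real ^ 3 \<Rightarrow> (nat \<Rightarrow> real) \<Rightarrow> bool" where
  "expansion T x f \<longleftrightarrow> (\<forall>n. 0 \<le> f n) \<and> (\<forall>n\<le>6. f n > 0 \<longrightarrow> ray n \<in> T) \<and>
     x = f 0 *\<^sub>R ray 0 + f 1 *\<^sub>R ray 1 + f 2 *\<^sub>R ray 2 + f 3 *\<^sub>R ray 3 + f 4 *\<^sub>R ray 4 + f 5 *\<^sub>R ray 5 + f 6 *\<^sub>R ray 6"

lemma le_6_cases: "(n::nat) \<le> 6 \<Longrightarrow> n = 0 \<or> n = 1 \<or> n = 2 \<or> n = 3 \<or> n = 4 \<or> n = 5 \<or> n = 6"
  by arith

text \<open>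
  Replacing \<open>ray a + ray b\<close> by \<open>ray c\<close> as often as possible leaves at
  least one of the coefficients of \<open>a\<close> and \<open>b\<close> zero, and the new ray
  \<open>c\<close> is in \<open>T\<close> if it is used, as \<open>T\<close> is closed under
  addition.
\<close>

lemma straighten_pair:
  assumes T: "cone_closed T" and f: "expansion T x f" and abc: "(a, b, c) \<in> {(1, 3, 2), (1, 4, 0), (0, 3, 6), (2, 4, 6)}"
  shows "expansion T x (f(a := f a - min (f a) (f b), b := f b - min (f a) (f b), c := f c + min (f a) (f b)))"
    (is "expansion T x ?g")
proof -
  have rel: "ray c = ray a + ray b" using abc ray_relations by auto
  have nn: "0 \<le> f n" for n using f unfolding expansion_def by blast
  have le: "a \<le> 6" "b \<le> 6" "c \<le> 6" using abc by auto
  have T': "n \<le> 6 \<Longrightarrow> f n > 0 \<Longrightarrow> ray n \<in> T" for n using f unfolding expansion_def by blast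
  have "ray n \<in> T" if n: "n \<le> 6" "?g n > 0" for n
  proof (cases "f n > 0")
    case True thus ?thesis using T' n by blast
  next
    case False
    hence "f n = 0" using nn[of n] by simp
    have "n = c"
    proof (rule ccontr)
      assume "n \<noteq> c"
      hence "?g n \<le> f n" using nn[of a] nn[of b] by auto
      thus False using n(2) \<open>f n = 0\<close> by simp
    qed
    hence "min (f a) (f b) > 0" using n(2) \<open>f n = 0\<close> by simp
    hence "ray a \<in> T" "ray b \<in> T" using T' le by auto
    thus ?thesis using T \<open>n = c\<close> rel unfolding cone_closed_def by simp
  qed
  moreover have "0 \<le> ?g n" for n using nn[of n] nn[of a] nn[of b] nn[of c] by auto
  moreover have "x = ?g 0 *\<^sub>R ray 0 + ?g 1 *\<^sub>R ray 1 + ?g 2 *\<^sub>R ray 2 + ?g 3 *\<^sub>R ray 3 + ?g 4 *\<^sub>R ray 4 + ?g 5 *\<^sub>R ray 5 + ?g 6 *\<^sub>R ray 6"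
  proof -
    define m where "m = min (f a) (f b)"
    have x: "x = f 0 *\<^sub>R ray 0 + f 1 *\<^sub>R ray 1 + f 2 *\<^sub>R ray 2 + f 3 *\<^sub>R ray 3 + f 4 *\<^sub>R ray 4 + f 5 *\<^sub>R ray 5 + f 6 *\<^sub>R ray 6"
      using f unfolding expansion_def by blast
    from abc show ?thesis unfolding m_def[symmetric] x
      by (elim insertE emptyE; clarsimp) (simp_all add: vec_eq_iff forall_3 ray_nth)
  qed
  ultimately show ?thesis unfolding expansion_def by blast
qed

lemma straighten_opposite:
  assumes f: "expansion T x f"
  shows "expansion T x (f(5 := f 5 - min (f 5) (f 6), 6 := f 6 - min (f 5) (f 6)))" (is "expansion T x ?g")
proof -
  have nn: "0 \<le> f n" for n using f unfolding expansion_def by blast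
  have "?g n \<le> f n" for n using nn[of 5] nn[of 6] by auto
  hence "ray n \<in> T" if "n \<le> 6" "?g n > 0" for n
    using f that unfolding expansion_def by (meson less_le_trans)
  moreover have "0 \<le> ?g n" for n using nn[of n] nn[of 5] nn[of 6] by auto
  moreover have "x = ?g 0 *\<^sub>R ray 0 + ?g 1 *\<^sub>R ray 1 + ?g 2 *\<^sub>R ray 2 + ?g 3 *\<^sub>R ray 3 + ?g 4 *\<^sub>R ray 4 + ?g 5 *\<^sub>R ray 5 + ?g 6 *\<^sub>R ray 6"
    using f unfolding expansion_def by (auto simp: vec_eq_iff forall_3 ray_nth algebra_simps)
  ultimately show ?thesis unfolding expansion_def by blast
qed

lemma straighten_triple:
  assumes T: "cone_closed T" and f: "expansion T x f"
  defines "t \<equiv> min (f 0) (min (f 2) (f 5))"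
  shows "expansion T x (f(0 := f 0 - t, 2 := f 2 - t, 5 := f 5 - t, 1 := f 1 + t))" (is "expansion T x ?g")
proof -
  have nn: "0 \<le> f n" for n using f unfolding expansion_def by blast
  have t: "0 \<le> t" "t \<le> f 0" "t \<le> f 2" "t \<le> f 5" unfolding t_def using nn by auto
  have T': "n \<le> 6 \<Longrightarrow> f n > 0 \<Longrightarrow> ray n \<in> T" for n using f unfolding expansion_def by blast
  have "ray n \<in> T" if n: "n \<le> 6" "?g n > 0" for n
  proof (cases "f n > 0")
    case True thus ?thesis using T' n by blast
  next
    case False
    hence "f n = 0" using nn[of n] by simp
    have "n = 1"
    proof (rule ccontr)
      assume "n \<noteq> 1"
      hence "?g n \<le> f n" using t by auto
      thus False using n(2) \<open>f n = 0\<close> by simp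
    qed
    hence "t > 0" using n(2) \<open>f n = 0\<close> by simp
    hence "f 0 > 0" "f 2 > 0" "f 5 > 0" using t by auto
    hence "ray 0 \<in> T" "ray 2 \<in> T" "ray 5 \<in> T" using T' by auto
    hence "ray 0 + ray 2 + ray 5 \<in> T" using T unfolding cone_closed_def by blast
    thus ?thesis using \<open>n = 1\<close> ray_relations(6) by simp
  qed
  moreover have "0 \<le> ?g n" for n using nn[of n] t by auto
  moreover have "x = ?g 0 *\<^sub>R ray 0 + ?g 1 *\<^sub>R ray 1 + ?g 2 *\<^sub>R ray 2 + ?g 3 *\<^sub>R ray 3 + ?g 4 *\<^sub>R ray 4 + ?g 5 *\<^sub>R ray 5 + ?g 6 *\<^sub>R ray 6"
    using f unfolding expansion_def by (auto simp: vec_eq_iff forall_3 ray_nth algebra_simps)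
  ultimately show ?thesis unfolding expansion_def by blast
qed

text \<open>
  The sets of rays excluded here are the minimal sets that do not span a cone of the fan: the
  pairs 13, 14, 03, 24, 56, 16 and the triple 025.
\<close>

definition reduced :: "(nat \<Rightarrow> real) \<Rightarrow> bool" where
  "reduced f \<longleftrightarrow> (f 1 = 0 \<or> f 3 = 0) \<and> (f 1 = 0 \<or> f 4 = 0) \<and> (f 0 = 0 \<or> f 3 = 0) \<and> (f 2 = 0 \<or> f 4 = 0) \<and>
     (f 5 = 0 \<or> f 6 = 0) \<and> (f 1 = 0 \<or> f 6 = 0) \<and> (f 0 = 0 \<or> f 2 = 0 \<or> f 5 = 0)"

text \<open>
  The order of the relations matters, as later steps must not destroy what the earlier ones
  achieved. If ray 1 remains after the first two steps, then rays 3 and 4 are gone and only the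
  triple relation is left. Otherwise the steps that produce ray 6 follow, and ray 1 reappears in
  the last step only if the rays 0, 2 and 5 were all present, in which case the rays 3, 4 and 6
  are absent.
\<close>

lemma straighten:
  assumes T: "cone_closed T" and f: "expansion T x f" and f6: "f 6 = 0"
  obtains g where "expansion T x g" "reduced g"
proof -
  have nonneg: "0 \<le> h n" if "expansion T x h" for h n using that unfolding expansion_def by blast
  define f1 where "f1 = f(1 := f 1 - min (f 1) (f 3), 3 := f 3 - min (f 1) (f 3), 2 := f 2 + min (f 1) (f 3))"
  have f1: "expansion T x f1" unfolding f1_def by (rule straighten_pair[OF T f]) simp
  define f2 where "f2 = f1(1 := f1 1 - min (f1 1) (f1 4), 4 := f1 4 - min (f1 1) (f1 4), 0 := f1 0 + min (f1 1) (f1 4))"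
  have f2: "expansion T x f2" unfolding f2_def by (rule straighten_pair[OF T f1]) simp
  have f2': "f2 1 = 0 \<or> f2 3 = 0" "f2 1 = 0 \<or> f2 4 = 0" "f2 6 = 0"
    using nonneg[OF f] nonneg[OF f1] f6 unfolding f2_def f1_def by (auto simp: min_def)
  show ?thesis
  proof (cases "f2 1 = 0")
    case False
    define t where "t = min (f2 0) (min (f2 2) (f2 5))"
    have g: "expansion T x (f2(0 := f2 0 - t, 2 := f2 2 - t, 5 := f2 5 - t, 1 := f2 1 + t))"
      unfolding t_def by (rule straighten_triple[OF T f2])
    have "f2 3 = 0" "f2 4 = 0" using f2' False by auto
    thus ?thesis using that[OF g] f2'(3) unfolding reduced_def t_def by (auto simp: min_def)
  next
    case True
    define f3 where "f3 = f2(0 := f2 0 - min (f2 0) (f2 3), 3 := f2 3 - min (f2 0) (f2 3), 6 := f2 6 + min (f2 0) (f2 3))"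
    have f3: "expansion T x f3" unfolding f3_def by (rule straighten_pair[OF T f2]) simp
    define f4 where "f4 = f3(2 := f3 2 - min (f3 2) (f3 4), 4 := f3 4 - min (f3 2) (f3 4), 6 := f3 6 + min (f3 2) (f3 4))"
    have f4: "expansion T x f4" unfolding f4_def by (rule straighten_pair[OF T f3]) simp
    define f5 where "f5 = f4(5 := f4 5 - min (f4 5) (f4 6), 6 := f4 6 - min (f4 5) (f4 6))"
    have f5: "expansion T x f5" unfolding f5_def by (rule straighten_opposite[OF f4])
    have f3': "f3 1 = 0" "f3 0 = 0 \<or> f3 3 = 0" unfolding f3_def using True by (auto simp: min_def)
    have f4': "f4 1 = 0" "f4 0 = 0 \<or> f4 3 = 0" "f4 2 = 0 \<or> f4 4 = 0" unfolding f4_def using f3' by (auto simp: min_def)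
    have f5': "f5 1 = 0" "f5 0 = 0 \<or> f5 3 = 0" "f5 2 = 0 \<or> f5 4 = 0" "f5 5 = 0 \<or> f5 6 = 0"
      unfolding f5_def using f4' by (auto simp: min_def)
    show ?thesis
    proof (cases "f5 0 = 0 \<or> f5 2 = 0 \<or> f5 5 = 0")
      case True
      thus ?thesis using that[OF f5] f5' unfolding reduced_def by blast
    next
      case False
      define t where "t = min (f5 0) (min (f5 2) (f5 5))"
      have g: "expansion T x (f5(0 := f5 0 - t, 2 := f5 2 - t, 5 := f5 5 - t, 1 := f5 1 + t))"
        unfolding t_def by (rule straighten_triple[OF T f5])
      have "f5 3 = 0" "f5 4 = 0" "f5 6 = 0" using f5' False by auto
      thus ?thesis using that[OF g] unfolding reduced_def t_def by (auto simp: min_def)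
    qed
  qed
qed

lemma reduced_in_cone:
  assumes "reduced g"
  obtains a b c v where "((a, b, c), v) \<in> cone_table" "\<And>n. n \<le> 6 \<Longrightarrow> g n \<noteq> 0 \<Longrightarrow> n \<in> {a, b, c}"
proof -
  have "(g 3 = 0 \<and> g 4 = 0 \<and> g 5 = 0 \<and> g 6 = 0) \<or>
     (g 2 = 0 \<and> g 3 = 0 \<and> g 4 = 0 \<and> g 6 = 0) \<or>
     (g 1 = 0 \<and> g 3 = 0 \<and> g 4 = 0 \<and> g 5 = 0) \<or>
     (g 1 = 0 \<and> g 2 = 0 \<and> g 3 = 0 \<and> g 6 = 0) \<or>
     (g 1 = 0 \<and> g 2 = 0 \<and> g 3 = 0 \<and> g 5 = 0) \<or>
     (g 0 = 0 \<and> g 3 = 0 \<and> g 4 = 0 \<and> g 6 = 0) \<or>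
     (g 0 = 0 \<and> g 1 = 0 \<and> g 4 = 0 \<and> g 6 = 0) \<or>
     (g 0 = 0 \<and> g 1 = 0 \<and> g 4 = 0 \<and> g 5 = 0) \<or>
     (g 0 = 0 \<and> g 1 = 0 \<and> g 2 = 0 \<and> g 6 = 0) \<or>
     (g 0 = 0 \<and> g 1 = 0 \<and> g 2 = 0 \<and> g 5 = 0)"
    using assms unfolding reduced_def by argo
  moreover have le: "n = 0 \<or> n = 1 \<or> n = 2 \<or> n = 3 \<or> n = 4 \<or> n = 5 \<or> n = 6" if "n \<le> 6" for n :: nat
    using that by arith
  ultimately show ?thesis
  proof (elim disjE conjE)
    assume z: "g 3 = 0" "g 4 = 0" "g 5 = 0" "g 6 = 0"
    show ?thesis by (rule that[of 0 1 2 "(2, 2, 1)"]) (simp add: cone_table_def, use le z in fastforce)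
  next
    assume z: "g 2 = 0" "g 3 = 0" "g 4 = 0" "g 6 = 0"
    show ?thesis by (rule that[of 0 1 5 "(3, 2, 0)"]) (simp add: cone_table_def, use le z in fastforce)
  next
    assume z: "g 1 = 0" "g 3 = 0" "g 4 = 0" "g 5 = 0"
    show ?thesis by (rule that[of 0 2 6 "(1, 1, 2)"]) (simp add: cone_table_def, use le z in fastforce)
  next
    assume z: "g 1 = 0" "g 2 = 0" "g 3 = 0" "g 6 = 0"
    show ?thesis by (rule that[of 0 4 5 "(3, 0, 0)"]) (simp add: cone_table_def, use le z in fastforce)
  next
    assume z: "g 1 = 0" "g 2 = 0" "g 3 = 0" "g 5 = 0"
    show ?thesis by (rule that[of 0 4 6 "(1, 0, 2)"]) (simp add: cone_table_def, use le z in fastforce)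
  next
    assume z: "g 0 = 0" "g 3 = 0" "g 4 = 0" "g 6 = 0"
    show ?thesis by (rule that[of 1 2 5 "(2, 3, 0)"]) (simp add: cone_table_def, use le z in fastforce)
  next
    assume z: "g 0 = 0" "g 1 = 0" "g 4 = 0" "g 6 = 0"
    show ?thesis by (rule that[of 2 3 5 "(0, 3, 0)"]) (simp add: cone_table_def, use le z in fastforce)
  next
    assume z: "g 0 = 0" "g 1 = 0" "g 4 = 0" "g 5 = 0"
    show ?thesis by (rule that[of 2 3 6 "(0, 1, 2)"]) (simp add: cone_table_def, use le z in fastforce)
  next
    assume z: "g 0 = 0" "g 1 = 0" "g 2 = 0" "g 6 = 0"
    show ?thesis by (rule that[of 3 4 5 "(0, 0, 0)"]) (simp add: cone_table_def, use le z in fastforce)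
  next
    assume z: "g 0 = 0" "g 1 = 0" "g 2 = 0" "g 5 = 0"
    show ?thesis by (rule that[of 3 4 6 "(0, 0, 2)"]) (simp add: cone_table_def, use le z in fastforce)
  qed
qed

text \<open>
  So a closed set \<open>T\<close> containing a combination of its own rays contains a whole cone
  of the fan around it.
\<close>

lemma cone_contains_fan_cone:
  assumes T: "cone_closed T" and f: "expansion T x f" and f6: "f 6 = 0"
  obtains i J where "i \<in> cone_table" "x \<in> fcone (cone_rows i) J" "fcone (cone_rows i) J \<subseteq> T"
proof -
  obtain g where g: "expansion T x g" "reduced g" by (rule straighten[OF T f f6])
  obtain a b c v where abc: "((a, b, c), v) \<in> cone_table" "\<And>n. n \<le> 6 \<Longrightarrow> g n \<noteq> 0 \<Longrightarrow> n \<in> {a, b, c}"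
    using reduced_in_cone[OF g(2)] by metis
  define i where "i = ((a, b, c), v)"
  have i: "i \<in> cone_table" unfolding i_def by (rule abc(1))
  define idx where "idx k = (if k = 1 then a else if k = 2 then b else c)" for k :: 3
  have row: "real_vec (cone_rows i $ k) = ray (idx k)" for k
    unfolding ray_def i_def idx_def using exhaust_3[of k] by auto
  define J where "J = {k. g (idx k) > 0}"
  have nn: "0 \<le> g n" for n using g(1) unfolding expansion_def by blast
  have le: "a \<le> 6" "b \<le> 6" "c \<le> 6" and dist: "a \<noteq> b" "a \<noteq> c" "b \<noteq> c" using abc(1) unfolding cone_table_def by auto
  have zero: "g n *\<^sub>R ray n = 0" if "n \<notin> {a, b, c}" "n \<le> 6" for n using abc(2) that by fastforce
  have "x = (\<Sum>n\<in>{0, 1, 2, 3, 4, 5, 6}. g n *\<^sub>R ray n)" using g(1) unfolding expansion_def by (simp add: add_ac)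
  also have "\<dots> = (\<Sum>n\<in>{a, b, c}. g n *\<^sub>R ray n)"
  proof (rule sum.mono_neutral_right)
    show "{a, b, c} \<subseteq> {0, 1, 2, 3, 4, 5, 6}" using le le_6_cases by blast
    show "\<forall>n\<in>{0, 1, 2, 3, 4, 5, 6} - {a, b, c}. g n *\<^sub>R ray n = 0"
    proof
      fix n :: nat assume n: "n \<in> {0, 1, 2, 3, 4, 5, 6} - {a, b, c}"
      hence "n \<le> 6" by auto
      with n show "g n *\<^sub>R ray n = 0" by (intro zero) auto
    qed
  qed simp
  also have "\<dots> = g a *\<^sub>R ray a + g b *\<^sub>R ray b + g c *\<^sub>R ray c" using dist by simp
  also have "\<dots> = (\<Sum>k\<in>UNIV. g (idx k) *\<^sub>R real_vec (cone_rows i $ k))" unfolding row by (simp add: sum_3 idx_def)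
  finally have x: "x = \<dots>" .
  have "x \<in> fcone (cone_rows i) J"
    unfolding fcone_def
  proof (intro CollectI exI[of _ "\<lambda>k. g (idx k)"] conjI allI impI)
    fix k assume "k \<notin> J" thus "g (idx k) = 0" unfolding J_def using nn[of "idx k"] by simp
  qed (use nn x in auto)
  moreover have "fcone (cone_rows i) J \<subseteq> T"
  proof
    fix y assume "y \<in> fcone (cone_rows i) J"
    then obtain h where h: "\<forall>k. 0 \<le> h k" "\<forall>k. k \<notin> J \<longrightarrow> h k = 0" "y = (\<Sum>k\<in>UNIV. h k *\<^sub>R ray (idx k))"
      unfolding fcone_def row by blast
    have idx: "idx k \<le> 6" for k unfolding idx_def using le by auto
    have "h k *\<^sub>R ray (idx k) \<in> T" for k
    proof (cases "k \<in> J")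
      case True
      hence "ray (idx k) \<in> T" using g(1) idx unfolding J_def expansion_def by blast
      thus ?thesis using T h(1) unfolding cone_closed_def by blast
    next
      case False
      thus ?thesis using h(2) T unfolding cone_closed_def by simp
    qed
    hence "h 1 *\<^sub>R ray (idx 1) + h 2 *\<^sub>R ray (idx 2) + h 3 *\<^sub>R ray (idx 3) \<in> T" using T unfolding cone_closed_def by blast
    thus "y \<in> T" unfolding h(3) by (simp add: sum_3)
  qed
  ultimately show ?thesis using that[OF i] by blast
qed

subsection \<open>Images of the faces of the orthant\<close>

lemma UNIV_6: "(UNIV :: 6 set) = {1, 2, 3, 4, 5, 6}"
proof -
  have "card {1, 2, 3, 4, 5, 6 :: 6} = 6" by simp
  hence "card {1, 2, 3, 4, 5, 6 :: 6} = card (UNIV :: 6 set)" by simp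
  thus ?thesis by (metis card_subset_eq finite top_greatest)
qed

lemma sum_6: "sum f (UNIV :: 6 set) = f 1 + f 2 + f 3 + f 4 + f 5 + f 6"
  unfolding UNIV_6 by (simp add: add_ac)

lemma forall_6: "(\<forall>k :: 6. P k) \<longleftrightarrow> P 1 \<and> P 2 \<and> P 3 \<and> P 4 \<and> P 5 \<and> P 6"
  using UNIV_6 by (metis UNIV_I insert_iff empty_iff)

lemma quot_matrix_nth:
  "quot_matrix $ 1 = vector [-1, -1, 0, 1, 0, 0]" "quot_matrix $ 2 = vector [0, -1, -1, 0, 1, 0]"
  "quot_matrix $ 3 = vector [-1, -1, -1, 0, 0, 1]"
  by (simp_all add: quot_matrix_def)

lemma vector_6:
  "(vector [a, b, c, d, e, f] :: 'a::zero ^ 6) $ 1 = a" "(vector [a, b, c, d, e, f] :: 'a::zero ^ 6) $ 2 = b"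
  "(vector [a, b, c, d, e, f] :: 'a::zero ^ 6) $ 3 = c" "(vector [a, b, c, d, e, f] :: 'a::zero ^ 6) $ 4 = d"
  "(vector [a, b, c, d, e, f] :: 'a::zero ^ 6) $ 5 = e" "(vector [a, b, c, d, e, f] :: 'a::zero ^ 6) $ 6 = f"
  unfolding vector_def by auto

lemma quot_map_expand:
  "quot_map x = x $ 1 *\<^sub>R ray 0 + x $ 2 *\<^sub>R ray 1 + x $ 3 *\<^sub>R ray 2 + x $ 4 *\<^sub>R ray 3 + x $ 5 *\<^sub>R ray 4 + x $ 6 *\<^sub>R ray 5"
  by (simp add: vec_eq_iff forall_3 matrix_vector_mult_def quot_matrix_nth sum_6 vector_6 ray_nth)

text \<open>
  The image of the \<open>k\<close>-th unit vector is the ray with number \<open>k - 1\<close>;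
  the index type is cyclic with \<open>6 = 0\<close>, whence the case distinction.
\<close>

definition ray_index :: "6 \<Rightarrow> nat" where
  "ray_index k = (if k = 1 then 0 else if k = 2 then 1 else if k = 3 then 2 else if k = 4 then 3 else if k = 5 then 4 else 5)"

lemma ray_index_simps [simp]:
  "ray_index 1 = 0" "ray_index 2 = 1" "ray_index 3 = 2" "ray_index 4 = 3" "ray_index 5 = 4" "ray_index 6 = 5"
  by (simp_all add: ray_index_def)

lemma ray_index_surj:
  assumes "n \<le> 5" obtains k where "ray_index k = n"
proof -
  have "n = 0 \<or> n = 1 \<or> n = 2 \<or> n = 3 \<or> n = 4 \<or> n = 5" using assms by arith
  thus ?thesis using ray_index_simps that by metis
qed

definition orthant_face :: "6 set \<Rightarrow> (real ^ 6) set" where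
  "orthant_face J = {x. (\<forall>k. 0 \<le> x $ k) \<and> (\<forall>k. k \<notin> J \<longrightarrow> x $ k = 0)}"

lemma nilp_fan_eq: "nilp_fan = range orthant_face"
proof -
  have inv: "invertible (mat 1 :: int ^ 6 ^ 6)"
    unfolding invertible_def by (intro exI[of _ "mat 1"]) simp
  have "matrix_inv (mat 1 :: int ^ 6 ^ 6) = mat 1" using inv_mult(1)[OF inv] by simp
  hence coord: "coord (mat 1 :: int ^ 6 ^ 6) k x = x $ k" for k x
    unfolding coord_def dual_vec_def
    by (simp add: real_vec_def inner_vec_def column_def mat_def if_distrib[of real_of_int] if_distrib[of "\<lambda>y. y * _"] cong: if_cong)
  have face: "fcone (mat 1 :: int ^ 6 ^ 6) J = orthant_face J" for J
    unfolding orthant_face_def using fcone_iff[OF inv, of _ J] by (auto simp: coord)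
  have orthant: "{x :: real ^ 6. \<forall>i. 0 \<le> x $ i} = fcone (mat 1) UNIV" unfolding face by (simp add: orthant_face_def)
  show ?thesis
    unfolding nilp_fan_def face_fan_def orthant
  proof (intro set_eqI iffI)
    fix \<tau> assume "\<tau> \<in> {\<tau>. cone_face \<tau> (fcone (mat 1 :: int ^ 6 ^ 6) UNIV)}"
    hence "cone_face \<tau> (fcone (mat 1 :: int ^ 6 ^ 6) UNIV)" by simp
    then obtain J where "\<tau> = fcone (mat 1) J" by (rule face_fcone[OF inv])
    thus "\<tau> \<in> range orthant_face" using face by simp
  next
    fix \<tau> assume "\<tau> \<in> range orthant_face"
    then obtain J where "\<tau> = fcone (mat 1) J" using face by auto
    thus "\<tau> \<in> {\<tau>. cone_face \<tau> (fcone (mat 1 :: int ^ 6 ^ 6) UNIV)}" using fcone_face[OF inv, of J UNIV] by simp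
  qed
qed

lemma quot_map_linear: "quot_map (x + y) = quot_map x + quot_map y" "quot_map (t *\<^sub>R x) = t *\<^sub>R quot_map x" "quot_map 0 = 0"
  by (simp_all add: quot_map_expand algebra_simps)

lemma image_closed: "cone_closed (quot_map ` orthant_face J)"
  unfolding cone_closed_def
proof (intro conjI ballI allI impI)
  have "0 \<in> orthant_face J" by (simp add: orthant_face_def)
  thus "0 \<in> quot_map ` orthant_face J" using quot_map_linear(3) by (metis image_eqI)
next
  fix x y assume "x \<in> quot_map ` orthant_face J" "y \<in> quot_map ` orthant_face J"
  then obtain u v where uv: "x = quot_map u" "y = quot_map v" "u \<in> orthant_face J" "v \<in> orthant_face J" by blast
  hence "u + v \<in> orthant_face J" by (simp add: orthant_face_def)
  thus "x + y \<in> quot_map ` orthant_face J" using uv quot_map_linear(1) by (metis image_eqI)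
next
  fix x and t :: real assume "x \<in> quot_map ` orthant_face J" and t: "0 \<le> t"
  then obtain u where u: "x = quot_map u" "u \<in> orthant_face J" by blast
  hence "t *\<^sub>R u \<in> orthant_face J" using t by (simp add: orthant_face_def)
  thus "t *\<^sub>R x \<in> quot_map ` orthant_face J" using u quot_map_linear(2) by (metis image_eqI)
qed

lemma quot_map_axis: "quot_map (axis k 1) = ray (ray_index k)"
proof -
  have "k \<in> {1, 2, 3, 4, 5, 6}" using UNIV_6 by blast
  thus ?thesis unfolding quot_map_expand by (auto simp: axis_def ray_index_def)
qed

lemma ray_in_image: "k \<in> J \<Longrightarrow> ray (ray_index k) \<in> quot_map ` orthant_face J"
  using quot_map_axis[of k] by (intro image_eqI[of _ _ "axis k 1"]) (auto simp: orthant_face_def axis_def)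

lemma image_expansion:
  assumes "x \<in> quot_map ` orthant_face J"
  obtains f where "expansion (quot_map ` orthant_face J) x f" "f 6 = 0"
proof -
  obtain u where u: "x = quot_map u" "u \<in> orthant_face J" using assms by blast
  define f where "f n = (if n = 0 then u $ 1 else if n = 1 then u $ 2 else if n = 2 then u $ 3 else if n = 3 then u $ 4
    else if n = 4 then u $ 5 else if n = 5 then u $ 6 else 0)" for n :: nat
  have nn: "0 \<le> u $ k" and supp: "u $ k > 0 \<Longrightarrow> k \<in> J" for k using u(2) unfolding orthant_face_def by force+
  have "ray n \<in> quot_map ` orthant_face J" if n: "n \<le> 6" "f n > 0" for n
  proof -
    have f: "f (ray_index k) = u $ k" for k
    proof -
      have "\<forall>k. f (ray_index k) = u $ k" unfolding forall_6 by (simp add: f_def)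
      thus ?thesis by blast
    qed
    have "n \<le> 5" using n by (cases "n = 6") (auto simp: f_def)
    then obtain k where k: "ray_index k = n" by (rule ray_index_surj)
    have "k \<in> J" using supp[of k] n(2) f[of k] k by simp
    thus ?thesis using ray_in_image k by blast
  qed
  hence "expansion (quot_map ` orthant_face J) x f"
    unfolding expansion_def using nn by (auto simp: f_def u(1) quot_map_expand)
  thus ?thesis using that by (simp add: f_def)
qed

lemma cone3_subset_image:
  assumes "ray a \<in> quot_map ` orthant_face J" "ray b \<in> quot_map ` orthant_face J" "ray c \<in> quot_map ` orthant_face J"
  shows "cone3 a b c \<subseteq> quot_map ` orthant_face J"
proof
  fix y assume "y \<in> cone3 a b c"
  then obtain p q r where y: "0 \<le> p" "0 \<le> q" "0 \<le> r" "y = p *\<^sub>R ray a + q *\<^sub>R ray b + r *\<^sub>R ray c"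
    unfolding cone3_def by blast
  show "y \<in> quot_map ` orthant_face J" unfolding y(4)
    by (intro cone_closed_add[OF image_closed] cone_closed_scale[OF image_closed] assms y)
qed

lemma image_triple: "quot_map ` orthant_face {k, l, m} = cone3 (ray_index k) (ray_index l) (ray_index m)"
  if "k \<noteq> l" "k \<noteq> m" "l \<noteq> m"
proof
  show "cone3 (ray_index k) (ray_index l) (ray_index m) \<subseteq> quot_map ` orthant_face {k, l, m}"
    by (intro cone3_subset_image ray_in_image) auto
  show "quot_map ` orthant_face {k, l, m} \<subseteq> cone3 (ray_index k) (ray_index l) (ray_index m)"
  proof
    fix x assume "x \<in> quot_map ` orthant_face {k, l, m}"
    then obtain u where u: "x = quot_map u" "u \<in> orthant_face {k, l, m}" by blast
    have "u = u $ k *\<^sub>R axis k 1 + u $ l *\<^sub>R axis l 1 + u $ m *\<^sub>R axis m 1"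
      using u(2) that by (auto simp: vec_eq_iff orthant_face_def axis_def)
    hence "x = u $ k *\<^sub>R ray (ray_index k) + u $ l *\<^sub>R ray (ray_index l) + u $ m *\<^sub>R ray (ray_index m)"
      using u(1) by (metis quot_map_linear(1,2) quot_map_axis)
    thus "x \<in> cone3 (ray_index k) (ray_index l) (ray_index m)"
      unfolding cone3_def using u(2) by (auto simp: orthant_face_def)
  qed
qed

text \<open>
  The cones with ray 6 are intersections of two cones without it, because ray 6 is the sum of ray
  0 and ray 3 and also of ray 2 and ray 4. After ray 6 has been split off from one representation
  of a point, the only coefficient that might be negative equals a coefficient of the other
  representation.
\<close>

lemma Int_cone3:
  "cone3 0 2 3 \<inter> cone3 0 2 4 \<subseteq> cone3 0 2 6" "cone3 0 4 3 \<inter> cone3 0 4 2 \<subseteq> cone3 0 4 6"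
  "cone3 2 3 0 \<inter> cone3 2 3 4 \<subseteq> cone3 2 3 6" "cone3 3 4 0 \<inter> cone3 3 4 2 \<subseteq> cone3 3 4 6"
proof -
  have *: "y \<in> cone3 a b 6"
    if "y = p *\<^sub>R ray a + q *\<^sub>R ray b + r *\<^sub>R ray 6" "0 \<le> p" "0 \<le> q" "0 \<le> r" for y a b p q r
    using that unfolding cone3_def by blast
  show "cone3 0 2 3 \<inter> cone3 0 2 4 \<subseteq> cone3 0 2 6"
  proof
    fix y assume "y \<in> cone3 0 2 3 \<inter> cone3 0 2 4"
    then obtain p q r p' q' r' where "0 \<le> q" "0 \<le> r" "0 \<le> p'"
      "y = p *\<^sub>R ray 0 + q *\<^sub>R ray 2 + r *\<^sub>R ray 3" "y = p' *\<^sub>R ray 0 + q' *\<^sub>R ray 2 + r' *\<^sub>R ray 4"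
      unfolding cone3_def by blast
    thus "y \<in> cone3 0 2 6" by (intro *[of y p' 0 q 2 r]) (auto simp: vec_eq_iff forall_3 ray_nth)
  qed
  show "cone3 0 4 3 \<inter> cone3 0 4 2 \<subseteq> cone3 0 4 6"
  proof
    fix y assume "y \<in> cone3 0 4 3 \<inter> cone3 0 4 2"
    then obtain p q r p' q' r' where "0 \<le> q" "0 \<le> r" "0 \<le> p'"
      "y = p *\<^sub>R ray 0 + q *\<^sub>R ray 4 + r *\<^sub>R ray 3" "y = p' *\<^sub>R ray 0 + q' *\<^sub>R ray 4 + r' *\<^sub>R ray 2"
      unfolding cone3_def by blast
    thus "y \<in> cone3 0 4 6" by (intro *[of y p' 0 q 4 r]) (auto simp: vec_eq_iff forall_3 ray_nth)
  qed
  show "cone3 2 3 0 \<inter> cone3 2 3 4 \<subseteq> cone3 2 3 6"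
  proof
    fix y assume "y \<in> cone3 2 3 0 \<inter> cone3 2 3 4"
    then obtain p q r p' q' r' where "0 \<le> p" "0 \<le> r" "0 \<le> q'"
      "y = p *\<^sub>R ray 2 + q *\<^sub>R ray 3 + r *\<^sub>R ray 0" "y = p' *\<^sub>R ray 2 + q' *\<^sub>R ray 3 + r' *\<^sub>R ray 4"
      unfolding cone3_def by blast
    thus "y \<in> cone3 2 3 6" by (intro *[of y p 2 q' 3 r]) (auto simp: vec_eq_iff forall_3 ray_nth)
  qed
  show "cone3 3 4 0 \<inter> cone3 3 4 2 \<subseteq> cone3 3 4 6"
  proof
    fix y assume "y \<in> cone3 3 4 0 \<inter> cone3 3 4 2"
    then obtain p q r p' q' r' where "0 \<le> q" "0 \<le> r" "0 \<le> p'"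
      "y = p *\<^sub>R ray 3 + q *\<^sub>R ray 4 + r *\<^sub>R ray 0" "y = p' *\<^sub>R ray 3 + q' *\<^sub>R ray 4 + r' *\<^sub>R ray 2"
      unfolding cone3_def by blast
    thus "y \<in> cone3 3 4 6" by (intro *[of y p' 3 q 4 r]) (auto simp: vec_eq_iff forall_3 ray_nth)
  qed
qed

text \<open>
  A cone without ray 6 is itself the image of a three-dimensional face, and a cone with ray 6 is
  contained in two such images, whose intersection it contains by \<open>Int_cone3\<close>.
\<close>

lemma maximal_cone_Int_images:
  assumes i: "i \<in> cone_table" and x: "x \<in> fcone (cone_rows i) UNIV"
    and y: "\<And>J. x \<in> quot_map ` orthant_face J \<Longrightarrow> y \<in> quot_map ` orthant_face J"
  shows "y \<in> fcone (cone_rows i) UNIV"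
proof -
  obtain a b c v where i': "i = ((a, b, c), v)" by (cases i) auto
  have x': "x \<in> cone3 a b c" using x unfolding i' fcone_rows .
  have triple: "y \<in> cone3 (ray_index k) (ray_index l) (ray_index m)"
    if "k \<noteq> l" "k \<noteq> m" "l \<noteq> m" "x \<in> cone3 (ray_index k) (ray_index l) (ray_index m)" for k l m
    using y[of "{k, l, m}"] that image_triple[OF that(1-3)] by simp
  have idx: "ray_index 1 = 0" "ray_index 2 = 1" "ray_index 3 = 2" "ray_index 4 = 3" "ray_index 5 = 4" "ray_index 6 = 5"
    by (simp_all add: ray_index_def)
  have triple6: "y \<in> cone3 (ray_index k) (ray_index l) (ray_index m)"
    if "k \<noteq> l" "k \<noteq> m" "l \<noteq> m" "x \<in> cone3 (ray_index k) (ray_index l) 6"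
      "ray 6 = ray (ray_index k) + ray (ray_index m) \<or> ray 6 = ray (ray_index l) + ray (ray_index m)" for k l m
  proof (rule triple[OF that(1-3)])
    let ?T = "quot_map ` orthant_face {k, l, m}"
    have r: "ray (ray_index k) \<in> ?T" "ray (ray_index l) \<in> ?T" "ray (ray_index m) \<in> ?T"
      by (rule ray_in_image; simp)+
    hence "ray 6 \<in> ?T" using that(5) image_closed[of "{k, l, m}"] unfolding cone_closed_def by metis
    hence "cone3 (ray_index k) (ray_index l) 6 \<subseteq> ?T" using r by (intro cone3_subset_image)
    thus "x \<in> cone3 (ray_index k) (ray_index l) (ray_index m)" using that(4) image_triple[OF that(1-3)] by blast
  qed
  have rel: "ray 6 = ray 0 + ray 3" "ray 6 = ray 3 + ray 0" "ray 6 = ray 2 + ray 4" "ray 6 = ray 4 + ray 2"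
    using ray_relations by (simp_all add: add.commute)
  have "y \<in> cone3 a b c"
    using i unfolding i' cone_table_def
  proof (elim insertE emptyE; clarsimp)
    note x'' = x'
    show "y \<in> cone3 0 (Suc 0) 2" if "a = 0" "b = Suc 0" "c = 2" using triple[of 1 2 3] x' that by (simp add: idx)
    show "y \<in> cone3 0 (Suc 0) 5" if "a = 0" "b = Suc 0" "c = 5" using triple[of 1 2 6] x' that by (simp add: idx)
    show "y \<in> cone3 0 2 6" if "a = 0" "b = 2" "c = 6"
      using triple6[of 1 3 4] triple6[of 1 3 5] x' that rel Int_cone3(1) by (simp add: idx) blast
    show "y \<in> cone3 0 4 5" if "a = 0" "b = 4" "c = 5" using triple[of 1 5 6] x' that by (simp add: idx)
    show "y \<in> cone3 0 4 6" if "a = 0" "b = 4" "c = 6"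
      using triple6[of 1 5 4] triple6[of 1 5 3] x' that rel Int_cone3(2) by (simp add: idx) blast
    show "y \<in> cone3 (Suc 0) 2 5" if "a = Suc 0" "b = 2" "c = 5" using triple[of 2 3 6] x' that by (simp add: idx)
    show "y \<in> cone3 2 3 5" if "a = 2" "b = 3" "c = 5" using triple[of 3 4 6] x' that by (simp add: idx)
    show "y \<in> cone3 2 3 6" if "a = 2" "b = 3" "c = 6"
      using triple6[of 3 4 1] triple6[of 3 4 5] x' that rel Int_cone3(3) by (simp add: idx) blast
    show "y \<in> cone3 3 4 5" if "a = 3" "b = 4" "c = 5" using triple[of 4 5 6] x' that by (simp add: idx)
    show "y \<in> cone3 3 4 6" if "a = 3" "b = 4" "c = 6"
      using triple6[of 4 5 1] triple6[of 4 5 3] x' that rel Int_cone3(4) by (simp add: idx) blast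
  qed
  thus ?thesis unfolding i' fcone_rows .
qed

lemma image_full: "quot_map ` orthant_face UNIV = UNIV"
proof -
  let ?T = "quot_map ` orthant_face UNIV"
  have r: "ray n \<in> ?T" if "n \<le> 6" for n
  proof (cases "n = 6")
    case True
    have "ray (ray_index 1) + ray (ray_index 4) \<in> ?T"
      by (intro cone_closed_add[OF image_closed] ray_in_image) simp_all
    thus ?thesis using True ray_relations(3) by (simp only: ray_index_simps)
  next
    case False
    hence "n \<le> 5" using that by simp
    then obtain k where "ray_index k = n" by (rule ray_index_surj)
    thus ?thesis using ray_in_image[of k UNIV] by simp
  qed
  have "x \<in> ?T" for x
  proof -
    obtain i where i: "i \<in> cone_table" "x \<in> fcone (cone_rows i) UNIV" using quotient.complete by blast
    obtain a b c v where i': "i = ((a, b, c), v)" by (cases i) auto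
    have "a \<le> 6" "b \<le> 6" "c \<le> 6" using i(1) unfolding i' cone_table_def by auto
    hence "cone3 a b c \<subseteq> ?T" using r by (intro cone3_subset_image)
    thus ?thesis using i(2) unfolding i' fcone_rows by blast
  qed
  thus ?thesis by blast
qed

text \<open>
  The inclusion from left to right holds because the maximal cones around \<open>x\<close> are
  already determined by the images, and the converse because every image that contains
  \<open>x\<close> contains a cone of the fan around \<open>x\<close>.
\<close>

lemma quotient_cone:
  assumes i: "i \<in> cone_table" and x: "x \<in> fcone (cone_rows i) UNIV"
  shows "\<Inter>{quot_map ` \<sigma> | \<sigma>. \<sigma> \<in> nilp_fan \<and> x \<in> quot_map ` \<sigma>} = fcone (cone_rows i) (quotient.support i x)"
    (is "\<Inter>?S = _")
proof
  have S: "?S = {quot_map ` orthant_face J | J. x \<in> quot_map ` orthant_face J}"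
    unfolding nilp_fan_eq by blast
  show "fcone (cone_rows i) (quotient.support i x) \<subseteq> \<Inter>?S"
  proof (rule Inter_greatest)
    fix T assume "T \<in> ?S"
    then obtain J where J: "T = quot_map ` orthant_face J" "x \<in> quot_map ` orthant_face J" unfolding S by blast
    obtain f where f: "expansion (quot_map ` orthant_face J) x f" "f 6 = 0" by (rule image_expansion[OF J(2)])
    obtain j J' where j: "j \<in> cone_table" "x \<in> fcone (cone_rows j) J'" "fcone (cone_rows j) J' \<subseteq> quot_map ` orthant_face J"
      by (rule cone_contains_fan_cone[OF image_closed f])
    show "fcone (cone_rows i) (quotient.support i x) \<subseteq> T"
      using quotient.support_cone_least[OF i j(1) x j(2)] j(3) J(1) by blast
  qed
  show "\<Inter>?S \<subseteq> fcone (cone_rows i) (quotient.support i x)"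
  proof
    fix y assume "y \<in> \<Inter>?S"
    hence y: "y \<in> quot_map ` orthant_face J" if "x \<in> quot_map ` orthant_face J" for J using that unfolding S by blast
    show "y \<in> fcone (cone_rows i) (quotient.support i x)"
    proof (rule quotient.Inter_maximal_cones[OF i x])
      fix j assume "j \<in> cone_table" "x \<in> fcone (cone_rows j) UNIV"
      thus "y \<in> fcone (cone_rows j) UNIV" using y by (rule maximal_cone_Int_images)
    qed
  qed
qed

lemma quotient_fan_eq: "quotient_fan quot_map nilp_fan = quotient.Sig"
proof -
  have "orthant_face UNIV \<subseteq> \<Union>nilp_fan" unfolding nilp_fan_eq by (rule Union_upper) (rule rangeI)
  hence "quot_map ` orthant_face UNIV \<subseteq> quot_map ` \<Union>nilp_fan" by (rule image_mono)
  hence full: "quot_map ` \<Union>nilp_fan = UNIV" unfolding image_full by (rule top.extremum_uniqueI)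
  show ?thesis
  proof (intro set_eqI iffI)
    fix \<sigma> assume "\<sigma> \<in> quotient_fan quot_map nilp_fan"
    then obtain x where \<sigma>: "\<sigma> = \<Inter>{quot_map ` \<sigma> | \<sigma>. \<sigma> \<in> nilp_fan \<and> x \<in> quot_map ` \<sigma>}"
      unfolding quotient_fan_def by blast
    obtain i where i: "i \<in> cone_table" "x \<in> fcone (cone_rows i) UNIV" using quotient.complete by blast
    show "\<sigma> \<in> quotient.Sig" unfolding \<sigma> quotient_cone[OF i] by (rule quotient.fcone_Sig[OF i(1)])
  next
    fix \<sigma> assume "\<sigma> \<in> quotient.Sig"
    then obtain i J where i: "i \<in> cone_table" "\<sigma> = fcone (cone_rows i) J" by (rule quotient.Sig_cases)
    note inv = quotient.inv[OF i(1)]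
    \<comment> \<open>The sum of the generators of the cone, a point in its relative interior.\<close>
    define x where "x = (\<Sum>k\<in>UNIV. (if k \<in> J then 1 else 0) *\<^sub>R real_vec (cone_rows i $ k))"
    have coord: "coord (cone_rows i) k x = (if k \<in> J then 1 else 0)" for k
      unfolding x_def by (rule coord_combination[OF inv])
    have x: "x \<in> fcone (cone_rows i) UNIV" unfolding fcone_iff[OF inv] coord by simp
    have "quotient.support i x = J" unfolding quotient.support_def coord by auto
    hence "\<sigma> = \<Inter>{quot_map ` \<sigma> | \<sigma>. \<sigma> \<in> nilp_fan \<and> x \<in> quot_map ` \<sigma>}"
      using quotient_cone[OF i(1) x] i(2) by simp
    thus "\<sigma> \<in> quotient_fan quot_map nilp_fan" unfolding quotient_fan_def full by blast
  qed
qed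

lemma ray_set_eq: "quotient.ray_set = (\<lambda>n. vec3 (ray_coords n)) ` {0, 1, 2, 3, 4, 5, 6}"
proof -
  have rows: "range (($) (cone_rows ((a, b, c), v))) = (\<lambda>n. vec3 (ray_coords n)) ` {a, b, c}" for a b c v
    unfolding UNIV_3 by simp
  show ?thesis
  proof -
    have "quotient.ray_set = (\<Union>i\<in>cone_table. range (($) (cone_rows i)))"
      unfolding quotient.ray_set_def by blast
    also have "\<dots> = (\<lambda>n. vec3 (ray_coords n)) ` {0, 1, 2, 3, 4, 5, 6}"
      unfolding cone_table_def UN_insert UN_empty rows by (simp only: image_insert image_empty) blast
    finally show ?thesis .
  qed
qed

lemma card_ray_set: "card quotient.ray_set = 7"
proof -
  have "inj_on (\<lambda>n. vec3 (ray_coords n)) {0, 1, 2, 3, 4, 5, 6}"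
    unfolding inj_on_def by (simp add: vec_eq_iff forall_3)
  from card_image[OF this] show ?thesis unfolding ray_set_eq by simp
qed

lemma rays_quotient:
  "rays quotient.Sig = (\<lambda>\<rho>. conic hull {\<rho>}) `
        {vector [-1, 0, -1], vector [-1, -1, -1], vector [0, -1, -1],
         vector [1, 0, 0], vector [0, 1, 0], vector [0, 0, 1], vector [0, 0, -1]}"
proof -
  have "rays quotient.Sig = (\<lambda>\<rho>. conic hull {\<rho>}) ` real_vec ` quotient.ray_set"
    unfolding quotient.rays_Sig quotient.ray_set_def by blast
  moreover have "real_vec (vec3 (x, y, z)) = vector [of_int x, of_int y, of_int z]" for x y z
    by (simp add: real_vec_def vec_eq_iff forall_3)
  ultimately show ?thesis unfolding ray_set_eq by simp
qed

section \<open>The torus of diagonal matrices\<close>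

text \<open>
  Since \<open>matrix_inv\<close> chooses some two-sided inverse, uniqueness of inverses
  identifies it with the diagonal one.
\<close>

lemma conj_diag:
  assumes "\<forall>i. h $ i \<noteq> 0"
  shows "(diag_matrix h ** A ** matrix_inv (diag_matrix h)) $ i $ j = h $ i * A $ i $ j / h $ j"
proof -
  define D' where "D' = diag_matrix (\<chi> i. inverse (h $ i))"
  have entry: "diag_matrix u $ i $ j = (if i = j then u $ i else 0)" for u i j
    by (simp add: diag_matrix_def)
  have mult: "(diag_matrix u ** A) $ i $ j = u $ i * A $ i $ j" "(A ** diag_matrix u) $ i $ j = A $ i $ j * u $ j" for u A i j
    by (simp_all add: entry matrix_matrix_mult_def if_distrib[of "\<lambda>x. x * _"] if_distrib[of "\<lambda>x. _ * x"] cong: if_cong)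
  have D': "diag_matrix h ** D' = mat 1" "D' ** diag_matrix h = mat 1"
    unfolding vec_eq_iff D'_def mult using assms by (auto simp: mat_def entry)
  hence "\<exists>C. diag_matrix h ** C = mat 1 \<and> C ** diag_matrix h = mat 1" by blast
  from someI_ex[OF this] have "matrix_inv (diag_matrix h) ** diag_matrix h = mat 1" unfolding matrix_inv_def by blast
  hence "matrix_inv (diag_matrix h) ** diag_matrix h ** D' = D'" by simp
  hence "matrix_inv (diag_matrix h) = D'" using D'(1) by (simp flip: matrix_mul_assoc)
  thus ?thesis by (simp add: D'_def mult divide_inverse)
qed

text \<open>
  For one-parameter subgroups, the conditions say that \<open>y\<^sub>a\<^sub>b\<close> is scaled
  by the product of \<open>t\<^sub>a, \<dots>, t\<^sub>b\<close>.
\<close>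

lemma quot_kernel_iff:
  "quot_matrix *v v = (0 :: int ^ 3) \<longleftrightarrow> v $ 4 = v $ 1 + v $ 2 \<and> v $ 5 = v $ 2 + v $ 3 \<and> v $ 6 = v $ 1 + v $ 2 + v $ 3"
  by (auto simp: vec_eq_iff forall_3 matrix_vector_mult_def quot_matrix_nth sum_6 vector_6)

lemma one_param_H: "one_param_subgroups H_torus = {v. quot_matrix *v v = (0 :: int ^ 3)}"
proof (intro set_eqI iffI)
  fix v assume "v \<in> {v. quot_matrix *v v = (0 :: int ^ 3)}"
  hence v: "v $ 4 = v $ 1 + v $ 2" "v $ 5 = v $ 2 + v $ 3" "v $ 6 = v $ 1 + v $ 2 + v $ 3"
    using quot_kernel_iff by auto
  have "(\<chi> i. s powi (v $ i)) \<in> H_torus" if s: "s \<noteq> 0" for s :: complex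
  proof -
    \<comment> \<open>The partial products of \<open>t\<^sub>1, t\<^sub>2, t\<^sub>3\<close>, normalised by
      the first entry.\<close>
    define h :: "complex ^ 4" where "h = vector [1, s powi (v $ 1), s powi (v $ 1 + v $ 2), s powi (v $ 1 + v $ 2 + v $ 3)]"
    have hn: "h $ 1 = 1" "h $ 2 = s powi (v $ 1)" "h $ 3 = s powi (v $ 1 + v $ 2)" "h $ 4 = s powi (v $ 1 + v $ 2 + v $ 3)"
      unfolding h_def by (simp_all add: vector_def)
    have h: "\<forall>i. h $ i \<noteq> 0" using s by (simp add: forall_4 hn)
    have "nilp_coords (diag_matrix h ** A ** matrix_inv (diag_matrix h)) = (\<chi> i. (\<chi> i. s powi (v $ i)) $ i * nilp_coords A $ i)" for A
      unfolding nilp_coords_def vec_eq_iff forall_6 conj_diag[OF h]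
      using s by (simp add: vector_6 hn v power_int_add)
    thus ?thesis unfolding H_torus_def using h s by (intro CollectI conjI exI[of _ h]) auto
  qed
  thus "v \<in> one_param_subgroups H_torus" unfolding one_param_subgroups_def by blast
next
  fix v assume "v \<in> one_param_subgroups H_torus"
  hence "(\<chi> i. (2 :: complex) powi (v $ i)) \<in> H_torus" unfolding one_param_subgroups_def by simp
  then obtain h :: "complex ^ 4" where h: "\<forall>i. h $ i \<noteq> 0"
    "\<forall>A\<in>nilp_lower. nilp_coords (diag_matrix h ** A ** matrix_inv (diag_matrix h)) = (\<chi> i. (\<chi> i. 2 powi (v $ i)) $ i * nilp_coords A $ i)"
    unfolding H_torus_def by blast
  \<comment> \<open>A test matrix with all six coordinates one, and \<open>s = 2\<close>, suffice, because
    powers of 2 determine their exponents.\<close>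
  define A :: "complex ^ 4 ^ 4" where
    "A = vector [vector [0, 0, 0, 0], vector [1, 0, 0, 0], vector [1, 1, 0, 0], vector [1, 1, 1, 0]]"
  have An: "A $ 1 = vector [0, 0, 0, 0]" "A $ 2 = vector [1, 0, 0, 0]" "A $ 3 = vector [1, 1, 0, 0]" "A $ 4 = vector [1, 1, 1, 0]"
    unfolding A_def by (simp_all add: vector_def)
  have v4: "(vector [a, b, c, d] :: complex ^ 4) $ 1 = a" "(vector [a, b, c, d] :: complex ^ 4) $ 2 = b"
    "(vector [a, b, c, d] :: complex ^ 4) $ 3 = c" "(vector [a, b, c, d] :: complex ^ 4) $ 4 = d" for a b c d
    by (simp_all add: vector_def)
  have "((**) A ^^ 4) (mat 1) = 0"
    by (simp add: eval_nat_numeral vec_eq_iff forall_4 matrix_matrix_mult_def sum_4 An v4 mat_def)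
  hence "A \<in> nilp_lower" unfolding nilp_lower_def lower_triangular_def by (auto simp: An v4)
  hence "nilp_coords (diag_matrix h ** A ** matrix_inv (diag_matrix h)) = (\<chi> i. (\<chi> i. 2 powi (v $ i)) $ i * nilp_coords A $ i)"
    using h(2) by blast
  hence eq: "h $ 2 / h $ 1 = 2 powi (v $ 1)" "h $ 3 / h $ 2 = 2 powi (v $ 2)" "h $ 4 / h $ 3 = 2 powi (v $ 3)"
    "h $ 3 / h $ 1 = 2 powi (v $ 4)" "h $ 4 / h $ 2 = 2 powi (v $ 5)" "h $ 4 / h $ 1 = 2 powi (v $ 6)"
    unfolding nilp_coords_def vec_eq_iff forall_6 conj_diag[OF h(1)] by (simp_all add: vector_6 An v4)
  have inj: "a = b" if "(2 :: complex) powi a = 2 powi b" for a b :: int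
  proof -
    have "norm ((2 :: complex) powi a) = norm ((2 :: complex) powi b)" using that by simp
    hence "(2 :: real) powi a = 2 powi b" by (simp add: norm_power_int)
    thus ?thesis
      using power_int_strict_increasing[of a b "2 :: real"] power_int_strict_increasing[of b a "2 :: real"]
      by (cases a b rule: linorder_cases) auto
  qed
  have "(2 :: complex) powi (v $ 4) = 2 powi (v $ 1 + v $ 2)" "(2 :: complex) powi (v $ 5) = 2 powi (v $ 2 + v $ 3)"
    "(2 :: complex) powi (v $ 6) = 2 powi (v $ 1 + v $ 2 + v $ 3)"
    using h(1) by (simp_all add: power_int_add flip: eq)
  thus "v \<in> {v. quot_matrix *v v = (0 :: int ^ 3)}" using inj quot_kernel_iff by simp
qed

lemma presents_quotient: "presents_quotient_lattice quot_matrix H_torus"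
  unfolding presents_quotient_lattice_def
proof
  show "surj (\<lambda>v :: int ^ 6. quot_matrix *v v :: int ^ 3)"
  proof (rule surjI)
    fix y :: "int ^ 3"
    show "quot_matrix *v (vector [0, 0, 0, y $ 1, y $ 2, y $ 3] :: int ^ 6) = y"
      by (simp add: vec_eq_iff forall_3 matrix_vector_mult_def quot_matrix_nth sum_6 vector_6)
  qed
  show "{v. quot_matrix *v v = (0 :: int ^ 3)} = one_param_subgroups H_torus" using one_param_H by simp
qed

theorem proposition4p1:
  shows "presents_quotient_lattice quot_matrix H_torus \<and>
    fan (quotient_fan quot_map nilp_fan) \<and>
    smooth_variety X_e \<and>
    projective_variety X_e \<and>
    krull_dim (Zar X_e) = 3 \<and>
    picard_number X_e = 4 \<and>
    rays (quotient_fan quot_map nilp_fan) =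
      (\<lambda>\<rho>. conic hull {\<rho>}) `
        {vector [-1, 0, -1], vector [-1, -1, -1], vector [0, -1, -1],
         vector [1, 0, 0], vector [0, 1, 0], vector [0, 0, 1], vector [0, 0, -1]}"
proof -
  have X: "X_e = toric_variety quotient.Sig"
    by (simp add: X_e_def combinatorial_quotient_def quotient_fan_eq)
  have "picard_number X_e = 4"
    unfolding X quotient.picard_number_eq card_ray_set by (simp add: numeral_eq_enat)
  thus ?thesis
    using presents_quotient quotient.fan_Sig quotient.smooth quotient.projective quotient.krull_dim_3 rays_quotient
    unfolding X quotient_fan_eq by blast
qed

end
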